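(* Let $D$ be a finite $p$-group and $A$ a Dade $D$-algebra over a finite field $E$ of characteristic $p$, let $\rho:D\to A^\times$ be the unique group homomorphism with $x^d=\rho(d)^{-1}x\rho(d)$ for all $d\in D$, $x\in A$, and put $D_1=\rho(D)$. Let $B=\bar A(D)$ with Brauer homomorphism $\mathrm{br}_D:A^D\to B$, $m=\sqrt{\dim_E A}$, $l=\sqrt{\dim_E B}$, $s=[E:\mathbb{F}_p]$, and fix unitary $\mathbb{F}_p$-algebra embeddings $\iota:A\to\mathfrak{E}_1:=\mathrm{M}_{ms}(\mathbb{F}_p)$ and $\iota':B\to\mathfrak{E}_2:=\mathrm{M}_{ls}(\mathbb{F}_p)$. Then there is a group homomorphism $\phi:\mathbf{N}_{\mathfrak{E}_1^\times}(\iota(D_1))\to\mathfrak{E}_2^\times$ such that $\phi(\iota(c))=\iota'(\mathrm{br}_D(c))$ for all $c\in(A^D)^\times$.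
   Context: A $D$-algebra over $E$ is an $E$-algebra with a homomorphism $D\to\mathrm{Aut}_E(A)$, $x\mapsto x^d$. $A^Q$ denotes $Q$-fixed points; $\mathrm{Tr}_Q^D:A^Q\to A^D$, $x\mapsto\sum x^d$ over representatives $d$ of right cosets of $Q$ in $D$, with image $A^D_Q$. $A$ is a Dade $D$-algebra if it is a full matrix algebra over $E$ and has a $D$-stable $E$-basis with at least one $D$-fixed element. Brauer quotient $\bar A(D)=A^D/\sum_{Q<D}A^D_Q$ with quotient map $\mathrm{br}_D$; it is a full matrix algebra over $E$. A unitary embedding is an injective identity-preserving algebra homomorphism; $\mathbf{N}_{\mathfrak{E}_1^\times}(\cdot)$ is the normalizer in the unit group. *)

theory Defs
  imports "Jordan_Normal_Form.Matrix" "HOL-Algebra.Group_Action" "HOL-Algebra.QuotRing"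
begin

text \<open>The Dade algebra A is the full matrix algebra M_m(E), realised as carrier_mat m m
  over a finite field type 'e; the D-action is act :: 'd => 'e mat => 'e mat, with
  x^d = act d x (a right action).\<close>

definition E_basis :: "nat \<Rightarrow> 'e::field mat set \<Rightarrow> bool" where
  "E_basis m X \<longleftrightarrow> X \<subseteq> carrier_mat m m \<and> finite X \<and>
     (\<forall>x\<in>carrier_mat m m. \<exists>!c. (\<forall>b. b \<notin> X \<longrightarrow> c b = 0) \<and>
        (\<forall>i<m. \<forall>j<m. x $$ (i,j) = (\<Sum>b\<in>X. c b * b $$ (i,j))))"

definition D_algebra :: "'d monoid \<Rightarrow> ('d \<Rightarrow> 'e::field mat \<Rightarrow> 'e mat) \<Rightarrow> nat \<Rightarrow> bool" where
  "D_algebra D act m \<longleftrightarrow>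
     (\<forall>d\<in>carrier D. bij_betw (act d) (carrier_mat m m) (carrier_mat m m) \<and>
        act d (1\<^sub>m m) = 1\<^sub>m m \<and>
        (\<forall>x\<in>carrier_mat m m. \<forall>y\<in>carrier_mat m m.
            act d (x + y) = act d x + act d y \<and> act d (x * y) = act d x * act d y) \<and>
        (\<forall>a. \<forall>x\<in>carrier_mat m m. act d (a \<cdot>\<^sub>m x) = a \<cdot>\<^sub>m act d x)) \<and>
     (\<forall>x\<in>carrier_mat m m. act \<one>\<^bsub>D\<^esub> x = x) \<and>
     (\<forall>d\<in>carrier D. \<forall>e\<in>carrier D. \<forall>x\<in>carrier_mat m m.
        act (d \<otimes>\<^bsub>D\<^esub> e) x = act e (act d x))"

definition Dade_algebra :: "'d monoid \<Rightarrow> ('d \<Rightarrow> 'e::field mat \<Rightarrow> 'e mat) \<Rightarrow> nat \<Rightarrow> bool" where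
  "Dade_algebra D act m \<longleftrightarrow> D_algebra D act m \<and>
     (\<exists>X. E_basis m X \<and> (\<forall>d\<in>carrier D. act d ` X = X) \<and>
          (\<exists>b\<in>X. \<forall>d\<in>carrier D. act d b = b))"

definition fixed_pts :: "('d \<Rightarrow> 'e::field mat \<Rightarrow> 'e mat) \<Rightarrow> nat \<Rightarrow> 'd set \<Rightarrow> 'e mat set" where
  "fixed_pts act m Q = {x \<in> carrier_mat m m. \<forall>q\<in>Q. act q x = x}"

definition rel_trace :: "'d monoid \<Rightarrow> ('d \<Rightarrow> 'e::field mat \<Rightarrow> 'e mat) \<Rightarrow> nat \<Rightarrow> 'd set \<Rightarrow> 'e mat \<Rightarrow> 'e mat" where
  "rel_trace D act m Q x =
     mat m m (\<lambda>(i,j). \<Sum>C\<in>rcosets\<^bsub>D\<^esub> Q. act (SOME d. d \<in> C) x $$ (i,j))"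

definition trace_image :: "'d monoid \<Rightarrow> ('d \<Rightarrow> 'e::field mat \<Rightarrow> 'e mat) \<Rightarrow> nat \<Rightarrow> 'd set \<Rightarrow> 'e mat set" where
  "trace_image D act m Q = rel_trace D act m Q ` fixed_pts act m Q"

definition proper_subgroups :: "'d monoid \<Rightarrow> 'd set set" where
  "proper_subgroups D = {Q. subgroup Q D \<and> Q \<noteq> carrier D}"

definition brauer_kernel :: "'d monoid \<Rightarrow> ('d \<Rightarrow> 'e::field mat \<Rightarrow> 'e mat) \<Rightarrow> nat \<Rightarrow> 'e mat set" where
  "brauer_kernel D act m = {x \<in> carrier_mat m m. \<exists>f.
      (\<forall>Q\<in>proper_subgroups D. f Q \<in> trace_image D act m Q) \<and>
      x = mat m m (\<lambda>(i,j). \<Sum>Q\<in>proper_subgroups D. f Q $$ (i,j))}"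

definition fixed_alg :: "'d monoid \<Rightarrow> ('d \<Rightarrow> 'e::field mat \<Rightarrow> 'e mat) \<Rightarrow> nat \<Rightarrow> 'e mat ring" where
  "fixed_alg D act m = (ring_mat TYPE('e) m ()) \<lparr>carrier := fixed_pts act m (carrier D)\<rparr>"

definition brauer_quotient :: "'d monoid \<Rightarrow> ('d \<Rightarrow> 'e::field mat \<Rightarrow> 'e mat) \<Rightarrow> nat \<Rightarrow> 'e mat set ring" where
  "brauer_quotient D act m = fixed_alg D act m Quot brauer_kernel D act m"

definition brD :: "'d monoid \<Rightarrow> ('d \<Rightarrow> 'e::field mat \<Rightarrow> 'e mat) \<Rightarrow> nat \<Rightarrow> 'e mat \<Rightarrow> 'e mat set" where
  "brD D act m c = brauer_kernel D act m +>\<^bsub>fixed_alg D act m\<^esub> c"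

end

theory Submission
 imports Defs "HOL-Library.Poly_Mapping" "HOL-Computational_Algebra.Fraction_Field"
  "HOL-Computational_Algebra.Polynomial" "Jordan_Normal_Form.Char_Poly" "HOL-Number_Theory.Cong"
  "HOL-Combinatorics.Permutations" "HOL-Algebra.Multiplicative_Group" "HOL-Algebra.Subrings"
begin

hide_const (open) up_ring.monom up_ring.coeff

text \<open>
An additive endomorphism of \<open>E^m\<close> is a sum of semilinear maps \<open>G_t \<circ> t\<close>, one for each field
automorphism \<open>t\<close>, and if it normalises \<open>D_1\<close> then so does each summand, up to a twist of \<open>D_1\<close> by an
automorphism. It therefore suffices to extend the Brauer homomorphism from \<open>A^D\<close> to all matrices \<open>G\<close>
with \<open>G \<cdot> t(d) = f(d) \<cdot> G\<close>, compatibly with sums and semilinear products. By a characteristic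
central series of \<open>D_1\<close> this reduces to an elementary abelian group with generators \<open>d_i\<close>. There, over
the rational function field in variables \<open>x_i\<close>, the element \<open>X = \<Sum> x_i (d_i - 1)\<close> satisfies \<open>X^p = 0\<close>
and commutes with every \<open>G\<close> once \<open>G\<close> also acts on the variables. On \<open>A\<close> the kernel of \<open>ad X\<close> modulo the
image of \<open>(ad X)^(p-1)\<close> only sees the fixed points of the basis, so that the action of \<open>A^D\<close> on a
nonzero layer \<open>(ker X \<inter> im X^i) / (ker X \<inter> im X^(i+1))\<close> realises the Brauer quotient over the
function field. A valuation with residue field \<open>E\<close> conjugates this representation to one over \<open>E\<close>, a
greatest common divisor makes the matrices of all \<open>G\<close> polynomial in the variables, and evaluation at
the origin yields the extension.
\<close>

section \<open>Row-finite matrices\<close>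

text \<open>The obstacle is a choice of scalars. An invertible intertwiner \<open>G\<close> acts on
  the Brauer quotient by a semilinear automorphism, which by Skolem-Noether comes from a matrix that
  is unique only up to a scalar, and the scalars have to be chosen additively and multiplicatively
  for all \<open>G\<close> at once. Letting every \<open>G\<close> act on one space removes the
  choice; the layer is such a space. An element of the group algebra with constant coefficients
  would not commute with \<open>G\<close>, because \<open>G\<close> permutes the group elements;
  giving each of them its own variable and permuting the variables along makes \<open>X\<close>
  invariant. For the same reason all elements of the elementary abelian group serve as generators,
  since that set is preserved by every automorphism. Returning to constants costs one more scalar: a
  greatest common divisor \<open>d\<close> of the matrix entries rescales the matrix of
  \<open>G\<close> by the coboundary \<open>om ta pm d / d\<close>, which respects products and is
  trivial on the fixed algebra. The origin is fixed by all permutations of the variables, so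
  evaluation there is compatible with every \<open>G\<close>.\<close>

typedef (overloaded) 'a rfm = "{f :: nat => nat => 'a::zero. \<forall>i. finite {j. f i j ~= 0}}"
 morphisms ent Rfm
 by (rule exI[of _ "%_ _. 0"]) auto

setup_lifting type_definition_rfm

lemma finite_ent [simp]: "finite {j. ent A i j ~= 0}"
 using ent[of A] by auto

lemma rfm_eqI: "(!!i j. ent A i j = ent B i j) ==> A = B"
 by (rule iffD1[OF ent_inject], intro ext)

instantiation rfm :: (ab_group_add) ab_group_add
begin
lift_definition zero_rfm :: "'a rfm" is "%_ _. 0" by simp
lift_definition plus_rfm :: "'a rfm => 'a rfm => 'a rfm" is "%f g i j. f i j + g i j"
proof -
 fix f g :: "nat => nat => 'a" and i :: nat
 assume "!!i. finite {j. f i j ~= 0}" "!!i. finite {j. g i j ~= 0}"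
 hence "finite {j. f i j ~= 0}" "finite {j. g i j ~= 0}" by auto
 thus "finite {j. f i j + g i j ~= 0}"
  apply -
  apply (rule finite_subset[of _ "{j. f i j ~= 0} \<union> {j. g i j ~= 0}"])
  apply auto
  done
qed
lift_definition uminus_rfm :: "'a rfm => 'a rfm" is "%f i j. - f i j" by simp
lift_definition minus_rfm :: "'a rfm => 'a rfm => 'a rfm" is "%f g i j. f i j - g i j"
proof -
 fix f g :: "nat => nat => 'a" and i :: nat
 assume "!!i. finite {j. f i j ~= 0}" "!!i. finite {j. g i j ~= 0}"
 hence "finite {j. f i j ~= 0}" "finite {j. g i j ~= 0}" by auto
 thus "finite {j. f i j - g i j ~= 0}"
  apply -
  apply (rule finite_subset[of _ "{j. f i j ~= 0} \<union> {j. g i j ~= 0}"])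
  apply auto
  done
qed
lemma ent_zero [simp]: "ent 0 i j = 0" by (rule zero_rfm.rep_eq[THEN fun_cong, THEN fun_cong])
lemma ent_add [simp]: "ent (A + B) i j = ent A i j + ent B i j"
 by (rule plus_rfm.rep_eq[THEN fun_cong, THEN fun_cong])
lemma ent_uminus [simp]: "ent (- A) i j = - ent A i j"
 by (rule uminus_rfm.rep_eq[THEN fun_cong, THEN fun_cong])
lemma ent_minus [simp]: "ent (A - B) i j = ent A i j - ent B i j"
 by (rule minus_rfm.rep_eq[THEN fun_cong, THEN fun_cong])
instance
 by standard (rule rfm_eqI, simp add: algebra_simps)+
end

lemma ent_sum: "ent (sum f S) i j = (\<Sum>s\<in>S. ent (f s) i j)"
 by (induction S rule: infinite_finite_induct) auto

lift_definition un :: "nat => nat => 'a::zero_neq_one rfm"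
 is "%a b i j. if i = a & j = b then 1 else 0"
 by auto

lemma ent_un: "ent (un a b) i j = (if i = a & j = b then 1 else 0)"
 by transfer simp

instantiation rfm :: (ring_1) ring_1
begin
lift_definition one_rfm :: "'a rfm" is "%i j. if i = j then 1 else 0" by simp
lift_definition times_rfm :: "'a rfm => 'a rfm => 'a rfm"
 is "%f g i j. \<Sum>k\<in>{k. f i k ~= 0}. f i k * g k j"
proof -
 fix f g :: "nat => nat => 'a" and i :: nat
 assume *: "!!i. finite {j. f i j ~= 0}" "!!i. finite {j. g i j ~= 0}"
 have "{j. (\<Sum>k\<in>{k. f i k ~= 0}. f i k * g k j) ~= 0} \<subseteq> (\<Union>k\<in>{k. f i k ~= 0}. {j. g k j ~= 0})"
 proof
  fix j assume "j \<in> {j. (\<Sum>k\<in>{k. f i k ~= 0}. f i k * g k j) ~= 0}"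
  then obtain k where "k \<in> {k. f i k ~= 0}" "f i k * g k j ~= 0"
   by (metis (mono_tags, lifting) mem_Collect_eq sum.neutral)
  thus "j \<in> (\<Union>k\<in>{k. f i k ~= 0}. {j. g k j ~= 0})" by auto
 qed
 thus "finite {j. (\<Sum>k\<in>{k. f i k ~= 0}. f i k * g k j) ~= 0}"
  using * by (meson finite_UN_I finite_subset)
qed
lemma ent_times_aux:
 assumes "finite K" "!!k. k \<notin> K ==> ent A i k = 0"
 shows "ent (A * B) i j = (\<Sum>k\<in>K. ent A i k * ent (B::'a rfm) k j)"
proof -
 have "(\<Sum>k\<in>{k. ent A i k ~= 0}. ent A i k * ent B k j) = (\<Sum>k\<in>K. ent A i k * ent B k j)"
  using assms by (intro sum.mono_neutral_left) auto
 thus ?thesis by (simp add: times_rfm.rep_eq)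
qed
instance
proof
 fix A B C :: "'a rfm"
 show "A * B * C = A * (B * C)"
 proof (rule rfm_eqI)
  fix i j
  let ?K = "{k. ent A i k ~= 0}"
  let ?L = "\<Union>k\<in>?K. {l. ent B k l ~= 0}"
  have fK: "finite ?K" and fL: "finite ?L" by auto
  have AB: "ent (A * B) i l = (\<Sum>k\<in>?K. ent A i k * ent B k l)" for l
   by (rule ent_times_aux) auto
  have "ent (A * B * C) i j = (\<Sum>l\<in>?L. ent (A * B) i l * ent C l j)"
   by (rule ent_times_aux[OF fL]) (auto simp: AB intro!: sum.neutral)
  also have "... = (\<Sum>l\<in>?L. \<Sum>k\<in>?K. ent A i k * ent B k l * ent C l j)"
   by (simp add: AB sum_distrib_right)
  also have "... = (\<Sum>k\<in>?K. \<Sum>l\<in>?L. ent A i k * ent B k l * ent C l j)"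
   by (rule sum.swap)
  also have "... = (\<Sum>k\<in>?K. ent A i k * ent (B * C) k j)"
  proof (rule sum.cong[OF refl])
   fix k assume k: "k \<in> ?K"
   have "ent (B * C) k j = (\<Sum>l\<in>?L. ent B k l * ent C l j)"
    using k by (intro ent_times_aux[OF fL]) auto
   thus "(\<Sum>l\<in>?L. ent A i k * ent B k l * ent C l j) = ent A i k * ent (B * C) k j"
    by (simp add: sum_distrib_left mult.assoc)
  qed
  also have "... = ent (A * (B * C)) i j"
   by (rule ent_times_aux[symmetric]) auto
  finally show "ent (A * B * C) i j = ent (A * (B * C)) i j" .
 qed
 show "1 * A = A"
  by (rule rfm_eqI, subst ent_times_aux[of "{_}"]) (auto simp: one_rfm.rep_eq)
 show "A * 1 = A"
 proof (rule rfm_eqI)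
  fix i j
  have "ent (A * 1) i j = (\<Sum>k\<in>insert j {k. ent A i k ~= 0}. ent A i k * ent 1 k j)"
   by (rule ent_times_aux) auto
  also have "... = ent A i j"
   by (subst sum.insert_remove) (auto simp: one_rfm.rep_eq intro!: sum.neutral)
  finally show "ent (A * 1) i j = ent A i j" .
 qed
 show "(A + B) * C = A * C + B * C"
 proof (rule rfm_eqI)
  fix i j
  let ?K = "{k. ent A i k ~= 0} \<union> {k. ent B i k ~= 0}"
  have 1: "ent ((A + B) * C) i j = (\<Sum>k\<in>?K. ent (A + B) i k * ent C k j)"
   by (rule ent_times_aux) auto
  have 2: "ent (A * C) i j = (\<Sum>k\<in>?K. ent A i k * ent C k j)"
   by (rule ent_times_aux) auto
  have 3: "ent (B * C) i j = (\<Sum>k\<in>?K. ent B i k * ent C k j)"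
   by (rule ent_times_aux) auto
  show "ent ((A + B) * C) i j = ent (A * C + B * C) i j"
   by (simp only: 1 2 3 ent_add) (simp add: distrib_right sum.distrib)
 qed
 show "A * (B + C) = A * B + A * C"
 proof (rule rfm_eqI)
  fix i j
  have *: "ent (A * X) i j = (\<Sum>k\<in>{k. ent A i k ~= 0}. ent A i k * ent X k j)" for X
   by (rule ent_times_aux) auto
  show "ent (A * (B + C)) i j = ent (A * B + A * C) i j"
   by (simp only: * ent_add) (simp add: distrib_left sum.distrib)
 qed
 have "ent (0::'a rfm) 0 0 ~= ent 1 0 0" by (simp add: one_rfm.rep_eq)
 thus "(0::'a rfm) ~= 1" by metis
qed
end

lemma ent_one: "ent 1 i j = (if i = j then 1 else 0)"
 by (simp add: one_rfm.rep_eq)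

lemma ent_times:
 assumes "finite K" "!!k. k \<notin> K ==> ent A i k = 0"
 shows "ent (A * B) i j = (\<Sum>k\<in>K. ent A i k * ent B k j)"
 using assms by (rule ent_times_aux)

section \<open>Scalar multiples, matrix units and corner idempotents\<close>

lift_definition sc :: "'a::mult_zero => 'a rfm => 'a rfm" is "%c f i j. c * f i j"
proof -
 fix c :: 'a and f :: "nat => nat => 'a" and i :: nat
 assume *: "!!i. finite {j. f i j ~= 0}"
 show "finite {j. c * f i j ~= 0}"
  by (rule finite_subset[OF _ *[of i]]) auto
qed

lemma ent_sc [simp]: "ent (sc c A) i j = c * ent A i j"
 by transfer simp

lemma sc_zero_left [simp]: "sc (0::'a::ring_1) A = 0"
 and sc_zero_right [simp]: "sc c (0::'a::ring_1 rfm) = 0"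
 and sc_one [simp]: "sc (1::'a::ring_1) A = A"
 and sc_sc [simp]: "sc a (sc b A) = sc (a * b :: 'a::ring_1) A"
 and sc_add_left: "sc (a + b :: 'a::ring_1) A = sc a A + sc b A"
 and sc_add_right: "sc (a::'a::ring_1) (A + B) = sc a A + sc a B"
 and sc_minus_right: "sc (a::'a::ring_1) (A - B) = sc a A - sc a B"
 and sc_minus_left: "sc (a - b::'a::ring_1) A = sc a A - sc b A"
 and sc_uminus: "sc (- a::'a::ring_1) A = - sc a A"
 by (rule rfm_eqI, simp add: algebra_simps)+

lemma sc_mult_left: "sc (c::'a::ring_1) A * B = sc c (A * B)"
proof (rule rfm_eqI)
 fix i j
 have 1: "ent (sc c A * B) i j = (\<Sum>k\<in>{k. ent A i k ~= 0}. ent (sc c A) i k * ent B k j)"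
  by (rule ent_times) auto
 have 2: "ent (A * B) i j = (\<Sum>k\<in>{k. ent A i k ~= 0}. ent A i k * ent B k j)"
  by (rule ent_times) auto
 show "ent (sc c A * B) i j = ent (sc c (A * B)) i j"
  by (simp only: 1 2 ent_sc sum_distrib_left mult.assoc)
qed

lemma sc_mult_right: "A * sc (c::'a::comm_ring_1) B = sc c (A * B)"
proof (rule rfm_eqI)
 fix i j
 have 1: "ent (A * X) i j = (\<Sum>k\<in>{k. ent A i k ~= 0}. ent A i k * ent X k j)" for X
  by (rule ent_times) auto
 show "ent (A * sc c B) i j = ent (sc c (A * B)) i j"
  by (simp only: 1 ent_sc sum_distrib_left mult.left_commute)
qed

lemma sc_power: "sc (c::'a::comm_ring_1) A ^ n = sc (c ^ n) (A ^ n)"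
 by (induction n) (auto simp: sc_mult_left sc_mult_right mult.commute)

lemma sc_sum_right: "sc (c::'a::ring_1) (sum f S) = (\<Sum>s\<in>S. sc c (f s))"
 by (induction S rule: infinite_finite_induct) (auto simp: sc_add_right)

lemma sc_sum_left: "sc (sum f S) (A::'a::ring_1 rfm) = (\<Sum>s\<in>S. sc (f s) A)"
 by (induction S rule: infinite_finite_induct) (auto simp: sc_add_left)

lemma un_mult_un: "un i j * un k l = (if j = k then un i l else (0::'a::ring_1 rfm))"
 by (rule rfm_eqI, subst ent_times[of "{j}"]) (auto simp: ent_un)

lemma un_mult_un_same [simp]: "un i j * un j l = (un i l :: 'a::ring_1 rfm)"
 by (simp add: un_mult_un)

lemma un_mult_un_left [simp]: "un i j * (un j l * A) = (un i l * A :: 'a::ring_1 rfm)"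
 by (simp flip: mult.assoc)

text \<open>Entries become ring elements in this way, so that later proofs pick them out by
  multiplication alone.\<close>

lemma un_sandwich: "un i a * M * un b j = sc (ent M a b) (un i j :: 'a::ring_1 rfm)"
proof (rule rfm_eqI)
 fix k l
 have 1: "ent (un i a * M) k x = (if k = i then ent M a x else 0)" for x
  by (subst ent_times[of "{a}"]) (auto simp: ent_un)
 show "ent (un i a * M * un b j) k l = ent (sc (ent M a b) (un i j)) k l"
 proof -
  have "ent (un i a * M * un b j) k l = (\<Sum>x\<in>insert b {x. ent (un i a * M) k x ~= 0}. ent (un i a * M) k x * ent (un b j) x l)"
   by (rule ent_times) auto
  also have "... = ent (un i a * M) k b * ent (un b j) b l"
   by (subst sum.insert_remove) (auto simp: ent_un intro!: sum.neutral)
  finally show ?thesis by (auto simp: 1 ent_un)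
 qed
qed

lift_definition ee :: "nat => 'a::zero_neq_one rfm" is "%m i j. if i = j & i < m then 1 else 0"
 by auto

lemma ent_ee: "ent (ee m) i j = (if i = j & i < m then 1 else 0)"
 by transfer simp

lemma ee_0 [simp]: "ee 0 = (0::'a::ring_1 rfm)"
 by (rule rfm_eqI) (simp add: ent_ee)

lemma ee_eq_sum: "ee m = (\<Sum>i<m. un i i :: 'a::ring_1 rfm)"
proof (rule rfm_eqI)
 fix i j
 have "ent (\<Sum>k<m. un k k :: 'a rfm) i j = (\<Sum>k<m. if i = k then (if i = j then 1 else 0) else 0)"
  unfolding ent_sum by (intro sum.cong) (auto simp: ent_un)
 thus "ent (ee m) i j = ent (\<Sum>k<m. un k k :: 'a rfm) i j"
  by (simp add: ent_ee)
qed

lemma ent_ee_mult: "ent (ee m * A) i j = (if i < m then ent A i j else (0::'a::ring_1))"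
 by (subst ent_times[of "{i}"]) (auto simp: ent_ee)

lemma ent_mult_ee: "ent (A * ee m) i j = (if j < m then ent A i j else (0::'a::ring_1))"
proof -
 have "ent (A * ee m) i j = (\<Sum>k\<in>insert j {k. ent A i k ~= 0}. ent A i k * ent (ee m) k j)"
  by (rule ent_times) auto
 also have "... = ent A i j * ent (ee m) j j"
  by (subst sum.insert_remove) (auto simp: ent_ee intro!: sum.neutral)
 finally show ?thesis by (simp add: ent_ee)
qed

text \<open>Matrices of all sizes live in one unital ring, and those of size \<open>m\<close> by
  \<open>n\<close> are the corner cut out by the idempotents \<open>ee\<close>, so that rectangular
  products and powers obey plain ring laws. Row-finiteness rather than finite support lets the ring
  contain 1 and the permutation matrices.\<close>

definition Mat :: "nat => nat => 'a::ring_1 rfm set" where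
 "Mat m n = {A. ee m * A = A & A * ee n = A}"

lemma MatD: "A \<in> Mat m n ==> ee m * A = A" "A \<in> Mat m n ==> A * ee n = A"
 by (auto simp: Mat_def)

lemma Mat_iff: "A \<in> Mat m n \<longleftrightarrow> (\<forall>i j. ent A i j ~= 0 --> i < m & j < n)"
proof
 assume "A \<in> Mat m n"
 thus "\<forall>i j. ent A i j ~= 0 --> i < m & j < n"
  using ent_ee_mult[of m A] ent_mult_ee[of A n] by (metis MatD)
next
 assume *: "\<forall>i j. ent A i j ~= 0 --> i < m & j < n"
 show "A \<in> Mat m n"
  unfolding Mat_def using * by (force intro!: rfm_eqI simp: ent_ee_mult ent_mult_ee)
qed

lemma Mat_ent: "A \<in> Mat m n ==> \<not> (i < m & j < n) ==> ent A i j = 0"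
 using Mat_iff by blast

lemma Mat_eqI:
 assumes "A \<in> Mat m n" "B \<in> Mat m n" "!!i j. i < m ==> j < n ==> ent A i j = ent B i j"
 shows "A = B"
 using assms by (intro rfm_eqI) (metis Mat_ent)

lemma ent_mult_Mat: "A \<in> Mat m n ==> ent (A * B) i j = (\<Sum>k<n. ent A i k * ent B k j)"
 by (rule ent_times) (auto simp: Mat_iff)

lemma Mat_mult [intro]: "A \<in> Mat m n ==> B \<in> Mat n k ==> A * B \<in> Mat m k"
 unfolding Mat_def by (auto simp: mult.assoc) (simp flip: mult.assoc)

lemma Mat_mult_gen: "ee m * A = A ==> B * ee k = B ==> A * B \<in> Mat m k"
 unfolding Mat_def by (auto simp: mult.assoc) (simp flip: mult.assoc)

lemma Mat_0 [simp, intro]: "0 \<in> Mat m n"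
 and Mat_add [intro]: "A \<in> Mat m n ==> B \<in> Mat m n ==> A + B \<in> Mat m n"
 and Mat_minus [intro]: "A \<in> Mat m n ==> B \<in> Mat m n ==> A - B \<in> Mat m n"
 by (auto simp: Mat_def algebra_simps)

lemma Mat_sc [intro]: "A \<in> Mat m n ==> sc (c::'a::comm_ring_1) A \<in> Mat m n"
 by (auto simp: Mat_def sc_mult_left sc_mult_right)

lemma Mat_sum [intro]: "(!!s. s \<in> S ==> f s \<in> Mat m n) ==> sum f S \<in> Mat m n"
 by (induction S rule: infinite_finite_induct) auto

lemma Mat_un [intro]: "i < m ==> j < n ==> un i j \<in> Mat m n"
 by (auto simp: Mat_iff ent_un split: if_splits)

lemma ee_Mat [simp, intro]: "ee m \<in> Mat m m"
 by (auto simp: Mat_iff ent_ee split: if_splits)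

lemma ee_idem [simp]: "ee m * ee m = (ee m :: 'a::ring_1 rfm)"
 using ee_Mat MatD by blast

lemma Mat_power: "A \<in> Mat m m ==> k > 0 ==> A ^ k \<in> Mat m m"
proof (induction k)
 case (Suc k)
 thus ?case by (cases "k = 0") auto
qed auto

lemma Mat_expand:
 assumes "A \<in> Mat m n"
 shows "A = (\<Sum>i<m. \<Sum>j<n. sc (ent A i j) (un i j))"
proof -
 have "A = ee m * A * ee n" using assms by (simp add: MatD)
 also have "... = (\<Sum>i<m. \<Sum>j<n. un i i * A * un j j)"
  by (subst sum.swap) (simp add: ee_eq_sum sum_distrib_left sum_distrib_right)
 also have "... = (\<Sum>i<m. \<Sum>j<n. sc (ent A i j) (un i j))"
  by (simp add: un_sandwich)
 finally show ?thesis .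
qed

lift_definition mk :: "nat => nat => (nat => nat => 'a::zero) => 'a rfm"
 is "%m n f i j. if i < m & j < n then f i j else 0"
 by auto

lemma ent_mk: "ent (mk m n f) i j = (if i < m & j < n then f i j else 0)"
 by transfer simp

lemma mk_Mat [simp, intro]: "mk m n f \<in> Mat m n"
 by (auto simp: Mat_iff ent_mk split: if_splits)

text \<open>Meaningful when \<open>h 0 = 0\<close>; otherwise row-finiteness may be lost and
  \<open>Rfm\<close> is applied outside its domain.\<close>

definition rmap :: "('a::zero => 'b::zero) => 'a rfm => 'b rfm" where
 "rmap h A = Rfm (%i j. h (ent A i j))"

lemma ent_rmap:
 assumes "h 0 = 0"
 shows "ent (rmap h A) i j = h (ent A i j)"
proof -
 have "{j. h (ent A i j) ~= 0} \<subseteq> {j. ent A i j ~= 0}" for i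
  using assms by auto
 hence "finite {j. h (ent A i j) ~= 0}" for i
  by (rule finite_subset) (rule finite_ent)
 thus ?thesis unfolding rmap_def by (subst Rfm_inverse) auto
qed

lemma rmap_comp:
 assumes "h 0 = 0" "g 0 = 0"
 shows "rmap g (rmap h A) = rmap (g \<circ> h) A"
 by (rule rfm_eqI) (simp add: ent_rmap assms)

lemma rmap_id [simp]: "rmap (%x. x) A = A" "rmap id A = A"
 by (auto intro!: rfm_eqI simp: ent_rmap)

context comm_ring_hom
begin

lemma ent_rmap_hom [simp]: "ent (rmap hom A) i j = hom (ent A i j)"
 by (simp add: ent_rmap)

lemma rmap_add: "rmap hom (A + B) = rmap hom A + rmap hom B"
 and rmap_minus: "rmap hom (A - B) = rmap hom A - rmap hom B"
 and rmap_zero [simp]: "rmap hom 0 = 0"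
 and rmap_one [simp]: "rmap hom 1 = 1"
 and rmap_un [simp]: "rmap hom (un a b) = un a b"
 and rmap_ee [simp]: "rmap hom (ee m) = ee m"
 and rmap_sc: "rmap hom (sc c A) = sc (hom c) (rmap hom A)"
 by (rule rfm_eqI, simp add: hom_distribs ent_un ent_ee ent_one)+

lemma rmap_sum: "rmap hom (sum f S) = (\<Sum>s\<in>S. rmap hom (f s))"
 by (induction S rule: infinite_finite_induct) (auto simp: rmap_add)

lemma rmap_mult: "rmap hom (A * B) = rmap hom A * rmap hom B"
proof (rule rfm_eqI)
 fix i j
 let ?K = "{k. ent A i k ~= 0}"
 have "ent (A * B) i j = (\<Sum>k\<in>?K. ent A i k * ent B k j)"
  by (rule ent_times) auto
 moreover have "ent (rmap hom A * rmap hom B) i j = (\<Sum>k\<in>?K. ent (rmap hom A) i k * ent (rmap hom B) k j)"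
  by (rule ent_times) auto
 ultimately show "ent (rmap hom (A * B)) i j = ent (rmap hom A * rmap hom B) i j"
  by (simp add: hom_distribs)
qed

lemma rmap_power: "rmap hom (A ^ k) = rmap hom A ^ k"
 by (induction k) (auto simp: rmap_mult)

lemma rmap_Mat [intro]: "A \<in> Mat m n ==> rmap hom A \<in> Mat m n"
 unfolding Mat_def by (auto simp flip: rmap_mult rmap_ee)

end

text \<open>Elimination: if \<open>U * M * V\<close> is an identity matrix, then a nonzero entry of the remainder
 \<open>M - M * V * U * M\<close> extends \<open>U\<close> and \<open>V\<close>, and the remainder loses a nonzero row.\<close>

lemma rank_factorisation:
 fixes M :: "'a::field rfm"
 assumes M: "M \<in> Mat m k"
 obtains n C D C' D' where "C \<in> Mat m n" "D \<in> Mat n k" "C' \<in> Mat n m" "D' \<in> Mat k n"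
  "M = C * D" "C' * C = ee n" "D * D' = ee n"
proof -
 let ?r = "%R :: 'a rfm. {i. \<exists>j. ent R i j ~= 0}"
 have "\<exists>n U V. U \<in> Mat n m & V \<in> Mat k n & U * M * V = ee n & M * V * U * M = M"
  if "U \<in> Mat n m" "V \<in> Mat k n" "U * M * V = ee n" for n U V
  using that
 proof (induction "card (?r (M - M * V * U * M))" arbitrary: n U V rule: less_induct)
  case less
  note U = less.prems(1) and V = less.prems(2)
  define R where "R = M - M * V * U * M"
  have R: "R \<in> Mat m k" unfolding R_def using M U V by blast
  show ?case
  proof (cases "R = 0")
   case True
   hence "M * V * U * M = M" by (simp add: R_def)
   thus ?thesis using less.prems by blast
  next
   case False
   then obtain i j where ij: "ent R i j ~= 0" by (metis ent_zero rfm_eqI)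
   let ?e = "ent R i j"
   have lt: "i < m" "j < k" using ij R by (auto simp: Mat_iff)
   \<comment> \<open>The correction terms separate the new row and column from the old ones, that is
     \<open>u * M * V = 0\<close> and \<open>U * M * v = 0\<close>; the factor \<open>1/?e\<close>
     normalises the new diagonal entry.\<close>
   define u where "u = sc (1/?e) (un n i - un n i * M * V * U)"
   define v where "v = un j n - V * U * M * un j n"
   have up: "Mat x n \<subseteq> Mat x (Suc n)" "Mat n x \<subseteq> Mat (Suc n) x" for x
    by (auto simp: Mat_iff less_SucI)
   have n: "un n i \<in> Mat (Suc n) m" "un j n \<in> Mat k (Suc n)" using lt by auto
   have Uu: "U + u \<in> Mat (Suc n) m" "V + v \<in> Mat k (Suc n)"
    unfolding u_def v_def using up U V M n by (blast intro!: Mat_add Mat_sc Mat_minus Mat_mult)+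
   have MVe: "M * V * U * M * V = M * V" "U * M * V * U * M = U * M"
    using less.prems(3) U V by (metis MatD mult.assoc)+
   have z: "ee n * un n x = (0::'a rfm)" "un x n * ee n = (0::'a rfm)" for x
    by (auto intro!: rfm_eqI simp: ent_ee_mult ent_mult_ee ent_un)
   have z2: "V * (un n x * B) = 0" "un x n * (U * B) = 0" for x B
    using z[of x] MatD(2)[OF V] MatD(1)[OF U] by (metis mult.assoc mult_zero_left mult_zero_right)+
   have f: "u * M = sc (1/?e) (un n i * R)" "M * v = R * un j n" "R * V = 0" "U * R = 0"
    by (simp_all add: u_def v_def R_def sc_mult_left algebra_simps MVe[unfolded mult.assoc])
   have "u * M * v = sc (1/?e) (un n i * R * un j n) - sc (1/?e) (un n i * (R * V) * U * M * un j n)"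
    unfolding f(1) by (simp only: v_def sc_mult_left right_diff_distrib mult.assoc)
   hence uv: "u * M * v = un n n" using ij by (simp add: f un_sandwich)
   have e: "(U + u) * M * (V + v) = ee (Suc n)"
   proof -
    have "(U + u) * M * (V + v) = U * M * V + U * (M * v) + u * M * V + u * M * v"
     by (simp add: algebra_simps)
    also have "... = ee n + (U * R) * un j n + sc (1/?e) (un n i * (R * V)) + un n n"
     by (simp only: uv less.prems(3)) (simp add: f(1,2) sc_mult_left mult.assoc)
    finally show ?thesis by (simp add: f ee_eq_sum)
   qed
   define R' where "R' = M - M * (V + v) * (U + u) * M"
   have "R' = M - (M * V + M * v) * (U * M + u * M)" by (simp add: R'_def algebra_simps)
   hence "R' = R - sc (1/?e) (R * un j i * R)"
    unfolding f(1,2) by (simp add: R_def sc_mult_right distrib_left distrib_right mult.assoc z2)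
   moreover have "ent (R * un j i * R) a b = ent R a j * ent R i b" for a b
   proof -
    have "ent (R * un j i) a x = (if x = i then ent R a j else 0)" for x
     using lt(2) by (simp add: ent_mult_Mat[OF R] ent_un sum.delta if_distrib cong: if_cong)
    thus ?thesis by (subst ent_times[of "{i}"]) auto
   qed
   \<comment> \<open>One step of Gaussian elimination on the remainder with pivot
     \<open>(i, j)\<close>: it clears row \<open>i\<close> and creates no new nonzero row.\<close>
   ultimately have eR': "ent R' a b = ent R a b - ent R a j * ent R i b / ?e" for a b by simp
   have "card (?r R') < card (?r R)"
   proof (rule psubset_card_mono)
    show "finite (?r R)" by (rule finite_subset[of _ "{..<m}"]) (use R in \<open>auto simp: Mat_iff\<close>)
    have "ent R' i b = 0" "\<forall>x. ent R a x = 0 ==> ent R' a b = 0" for a b using ij by (auto simp: eR')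
    thus "?r R' \<subset> ?r R" using ij by blast
   qed
   from less.hyps[OF this[unfolded R_def R'_def] Uu e] show ?thesis .
  qed
 qed
 from this[of 0 0 0] obtain n U V where *: "U \<in> Mat n m" "V \<in> Mat k n" "U * M * V = ee n" "M * V * U * M = M"
  by auto
 show ?thesis by (rule that[of "M * V" n "U * M" U V]) (use * M in \<open>auto simp: mult.assoc\<close>)
qed

lemma generalised_inverse:
 fixes M :: "'a::field rfm"
 assumes "M \<in> Mat m k"
 obtains N where "N \<in> Mat k m" "M * N * M = M"
proof -
 from rank_factorisation[OF assms] obtain n C D C' D' where
  *: "C \<in> Mat m n" "D \<in> Mat n k" "C' \<in> Mat n m" "D' \<in> Mat k n"
  "M = C * D" "C' * C = ee n" "D * D' = ee n" .
 have "M * (D' * C') * M = C * (D * D') * (C' * C) * D" by (simp only: *(5) mult.assoc)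
 also have "... = (C * ee n * ee n) * D" by (simp only: *)
 also have "... = M" using * by (simp add: MatD)
 finally show ?thesis using that[of "D' * C'"] * by blast
qed

section \<open>Polynomials in countably many variables and their fraction field\<close>

text \<open>Countably many variables are provided at once, so that the number of generators of the
  elementary abelian group stays a number and is not part of a type.\<close>

type_synonym 'e mp = "(nat \<Rightarrow>\<^sub>0 nat) \<Rightarrow>\<^sub>0 'e"

abbreviation mlook :: "('a \<Rightarrow>\<^sub>0 'b::zero) => 'a => 'b" where "mlook \<equiv> Poly_Mapping.lookup"
abbreviation mkeys :: "('a \<Rightarrow>\<^sub>0 'b::zero) => 'a set" where "mkeys \<equiv> Poly_Mapping.keys"
abbreviation msingle :: "'a => 'b::zero => ('a \<Rightarrow>\<^sub>0 'b)" where "msingle \<equiv> Poly_Mapping.single"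

lemma mp_expand:
 fixes f :: "'a \<Rightarrow>\<^sub>0 'b::comm_monoid_add"
 assumes "finite K" "mkeys f \<subseteq> K"
 shows "(\<Sum>k\<in>K. msingle k (mlook f k)) = f"
proof (rule poly_mapping_eqI)
 fix k
 have "mlook (\<Sum>k\<in>K. msingle k (mlook f k)) k = (\<Sum>l\<in>K. if k = l then mlook f k else 0)"
  unfolding lookup_sum by (intro sum.cong) (auto simp: lookup_single when_def)
 also have "... = mlook f k"
  using assms by (auto simp: in_keys_iff)
 finally show "mlook (\<Sum>k\<in>K. msingle k (mlook f k)) k = mlook f k" .
qed

definition psum :: "('a => 'b::zero => 'c::comm_monoid_add) => ('a \<Rightarrow>\<^sub>0 'b) => 'c" where
 "psum g f = (\<Sum>k\<in>mkeys f. g k (mlook f k))"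

lemma psum_eq:
 assumes "!!k. g k 0 = 0" "finite K" "mkeys f \<subseteq> K"
 shows "psum g f = (\<Sum>k\<in>K. g k (mlook f k))"
 unfolding psum_def using assms
 by (intro sum.mono_neutral_left) (auto simp: in_keys_iff)

lemma psum_add:
 assumes "!!k. g k 0 = 0" "!!k a b. g k (a + b) = g k a + g k b"
 shows "psum g (f + f') = psum g f + psum g (f' :: 'a \<Rightarrow>\<^sub>0 'b::comm_monoid_add)"
proof -
 let ?K = "mkeys f \<union> mkeys f'"
 have "mkeys (f + f') \<subseteq> ?K" by (rule Poly_Mapping.keys_add)
 thus ?thesis
  using assms by (simp add: psum_eq[where K = ?K] lookup_add sum.distrib)
qed

lemma psum_zero [simp]: "psum g 0 = 0"
 by (simp add: psum_def)

lemma psum_sum: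
 assumes "!!k. g k 0 = 0" "!!k a b. g k (a + b) = g k a + g k b"
 shows "psum g (\<Sum>i\<in>I. f i) = (\<Sum>i\<in>I. psum g (f i :: 'a \<Rightarrow>\<^sub>0 'b::comm_monoid_add))"
 by (induction I rule: infinite_finite_induct) (auto simp: psum_add assms)

lemma psum_single: "g k 0 = 0 ==> psum g (msingle k a) = g k a"
 by (simp add: psum_def)

lemma mp_mult_expand:
 fixes f g :: "'a::comm_monoid_add \<Rightarrow>\<^sub>0 'b::comm_semiring_1"
 shows "f * g = (\<Sum>k\<in>mkeys f. \<Sum>l\<in>mkeys g. msingle (k + l) (mlook f k * mlook g l))"
proof -
 have "f * g = (\<Sum>k\<in>mkeys f. msingle k (mlook f k)) * (\<Sum>l\<in>mkeys g. msingle l (mlook g l))"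
  by (simp add: mp_expand)
 thus ?thesis by (simp add: sum_product mult_single)
qed

lemma lookup_mult_expand:
 fixes f g :: "'a::comm_monoid_add \<Rightarrow>\<^sub>0 'b::comm_semiring_1"
 shows "mlook (f * g) n = (\<Sum>k\<in>mkeys f. \<Sum>l\<in>mkeys g. if k + l = n then mlook f k * mlook g l else 0)"
 by (subst mp_mult_expand) (simp add: lookup_sum lookup_single when_def)

lemma lookup_single_mult:
 fixes g :: "'a::cancel_comm_monoid_add \<Rightarrow>\<^sub>0 'b::comm_semiring_1"
 shows "mlook (msingle k c * g) (k + n) = c * mlook g n"
proof (cases "c = 0")
 case False
 have "mlook (msingle k c * g) (k + n) = (\<Sum>l\<in>mkeys g. if l = n then c * mlook g l else 0)"
  using False by (subst lookup_mult_expand) simp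
 thus ?thesis by (simp add: in_keys_iff)
qed simp

lemma lookup_single_mult_0:
 fixes g :: "'a::comm_monoid_add \<Rightarrow>\<^sub>0 'b::comm_semiring_1"
 assumes "!!l. k + l ~= n"
 shows "mlook (msingle k c * g) n = 0"
proof (cases "c = 0")
 case False
 thus ?thesis using assms by (subst lookup_mult_expand) simp
qed simp

subsection \<open>Substitutions\<close>

definition msub :: "((nat \<Rightarrow>\<^sub>0 nat) => (nat \<Rightarrow>\<^sub>0 nat)) => ('e => 'e) => 'e::comm_ring_1 mp => 'e mp" where
 "msub ka ta f = psum (%mu c. msingle (ka mu) (ta c)) f"

text \<open>Used for the shift of all variables by one and for a field automorphism combined with a
  permutation of the variables. Injectivity lets these endomorphisms extend to fractions.\<close>

locale monomial_sub = comm_ring_hom ta for ta :: "'e::comm_ring_1 => 'e" +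
 fixes ka :: "(nat \<Rightarrow>\<^sub>0 nat) => (nat \<Rightarrow>\<^sub>0 nat)"
 assumes ka_add: "ka (a + b) = ka a + ka b" and ka_inj: "inj ka" and ta_inj: "inj ta"
begin

lemma ka_0 [simp]: "ka 0 = 0"
 using ka_add[of 0 0] by (metis add_cancel_right_left add.right_neutral)

lemma msub_add: "msub ka ta (f + g) = msub ka ta f + msub ka ta g"
 unfolding msub_def by (rule psum_add) (auto simp: hom_distribs single_add)

lemma msub_sum: "msub ka ta (\<Sum>i\<in>I. f i) = (\<Sum>i\<in>I. msub ka ta (f i))"
 unfolding msub_def by (rule psum_sum) (auto simp: hom_distribs single_add)

lemma msub_single [simp]: "msub ka ta (msingle k c) = msingle (ka k) (ta c)"
 unfolding msub_def by (rule psum_single) auto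

lemma msub_mult: "msub ka ta (f * g) = msub ka ta f * msub ka ta g"
proof -
 have f: "msub ka ta f = (\<Sum>k\<in>mkeys f. msingle (ka k) (ta (mlook f k)))" for f
  by (simp add: msub_def psum_def)
 have "msub ka ta (f * g) = (\<Sum>k\<in>mkeys f. \<Sum>l\<in>mkeys g. msingle (ka k + ka l) (ta (mlook f k) * ta (mlook g l)))"
  by (simp only: mp_mult_expand[of f g] msub_sum msub_single ka_add hom_mult)
 also have "... = msub ka ta f * msub ka ta g"
  by (simp only: f sum_product mult_single)
 finally show ?thesis .
qed

lemma lookup_msub: "mlook (msub ka ta f) (ka mu) = ta (mlook f mu)"
proof -
 have "mlook (msub ka ta f) (ka mu) = (\<Sum>k\<in>mkeys f. if k = mu then ta (mlook f k) else 0)"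
  using ka_inj by (simp add: msub_def psum_def lookup_sum lookup_single when_def inj_eq)
 thus ?thesis by (simp add: in_keys_iff)
qed

lemma lookup_msub_notin: "ny \<notin> range ka ==> mlook (msub ka ta f) ny = 0"
 by (auto simp: msub_def psum_def lookup_sum lookup_single when_def intro!: sum.neutral)

lemma inj_msub: "inj (msub ka ta)"
proof (rule injI)
 fix f g assume "msub ka ta f = msub ka ta g"
 thus "f = g"
  using ta_inj by (intro poly_mapping_eqI) (metis injD lookup_msub)
qed

sublocale msub: inj_comm_ring_hom "msub ka ta"
proof
 show "msub ka ta 1 = 1"
  by (simp flip: single_one)
 show "!!x. msub ka ta x = 0 ==> x = 0"
  using inj_msub by (metis inj_eq msub_def psum_zero)
qed (auto simp: msub_add msub_mult msub_def[of _ _ 0])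

end

definition ren :: "(nat => nat) => (nat \<Rightarrow>\<^sub>0 nat) => (nat \<Rightarrow>\<^sub>0 nat)" where
 "ren pm mu = psum (%i n. msingle (pm i) n) mu"

lemma ren_add: "ren pm (mu + ny) = ren pm mu + ren pm ny"
 unfolding ren_def by (rule psum_add) (auto simp: single_add)

lemma ren_single [simp]: "ren pm (msingle i n) = msingle (pm i) n"
 unfolding ren_def by (rule psum_single) auto

lemma ren_0 [simp]: "ren pm 0 = 0"
 by (simp add: ren_def)

lemma lookup_ren: "inj pm ==> mlook (ren pm mu) (pm i) = mlook mu i"
proof -
 assume "inj pm"
 hence "mlook (ren pm mu) (pm i) = (\<Sum>k\<in>mkeys mu. if k = i then mlook mu k else 0)"
  by (simp add: ren_def psum_def lookup_sum lookup_single when_def inj_eq)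
 thus ?thesis by (simp add: in_keys_iff)
qed

lemma lookup_ren_notin: "j \<notin> range pm ==> mlook (ren pm mu) j = 0"
 by (auto simp: ren_def psum_def lookup_sum lookup_single when_def intro!: sum.neutral)

lemma inj_ren: "inj pm ==> inj (ren pm)"
 by (rule injI, rule poly_mapping_eqI) (metis lookup_ren)

lemma monomial_sub_ren:
 "comm_ring_hom ta ==> inj ta ==> inj pm ==> monomial_sub ta (ren pm)"
 by (simp add: monomial_sub_def monomial_sub_axioms_def ren_add inj_ren)

lemma ren_comp: "ren pm (ren pm' mu) = ren (pm \<circ> pm') mu"
proof -
 have "ren pm (\<Sum>i\<in>I. f i) = (\<Sum>i\<in>I. ren pm (f i))" for f :: "nat => nat \<Rightarrow>\<^sub>0 nat" and I
  unfolding ren_def by (rule psum_sum) (auto simp: single_add)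
 moreover have "ren pm mu = (\<Sum>i\<in>mkeys mu. msingle (pm i) (mlook mu i))" for pm mu
  by (simp add: ren_def psum_def)
 ultimately show ?thesis
  by (metis (no_types, lifting) comp_apply ren_single sum.cong)
qed

lemma ren_id [simp]: "ren id mu = mu" "ren (%x. x) mu = mu"
 by (simp_all add: ren_def psum_def mp_expand)

subsection \<open>Fractions\<close>

definition fr :: "'a::idom => 'a fract" where "fr a = Fract a 1"

global_interpretation fr: inj_comm_ring_hom "fr :: 'a::idom => 'a fract"
proof
 show "!!x::'a. fr x = 0 ==> x = 0"
  by (simp add: fr_def Zero_fract_def eq_fract)
qed (auto simp: fr_def Zero_fract_def One_fract_def)

lemma Fract_fr: "b ~= 0 ==> Fract a b = fr a / fr b"
 by (simp add: fr_def)

lemma fract_cases_fr: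
 fixes q :: "'a::idom fract"
 obtains a b where "b ~= 0" "q = fr a / fr b"
 by (cases q) (metis Fract_fr)

text \<open>Independence of the representing fraction is the content of \<open>extF_frac\<close>;
  injectivity of \<open>h\<close> keeps the denominators nonzero.\<close>

definition extF :: "('a::idom => 'a) => 'a fract => 'a fract" where
 "extF h q = (THE r. \<exists>a b. b ~= 0 & q = fr a / fr b & r = fr (h a) / fr (h b))"

lemma extF_frac:
 fixes h :: "'a::idom => 'a"
 assumes "inj_comm_ring_hom h" "b ~= 0"
 shows "extF h (fr a / fr b) = fr (h a) / fr (h b)"
proof -
 interpret inj_comm_ring_hom h by (fact assms)
 show ?thesis
  unfolding extF_def
 proof (rule the_equality)
  fix r assume "\<exists>a' b'. b' ~= 0 & fr a / fr b = fr a' / fr b' & r = fr (h a') / fr (h b')"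
  then obtain a' b' where *: "b' ~= 0" "fr a / fr b = fr a' / fr b'" "r = fr (h a') / fr (h b')"
   by blast
  have "fr (a * b') = fr (a' * b)"
   using * assms(2) by (simp add: frac_eq_eq fr.hom_mult)
  hence "h a * h b' = h a' * h b"
   by (metis fr.eq_iff hom_mult)
  hence "fr (h a) * fr (h b') = fr (h a') * fr (h b)"
   by (metis fr.hom_mult)
  moreover have "h b ~= 0" "h b' ~= 0"
   using assms * by auto
  ultimately show "r = fr (h a) / fr (h b)"
   using * by (simp add: frac_eq_eq)
 qed (use assms in blast)
qed

lemma extF_hom:
 fixes h :: "'a::idom => 'a"
 assumes "inj_comm_ring_hom h"
 shows "inj_comm_ring_hom (extF h)"
proof -
 interpret inj_comm_ring_hom h by (fact assms)
 note eq = extF_frac[OF assms]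
 have fr: "extF h (fr a) = fr (h a)" for a
  using eq[of 1 a] by simp
 show ?thesis
 proof
  show "extF h 0 = 0" "extF h 1 = 1"
   using fr[of 0] fr[of 1] by simp_all
  fix x y :: "'a fract"
  obtain a b where x: "b ~= 0" "x = fr a / fr b" by (rule fract_cases_fr)
  obtain c d where y: "d ~= 0" "y = fr c / fr d" by (rule fract_cases_fr)
  have nz: "h b ~= 0" "h d ~= 0" "b * d ~= 0" using x y by auto
  have "x + y = fr (a * d + c * b) / fr (b * d)"
   using x y by (simp add: add_frac_eq fr.hom_add fr.hom_mult)
  hence "extF h (x + y) = fr (h (a * d + c * b)) / fr (h (b * d))"
   using eq[OF nz(3)] by simp
  also have "... = fr (h a) / fr (h b) + fr (h c) / fr (h d)"
   using nz by (simp add: add_frac_eq fr.hom_add fr.hom_mult hom_distribs)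
  finally show "extF h (x + y) = extF h x + extF h y"
   using x y eq by simp
  have "x * y = fr (a * c) / fr (b * d)"
   using x y by (simp add: fr.hom_mult)
  hence "extF h (x * y) = fr (h (a * c)) / fr (h (b * d))"
   using eq[OF nz(3)] by simp
  thus "extF h (x * y) = extF h x * extF h y"
   using x y eq by (simp add: fr.hom_mult hom_distribs)
  show "x = 0" if "extF h x = 0"
   using that x eq by simp
 qed
qed

lemma extF_fr:
 assumes "inj_comm_ring_hom h"
 shows "extF h (fr a) = fr (h a)"
proof -
 interpret inj_comm_ring_hom h by (fact assms)
 show ?thesis using extF_frac[OF assms, of 1 a] by simp
qed

subsection \<open>A valuation ring with residue field the coefficient field\<close>

text \<open>Exponents are ordered lexicographically, and the smallest exponent of a nonzero
  polynomial is its value under a valuation; \<open>bnd f ny\<close> bounds this value from below by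
  \<open>ny\<close>.\<close>

definition bnd :: "'e::zero mp => (nat \<Rightarrow>\<^sub>0 nat) => bool" where
 "bnd f ny \<longleftrightarrow> (\<forall>mu\<in>mkeys f. ny \<le> mu)"

lemma bnd_mult:
 fixes f g :: "'e::comm_ring_1 mp"
 assumes "bnd f mu" "bnd g ny"
 shows "bnd (f * g) (mu + ny)" "mlook (f * g) (mu + ny) = mlook f mu * mlook g ny"
proof -
 show "bnd (f * g) (mu + ny)"
  unfolding bnd_def
 proof
  fix k assume "k \<in> mkeys (f * g)"
  then obtain a b where "k = a + b" "a \<in> mkeys f" "b \<in> mkeys g"
   using Poly_Mapping.keys_mult by blast
  thus "mu + ny \<le> k" using assms by (auto simp: bnd_def intro: add_mono)
 qed
 have *: "k = mu & l = ny" if "k \<in> mkeys f" "l \<in> mkeys g" "k + l = mu + ny" for k l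
 proof -
  have "mu \<le> k" "ny \<le> l" using that assms by (auto simp: bnd_def)
  have "\<not> mu < k" using add_less_le_mono[of mu k ny l] \<open>ny \<le> l\<close> that(3) by auto
  moreover have "\<not> ny < l" using add_le_less_mono[of mu k ny l] \<open>mu \<le> k\<close> that(3) by auto
  ultimately show ?thesis using \<open>mu \<le> k\<close> \<open>ny \<le> l\<close> by auto
 qed
 have "mlook (f * g) (mu + ny) = (\<Sum>k\<in>mkeys f. \<Sum>l\<in>mkeys g. if k = mu & l = ny then mlook f k * mlook g l else 0)"
  unfolding lookup_mult_expand using * by (intro sum.cong) auto
 also have "... = (\<Sum>k\<in>mkeys f. if k = mu then mlook f k * mlook g ny else 0)"
  by (intro sum.cong) (auto simp: in_keys_iff)
 also have "... = mlook f mu * mlook g ny"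
  by (simp add: in_keys_iff)
 finally show "mlook (f * g) (mu + ny) = mlook f mu * mlook g ny" .
qed

lemma bnd_add: "bnd f mu ==> bnd g mu ==> bnd (f + g :: 'e::comm_ring_1 mp) mu"
 unfolding bnd_def using Poly_Mapping.keys_add[of f g] by blast

definition lm :: "'e::zero mp => (nat \<Rightarrow>\<^sub>0 nat)" where "lm f = Min (mkeys f)"

lemma lm: "f ~= 0 ==> bnd f (lm f)" "f ~= 0 ==> mlook f (lm f) ~= 0"
 by (auto simp: lm_def bnd_def simp flip: in_keys_iff)

text \<open>Membership in the valuation ring and the residue in one relation: \<open>a / b\<close>
  is integral when the value of \<open>a\<close> is at least that of \<open>b\<close>. A strictly
  larger value gives \<open>mlook a (lm b) = 0\<close>, hence residue 0.\<close>

definition isres :: "'e::field mp fract => 'e => bool" where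
 "isres q e \<longleftrightarrow> (\<exists>a b. b ~= 0 & q = fr a / fr b & bnd a (lm b) & e = mlook a (lm b) / mlook b (lm b))"

lemma isres_unique:
 assumes "isres q e" "isres q e'"
 shows "e = e'"
proof -
 from assms obtain a b a' b' where *: "b ~= 0" "q = fr a / fr b" "bnd a (lm b)" "e = mlook a (lm b) / mlook b (lm b)"
   "b' ~= 0" "q = fr a' / fr b'" "bnd a' (lm b')" "e' = mlook a' (lm b') / mlook b' (lm b')"
  unfolding isres_def by blast
 have "fr (a * b') = fr (a' * b)"
  using * by (simp add: frac_eq_eq fr.hom_mult)
 hence "a * b' = a' * b" by simp
 hence "mlook (a * b') (lm b + lm b') = mlook (a' * b) (lm b' + lm b)"
  by (simp add: add.commute)
 hence "mlook a (lm b) * mlook b' (lm b') = mlook a' (lm b') * mlook b (lm b)"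
  using * by (simp add: bnd_mult lm)
 thus ?thesis using * by (simp add: frac_eq_eq lm)
qed

lemma lm_mult:
 fixes f g :: "'e::field mp"
 assumes "f ~= 0" "g ~= 0"
 shows "lm (f * g) = lm f + lm g"
proof -
 note b = bnd_mult[OF lm(1)[OF assms(1)] lm(1)[OF assms(2)]]
 have "mlook (f * g) (lm f + lm g) ~= 0" using b(2) lm(2)[OF assms(1)] lm(2)[OF assms(2)] by simp
 hence "lm f + lm g \<in> mkeys (f * g)" by (simp add: in_keys_iff)
 thus ?thesis unfolding lm_def[of "f * g"] using b(1)
  by (intro Min_eqI) (auto simp: bnd_def)
qed

lemma isres_add: "isres q e ==> isres q' e' ==> isres (q + q') (e + e')"
 and isres_mult: "isres q e ==> isres q' e' ==> isres (q * q') (e * e')"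
proof -
 assume "isres q e" "isres q' e'"
 then obtain a b a' b' where *: "b ~= 0" "q = fr a / fr b" "bnd a (lm b)" "e = mlook a (lm b) / mlook b (lm b)"
   "b' ~= 0" "q' = fr a' / fr b'" "bnd a' (lm b')" "e' = mlook a' (lm b') / mlook b' (lm b')"
  by (auto simp: isres_def)
 have l: "lm (b * b') = lm b + lm b'" "lm (b * b') = lm b' + lm b" using * by (auto simp: lm_mult add.commute)
 have b: "mlook (b * b') (lm (b * b')) = mlook b (lm b) * mlook b' (lm b')"
  using * by (simp add: l(1) bnd_mult lm)
 show "isres (q * q') (e * e')"
  unfolding isres_def
  by (rule exI[of _ "a * a'"], rule exI[of _ "b * b'"])
    (use * in \<open>simp add: fr.hom_mult b bnd_mult lm l(1)\<close>)
 have 1: "bnd (a * b') (lm (b * b'))" "mlook (a * b') (lm (b * b')) = mlook a (lm b) * mlook b' (lm b')"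
  using * by (simp_all add: l(1) bnd_mult lm)
 have 2: "bnd (a' * b) (lm (b * b'))" "mlook (a' * b) (lm (b * b')) = mlook a' (lm b') * mlook b (lm b)"
  using * by (simp_all add: l(2) bnd_mult lm)
 show "isres (q + q') (e + e')"
  unfolding isres_def
  by (rule exI[of _ "a * b' + a' * b"], rule exI[of _ "b * b'"])
    (use * 1 2 b in \<open>simp add: fr.hom_mult fr.hom_add bnd_add lookup_add lm add_frac_eq\<close>)
qed

lemma isres_const: "isres (fr (msingle 0 c)) (c::'e::field)"
proof -
 have "lm (1::'e mp) = 0"
  by (simp add: lm_def)
 moreover have "bnd (msingle 0 c) 0" by (auto simp: bnd_def)
 ultimately show ?thesis unfolding isres_def
  by (intro exI[of _ "msingle 0 c"] exI[of _ 1]) (auto simp: lookup_one)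
qed

text \<open>The defining property of a valuation ring, from the totality of the order on
  exponents.\<close>

lemma isres_total:
 fixes q :: "'e::field mp fract"
 assumes "q ~= 0"
 shows "(\<exists>e. isres q e) \<or> (\<exists>e. isres (1 / q) e)"
proof -
 obtain a b where ab: "b ~= 0" "q = fr a / fr b" by (rule fract_cases_fr)
 hence a: "a ~= 0" using assms by auto
 have "bnd a (lm b) \<or> bnd b (lm a)"
  using lm(1)[OF a] lm(1)[OF ab(1)] unfolding bnd_def
  by (metis linear order_trans)
 thus ?thesis
 proof
  assume "bnd a (lm b)"
  thus ?thesis using ab unfolding isres_def by blast
 next
  assume *: "bnd b (lm a)"
  have "1 / q = fr b / fr a" using ab a by simp
  thus ?thesis using a * unfolding isres_def by blast
 qed
qed

subsection \<open>Evaluation at the origin\<close>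

definition ev0 :: "'e::zero mp => 'e" where "ev0 f = mlook f 0"

global_interpretation ev0: comm_ring_hom "ev0 :: 'e::comm_ring_1 mp => 'e"
proof
 fix f g :: "'e mp"
 \<comment> \<open>Zero is the smallest exponent, so the constant term of a product is the product
   of the constant terms.\<close>
 have b: "bnd h 0" for h :: "'e mp"
  unfolding bnd_def
 proof
  fix mu :: "nat \<Rightarrow>\<^sub>0 nat"
  show "0 \<le> mu"
  proof (cases "mu = 0")
   case False
   then obtain i where i: "mlook mu i ~= 0" by (metis lookup_zero poly_mapping_eqI)
   define k where "k = (LEAST i. mlook mu i ~= 0)"
   have "mlook mu k ~= 0" unfolding k_def by (rule LeastI[of _ i]) (fact i)
   moreover have "mlook mu j = 0" if "j < k" for j
    using that not_less_Least unfolding k_def by blast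
   ultimately have "0 < mu"
    by (auto simp: less_poly_mapping.rep_eq less_fun_def)
   thus ?thesis by simp
  qed simp
 qed
 show "ev0 (f * g) = ev0 f * ev0 g"
  using bnd_mult(2)[OF b[of f] b[of g]] by (simp add: ev0_def)
qed (auto simp: ev0_def lookup_add lookup_one)

subsection \<open>Greatest common divisors\<close>

text \<open>The property \<open>fractional_gcd S H\<close> says that the fractional ideal inverse to a finitely generated
 one with generators in \<open>H\<close> is principal; this is how unique factorisation enters.\<close>

definition fractional_gcd :: "'k::field set => 'k set => bool" where
 "fractional_gcd S H \<longleftrightarrow> (\<forall>Z. finite Z & Z \<subseteq> H & (\<exists>z\<in>Z. z ~= 0) -->
   (\<exists>e. e ~= 0 & (\<forall>w. (\<forall>z\<in>Z. w * z \<in> S) \<longleftrightarrow> w * e \<in> S)))"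

definition pin :: "'k::zero set => 'k poly set" where
 "pin S = {p. \<forall>i. coeff p i \<in> S}"

locale subring_set =
 fixes S :: "'k::field set"
 assumes S_0 [simp]: "0 \<in> S" and S_1 [simp]: "1 \<in> S"
  and S_add: "a \<in> S ==> b \<in> S ==> a + b \<in> S"
  and S_minus: "a \<in> S ==> b \<in> S ==> a - b \<in> S"
  and S_mult: "a \<in> S ==> b \<in> S ==> a * b \<in> S"
begin

lemma S_sum: "(!!i. i \<in> I ==> f i \<in> S) ==> sum f I \<in> S"
 by (induction I rule: infinite_finite_induct) (auto intro: S_add)

lemma S_power: "a \<in> S ==> a ^ n \<in> S"
 by (induction n) (auto intro: S_mult)

lemma pin_add: "p \<in> pin S ==> q \<in> pin S ==> p + q \<in> pin S"
 and pin_minus: "p \<in> pin S ==> q \<in> pin S ==> p - q \<in> pin S"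
 and pin_smult: "a \<in> S ==> p \<in> pin S ==> smult a p \<in> pin S"
 and pin_monom: "a \<in> S ==> monom a n \<in> pin S"
 and pin_0 [simp]: "0 \<in> pin S"
 and pin_mult: "p \<in> pin S ==> q \<in> pin S ==> p * q \<in> pin S"
 by (auto simp: pin_def coeff_mult intro!: S_add S_minus S_mult S_sum)

lemma pin_sum: "(!!i. i \<in> I ==> f i \<in> pin S) ==> sum f I \<in> pin S"
 by (induction I rule: infinite_finite_induct) (auto intro: pin_add)

text \<open>Gauss' lemma in the form: if \<open>ab\<close> has coefficients in \<open>S\<close>, then so has every product of a
 coefficient of \<open>a\<close> and one of \<open>b\<close>. Splitting off the leading term of \<open>b\<close> and then that of \<open>a\<close>
 lowers the degrees.\<close>

lemma gauss:
 assumes H: "fractional_gcd S H" "0 \<in> H"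
 shows "a \<in> pin H ==> a * b \<in> pin S ==> (\<forall>i\<ge>n. coeff a i = 0) ==> (\<forall>j\<ge>m. coeff b j = 0)
  ==> coeff a i * coeff b j \<in> S"
proof (induction "n + m" arbitrary: n m a b i j rule: less_induct)
 case less
 show ?case
 proof (cases "n = 0 \<or> m = 0 \<or> a = 0")
  case True
  thus ?thesis using less.prems by (auto simp: poly_eq_iff)
 next
  case False
  then obtain n' m' where nm: "n = Suc n'" "m = Suc m'" by (metis not0_implies_Suc)
  have a0: "a ~= 0" using False by simp
  define Z where "Z = coeff a ` {..<n}"
  have cZ: "coeff a i \<in> insert 0 Z" for i using less.prems(3) by (cases "i < n") (auto simp: Z_def)
  have "finite Z" "Z \<subseteq> H" using less.prems(1) by (auto simp: Z_def pin_def)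
  moreover have "\<exists>z\<in>Z. z ~= 0"
  proof -
   obtain k where "coeff a k ~= 0" using a0 by (auto simp: poly_eq_iff)
   thus ?thesis using cZ[of k] by auto
  qed
  \<comment> \<open>\<open>e\<close> is the content of \<open>a\<close>: it divides every
    coefficient, and a multiplier that makes all coefficients integral makes \<open>e\<close>
    integral.\<close>
  ultimately obtain e where e: "e ~= 0" "!!w. (\<forall>z\<in>Z. w * z \<in> S) \<longleftrightarrow> w * e \<in> S"
   using H unfolding fractional_gcd_def by metis
  have ae: "coeff a i / e \<in> S" for i
  proof -
   have "\<forall>z\<in>Z. (1 / e) * z \<in> S" using e(2)[of "1 / e"] e(1) by simp
   thus ?thesis using cZ[of i] by auto
  qed
  have top: "coeff a n' * coeff b m' \<in> S"
  proof -
   have "coeff (a * b) (n' + m') = (\<Sum>k\<le>n' + m'. coeff a k * coeff b (n' + m' - k))"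
    by (rule coeff_mult)
   also have "... = (\<Sum>k\<le>n' + m'. if k = n' then coeff a n' * coeff b m' else 0)"
   proof (rule sum.cong[OF refl])
    fix k assume "k \<in> {..n' + m'}"
    consider "k < n'" | "k = n'" | "k > n'" by linarith
    thus "coeff a k * coeff b (n' + m' - k) = (if k = n' then coeff a n' * coeff b m' else 0)"
     by cases (use less.prems(3,4) nm in auto)
   qed
   also have "... = coeff a n' * coeff b m'" by simp
   finally show ?thesis using less.prems(2) by (metis (no_types, lifting) mem_Collect_eq pin_def)
  qed
  \<comment> \<open>Removing the leading term of \<open>b\<close> alone could destroy integrality of
    the product. After scaling by \<open>c\<close> the removed part is
    \<open>coeff a n' * coeff b m'\<close>, which lies in \<open>S\<close>, times the polynomial
    \<open>a / e\<close> over \<open>S\<close>.\<close>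
  define c where "c = coeff a n' / e"
  define b' where "b' = b - monom (coeff b m') m'"
  have b': "coeff b' j = (if j = m' then 0 else coeff b j)" for j
   by (auto simp: b'_def)
  have "a * smult c b' = smult c (a * b) - monom 1 m' * smult (coeff a n' * coeff b m') (smult (1 / e) a)"
   using e(1) by (simp add: b'_def c_def algebra_simps smult_diff_right monom_altdef)
  also have "... \<in> pin S"
  proof -
   have "c \<in> S" "smult (1 / e) a \<in> pin S" using ae by (auto simp: c_def pin_def)
   thus ?thesis
    using pin_minus[OF pin_smult pin_mult[OF pin_monom pin_smult]] less.prems(2) top S_1 by blast
  qed
  finally have m1: "a * smult c b' \<in> pin S" .
  have low: "coeff a i * coeff (smult c b') j \<in> S" for i j
   by (rule less.hyps[of n m' a "smult c b'"]) (use nm less.prems m1 b' in auto)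
  have an: "coeff a n' * coeff b j \<in> S" for j
  proof (cases "j = m'")
   case False
   \<comment> \<open>By the property of the content this makes \<open>c * coeff b j * e\<close>
     integral, and that is \<open>coeff a n' * coeff b j\<close>.\<close>
   have "\<forall>z\<in>Z. (c * coeff b j) * z \<in> S"
    using low[of _ j] False by (auto simp: Z_def b' mult_ac)
   hence "c * coeff b j * e \<in> S" using e by blast
   thus ?thesis using e(1) by (simp add: c_def mult_ac)
  qed (use top in simp)
  define a' where "a' = a - monom (coeff a n') n'"
  have a': "coeff a' j = (if j = n' then 0 else coeff a j)" for j
   by (auto simp: a'_def)
  have "a' * b = a * b - monom 1 n' * smult (coeff a n') b"
   by (simp add: a'_def algebra_simps monom_altdef)
  also have "... \<in> pin S"
  proof -
   have "smult (coeff a n') b \<in> pin S" using an by (auto simp: pin_def)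
   thus ?thesis using pin_minus[OF _ pin_mult[OF pin_monom]] less.prems(2) S_1 by blast
  qed
  finally have m2: "a' * b \<in> pin S" .
  have "a' \<in> pin H" using less.prems(1) H(2) by (auto simp: pin_def a')
  have "coeff a' i * coeff b j \<in> S"
   by (rule less.hyps[OF _ \<open>a' \<in> pin H\<close> m2, of n' m]) (use nm less.prems a' in auto)
  thus ?thesis using an[of j] by (cases "i = n'") (auto simp: a')
 qed
qed

end

locale subfield_set = subring_set H for H :: "'k::field set" +
 assumes H_div: "a \<in> H ==> b \<in> H ==> b ~= 0 ==> a / b \<in> H"
begin

lemma division:
 assumes "d \<in> pin H" "d ~= 0"
 shows "f \<in> pin H ==> \<exists>q\<in>pin H. \<exists>r\<in>pin H. f = d * q + r & (r = 0 \<or> Polynomial.degree r < Polynomial.degree d)"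
proof (induction "if f = 0 then 0 else Suc (Polynomial.degree f)" arbitrary: f rule: less_induct)
 case less
 show ?case
 proof (cases "f = 0 \<or> Polynomial.degree f < Polynomial.degree d")
  case True
  thus ?thesis using less.prems by (intro bexI[of _ 0] bexI[of _ f]) auto
 next
  case False
  define k where "k = Polynomial.degree f - Polynomial.degree d"
  define m where "m = monom (lead_coeff f / lead_coeff d) k"
  have m: "m \<in> pin H"
   unfolding m_def using less.prems assms by (intro pin_monom H_div) (auto simp: pin_def)
  define f' where "f' = f - d * m"
  have f': "f' \<in> pin H" unfolding f'_def using less.prems assms m by (intro pin_minus pin_mult)
  have dm: "Polynomial.degree (d * m) = Polynomial.degree f" "lead_coeff (d * m) = lead_coeff f"
  proof -
   have "m ~= 0" using False assms by (auto simp: m_def monom_eq_0_iff)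
   thus "Polynomial.degree (d * m) = Polynomial.degree f"
    using assms False by (simp add: degree_mult_eq m_def degree_monom_eq k_def monom_eq_0_iff)
   show "lead_coeff (d * m) = lead_coeff f"
    unfolding lead_coeff_mult m_def lead_coeff_monom using assms by simp
  qed
  have "(if f' = 0 then 0 else Suc (Polynomial.degree f')) < (if f = 0 then 0 else Suc (Polynomial.degree f))"
  proof (cases "f' = 0")
   case f'0: False
   have "Polynomial.degree f' \<le> Polynomial.degree f"
    unfolding f'_def using dm by (metis degree_diff_le order_refl)
   moreover have "coeff f' (Polynomial.degree f) = 0"
    unfolding f'_def using dm by simp
   ultimately have "Polynomial.degree f' < Polynomial.degree f"
    using f'0 by (metis leading_coeff_0_iff nless_le)
   thus ?thesis using False f'0 by auto
  qed (use False in auto)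
  from less.hyps[OF this f'] obtain q r where
   *: "q \<in> pin H" "r \<in> pin H" "f' = d * q + r" "r = 0 \<or> Polynomial.degree r < Polynomial.degree d" by blast
  have "f = d * (q + m) + r" using *(3) by (simp add: f'_def algebra_simps)
  thus ?thesis using * m pin_add by blast
 qed
qed

text \<open>A nonzero element of least degree in the ideal generated by \<open>Z\<close> divides all
  of \<open>Z\<close>, because a remainder would lie in the ideal as well; its membership in the
  ideal provides the Bezout coefficients \<open>c\<close>.\<close>

lemma polynomial_gcd:
 assumes "finite Z" "Z \<subseteq> pin H" "\<exists>z\<in>Z. z ~= 0"
 obtains d c g where "d \<in> pin H" "d ~= 0" "d = (\<Sum>z\<in>Z. c z * z)"
  "!!z. z \<in> Z ==> g z \<in> pin H" "!!z. z \<in> Z ==> z = d * g z"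
proof -
 define I where "I = {(\<Sum>z\<in>Z. c z * z) | c. \<forall>z\<in>Z. c z \<in> pin H}"
 have IH: "x \<in> pin H" if "x \<in> I" for x
  using that assms by (auto simp: I_def intro!: pin_sum pin_mult)
 have Z_I: "z \<in> I" if "z \<in> Z" for z
 proof -
  have "(\<Sum>y\<in>Z. (if y = z then 1 else 0) * y) = z"
   using assms(1) that by (simp add: if_distrib[of "%x. x * _"] cong: if_cong)
  moreover have "(1::'k poly) \<in> pin H" by (auto simp: pin_def)
  ultimately show ?thesis unfolding I_def
   by (intro CollectI exI[of _ "%y. if y = z then 1 else 0"]) auto
 qed
 have I_sub: "x - y * q \<in> I" if xy: "x \<in> I" "y \<in> I" "q \<in> pin H" for x y q
 proof -
  from xy obtain c c' where c: "x = (\<Sum>z\<in>Z. c z * z)" "\<forall>z\<in>Z. c z \<in> pin H"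
   "y = (\<Sum>z\<in>Z. c' z * z)" "\<forall>z\<in>Z. c' z \<in> pin H" by (auto simp: I_def)
  have "x - y * q = (\<Sum>z\<in>Z. (c z - c' z * q) * z)"
   by (simp add: c algebra_simps sum_subtractf sum_distrib_left)
  moreover have "\<forall>z\<in>Z. c z - c' z * q \<in> pin H" using c xy by (auto intro!: pin_minus pin_mult)
  ultimately show ?thesis unfolding I_def by (intro CollectI exI[of _ "%z. c z - c' z * q"]) auto
 qed
 obtain z0 where z0: "z0 \<in> Z" "z0 ~= 0" using assms by blast
 define d where "d = (ARG_MIN Polynomial.degree x. x \<in> I & x ~= 0)"
 have d: "d \<in> I" "d ~= 0" and dmin: "!!x. x \<in> I ==> x ~= 0 ==> Polynomial.degree d \<le> Polynomial.degree x"
  using arg_min_nat_lemma[of "%x. x \<in> I & x ~= 0" z0 Polynomial.degree] Z_I z0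
  unfolding d_def by blast+
 have "\<exists>q. q \<in> pin H & z = d * q" if z: "z \<in> Z" for z
 proof -
  obtain q r where qr: "q \<in> pin H" "r \<in> pin H" "z = d * q + r" "r = 0 \<or> Polynomial.degree r < Polynomial.degree d"
   using division[OF IH[OF d(1)] d(2) IH[OF Z_I[OF z]]] by blast
  have "r \<in> I" using I_sub[OF Z_I[OF z] d(1) qr(1)] qr(3) by simp
  hence "r = 0" using qr(4) dmin by force
  thus ?thesis using qr by auto
 qed
 then obtain g where "!!z. z \<in> Z ==> g z \<in> pin H" "!!z. z \<in> Z ==> z = d * g z"
  by metis
 moreover from d(1) obtain c where "d = (\<Sum>z\<in>Z. c z * z)" by (auto simp: I_def)
 ultimately show ?thesis using that IH[OF d(1)] d(2) by blast
qed

end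

lemma fractional_gcdE:
 assumes "fractional_gcd S H" "finite Z" "Z \<subseteq> H" "z \<in> Z" "z ~= 0"
 obtains e where "e ~= 0" "!!w. (\<forall>z\<in>Z. w * z \<in> S) \<longleftrightarrow> w * e \<in> S"
 using assms unfolding fractional_gcd_def by blast

section \<open>Adjoining the variables one at a time\<close>

definition PS :: "'e::field mp fract set" where "PS = range fr"

interpretation PS: subring_set "PS :: 'e::field mp fract set"
proof
 fix a b :: "'e mp fract" assume "a \<in> PS" "b \<in> PS"
 then obtain x y where "a = fr x" "b = fr y" by (auto simp: PS_def)
 thus "a + b \<in> PS" "a - b \<in> PS" "a * b \<in> PS"
  unfolding PS_def by (metis fr.hom_add rangeI, metis fr.hom_minus rangeI, metis fr.hom_mult rangeI)
qed (auto simp: PS_def intro: range_eqI[of _ _ 0] range_eqI[of _ _ 1])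

lemma fr_PS [simp]: "fr u \<in> PS"
 by (simp add: PS_def)

text \<open>Raising all indices by one frees the variable of index 0, so that old fractions can
  serve as coefficients of polynomials in that variable.\<close>

definition shift :: "'e::field mp => 'e mp" where "shift = msub (ren Suc) (%x. x)"

lemma monomial_sub_shift: "monomial_sub (%x::'e::field. x) (ren Suc)"
proof -
 have "comm_ring_hom (%x::'e. x)" by unfold_locales auto
 thus ?thesis by (intro monomial_sub_ren) (auto intro: injI)
qed

interpretation shift: inj_comm_ring_hom "shift :: 'e::field mp => 'e mp"
proof -
 interpret monomial_sub "%x::'e. x" "ren Suc" by (rule monomial_sub_shift)
 show "inj_comm_ring_hom (shift :: 'e mp => 'e mp)" unfolding shift_def by unfold_locales
qed

interpretation shiftF: inj_comm_ring_hom "extF shift :: 'e::field mp fract => _"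
 by (rule extF_hom) unfold_locales

lemma shiftF_fr [simp]: "extF shift (fr u) = fr (shift u)"
 by (rule extF_fr) unfold_locales

definition x0 :: "'e::field mp" where "x0 = msingle (msingle 0 1) 1"

text \<open>Reads a polynomial over the function field as a fraction again: the indeterminate
  becomes the variable that the shift of the coefficients has freed.\<close>

definition hat :: "'e::field mp fract poly => 'e mp fract" where
 "hat p = poly (map_poly (extF shift) p) (fr x0)"

interpretation shiftP: map_poly_inj_comm_ring_hom "extF shift :: 'e::field mp fract => _" ..

interpretation hat: comm_ring_hom "hat :: 'e::field mp fract poly => _"
proof
 show "hat (p + q) = hat p + hat q" "hat (p * q) = hat p * hat q" for p q :: "'e mp fract poly"
  by (simp_all only: hat_def shiftP.hom_add shiftP.hom_mult poly_add poly_mult)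
qed (simp_all add: hat_def)

lemma hat_const [simp]: "hat [:c:] = extF shift c"
 by (simp add: hat_def shiftF.map_poly_pCons_hom)

lemma hat_smult: "hat (smult c p) = extF shift c * hat p"
proof -
 have "hat (smult c p) = hat ([:c:] * p)" by simp
 thus ?thesis by (simp only: hat.hom_mult hat_const)
qed

text \<open>The coefficients of \<open>u\<close> as a polynomial in the variable with index 0; the other indices are
 lowered by one.\<close>

definition low :: "'e::field mp => nat => 'e mp" where
 "low u k = (\<Sum>mu\<in>{mu\<in>mkeys u. mlook mu 0 = k}. msingle (Poly_Mapping.map_key Suc mu) (mlook u mu))"

lemma lookup_mapkey_Suc [simp]: "mlook (Poly_Mapping.map_key Suc mu) i = mlook mu (Suc i)"
 by (simp add: Poly_Mapping.map_key.rep_eq)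

lemma split_var: "ren Suc (Poly_Mapping.map_key Suc mu) + msingle 0 (mlook mu 0) = mu"
proof (rule poly_mapping_eqI)
 fix i
 have [simp]: "mlook (ren Suc ny) (Suc j) = mlook ny j" for ny j by (rule lookup_ren) simp
 have [simp]: "mlook (ren Suc ny) 0 = 0" for ny by (rule lookup_ren_notin) auto
 show "mlook (ren Suc (Poly_Mapping.map_key Suc mu) + msingle 0 (mlook mu 0)) i = mlook mu i"
  by (cases i) (auto simp: lookup_add lookup_single)
qed

lemma x0_power: "x0 ^ k = msingle (msingle 0 k) 1"
 by (induction k) (auto simp: x0_def mult_single single_add[symmetric])

lemma low_sum:
 fixes u :: "'e::field mp"
 assumes "!!mu. mu \<in> mkeys u ==> mlook mu 0 < N"
 shows "u = (\<Sum>k<N. shift (low u k) * x0 ^ k)"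
proof -
 interpret monomial_sub "%x::'e. x" "ren Suc" by (rule monomial_sub_shift)
 have "shift (low u k) * x0 ^ k = (\<Sum>mu\<in>{mu\<in>mkeys u. mlook mu 0 = k}. msingle mu (mlook u mu))" for k
 proof -
  have "shift (low u k) * x0 ^ k = (\<Sum>mu\<in>{mu\<in>mkeys u. mlook mu 0 = k}.
    msingle (ren Suc (Poly_Mapping.map_key Suc mu) + msingle 0 k) (mlook u mu))"
   by (simp only: shift_def low_def msub_sum msub_single sum_distrib_right x0_power mult_single mult_1_right)
  also have "... = (\<Sum>mu\<in>{mu\<in>mkeys u. mlook mu 0 = k}. msingle mu (mlook u mu))"
   by (intro sum.cong refl) (use split_var in force)
  finally show ?thesis .
 qed
 hence "(\<Sum>k<N. shift (low u k) * x0 ^ k) = (\<Sum>k<N. \<Sum>mu\<in>{mu\<in>mkeys u. mlook mu 0 = k}. msingle mu (mlook u mu))"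
  by simp
 also have "... = (\<Sum>mu\<in>mkeys u. msingle mu (mlook u mu))"
  using assms by (intro sum.group) auto
 also have "... = u" by (simp add: mp_expand)
 finally show ?thesis by simp
qed

lemma hat_monom: "hat (monom c k) = extF shift c * fr x0 ^ k"
 by (simp add: hat_def poly_monom hom_distribs)

lemma hat_eq_sum:
 assumes "!!k. k \<ge> N ==> coeff q k = 0"
 shows "hat q = (\<Sum>k<N. extF shift (coeff q k) * fr x0 ^ k)"
proof -
 have "q = (\<Sum>k<N. monom (coeff q k) k)"
  using assms by (intro poly_eqI) (auto simp: coeff_sum not_less)
 hence "hat q = hat (\<Sum>k<N. monom (coeff q k) k)" by simp
 thus ?thesis by (simp only: hat.hom_sum hat_monom)
qed

lemma hat_pin: "p \<in> pin PS ==> hat p \<in> PS"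
proof -
 assume p: "p \<in> pin PS"
 have "extF shift (coeff p i) \<in> PS" for i
 proof -
  obtain u where "coeff p i = fr u" using p by (auto simp: pin_def PS_def)
  thus ?thesis by simp
 qed
 moreover have "hat p = (\<Sum>k<Suc (Polynomial.degree p). extF shift (coeff p k) * fr x0 ^ k)"
  by (rule hat_eq_sum) (simp add: coeff_eq_0)
 ultimately show ?thesis
  by (simp only:) (rule PS.S_sum, rule PS.S_mult, simp, rule PS.S_power, simp)
qed

lemma hat_poly_of_low:
 fixes u :: "'e::field mp"
 obtains q where "hat q = fr u" "!!k. coeff q k = fr (low u k)"
proof -
 define N where "N = Suc (Max (insert 0 ((%mu. mlook mu 0) ` mkeys u)))"
 have N: "mlook mu 0 < N" if "mu \<in> mkeys u" for mu
  using that by (auto simp: N_def less_Suc_eq_le intro!: Max_ge)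
 define q where "q = (\<Sum>k<N. monom (fr (low u k)) k)"
 have q: "coeff q k = fr (low u k)" for k
 proof (cases "k < N")
  case False
  hence "{mu\<in>mkeys u. mlook mu 0 = k} = {}" using N by force
  hence "low u k = 0" by (simp only: low_def sum.empty)
  thus ?thesis using False by (simp add: q_def coeff_sum)
 qed (simp add: q_def coeff_sum)
 have "hat q = (\<Sum>k<N. extF shift (fr (low u k)) * fr x0 ^ k)"
  by (simp add: q_def hat.hom_sum hat_monom)
 also have "... = fr (\<Sum>k<N. shift (low u k) * x0 ^ k)"
  by (simp add: hom_distribs)
 also have "... = fr u" using low_sum[of u N] N by metis
 finally show ?thesis using that q by blast
qed

lemma low_of_sum:
 fixes c :: "nat => 'e::field mp"
 assumes "k < N"
 shows "mlook (\<Sum>k<N. shift (c k) * x0 ^ k) (msingle 0 k + ren Suc mu) = mlook (c k) mu"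
proof -
 interpret monomial_sub "%x::'e. x" "ren Suc" by (rule monomial_sub_shift)
 have ren0: "mlook (ren Suc ny) 0 = 0" for ny by (rule lookup_ren_notin) auto
 have comm: "shift (c l) * x0 ^ l = msingle (msingle 0 l) 1 * shift (c l)" for l
  by (simp only: x0_power mult.commute)
 have "mlook (shift (c l) * x0 ^ l) (msingle 0 k + ren Suc mu) = (if l = k then mlook (c k) mu else 0)" for l
 proof (cases "l = k")
  case True
  have "mlook (msingle (msingle 0 k) 1 * shift (c k)) (msingle 0 k + ren Suc mu) = mlook (shift (c k)) (ren Suc mu)"
   by (simp only: lookup_single_mult mult_1)
  also have "... = mlook (c k) mu" unfolding shift_def by (rule lookup_msub)
  finally show ?thesis unfolding True comm by (simp only: if_True simp_thms)
 next
  case False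
  have nu: "mlook (shift (c l)) ny = 0" if eq: "msingle 0 l + ny = msingle 0 k + ren Suc mu" for ny
  proof -
   have "ny \<notin> range (ren Suc)"
   proof
    assume "ny \<in> range (ren Suc)"
    then obtain ny' where "ny = ren Suc ny'" by blast
    hence "mlook (msingle 0 l + ren Suc ny') 0 = mlook (msingle 0 k + ren Suc mu) 0" using eq by simp
    thus False using False by (simp add: lookup_add ren0)
   qed
   thus ?thesis unfolding shift_def by (rule lookup_msub_notin)
  qed
  have "mlook (msingle (msingle 0 l) 1 * shift (c l)) (msingle 0 k + ren Suc mu) = 0"
  proof (cases "\<exists>ny. msingle 0 l + ny = msingle 0 k + ren Suc mu")
   case True
   then obtain ny where ny: "msingle 0 l + ny = msingle 0 k + ren Suc mu" by blast
   have "mlook (msingle (msingle 0 l) 1 * shift (c l)) (msingle 0 l + ny) = mlook (shift (c l)) ny"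
    by (simp only: lookup_single_mult mult_1)
   thus ?thesis unfolding ny nu[OF ny] .
  next
   case no: False
   show ?thesis by (rule lookup_single_mult_0) (use no in blast)
  qed
  thus ?thesis unfolding comm using False by (simp only: if_False)
 qed
 thus ?thesis using assms by (simp add: lookup_sum)
qed

lemma common_denominator:
 fixes Z :: "'a::idom fract set"
 assumes "finite Z"
 obtains v where "v ~= 0" "!!z. z \<in> Z ==> fr v * z \<in> range fr"
proof -
 have "\<exists>v. v ~= 0 & (\<forall>z\<in>Z. fr v * z \<in> range fr)"
  using assms
 proof induction
  case (insert z Z)
  then obtain v where v: "v ~= 0" "\<forall>z\<in>Z. fr v * z \<in> range fr" by blast
  obtain a b where ab: "b ~= 0" "z = fr a / fr b" by (rule fract_cases_fr)
  have "fr (v * b) * z = fr (v * a)" using ab by (simp add: fr.hom_mult)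
  moreover have "fr (v * b) * y \<in> range fr" if y: "y \<in> Z" for y
  proof -
   obtain x where "fr v * y = fr x" using v y by blast
   hence "fr (v * b) * y = fr (x * b)" by (simp add: fr.hom_mult mult_ac)
   thus ?thesis by blast
  qed
  ultimately show ?case using v ab by (intro exI[of _ "v * b"]) auto
 qed (auto intro: exI[of _ 1])
 thus ?thesis using that by blast
qed

lemma hat_inj:
 fixes p :: "'e::field mp fract poly"
 assumes "hat p = 0"
 shows "p = 0"
proof -
 obtain v where v: "v ~= 0" "!!z. z \<in> coeff p ` {..Polynomial.degree p} ==> fr v * z \<in> range fr"
  using common_denominator[of "coeff p ` {..Polynomial.degree p}"] by auto
 define N where "N = Suc (Polynomial.degree p)"
 have "\<exists>c. fr v * coeff p k = fr c" for k
 proof (cases "k \<le> Polynomial.degree p")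
  case False
  hence "coeff p k = 0" by (simp add: coeff_eq_0)
  thus ?thesis by (intro exI[of _ 0]) simp
 qed (use v in blast)
 then obtain c where c: "!!k. fr v * coeff p k = fr (c k)" by metis
 have "hat (smult (fr v) p) = 0" using assms by (simp add: hat_smult)
 moreover have "hat (smult (fr v) p) = (\<Sum>k<N. extF shift (fr (c k)) * fr x0 ^ k)"
  by (subst hat_eq_sum[of N]) (auto simp: N_def coeff_eq_0 c)
 ultimately have "fr (\<Sum>k<N. shift (c k) * x0 ^ k) = 0"
  by (simp add: hom_distribs)
 hence "(\<Sum>k<N. shift (c k) * x0 ^ k) = 0" by simp
 hence "c k = 0" if "k < N" for k
  using low_of_sum[OF that, of c] by (intro poly_mapping_eqI) simp
 hence "fr v * coeff p k = 0" if "k < N" for k using c that by simp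
 hence "coeff p k = 0" for k
  using v(1) by (cases "k < N") (auto simp: N_def coeff_eq_0)
 thus ?thesis by (simp add: poly_eq_iff)
qed

text \<open>Gauss' lemma speaks of coefficients; this translates it to integrality in all variables.
  Every polynomial is the value of \<open>hat\<close> at one with polynomial coefficients, and
  \<open>hat\<close> is injective.\<close>

lemma hat_in_PS: "hat p \<in> PS \<longleftrightarrow> p \<in> pin PS"
proof
 assume "hat p \<in> PS"
 then obtain u where u: "hat p = fr u" by (auto simp: PS_def)
 obtain q where q: "hat q = fr u" "!!k. coeff q k = fr (low u k)"
  using hat_poly_of_low[of u] by blast
 have "hat (p - q) = 0" using u q by (simp add: hat.hom_minus)
 hence "p = q" using hat_inj by fastforce
 thus "p \<in> pin PS" using q(2) by (auto simp: pin_def PS_def)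
qed (rule hat_pin)

text \<open>Bounding the indices by \<open>r\<close> gives a chain of polynomial rings whose
  fraction fields \<open>Hv r\<close> exhaust the function field, so that induction on the number of
  variables becomes possible.\<close>

definition Uv :: "nat => 'e::field mp set" where
 "Uv r = {u. \<forall>mu\<in>mkeys u. mkeys mu \<subseteq> {..<r}}"

definition Hv :: "nat => 'e::field mp fract set" where
 "Hv r = {fr u / fr v | u v. u \<in> Uv r & v \<in> Uv r & v ~= 0}"

lemma Uv_ops: "0 \<in> Uv r" "1 \<in> Uv r" "u \<in> Uv r ==> v \<in> Uv r ==> u + v \<in> Uv r"
 "u \<in> Uv r ==> - u \<in> Uv r" "u \<in> Uv r ==> v \<in> Uv r ==> u * v \<in> Uv r"
proof -
 show "0 \<in> Uv r" "1 \<in> Uv r" "u \<in> Uv r ==> - u \<in> Uv r"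
  by (auto simp: Uv_def)
 show "u + v \<in> Uv r" if "u \<in> Uv r" "v \<in> Uv r"
  using that Poly_Mapping.keys_add[of u v] by (fastforce simp: Uv_def)
 show "u * v \<in> Uv r" if "u \<in> Uv r" "v \<in> Uv r"
  unfolding Uv_def
 proof safe
  fix mu i assume "mu \<in> mkeys (u * v)" "i \<in> mkeys mu"
  then obtain a b where ab: "mu = a + b" "a \<in> mkeys u" "b \<in> mkeys v"
   using Poly_Mapping.keys_mult by blast
  hence "i \<in> mkeys a \<union> mkeys b" using \<open>i \<in> mkeys mu\<close> Poly_Mapping.keys_add[of a b] by auto
  thus "i < r" using that ab by (auto simp: Uv_def)
 qed
qed

interpretation Hv: subfield_set "Hv r :: 'e::field mp fract set" for r
proof
 show "0 \<in> (Hv r :: 'e mp fract set)" "1 \<in> (Hv r :: 'e mp fract set)"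
  unfolding Hv_def using Uv_ops(1,2)[of r] by (force intro: exI[of _ 0] exI[of _ 1])+
 fix a b :: "'e mp fract" assume "a \<in> Hv r" "b \<in> Hv r"
 then obtain u v u' v' where *: "u \<in> Uv r" "v \<in> Uv r" "v ~= 0" "a = fr u / fr v"
  "u' \<in> Uv r" "v' \<in> Uv r" "v' ~= 0" "b = fr u' / fr v'"
  unfolding Hv_def by blast
 have "a + b = fr (u * v' + u' * v) / fr (v * v')"
  using * by (simp add: add_frac_eq fr.hom_add fr.hom_mult)
 moreover have "a - b = fr (u * v' + - (u' * v)) / fr (v * v')"
  using * by (simp add: diff_frac_eq fr.hom_minus fr.hom_mult)
 moreover have "a * b = fr (u * u') / fr (v * v')"
  using * by (simp add: fr.hom_mult)
 moreover have "v * v' ~= 0" "v * v' \<in> Uv r" using * Uv_ops by auto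
 moreover have "u * v' + u' * v \<in> Uv r" "u * v' + - (u' * v) \<in> Uv r" "u * u' \<in> Uv r"
 proof -
  have "u * v' \<in> Uv r" "u' * v \<in> Uv r" using * Uv_ops(5) by blast+
  thus "u * v' + u' * v \<in> Uv r" "u * v' + - (u' * v) \<in> Uv r" by (blast intro: Uv_ops(3,4))+
  show "u * u' \<in> Uv r" using * Uv_ops(5) by blast
 qed
 ultimately show "a + b \<in> Hv r" "a - b \<in> Hv r" "a * b \<in> Hv r"
  unfolding Hv_def by blast+
 show "a / b \<in> Hv r" if "b ~= 0"
 proof -
  have "a / b = fr (u * v') / fr (v * u')" using * by (simp add: fr.hom_mult)
  moreover have "v * u' ~= 0" using * that by auto
  ultimately show ?thesis unfolding Hv_def using * Uv_ops(5) by blast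
 qed
qed

lemma low_Uv: "u \<in> Uv (Suc r) ==> low u k \<in> Uv r"
proof -
 assume u: "u \<in> Uv (Suc r)"
 have "mkeys (Poly_Mapping.map_key Suc mu) \<subseteq> {..<r}" if "mu \<in> mkeys u" for mu
 proof
  fix i assume "i \<in> mkeys (Poly_Mapping.map_key Suc mu)"
  hence "Suc i \<in> mkeys mu" by (simp add: in_keys_iff)
  thus "i \<in> {..<r}" using u that by (force simp: Uv_def)
 qed
 hence "msingle (Poly_Mapping.map_key Suc mu) (mlook u mu) \<in> Uv r" if "mu \<in> mkeys u" for mu
  using that by (auto simp: Uv_def)
 hence *: "sum (%mu. msingle (Poly_Mapping.map_key Suc mu) (mlook u mu)) M \<in> Uv r" if "M \<subseteq> mkeys u" for M
  using that by (induction M rule: infinite_finite_induct) (auto intro: Uv_ops)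
 show ?thesis unfolding low_def by (rule *) auto
qed

text \<open>The gcd in one more variable is a product of \<open>hat d\<close>, the gcd over the
  coefficient field, and the shifted content \<open>e\<close> of the cofactors \<open>g z\<close>.
  If \<open>w\<close> makes all of \<open>Z\<close> integral, Bezout writes \<open>w * hat d\<close>
  as \<open>hat h'\<close>, and Gauss' lemma for \<open>g z * h'\<close> shows that \<open>e\<close>
  times \<open>h'\<close> is integral.\<close>

lemma gcd_step:
 fixes Z :: "'e::field mp fract poly set"
 assumes H: "fractional_gcd PS (Hv r :: 'e mp fract set)"
  and Z: "finite Z" "Z \<subseteq> pin (Hv r)" "\<exists>z\<in>Z. z ~= 0"
 shows "\<exists>e. e ~= 0 & (\<forall>w. (\<forall>z\<in>Z. w * hat z \<in> PS) \<longleftrightarrow> w * e \<in> PS)"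
proof -
 obtain d c g where d: "d \<in> pin (Hv r)" "d ~= 0" "d = (\<Sum>z\<in>Z. c z * z)"
  and g: "!!z. z \<in> Z ==> g z \<in> pin (Hv r)" "!!z. z \<in> Z ==> z = d * g z"
  using Hv.polynomial_gcd[OF Z] by blast
 define C where "C = (\<Union>z\<in>Z. coeff (g z) ` {..Polynomial.degree (g z)})"
 have C: "finite C" "C \<subseteq> Hv r" using Z g by (auto simp: C_def pin_def)
 have Cc: "coeff (g z) k \<in> insert 0 C" if "z \<in> Z" for z k
  using that by (cases "k \<le> Polynomial.degree (g z)") (auto simp: C_def coeff_eq_0)
 have "\<exists>z\<in>C. z ~= 0"
 proof -
  obtain z where z: "z \<in> Z" "z ~= 0" using Z by blast
  hence "g z ~= 0" using g(2)[of z] by auto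
  hence "lead_coeff (g z) ~= 0" by simp
  moreover have "lead_coeff (g z) \<in> C" using z by (auto simp: C_def)
  ultimately show ?thesis by blast
 qed
 then obtain e where e: "e ~= 0" "!!w. (\<forall>z\<in>C. w * z \<in> PS) \<longleftrightarrow> w * e \<in> PS"
  using fractional_gcdE[OF H C] by metis
 have ge: "smult (1 / e) (g z) \<in> pin PS" if "z \<in> Z" for z
 proof -
  have "\<forall>z\<in>C. 1 / e * z \<in> PS" using e(2)[of "1 / e"] e(1) by simp
  hence "1 / e * coeff (g z) k \<in> PS" for k using Cc[OF that, of k] by auto
  thus ?thesis by (simp add: pin_def)
 qed
 have e0: "extF shift e ~= 0" using e(1) by simp
 define f where "f = hat d * extF shift e"
 have "f ~= 0" using d(2) e0 hat_inj by (auto simp: f_def)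
 moreover have "(\<forall>z\<in>Z. w * hat z \<in> PS) \<longleftrightarrow> w * f \<in> PS" for w
 proof
  assume f: "w * f \<in> PS"
  show "\<forall>z\<in>Z. w * hat z \<in> PS"
  proof
   fix z assume z: "z \<in> Z"
   have "hat (smult (1 / e) (g z)) = hat (g z) / extF shift e"
   proof -
    have "extF shift (1 / e) * extF shift e = 1" using e(1) by (simp flip: shiftF.hom_mult)
    hence "extF shift (1 / e) = 1 / extF shift e" using e0 by (simp add: field_simps)
    thus ?thesis by (simp add: hat_smult)
   qed
   moreover have "hat z = hat d * hat (g z)" using g(2)[OF z] by (metis hat.hom_mult)
   ultimately have "w * hat z = (w * f) * hat (smult (1 / e) (g z))"
    using e0 by (simp add: f_def)
   thus "w * hat z \<in> PS" using f hat_pin[OF ge[OF z]] PS.S_mult by metis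
  qed
 next
  assume *: "\<forall>z\<in>Z. w * hat z \<in> PS"
  have "\<exists>h. hat h = w * hat z" if "z \<in> Z" for z
  proof -
   obtain u where "w * hat z = fr u" using * \<open>z \<in> Z\<close> by (auto simp: PS_def)
   thus ?thesis using hat_poly_of_low[of u] by metis
  qed
  then obtain h where h: "!!z. z \<in> Z ==> hat (h z) = w * hat z" by metis
  define h' where "h' = (\<Sum>z\<in>Z. c z * h z)"
  have "hat d = (\<Sum>z\<in>Z. hat (c z) * hat z)"
   by (subst d(3)) (simp add: hat.hom_sum hat.hom_mult)
  hence h': "hat h' = w * hat d"
   by (simp add: h'_def hat.hom_sum hat.hom_mult h sum_distrib_left mult_ac)
  have "coeff (g z) i * coeff h' j \<in> PS" if z: "z \<in> Z" for z i j
  proof (rule PS.gauss[OF H])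
   show "g z \<in> pin (Hv r)" by (rule g(1)[OF z])
   have "hat (g z * h') = w * hat z"
    by (subst g(2)[OF z]) (simp add: hat.hom_mult h')
   thus "g z * h' \<in> pin PS" using * z by (simp flip: hat_in_PS)
   show "\<forall>i\<ge>Suc (Polynomial.degree (g z)). coeff (g z) i = 0" "\<forall>j\<ge>Suc (Polynomial.degree h'). coeff h' j = 0"
    by (auto simp: coeff_eq_0)
  qed simp
  hence "\<forall>z\<in>C. coeff h' j * z \<in> PS" for j
   by (auto simp: C_def mult.commute)
  hence "coeff h' j * e \<in> PS" for j using e by blast
  hence "smult e h' \<in> pin PS" by (simp add: pin_def mult.commute)
  hence "hat (smult e h') \<in> PS" by (rule hat_pin)
  thus "w * f \<in> PS" by (simp add: hat_smult h' f_def mult_ac)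
 qed
 ultimately show ?thesis by blast
qed

lemma fractional_gcd_Hv: "fractional_gcd PS (Hv r :: 'e::field mp fract set)"
proof (induction r)
 case 0
 have U0: "u = msingle 0 (mlook u 0)" if "u \<in> Uv 0" for u :: "'e mp"
 proof -
  have "mkeys u \<subseteq> {0}" using that by (auto simp: Uv_def)
  thus ?thesis using mp_expand[of "{0}" u] by simp
 qed
 have H0: "\<exists>c. z = fr (msingle 0 c)" if "z \<in> Hv 0" for z :: "'e mp fract"
 proof -
  from that obtain u v where uv: "u \<in> Uv 0" "v \<in> Uv 0" "v ~= 0" "z = fr u / fr v" unfolding Hv_def by blast
  have v: "mlook v 0 ~= 0" using U0[OF uv(2)] uv(3) by auto
  have "msingle 0 (mlook u 0 / mlook v 0) * msingle 0 (mlook v 0) = msingle (0::nat \<Rightarrow>\<^sub>0 nat) (mlook u 0)"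
   using v by (simp add: mult_single)
  hence "fr (msingle 0 (mlook u 0 / mlook v 0)) * fr v = fr u"
   using U0[OF uv(1)] U0[OF uv(2)] by (metis fr.hom_mult)
  moreover have "fr v ~= 0" using uv(3) by simp
  ultimately have "z = fr (msingle 0 (mlook u 0 / mlook v 0))" by (simp add: uv(4) divide_eq_eq)
  thus ?thesis by blast
 qed
 show ?case unfolding fractional_gcd_def
 proof (safe, intro exI[of _ 1] conjI allI iffI ballI)
  fix Z :: "'e mp fract set" and z w
  assume Z: "finite Z" "Z \<subseteq> Hv 0" "z \<in> Z" "z ~= 0" and w: "\<forall>z\<in>Z. w * z \<in> PS"
  obtain c where c: "z = fr (msingle 0 c)" using H0 Z by blast
  hence c0: "c ~= 0" using Z by auto
  have "z * fr (msingle 0 (1/c)) = 1"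
   using c0 by (simp add: c mult_single flip: fr.hom_mult)
  hence "w = (w * z) * fr (msingle 0 (1/c))" by (simp add: mult.assoc)
  moreover have "(w * z) * fr (msingle 0 (1/c)) \<in> PS" using w Z by (intro PS.S_mult[OF _ fr_PS]) auto
  ultimately show "w * 1 \<in> PS" by (metis mult_1_right)
 next
  fix Z :: "'e mp fract set" and z w y :: "'e mp fract"
  assume "Z \<subseteq> Hv 0" "w * 1 \<in> PS" "y \<in> Z"
  moreover from this obtain c where "y = fr (msingle 0 c)" using H0 by blast
  ultimately show "w * y \<in> PS" using PS.S_mult[OF _ fr_PS, of w] by simp
 qed auto
next
 case (Suc r)
 show ?case unfolding fractional_gcd_def
 proof safe
  fix Z :: "'e mp fract set" and z
  assume Z: "finite Z" "Z \<subseteq> Hv (Suc r)" "z \<in> Z" "z ~= 0"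
  have "\<forall>z\<in>Z. \<exists>u v. u \<in> Uv (Suc r) & v \<in> Uv (Suc r) & v ~= 0 & z = fr u / fr v"
   using Z(2) unfolding Hv_def by blast
  then obtain u v where uv: "!!z. z \<in> Z ==> u z \<in> Uv (Suc r)" "!!z. z \<in> Z ==> v z \<in> Uv (Suc r)"
   "!!z. z \<in> Z ==> v z ~= 0" "!!z. z \<in> Z ==> z = fr (u z) / fr (v z)" by metis
  \<comment> \<open>A common denominator moves \<open>Z\<close> into the image under
    \<open>hat\<close> of polynomials over \<open>Hv r\<close>; the gcd found there is divided by it
    at the end.\<close>
  define v0 where "v0 = (\<Prod>z\<in>Z. v z)"
  have v0: "v0 ~= 0" using uv(3) Z(1) by (simp add: v0_def)
  have prU: "(\<Prod>z\<in>M. v z) \<in> Uv (Suc r)" if "M \<subseteq> Z" for M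
   using that by (induction M rule: infinite_finite_induct) (auto intro: Uv_ops uv)
  have "\<exists>p\<in>pin (Hv r). hat p = fr v0 * z" if z: "z \<in> Z" for z
  proof -
   define y where "y = u z * (\<Prod>z\<in>Z - {z}. v z)"
   have y: "y \<in> Uv (Suc r)" unfolding y_def by (intro Uv_ops prU uv z) auto
   have "v0 = v z * (\<Prod>z\<in>Z - {z}. v z)" using Z(1) z by (simp add: v0_def prod.remove)
   hence "fr v0 * z = fr y"
    by (subst uv(4)[OF z]) (use uv(3)[OF z] in \<open>simp add: y_def fr.hom_mult\<close>)
   moreover obtain q where q: "hat q = fr y" "!!k. coeff q k = fr (low y k)"
    using hat_poly_of_low[of y] by blast
   moreover have "q \<in> pin (Hv r)"
   proof -
    have "fr (low y k) / fr 1 \<in> Hv r" for k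
     unfolding Hv_def using low_Uv[OF y] Uv_ops(2) one_neq_zero by blast
    thus ?thesis unfolding pin_def by (simp add: q(2))
   qed
   ultimately show ?thesis by metis
  qed
  then obtain p where p: "!!z. z \<in> Z ==> p z \<in> pin (Hv r)" "!!z. z \<in> Z ==> hat (p z) = fr v0 * z" by metis
  have "p z ~= 0" using p(2)[OF Z(3)] Z(4) v0 by auto
  hence "\<exists>e. e ~= 0 & (\<forall>w. (\<forall>q\<in>p ` Z. w * hat q \<in> PS) \<longleftrightarrow> w * e \<in> PS)"
   using Z p(1) by (intro gcd_step[OF Suc]) auto
  then obtain e where e: "e ~= 0" "!!w. (\<forall>q\<in>p ` Z. w * hat q \<in> PS) \<longleftrightarrow> w * e \<in> PS" by blast
  show "\<exists>e. e ~= 0 & (\<forall>w. (\<forall>z\<in>Z. w * z \<in> PS) \<longleftrightarrow> w * e \<in> PS)"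
  proof (intro exI[of _ "e / fr v0"] conjI allI)
   show "e / fr v0 ~= 0" using e v0 by simp
   fix w
   have "(\<forall>z\<in>Z. w * z \<in> PS) \<longleftrightarrow> (\<forall>q\<in>p ` Z. (w / fr v0) * hat q \<in> PS)"
    using p(2) v0 by auto
   also have "... \<longleftrightarrow> w * (e / fr v0) \<in> PS" using e(2)[of "w / fr v0"] by simp
   finally show "(\<forall>z\<in>Z. w * z \<in> PS) \<longleftrightarrow> w * (e / fr v0) \<in> PS" .
  qed
 qed
qed

text \<open>A finite set of fractions involves finitely many variables only.\<close>

theorem fractional_gcd_mp: "fractional_gcd PS (UNIV :: 'e::field mp fract set)"
 unfolding fractional_gcd_def
proof safe
 fix Z :: "'e mp fract set" and z
 assume Z: "finite Z" "z \<in> Z" "z ~= 0"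
 have mono: "Hv r \<subseteq> (Hv r' :: 'e mp fract set)" if "r \<le> r'" for r r'
 proof -
  have "Uv r \<subseteq> (Uv r' :: 'e mp set)" using that by (fastforce simp: Uv_def)
  thus ?thesis unfolding Hv_def by blast
 qed
 have Uex: "\<exists>r. u \<in> Uv r" for u :: "'e mp"
 proof -
  have "finite (\<Union>mu\<in>mkeys u. mkeys mu)" by simp
  then obtain r where "\<forall>i\<in>(\<Union>mu\<in>mkeys u. mkeys mu). i < r"
   using finite_nat_set_iff_bounded by blast
  thus ?thesis by (intro exI[of _ r]) (auto simp: Uv_def)
 qed
 have Hex: "\<exists>r. y \<in> Hv r" for y :: "'e mp fract"
 proof -
  obtain a b where ab: "b ~= 0" "y = fr a / fr b" by (rule fract_cases_fr)
  obtain r r' where "a \<in> Uv r" "b \<in> Uv r'" using Uex by blast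
  hence "a \<in> Uv (max r r')" "b \<in> Uv (max r r')" by (fastforce simp: Uv_def)+
  thus ?thesis using ab unfolding Hv_def by blast
 qed
 then obtain f where f: "!!y :: 'e mp fract. y \<in> Hv (f y)" by metis
 have "Z \<subseteq> Hv (Max (f ` Z))"
 proof
  fix y assume "y \<in> Z"
  hence "f y \<le> Max (f ` Z)" using Z(1) by auto
  thus "y \<in> Hv (Max (f ` Z))" using f mono by blast
 qed
 thus "\<exists>e. e ~= 0 & (\<forall>w. (\<forall>z\<in>Z. w * z \<in> PS) \<longleftrightarrow> w * e \<in> PS)"
  using fractional_gcd_Hv[of "Max (f ` Z)"] Z unfolding fractional_gcd_def by metis
qed

section \<open>Commuting permutations of order p\<close>

lemma CHAR_prime: "prime p ==> of_nat p = (0::'k::field) ==> CHAR('k) = p"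
 using CHAR_not_1'[where 'a = 'k] by (auto simp: of_nat_eq_0_iff_char_dvd prime_nat_iff)

text \<open>Every orbit that is not a single point has exactly \<open>p\<close> elements on which
  \<open>h\<close> is constant, so it contributes a multiple of \<open>p\<close>, which is
  zero.\<close>

lemma sum_cyclic_fixed:
 fixes h :: "'y => 'k::comm_ring_1"
 assumes p: "prime p" "of_nat p = (0::'k)"
  and Y: "finite Y" "!!y. y \<in> Y ==> b y \<in> Y" "!!y. y \<in> Y ==> (b ^^ p) y = y"
  and h: "!!y. y \<in> Y ==> h (b y) = h y"
 shows "sum h Y = sum h {y\<in>Y. b y = y}"
 using Y h
proof (induction "card Y" arbitrary: Y rule: less_induct)
 case less
 show ?case
 proof (cases "\<forall>y\<in>Y. b y = y")
  case True
  hence "{y\<in>Y. b y = y} = Y" by auto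
  thus ?thesis by simp
 next
  case False
  then obtain y where y: "y \<in> Y" "b y ~= y" by blast
  define O' where "O' = (%k. (b ^^ k) y) ` {..<p}"
  have inY: "(b ^^ k) y \<in> Y" for k by (induction k) (auto simp: y less.prems)
  have hk: "h ((b ^^ k) y) = h y" for k by (induction k) (auto simp: less.prems inY)
  have per: "(b ^^ (k mod p)) y = (b ^^ k) y" for k
  proof -
   have "(b ^^ (p * q)) z = z" if "z \<in> Y" for q z
    using that less.prems(3) by (induction q) (auto simp: funpow_add)
   hence "(b ^^ (k mod p)) ((b ^^ (p * (k div p))) y) = (b ^^ (k mod p)) y" using y by simp
   thus ?thesis by (metis add.commute comp_apply funpow_add mult_div_mod_eq)
  qed
  have inj: "inj_on (%k. (b ^^ k) y) {..<p}"
  proof (rule linorder_inj_onI)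
   fix i j assume ij: "i < j" "i \<in> {..<p}" "j \<in> {..<p}"
   show "(b ^^ i) y ~= (b ^^ j) y"
   proof
    assume eq: "(b ^^ i) y = (b ^^ j) y"
    define d where "d = j - i"
    have d: "0 < d" "d < p" using ij by (auto simp: d_def)
    have "(b ^^ (p - i + i)) y = (b ^^ (p - i + j)) y"
     by (simp only: funpow_add comp_apply eq)
    moreover have "p - i + i = p" "p - i + j = p + d" using ij by (auto simp: d_def)
    ultimately have "(b ^^ p) y = (b ^^ (d + p)) y" by (simp add: add.commute)
    hence dy: "(b ^^ d) y = y" using less.prems(3)[OF y(1)] by (simp add: funpow_add)
    \<comment> \<open>A positive period below \<open>p\<close> is invertible modulo
      \<open>p\<close>, so \<open>b\<close> itself would fix \<open>y\<close>.\<close>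
    have "coprime d p" using d p(1) by (metis coprime_commute nat_dvd_not_less prime_imp_coprime)
    then obtain x where x: "[d * x = 1] (mod p)" using cong_solve_coprime_nat by auto
    have "(b ^^ (d * x)) y = y"
    proof -
     have "(b ^^ (d * q)) y = y" for q using dy by (induction q) (auto simp: funpow_add)
     thus ?thesis .
    qed
    moreover have "(b ^^ (d * x)) y = (b ^^ ((d * x) mod p)) y" by (simp add: per)
    moreover have "(d * x) mod p = 1" using x prime_gt_1_nat[OF p(1)] by (simp add: cong_def)
    ultimately show False using y(2) by simp
   qed
  qed auto
  have "sum h O' = (\<Sum>k<p. h y)"
   unfolding O'_def by (subst sum.reindex[OF inj]) (simp add: hk)
  hence sO: "sum h O' = 0" using p(2) by simp
  have OY: "O' \<subseteq> Y" by (auto simp: O'_def inY)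
  have p0: "0 < p" using prime_gt_0_nat[OF p(1)] .
  have yO: "y \<in> O'" unfolding O'_def using p0 by (intro image_eqI[of _ _ 0]) auto
  have bO: "z \<in> O' \<longleftrightarrow> b z \<in> O'" if "z \<in> Y" for z
  proof
   assume "z \<in> O'"
   then obtain k where k: "z = (b ^^ k) y" by (auto simp: O'_def)
   hence "b z = (b ^^ (Suc k mod p)) y" using per[of "Suc k"] by simp
   thus "b z \<in> O'" using p0 by (auto simp: O'_def)
  next
   assume "b z \<in> O'"
   then obtain k where k: "b z = (b ^^ k) y" by (auto simp: O'_def)
   have "z = (b ^^ (p - 1)) (b z)"
    using less.prems(3)[OF that] p0 by (metis Suc_pred' comp_apply funpow_Suc_right)
   also have "... = (b ^^ ((p - 1 + k) mod p)) y" by (simp add: k per funpow_add)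
   finally show "z \<in> O'" using p0 by (auto simp: O'_def)
  qed
  have nfix: "b z ~= z" if "z \<in> O'" for z
  proof
   assume bz: "b z = z"
   from that have "z \<in> (%k. (b ^^ k) y) ` {..<p}" by (simp only: O'_def)
   then obtain k where k: "z = (b ^^ k) y" "k \<in> {..<p}" by (rule imageE)
   have "(b ^^ j) z = z" for j by (induction j) (auto simp: bz)
   hence "(b ^^ (p - k)) z = z" by blast
   hence "(b ^^ (p - k + k)) y = z" by (simp only: k funpow_add comp_apply)
   hence "z = y" using k(2) less.prems(3)[OF y(1)] by simp
   thus False using bz y(2) by simp
  qed
  have "sum h (Y - O') = sum h {z\<in>Y - O'. b z = z}"
  proof (rule less.hyps)
   show "card (Y - O') < card Y"
    using yO y(1) less.prems(1) by (intro psubset_card_mono) auto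
  qed (use less.prems bO in auto)
  moreover have "{z\<in>Y - O'. b z = z} = {z\<in>Y. b z = z}" using nfix by auto
  moreover have "sum h Y = sum h (Y - O') + sum h O'"
   using sum.subset_diff[OF OY less.prems(1)] by simp
  ultimately show ?thesis using sO by simp
 qed
qed

text \<open>One permutation at a time: as the permutations commute, each one preserves the common
  fixed points of those before it.\<close>

lemma sum_commuting_fixed:
 fixes h :: "'y => 'k::comm_ring_1" and r :: nat
 assumes p: "prime p" "of_nat p = (0::'k)"
  and Y: "finite Y" "!!i y. i < r ==> y \<in> Y ==> b i y \<in> Y" "!!i y. i < r ==> y \<in> Y ==> (b i ^^ p) y = y"
   "!!i j y. i < r ==> j < r ==> y \<in> Y ==> b i (b j y) = b j (b i y)"
  and h: "!!i y. i < r ==> y \<in> Y ==> h (b i y) = h y"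
 shows "sum h Y = sum h {y\<in>Y. \<forall>i<r. b i y = y}"
 using Y h
proof (induction r)
 case (Suc r)
 have "sum h Y = sum h {y\<in>Y. \<forall>i<r. b i y = y}"
  by (rule Suc.IH) (use Suc.prems in auto)
 also have "... = sum h {y\<in>{y\<in>Y. \<forall>i<r. b i y = y}. b r y = y}"
 proof (rule sum_cyclic_fixed[OF p])
  fix y assume y: "y \<in> {y\<in>Y. \<forall>i<r. b i y = y}"
  have "b i (b r y) = b r y" if "i < r" for i
   using y that Suc.prems(4)[of i r y] by auto
  thus "b r y \<in> {y\<in>Y. \<forall>i<r. b i y = y}" using y Suc.prems by auto
 qed (use Suc.prems in auto)
 also have "{y\<in>{y\<in>Y. \<forall>i<r. b i y = y}. b r y = y} = {y\<in>Y. \<forall>i<Suc r. b i y = y}"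
  by (auto simp: less_Suc_eq)
 finally show ?case .
qed auto

section \<open>Binomial and Frobenius formulas for commuting elements\<close>

lemma commute_mult: "a * z = z * a ==> b * z = z * b ==> (a * b) * z = z * (a * b :: 'r::semigroup_mult)"
 by (metis mult.assoc)

lemma commuting_binomial:
 fixes a b :: "'r::ring_1"
 assumes "a * b = b * a"
 shows "(a + b) ^ n = (\<Sum>k\<le>n. of_nat (n choose k) * (a ^ k * b ^ (n - k)))"
proof (induction n)
 case (Suc n)
 have ba: "b * (a ^ k * b ^ l) = a ^ k * b ^ Suc l" for k l
 proof -
  have "b * a ^ k = a ^ k * b" using assms by (induction k) (auto simp: mult.assoc, metis mult.assoc)
  thus ?thesis by (metis mult.assoc power_Suc)
 qed
 have cm: "x * (of_nat c * y) = of_nat c * (x * y)" for x y :: 'r and c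
  by (metis mult.assoc mult_of_nat_commute)
 have 1: "a * (\<Sum>k\<le>n. of_nat (n choose k) * (a ^ k * b ^ (n - k)))
   = (\<Sum>k\<in>{1..Suc n}. of_nat (n choose (k - 1)) * (a ^ k * b ^ (Suc n - k)))"
  unfolding sum_distrib_left cm
  by (rule sum.reindex_bij_witness[of _ "%k. k - 1" Suc]) (auto simp: mult.assoc)
 have 2: "b * (\<Sum>k\<le>n. of_nat (n choose k) * (a ^ k * b ^ (n - k)))
   = (\<Sum>k\<le>n. of_nat (n choose k) * (a ^ k * b ^ (Suc n - k)))"
  unfolding sum_distrib_left cm ba by (intro sum.cong refl) (auto simp: Suc_diff_le)
 have 3: "(\<Sum>k\<in>{1..Suc n}. of_nat (n choose (k - 1)) * (a ^ k * b ^ (Suc n - k)))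
   = (\<Sum>k\<le>Suc n. of_nat (if k = 0 then 0 else n choose (k - 1)) * (a ^ k * b ^ (Suc n - k)))"
  by (rule sum.mono_neutral_cong_left) auto
 have 4: "(\<Sum>k\<le>n. of_nat (n choose k) * (a ^ k * b ^ (Suc n - k)))
  = (\<Sum>k\<le>Suc n. of_nat (n choose k) * (a ^ k * b ^ (Suc n - k)))"
  by (subst sum.atMost_Suc) (simp add: binomial_eq_0)
 have "(a + b) ^ Suc n = a * (a + b) ^ n + b * (a + b) ^ n" by (simp add: distrib_right)
 also have "... = (\<Sum>k\<le>Suc n. (of_nat (if k = 0 then 0 else n choose (k - 1)) + of_nat (n choose k)) * (a ^ k * b ^ (Suc n - k)))"
  by (simp only: Suc.IH 1 2 3 4 sum.distrib distrib_right)
 also have "... = (\<Sum>k\<le>Suc n. of_nat (Suc n choose k) * (a ^ k * b ^ (Suc n - k)))"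
 proof -
  have "(if k = 0 then 0 else n choose (k - 1)) + (n choose k) = Suc n choose k" for k
   by (cases k) auto
  thus ?thesis by (simp only: of_nat_add[symmetric])
 qed
 finally show ?case .
qed simp

lemma frobenius_commuting:
 fixes a b :: "'r::ring_1"
 assumes p: "prime p" "of_nat p = (0::'r)" and "a * b = b * a"
 shows "(a + b) ^ p = a ^ p + b ^ p"
proof -
 have "(a + b) ^ p = (\<Sum>k\<le>p. of_nat (p choose k) * (a ^ k * b ^ (p - k)))"
  by (rule commuting_binomial) fact
 also have "... = (\<Sum>k\<in>{0, p}. of_nat (p choose k) * (a ^ k * b ^ (p - k)))"
 proof (rule sum.mono_neutral_right)
  show "\<forall>k\<in>{..p} - {0, p}. of_nat (p choose k) * (a ^ k * b ^ (p - k)) = 0"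
  proof
   fix k assume "k \<in> {..p} - {0, p}"
   hence "p dvd p choose k" using p(1) by (intro dvd_choose_prime) auto
   then obtain q where "p choose k = p * q" by blast
   thus "of_nat (p choose k) * (a ^ k * b ^ (p - k)) = 0" using p(2) by simp
  qed
 qed auto
 also have "... = a ^ p + b ^ p"
  using prime_gt_0_nat[OF p(1)] by (simp add: add.commute)
 finally show ?thesis .
qed

lemma frobenius_sum:
 fixes f :: "'i => 'r::ring_1"
 assumes p: "prime p" "of_nat p = (0::'r)" and "!!i j. i \<in> I ==> j \<in> I ==> f i * f j = f j * f i" "finite I"
 shows "(\<Sum>i\<in>I. f i) ^ p = (\<Sum>i\<in>I. f i ^ p)"
 using assms(4,3)
proof (induction I)
 case empty
 show ?case using prime_gt_0_nat[OF p(1)] by (simp add: power_0_left)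
next
 case (insert x I)
 have "(\<Sum>i\<in>insert x I. f i) ^ p = (f x + (\<Sum>i\<in>I. f i)) ^ p" using insert by simp
 also have "... = f x ^ p + (\<Sum>i\<in>I. f i) ^ p"
  using insert by (intro frobenius_commuting[OF p]) (auto simp: sum_distrib_left sum_distrib_right intro!: sum.cong)
 finally show ?case using insert by simp
qed

text \<open>On a nontrivial orbit of commuting permutations of order \<open>p\<close> there is a grading by \<open>\<int>/p\<close>
 compatible with the action. If \<open>W k\<close> is the orbit under the first \<open>k\<close> permutations, the cosets of
 the last \<open>W k\<close> that is smaller than the whole orbit give the grading.\<close>

locale commuting_perms =
 fixes p r :: nat and b :: "nat => nat => nat"
 assumes prime_p: "prime p" and order_p: "(b i ^^ p) a = a" and comm: "b i (b j a) = b j (b i a)"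
begin

primrec W :: "nat => nat => nat set" where
 "W 0 a = {a}"
| "W (Suc k) a = (\<Union>n<p. (b k ^^ n) ` W k a)"

lemma pow_mod: "(b i ^^ (n mod p)) a = (b i ^^ n) a"
proof -
 have *: "(b i ^^ (p * q)) z = z" for q z by (induction q) (auto simp: funpow_add order_p)
 have "(b i ^^ n) a = (b i ^^ (n mod p + p * (n div p))) a" by simp
 also have "... = (b i ^^ (n mod p)) ((b i ^^ (p * (n div p))) a)" by (simp only: funpow_add comp_apply)
 also have "... = (b i ^^ (n mod p)) a" by (simp only: *)
 finally show ?thesis by simp
qed

lemma pow_comm: "(b i ^^ n) (b j a) = b j ((b i ^^ n) a)"
 by (induction n) (auto simp: comm)

lemma pow_comm2: "(b i ^^ n) ((b j ^^ n') a) = (b j ^^ n') ((b i ^^ n) a)"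
 by (induction n') (auto simp: pow_comm)

lemma inj_b: "b i a = b i a' ==> a = a'"
 using order_p[of i] prime_gt_0_nat[OF prime_p] by (metis Suc_pred' comp_apply funpow_Suc_right)

lemma W_Suc: "x \<in> W (Suc k) a \<longleftrightarrow> (\<exists>n. \<exists>y\<in>W k a. x = (b k ^^ n) y)"
proof
 assume "\<exists>n. \<exists>y\<in>W k a. x = (b k ^^ n) y"
 then obtain n y where "y \<in> W k a" "x = (b k ^^ (n mod p)) y" by (auto simp: pow_mod)
 moreover have "n mod p < p" using prime_gt_0_nat[OF prime_p] by simp
 ultimately show "x \<in> W (Suc k) a" by auto
qed auto

lemma W_shift: "W k ((b i ^^ n) a) = (b i ^^ n) ` W k a"
proof (induction k)
 case (Suc k)
 have "(b k ^^ l) ` (b i ^^ n) ` S = (b i ^^ n) ` (b k ^^ l) ` S" for l S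
  unfolding image_image by (rule image_cong[OF refl]) (rule pow_comm2)
 thus ?case by (simp add: Suc image_UN)
qed simp

declare W.simps(2) [simp del]

lemma W_self: "a \<in> W k a"
proof (induction k)
 case (Suc k)
 thus ?case by (auto simp: W_Suc intro!: exI[of _ 0])
qed simp

lemma W_mono: "W k a \<subseteq> W (Suc k) a"
 by (auto simp: W_Suc intro!: exI[of _ 0])

lemma W_eq: "y \<in> W k a ==> W k y = W k a"
proof (induction k arbitrary: y)
 case (Suc k)
 then obtain n z where z: "z \<in> W k a" "y = (b k ^^ n) z" by (auto simp: W_Suc)
 have Wy: "W k y = (b k ^^ n) ` W k a" using Suc.IH[OF z(1)] z(2) W_shift by simp
 have pn: "n \<le> p * n" using prime_gt_0_nat[OF prime_p] by simp
 show ?case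
 proof (intro equalityI subsetI)
  fix x assume "x \<in> W (Suc k) y"
  hence "\<exists>l. \<exists>u\<in>W k y. x = (b k ^^ l) u" by (simp only: W_Suc)
  then obtain l u where "u \<in> W k a" "x = (b k ^^ l) ((b k ^^ n) u)" unfolding Wy by auto
  hence "x = (b k ^^ (l + n)) u" by (simp add: funpow_add)
  thus "x \<in> W (Suc k) a" using \<open>u \<in> W k a\<close> unfolding W_Suc by blast
 next
  fix x assume "x \<in> W (Suc k) a"
  hence "\<exists>l. \<exists>u\<in>W k a. x = (b k ^^ l) u" by (simp only: W_Suc)
  then obtain l u where u: "u \<in> W k a" "x = (b k ^^ l) u" by auto
  have "(b k ^^ (l + (p * n - n))) ((b k ^^ n) u) = (b k ^^ (l + (p * n - n) + n)) u"
   by (simp only: funpow_add comp_apply)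
  also have "l + (p * n - n) + n = l + p * n" using pn by linarith
  also have "(b k ^^ (l + p * n)) u = (b k ^^ ((l + p * n) mod p)) u" by (rule pow_mod[symmetric])
  also have "... = x" using u(2) by (simp add: pow_mod)
  finally show "x \<in> W (Suc k) y" unfolding W_Suc Wy using u(1) by blast
 qed
qed simp

lemma W_b: "i < k ==> b i a \<in> W k a"
proof (induction k)
 case (Suc k)
 show ?case
 proof (cases "i = k")
  case True
  thus ?thesis using W_self[of a k] by (auto simp: W_Suc intro!: exI[of _ 1])
 next
  case False
  thus ?thesis using Suc W_mono by auto
 qed
qed simp

lemma orbit_grading:
 assumes "\<exists>i<r. b i a ~= a"
 obtains de ch :: "nat => nat" where
  "!!x i. x \<in> W r a ==> i < r ==> [de (b i x) = de x + ch i] (mod p)" "\<exists>i<r. \<not> p dvd ch i"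
proof -
 have p0: "p > 0" using prime_gt_0_nat[OF prime_p] .
 obtain i0 where i0: "i0 < r" "b i0 a ~= a" using assms by blast
 have "W r a ~= W 0 a" using W_b[OF i0(1), of a] i0(2) by auto
 define k where "k = (GREATEST k. k < r & W k a ~= W (Suc k) a)"
 have "\<exists>k. k < r & W k a ~= W (Suc k) a"
 proof (rule ccontr)
  assume "\<not> ?thesis"
  hence *: "W k a = W (Suc k) a" if "k < r" for k using that by blast
  have "l \<le> r ==> W l a = W 0 a" for l
  proof (induction l)
   case (Suc l)
   thus ?case using *[of l] by simp
  qed simp
  thus False using \<open>W r a ~= W 0 a\<close> by blast
 qed
 hence k: "k < r" "W k a ~= W (Suc k) a"
  unfolding k_def by (metis (mono_tags, lifting) GreatestI_nat less_or_eq_imp_le)+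
 have kmax: "W l a = W (Suc l) a" if "k < l" "l < r" for l
  using that Greatest_le_nat[of "%k. k < r & W k a ~= W (Suc k) a" l r] unfolding k_def by fastforce
 have top: "l \<le> r ==> Suc k \<le> l ==> W l a = W (Suc k) a" for l
 proof (induction l)
  case (Suc l)
  show ?case
  proof (cases "Suc k \<le> l")
   case True
   thus ?thesis using kmax[of l] Suc by simp
  next
   case False
   hence "l = k" using Suc.prems by simp
   thus ?thesis by simp
  qed
 qed simp
 have Wr: "W r a = W (Suc k) a" by (rule top) (use k(1) in auto)
 \<comment> \<open>The translates of \<open>W k a\<close> under \<open>b k\<close> repeat with
   period exactly \<open>p\<close>: otherwise an exponent invertible modulo \<open>p\<close>, and
   then \<open>b k\<close> itself, would preserve \<open>W k a\<close>, against the choice of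
   \<open>k\<close>.\<close>
 have key: "p dvd d" if "(b k ^^ d) u \<in> W k a" "u \<in> W k a" for d u
 proof (rule ccontr)
  assume nd: "\<not> p dvd d"
  have st: "(b k ^^ d) ` W k a = W k a"
   using W_eq[OF that(1)] W_eq[OF that(2)] W_shift by metis
  have "coprime d p" using nd prime_p by (metis coprime_commute prime_imp_coprime)
  then obtain x where x: "[d * x = 1] (mod p)" using cong_solve_coprime_nat by auto
  have "(b k ^^ (d * q)) ` W k a = W k a" for q
  proof (induction q)
   case (Suc q)
   have "(b k ^^ (d * Suc q)) ` W k a = (b k ^^ d) ` ((b k ^^ (d * q)) ` W k a)"
    by (simp add: funpow_add image_comp)
   thus ?case using Suc st by simp
  qed simp
  moreover have "(b k ^^ (d * x)) u = b k u" for u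
  proof -
   have "(d * x) mod p = 1" using x prime_gt_1_nat[OF prime_p] by (simp add: cong_def)
   thus ?thesis using pow_mod[where i = k and n = "d * x" and a = u] by simp
  qed
  ultimately have b1: "b k ` W k a = W k a" by (metis (no_types, lifting) image_cong)
  have bn: "(b k ^^ n) ` W k a = W k a" for n
  proof (induction n)
   case (Suc n)
   have "(b k ^^ Suc n) ` W k a = b k ` ((b k ^^ n) ` W k a)" by (simp add: image_comp)
   thus ?case using Suc b1 by simp
  qed simp
  have "W (Suc k) a \<subseteq> W k a"
  proof
   fix x assume "x \<in> W (Suc k) a"
   then obtain n u where "u \<in> W k a" "x = (b k ^^ n) u" unfolding W_Suc by blast
   thus "x \<in> W k a" using bn[of n] by blast
  qed
  thus False using k(2) W_mono by blast
 qed
 have ex: "\<exists>n. \<exists>u\<in>W k a. x = (b k ^^ n) u" if "x \<in> W r a" for x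
  using that Wr by (auto simp: W_Suc)
 define de where "de x = (SOME n. \<exists>u\<in>W k a. x = (b k ^^ n) u)" for x
 have de: "\<exists>u\<in>W k a. x = (b k ^^ de x) u" if "x \<in> W r a" for x
  unfolding de_def using someI_ex[OF ex[OF that]] .
 have uniq: "[n = n'] (mod p)" if "u \<in> W k a" "u' \<in> W k a" "(b k ^^ n) u = (b k ^^ n') u'" for n n' u u'
 proof -
  have "p dvd (p * n - n) + n'"
  proof (rule key)
   have "(b k ^^ ((p * n - n) + n')) u' = (b k ^^ (p * n - n)) ((b k ^^ n) u)"
    by (simp add: that(3) funpow_add)
   also have "... = (b k ^^ (p * n - n + n)) u" by (simp only: funpow_add comp_apply)
   also have "p * n - n + n = p * n" using p0 by simp
   also have "(b k ^^ (p * n)) u = u" using pow_mod[where i = k and n = "p * n" and a = u] by simp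
   finally show "(b k ^^ ((p * n - n) + n')) u' \<in> W k a" using that(1) by simp
  qed fact
  hence "[(p * n - n) + n' + n = 0 + n] (mod p)" by (intro cong_add cong_refl) (simp add: cong_0_iff)
  moreover have "(p * n - n) + n' + n = p * n + n'" using p0 by (cases p) auto
  ultimately have "[p * n + n' = n] (mod p)" by simp
  moreover have "[p * n + n' = n'] (mod p)" by (simp add: cong_def)
  ultimately show ?thesis by (metis cong_sym cong_trans)
 qed
 have bin: "b i x \<in> W r a" if "x \<in> W r a" "i < r" for x i
  using W_b[OF that(2), of x] W_eq[OF that(1)] by simp
 \<comment> \<open>The base point \<open>a\<close> has degree 0 modulo \<open>p\<close>, so the
   degree of the permutation \<open>b i\<close> can be read off at \<open>b i a\<close>.\<close>
 define ch where "ch i = de (b i a)" for i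
 have "[de (b i x) = de x + ch i] (mod p)" if x: "x \<in> W r a" and i: "i < r" for x i
 proof -
  obtain u where u: "u \<in> W k a" "x = (b k ^^ de x) u" using de[OF x] by blast
  obtain v where v: "v \<in> W k a" "b i a = (b k ^^ ch i) v"
   using de[OF bin[OF W_self i]] unfolding ch_def by blast
  have "b i u \<in> b i ` W k a" using u by blast
  also have "b i ` W k a = W k (b i a)" using W_shift[where k = k and i = i and n = 1 and a = a] by simp
  also have "... = (b k ^^ ch i) ` W k a" using v W_shift W_eq[OF v(1)] by metis
  finally obtain v' where v': "v' \<in> W k a" "b i u = (b k ^^ ch i) v'" by blast
  have "b i x = (b k ^^ de x) (b i u)" by (subst u(2)) (simp add: pow_comm)
  also have "... = (b k ^^ (de x + ch i)) v'" by (simp add: v' funpow_add)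
  finally have "b i x = (b k ^^ (de x + ch i)) v'" .
  moreover obtain w where "w \<in> W k a" "b i x = (b k ^^ de (b i x)) w" using de[OF bin[OF x i]] by blast
  ultimately show ?thesis using uniq v'(1) by metis
 qed
 moreover have "\<not> p dvd ch k"
 proof
  assume "p dvd ch k"
  moreover obtain v where v: "v \<in> W k a" "b k a = (b k ^^ ch k) v"
   using de[OF bin[OF W_self k(1)]] unfolding ch_def by blast
  ultimately have "b k a = v" using pow_mod[where i = k and n = "ch k" and a = v] by simp
  hence "p dvd 1" using key[of 1 a] v(1) W_self by simp
  thus False using prime_gt_1_nat[OF prime_p] by simp
 qed
 ultimately show ?thesis using that k(1) by blast
qed

end


subsection \<open>The generic nilpotent operator on a permutation module\<close>

lift_definition Pm :: "(nat => nat) => 'a::zero_neq_one rfm" is "%b i j. if j = b i then 1 else 0"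
 by simp

lift_definition dg :: "(nat => 'a::zero) => 'a rfm" is "%d i j. if i = j then d i else 0"
 by simp

lemma ent_Pm: "ent (Pm b) i j = (if j = b i then 1 else 0)" by transfer simp
lemma ent_dg: "ent (dg d) i j = (if i = j then d i else 0)" by transfer simp

lemma ent_Pm_mult: "ent (Pm b * A) i j = ent A (b i) (j::nat)" for A :: "'a::ring_1 rfm"
 by (subst ent_times[of "{b i}"]) (auto simp: ent_Pm)

lemma ent_dg_mult: "ent (dg d * A) i j = d i * ent A i j" for A :: "'a::ring_1 rfm"
 by (subst ent_times[of "{i}"]) (auto simp: ent_dg)

lemma Pm_mult: "Pm b * Pm c = (Pm (c \<circ> b) :: 'a::ring_1 rfm)"
 by (rule rfm_eqI) (simp add: ent_Pm_mult ent_Pm)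

lemma Pm_id: "Pm (%x. x) = (1 :: 'a::ring_1 rfm)"
 by (rule rfm_eqI) (auto simp: ent_Pm ent_one)

lemma Pm_power: "Pm b ^ n = (Pm (b ^^ n) :: 'a::ring_1 rfm)"
proof (induction n)
 case (Suc n)
 have "Pm b ^ Suc n = Pm b ^ n * (Pm b :: 'a rfm)" by (simp add: power_commutes)
 thus ?case by (simp add: Suc Pm_mult comp_def)
qed (simp add: Pm_id id_def)

lemma dg_mult: "dg d * dg d' = dg (%i. d i * d' i :: 'a::ring_1)"
 by (rule rfm_eqI) (auto simp: ent_dg_mult ent_dg)

lemma dg_power: "dg d ^ n = dg (%i. d i ^ n :: 'a::ring_1)"
proof (induction n)
 case 0
 show ?case by (rule rfm_eqI) (auto simp: ent_dg ent_one)
qed (simp add: dg_mult)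

lemma dg_sum: "(\<Sum>i\<in>I. dg (d i)) = dg (%a. \<Sum>i\<in>I. d i a :: 'a::ring_1)"
 by (rule rfm_eqI) (auto simp: ent_sum ent_dg)

lemma Pm_dg: "Pm b * dg d = dg (%a. d (b a)) * (Pm b :: 'a::ring_1 rfm)"
 by (rule rfm_eqI) (auto simp: ent_Pm_mult ent_dg_mult ent_dg ent_Pm)

lemma sc_dg: "sc c (dg d) = dg (%a. c * d a :: 'a::ring_1)"
 by (rule rfm_eqI) (auto simp: ent_dg)

lemma of_nat_rfm: "of_nat n = (sc (of_nat n) 1 :: 'a::ring_1 rfm)"
 by (induction n) (auto simp: sc_add_left)

context commuting_perms
begin

definition NN :: "(nat => 'k) => 'k::comm_ring_1 rfm" where
 "NN t = (\<Sum>i<r. sc (t i) (Pm (b i) - 1))"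

text \<open>The operator \<open>N = NN t\<close> has an inverse up to order \<open>p\<close> on the nontrivial orbits because there is
 an operator \<open>D'\<close> with \<open>N D' - D' N = 1\<close>: take multiplication by the grading \<open>de\<close>, whose commutator
 with \<open>N\<close> is an operator \<open>Y\<close> with \<open>Y^p\<close> invertible diagonal.\<close>

lemma acyclic:
 fixes t :: "nat => 'k::field"
 assumes pk: "of_nat p = (0::'k)"
  and t: "!!ch :: nat => nat. \<exists>i<r. \<not> p dvd ch i ==> (\<Sum>i<r. t i * of_nat (ch i)) ~= 0"
  and V: "NN t * V = 0" and V0: "!!a c. \<forall>i<r. b i a = a ==> ent V a c = 0"
 obtains V' where "V = NN t ^ (p - 1) * V'"
proof -
 define nf where "nf a \<longleftrightarrow> (\<exists>i<r. b i a ~= a)" for a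
 have "\<exists>de ch :: nat => nat. nf a --> (\<forall>x i. x \<in> W r a --> i < r --> [de (b i x) = de x + ch i] (mod p)) & (\<exists>i<r. \<not> p dvd ch i)" for a
  unfolding nf_def using orbit_grading by metis
 then obtain de0 ch0 :: "nat => nat => nat" where
  grading: "!!a x i. nf a ==> x \<in> W r a ==> i < r ==> [de0 a (b i x) = de0 a x + ch0 a i] (mod p)"
   "!!a. nf a ==> \<exists>i<r. \<not> p dvd ch0 a i"
  by metis
 \<comment> \<open>One representative per orbit lets the separate gradings be assembled into a
   single function \<open>de\<close>, with degrees \<open>ch\<close> that are constant on
   orbits.\<close>
 define rep where "rep a = (SOME x. x \<in> W r a)" for a
 have rep: "rep a \<in> W r a" for a unfolding rep_def by (rule someI) (rule W_self)
 have rep_b: "rep (b i a) = rep a" if "i < r" for i a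
  unfolding rep_def using W_eq[OF W_b[OF that, of a]] by simp
 have mem: "a \<in> W r (rep a)" for a using W_eq[OF rep[of a]] W_self by blast
 have nf_b: "nf (b i a) \<longleftrightarrow> nf a" for i a
  unfolding nf_def by (metis comm inj_b)
 have nf_pow: "nf ((b i ^^ n) a) \<longleftrightarrow> nf a" for i n a by (induction n) (auto simp: nf_b)
 have nf_W: "x \<in> W k a ==> nf x \<longleftrightarrow> nf a" for k x a
 proof (induction k arbitrary: x)
  case (Suc k)
  then obtain n y where "y \<in> W k a" "x = (b k ^^ n) y" unfolding W_Suc by blast
  thus ?case using Suc.IH nf_pow by simp
 qed simp
 have nf_rep: "nf (rep a) \<longleftrightarrow> nf a" for a by (rule nf_W[OF rep])
 define ch where "ch i a = (if nf a then of_nat (ch0 (rep a) i) else 0 :: 'k)" for i a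
 define de where "de a = (if nf a then of_nat (de0 (rep a) a) else 0 :: 'k)" for a
 note char = CHAR_prime[OF prime_p pk]
 have of_cong: "of_nat x = (of_nat y :: 'k)" if "[x = y] (mod p)" for x y
  using that by (simp add: of_nat_eq_iff_cong_CHAR char)
 have de_b: "de (b i a) = de a + ch i a" if i: "i < r" for i a
 proof (cases "nf a")
  case True
  have "[de0 (rep a) (b i a) = de0 (rep a) a + ch0 (rep a) i] (mod p)"
   using grading(1)[OF _ mem i] True nf_rep by blast
  thus ?thesis using True nf_b rep_b[OF i] of_cong by (force simp: de_def ch_def)
 qed (simp add: de_def ch_def nf_b)
 have ch_b: "ch i (b j a) = ch i a" if "j < r" for i j a
  using rep_b[OF that] by (simp add: ch_def nf_b)
 define y where "y a = (\<Sum>i<r. t i * ch i a)" for a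
 have y_b: "y (b j a) = y a" if "j < r" for j a by (simp add: y_def ch_b[OF that])
 have y0: "y a ~= 0 \<longleftrightarrow> nf a" for a
 proof (cases "nf a")
  case True
  have "(\<Sum>i<r. t i * of_nat (ch0 (rep a) i)) ~= 0"
   by (rule t) (use grading(2) True nf_rep in blast)
  thus ?thesis using True by (simp add: y_def ch_def)
 qed (simp add: y_def ch_def)
 define Q where "Q i = (Pm (b i) :: 'k rfm)" for i
 define D where "D = dg de"
 define Y where "Y = (\<Sum>i<r. sc (t i) (dg (ch i) * Q i))"
 define N where "N = NN t"
 have QQ: "Q i * Q j = Q j * Q i" for i j
  unfolding Q_def Pm_mult by (rule arg_cong[of _ _ Pm]) (auto simp: comm)
 have Qp: "Q i ^ p = 1" for i
 proof -
  have "b i ^^ p = (%x. x)" using order_p by auto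
  thus ?thesis by (simp add: Q_def Pm_power Pm_id)
 qed
 have Qdg: "Q j * dg d = dg d * Q j" if "!!a. d (b j a) = d a" for j and d :: "nat => 'k"
  unfolding Q_def Pm_dg using that by simp
 have dgdg: "dg d * dg d' = dg d' * dg d" for d d' :: "nat => 'k"
  by (simp add: dg_mult mult.commute)
 have QD: "Q i * D = D * Q i + dg (ch i) * Q i" if "i < r" for i
 proof -
  have "Q i * D = dg (%a. de a + ch i a) * Q i" unfolding Q_def D_def Pm_dg using de_b[OF that] by simp
  also have "dg (%a. de a + ch i a) = D + dg (ch i)"
   unfolding D_def by (rule rfm_eqI) (simp add: ent_dg)
  finally show ?thesis by (simp add: distrib_right)
 qed
 have N: "N = (\<Sum>i<r. sc (t i) (Q i - 1))" by (simp add: N_def NN_def Q_def)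
 have ND: "N * D = D * N + Y"
 proof -
  have "N * D = (\<Sum>i<r. sc (t i) (D * (Q i - 1)) + sc (t i) (dg (ch i) * Q i))"
   unfolding N sum_distrib_right
  proof (rule sum.cong[OF refl])
   fix i assume "i \<in> {..<r}"
   thus "sc (t i) (Q i - 1) * D = sc (t i) (D * (Q i - 1)) + sc (t i) (dg (ch i) * Q i)"
    using QD[of i] by (simp add: sc_mult_left algebra_simps flip: sc_add_right)
  qed
  thus ?thesis by (simp add: sum.distrib N Y_def sum_distrib_left sc_mult_right)
 qed
 have commN: "Z * N = N * Z" if "!!i. i < r ==> Z * Q i = Q i * Z" for Z
  unfolding N sum_distrib_left sum_distrib_right
  by (intro sum.cong refl) (auto simp: sc_mult_left sc_mult_right algebra_simps that)
 have term_comm: "(dg (ch i) * Q i) * (dg (ch j) * Q j) = (dg (ch j) * Q j) * (dg (ch i) * Q i)" if "i < r" "j < r" for i j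
 proof -
  have "(dg (ch i) * Q i) * (dg (ch j) * Q j) = dg (ch i) * (Q i * dg (ch j)) * Q j" by (simp add: mult.assoc)
  also have "... = (dg (ch i) * dg (ch j)) * (Q i * Q j)"
   using Qdg[of "ch j" i] ch_b[OF that(1)] by (simp add: mult.assoc)
  also have "... = (dg (ch j) * dg (ch i)) * (Q j * Q i)" by (simp only: dgdg[of "ch i"] QQ[of i])
  also have "... = dg (ch j) * (Q j * dg (ch i)) * Q i"
   using Qdg[of "ch i" j] ch_b[OF that(2)] by (simp add: mult.assoc)
  finally show ?thesis by (simp add: mult.assoc)
 qed
 have YQ: "Y * Q j = Q j * Y" if "j < r" for j
  unfolding Y_def sum_distrib_left sum_distrib_right
 proof (intro sum.cong refl)
  fix i
  have "dg (ch i) * Q i * Q j = Q j * (dg (ch i) * Q i)"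
   using Qdg[of "ch i" j] ch_b[OF that] QQ[of i j] by (metis mult.assoc)
  thus "sc (t i) (dg (ch i) * Q i) * Q j = Q j * sc (t i) (dg (ch i) * Q i)"
   by (simp add: sc_mult_left sc_mult_right)
 qed
 \<comment> \<open>The summands of \<open>Y\<close> commute, so the Frobenius formula applies; the
   factors \<open>Q i\<close> disappear because \<open>Q i ^ p = 1\<close>. By hypothesis
   \<open>t\<close> the value \<open>y a\<close> is nonzero exactly off the fixed points.\<close>
 have Yp: "Y ^ p = dg (%a. y a ^ p)"
 proof -
  have pr: "of_nat p = (0 :: 'k rfm)" by (simp add: of_nat_rfm pk)
  have tp: "(dg (ch i) * Q i) ^ n = dg (ch i) ^ n * Q i ^ n" if "i < r" for i n
  proof (induction n)
   case (Suc n)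
   have "Q i * dg (ch i) ^ n = dg (ch i) ^ n * Q i"
    unfolding dg_power by (rule Qdg) (simp add: ch_b[OF that])
   note c = this
   have "(dg (ch i) * Q i) ^ Suc n = dg (ch i) * (Q i * dg (ch i) ^ n) * Q i ^ n"
    by (simp add: Suc mult.assoc)
   thus ?case unfolding c by (simp add: mult.assoc)
  qed simp
  have "Y ^ p = (\<Sum>i<r. sc (t i) (dg (ch i) * Q i) ^ p)"
   unfolding Y_def using term_comm
   by (intro frobenius_sum[OF prime_p pr]) (auto simp: sc_mult_left sc_mult_right mult.commute)
  also have "... = (\<Sum>i<r. dg (%a. (t i * ch i a) ^ p))"
   by (intro sum.cong refl) (simp add: sc_power tp Qp dg_power sc_dg power_mult_distrib)
  also have "... = dg (%a. \<Sum>i<r. (t i * ch i a) ^ p)" by (rule dg_sum)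
  also have "(%a. \<Sum>i<r. (t i * ch i a) ^ p) = (%a. y a ^ p)"
   unfolding y_def by (intro ext frobenius_sum[OF prime_p pk, symmetric]) (auto simp: mult.commute)
  finally show ?thesis .
 qed
 have p0: "p > 0" using prime_gt_0_nat[OF prime_p] .
 define J where "J = dg (%a. if nf a then 1 else (0::'k))"
 \<comment> \<open>An inverse of \<open>Y\<close> on the nontrivial orbits, available because
   \<open>Y ^ p\<close> is diagonal. \<open>J\<close> is the projection onto these orbits and
   becomes the commutator of \<open>N\<close> with \<open>D'\<close>.\<close>
 define Yi where "Yi = dg (%a. inverse (y a ^ p)) * Y ^ (p - 1)"
 have YiY: "Yi * Y = J"
 proof -
  have "Yi * Y = dg (%a. inverse (y a ^ p)) * Y ^ p"
   using p0 by (metis Yi_def mult.assoc power_minus_mult)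
  also have "... = dg (%a. inverse (y a ^ p) * y a ^ p)" unfolding Yp dg_mult ..
  also have "(%a. inverse (y a ^ p) * y a ^ p) = (%a. if nf a then 1 else 0)"
  proof
   fix a show "inverse (y a ^ p) * y a ^ p = (if nf a then 1 else 0)"
    using y0[of a] p0 by (cases "nf a") (auto simp: zero_power)
  qed
  finally show ?thesis unfolding J_def .
 qed
 have YpQ: "Y ^ n * Q j = Q j * Y ^ n" if "j < r" for j n
 proof (induction n)
  case (Suc n)
  thus ?case using YQ[OF that] by (metis mult.assoc power_Suc)
 qed simp
 have YiQ: "Yi * Q j = Q j * Yi" if "j < r" for j
 proof -
  have "dg (%a. inverse (y a ^ p)) * Q j = Q j * dg (%a. inverse (y a ^ p))"
   by (rule Qdg[symmetric]) (simp add: y_b[OF that])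
  thus ?thesis unfolding Yi_def by (rule commute_mult[OF _ YpQ[OF that]])
 qed
 define D' where "D' = Yi * D"
 have ND': "N * D' = D' * N + J"
 proof -
  have "N * D' = Yi * (N * D)" unfolding D'_def using commN[OF YiQ] by (metis mult.assoc)
  thus ?thesis by (simp add: ND distrib_left D'_def YiY mult.assoc)
 qed
 have JQ: "J * Q j = Q j * J" for j
  unfolding J_def by (rule Qdg[symmetric]) (simp add: nf_b)
 have JY: "J * Y = Y * J"
  unfolding Y_def sum_distrib_left sum_distrib_right
  by (intro sum.cong refl) (simp add: sc_mult_left sc_mult_right, metis JQ J_def dgdg mult.assoc)
 have JYn: "J * Y ^ n = Y ^ n * J" for n
 proof (induction n)
  case (Suc n)
  thus ?case using JY by (metis mult.assoc power_Suc)
 qed simp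
 have JD': "J * D' = D' * J"
  unfolding D'_def Yi_def D_def
  by (rule sym, intro commute_mult) (unfold J_def, rule dgdg, fold J_def, rule JYn[symmetric], unfold J_def, rule dgdg)
 have JV: "J * V = V"
  by (rule rfm_eqI) (use V0 in \<open>auto simp: J_def ent_dg_mult nf_def\<close>)
 have JD'n: "J * (D' ^ k * V) = D' ^ k * V" for k
 proof (induction k)
  case (Suc k)
  have "J * (D' ^ Suc k * V) = (J * D') * (D' ^ k * V)" by (simp add: mult.assoc)
  also have "... = D' * (J * (D' ^ k * V))" by (simp only: JD' mult.assoc)
  finally have "J * (D' ^ Suc k * V) = D' * (J * (D' ^ k * V))" .
  thus ?case using Suc by (simp add: mult.assoc)
 qed (simp add: JV)
 \<comment> \<open>\<open>N\<close> differentiates powers of \<open>D'\<close> applied to the kernel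
   vector \<open>V\<close>. Iterating, \<open>N ^ (p - 1)\<close> takes
   \<open>D' ^ (p - 1) * V\<close> to the factorial of \<open>p - 1\<close> times \<open>V\<close>,
   and this factorial is invertible modulo \<open>p\<close>.\<close>
 have step: "N * (D' ^ Suc k * V) = sc (of_nat (Suc k)) (D' ^ k * V)" for k
 proof (induction k)
  case 0
  have "N * (D' * V) = (N * D') * V" by (simp add: mult.assoc)
  also have "... = D' * (N * V) + J * V" by (simp add: ND' distrib_right mult.assoc)
  also have "... = V" using V by (simp add: N_def JV)
  finally show ?case by simp
 next
  case (Suc k)
  have "N * (D' ^ Suc (Suc k) * V) = (N * D') * (D' ^ Suc k * V)" by (simp add: mult.assoc)
  also have "... = D' * (N * (D' ^ Suc k * V)) + J * (D' ^ Suc k * V)" by (simp add: ND' distrib_right mult.assoc)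
  also have "... = sc (of_nat (Suc k)) (D' ^ Suc k * V) + D' ^ Suc k * V"
   by (simp only: Suc JD'n sc_mult_right) (simp add: mult.assoc)
  also have "... = sc (of_nat (Suc (Suc k))) (D' ^ Suc k * V)"
  proof -
   have "of_nat (Suc (Suc k)) = of_nat (Suc k) + (1::'k)" by simp
   thus ?thesis by (simp only: sc_add_left sc_one)
  qed
  finally show ?case .
 qed
 have fin: "N ^ k * (D' ^ k * V) = sc (of_nat (fact k)) V" for k
 proof (induction k)
  case (Suc k)
  have "N ^ Suc k * (D' ^ Suc k * V) = N ^ k * (N * (D' ^ Suc k * V))" by (simp only: power_Suc2 mult.assoc)
  also have "... = sc (of_nat (Suc k)) (N ^ k * (D' ^ k * V))" by (simp only: step sc_mult_right)
  finally show ?case by (simp only: Suc sc_sc fact_Suc of_nat_mult of_nat_id)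
 qed simp
 have fp: "of_nat (fact (p - 1)) ~= (0::'k)"
  using p0 by (simp only: of_nat_eq_0_iff_char_dvd char prime_dvd_fact_iff[OF prime_p])
 have "V = N ^ (p - 1) * sc (inverse (of_nat (fact (p - 1)))) (D' ^ (p - 1) * V)"
  using fp by (simp add: sc_mult_right fin)
 thus ?thesis using that unfolding N_def by blast
qed

end

section \<open>Elementary abelian groups acting on a matrix algebra\<close>

text \<open>The \<open>rh i\<close> generate the group, padded by the identity for \<open>i \<ge> r\<close>; they permute the basis
 \<open>bx 0, ..., bx (L - 1)\<close> of the matrix algebra through \<open>be i\<close>, and \<open>cf a\<close> is the \<open>a\<close>-th coordinate.\<close>

locale stage =
 fixes p m r L :: nat and rh bx :: "nat => 'e::{finite,field} rfm"
  and be :: "nat => nat => nat" and ka :: "nat => nat => nat => 'e" and cf :: "nat => 'e rfm => 'e"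
 assumes prime_p: "prime p" and pE: "of_nat p = (0::'e)"
  and rh_Mat: "rh i \<in> Mat m m" and rh_out: "i \<ge> r ==> rh i = ee m"
  and rh_comm: "rh i * rh j = rh j * rh i" and rh_p: "rh i ^ p = ee m"
  and bx_Mat: "a < L ==> bx a \<in> Mat m m"
  and cf_def: "cf a M = (\<Sum>i<m. \<Sum>j<m. ka a i j * ent M i j)"
  and cf_bx: "a < L ==> b < L ==> cf a (bx b) = (if a = b then 1 else 0)"
  and span: "M \<in> Mat m m ==> (\<Sum>a<L. sc (cf a M) (bx a)) = M"
  and be_L: "a < L ==> be i a < L" and be_out: "a \<ge> L ==> be i a = a"
  and be_conj: "a < L ==> rh i * bx (be i a) = bx a * rh i"
  and fixpt: "\<exists>a<L. \<forall>i<r. be i a = a"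
begin

lemma p_pos: "p > 0" and p1_pos: "p - 1 > 0"
 using prime_gt_1_nat[OF prime_p] by auto

definition rinv :: "nat => 'e rfm" where "rinv i = rh i ^ (p - 1)"

lemma rinv_Mat: "rinv i \<in> Mat m m"
 unfolding rinv_def by (rule Mat_power[OF rh_Mat p1_pos])

lemma rinv1: "rh i * rinv i = ee m" and rinv2: "rinv i * rh i = ee m"
 using rh_p[of i] p_pos unfolding rinv_def
 by (metis power_minus_mult power_commutes)+

lemma bx_conj: "a < L ==> rinv i * bx a * rh i = bx (be i a)"
 using be_conj[of a i] MatD(1)[OF bx_Mat[OF be_L]] rinv2 by (metis mult.assoc)

lemma cf_add: "cf a (M + N) = cf a M + cf a N" and cf_minus: "cf a (M - N) = cf a M - cf a N"
 and cf_sc: "cf a (sc c M) = c * cf a M" and cf_0 [simp]: "cf a 0 = 0"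
 by (simp_all add: cf_def algebra_simps sum.distrib sum_subtractf sum_distrib_left)

lemma cf_sum: "cf a (sum f S) = (\<Sum>s\<in>S. cf a (f s))"
 by (induction S rule: infinite_finite_induct) (auto simp: cf_add)

lemma cf_lin: "b < L ==> cf b (\<Sum>a<L. sc (u a) (bx a)) = u b"
proof -
 assume "b < L"
 hence "cf b (\<Sum>a<L. sc (u a) (bx a)) = (\<Sum>a<L. if a = b then u a else 0)"
  unfolding cf_sum cf_sc by (intro sum.cong) (auto simp: cf_bx)
 thus ?thesis using \<open>b < L\<close> by simp
qed

lemma bx_inj: "a < L ==> b < L ==> bx a = bx b ==> a = b"
 using cf_bx[of a a] cf_bx[of a b] by (auto split: if_splits)

lemma be_comm: "be i (be j a) = be j (be i a)"
proof (cases "a < L")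
 case True
 have "bx (be i (be j a)) = rinv i * (rinv j * bx a * rh j) * rh i"
  using True by (simp add: bx_conj be_L)
 also have "... = (rinv i * rinv j) * bx a * (rh j * rh i)" by (simp add: mult.assoc)
 also have "rinv i * rinv j = rinv j * rinv i" unfolding rinv_def
  by (metis rh_comm power_commuting_commutes)
 also have "rh j * rh i = rh i * rh j" by (rule rh_comm)
 also have "(rinv j * rinv i) * bx a * (rh i * rh j) = rinv j * (rinv i * bx a * rh i) * rh j" by (simp add: mult.assoc)
 also have "... = bx (be j (be i a))" using True by (simp add: bx_conj be_L)
 finally have eq: "bx (be i (be j a)) = bx (be j (be i a))" .
 show ?thesis by (rule bx_inj[OF be_L[OF be_L[OF True]] be_L[OF be_L[OF True]] eq])
qed (simp add: be_out)

lemma be_p: "(be i ^^ p) a = a"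
proof (cases "a < L")
 case True
 have lt: "(be i ^^ n) a < L" for n by (induction n) (auto simp: True be_L)
 have *: "rh i ^ n * bx ((be i ^^ n) a) = bx a * rh i ^ n" for n
 proof (induction n)
  case (Suc n)
  have "rh i ^ Suc n * bx ((be i ^^ Suc n) a) = rh i ^ n * (rh i * bx (be i ((be i ^^ n) a)))"
   by (simp only: power_Suc2 funpow.simps comp_apply mult.assoc)
  also have "... = (rh i ^ n * bx ((be i ^^ n) a)) * rh i" by (simp add: be_conj lt mult.assoc)
  also have "... = bx a * rh i ^ Suc n" unfolding Suc by (simp add: mult.assoc power_commutes)
  finally show ?case .
 qed simp
 have "bx ((be i ^^ p) a) = bx a"
  using *[of p] MatD[OF bx_Mat[OF lt]] MatD[OF bx_Mat[OF True]] by (simp add: rh_p)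
 thus ?thesis using bx_inj lt True by blast
next
 case False
 hence "(be i ^^ n) a = a" for n by (induction n) (auto simp: be_out)
 thus ?thesis .
qed

lemma be_ge: "i \<ge> r ==> be i a = a"
proof (cases "a < L")
 case True
 assume "i \<ge> r"
 hence "bx (be i a) = bx a"
  using be_conj[OF True, of i] rh_out MatD[OF bx_Mat[OF True]] MatD[OF bx_Mat[OF be_L[OF True, of i]]] by simp
 thus ?thesis using bx_inj True be_L by blast
qed (simp add: be_out)

sublocale CP: commuting_perms p r be
 by unfold_locales (auto simp: prime_p be_p be_comm)

lemma bij_be: "bij_betw (be i) {..<L} {..<L}"
proof (rule bij_betwI')
 show "!!x y. x \<in> {..<L} ==> y \<in> {..<L} ==> (be i x = be i y) = (x = y)" using CP.inj_b by blast
 show "!!x. x \<in> {..<L} ==> be i x \<in> {..<L}" using be_L by auto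
 show "!!y. y \<in> {..<L} ==> \<exists>x\<in>{..<L}. y = be i x"
 proof -
  fix y assume y: "y \<in> {..<L}"
  have "(be i ^^ n) y < L" for n using y by (induction n) (auto simp: be_L)
  moreover have "y = be i ((be i ^^ (p - 1)) y)"
   using be_p[of i y] p_pos by (metis Suc_pred' comp_apply funpow.simps(2))
  ultimately show "\<exists>x\<in>{..<L}. y = be i x" by blast
 qed
qed

lemma sum_reindex_be: "(\<Sum>a<L. f (be i a)) = (\<Sum>a<L. f a)"
 by (rule sum.reindex_bij_betw[OF bij_be])

text \<open>\<open>TQ\<close> is the sum of the images of the proper traces: a fixed point is a combination of orbit
 sums, and those of nontrivial orbits are traces.\<close>

definition AQ :: "'e rfm set" where "AQ = {c \<in> Mat m m. \<forall>i. rh i * c = c * rh i}"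
definition FX :: "nat set" where "FX = {a. a < L & (\<forall>i<r. be i a = a)}"
definition TQ :: "'e rfm set" where "TQ = {c \<in> AQ. \<forall>a\<in>FX. cf a c = 0}"

lemma AQ_Mat: "c \<in> AQ ==> c \<in> Mat m m" and AQ_comm: "c \<in> AQ ==> rh i * c = c * rh i"
 by (auto simp: AQ_def)

lemma FX_L: "a \<in> FX ==> a < L" by (simp add: FX_def)
lemma FX_fix: "a \<in> FX ==> be i a = a"
 by (cases "i < r") (auto simp: FX_def be_ge)
lemma finite_FX: "finite FX" by (rule finite_subset[of _ "{..<L}"]) (auto simp: FX_def)
lemma FX_ne: "FX ~= {}" using fixpt by (auto simp: FX_def)

lemma AQ_add: "c \<in> AQ ==> d \<in> AQ ==> c + d \<in> AQ"
 and AQ_minus: "c \<in> AQ ==> d \<in> AQ ==> c - d \<in> AQ"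
 and AQ_sc: "c \<in> AQ ==> sc x c \<in> AQ"
 and AQ_0: "0 \<in> AQ"
 by (auto simp: AQ_def algebra_simps sc_mult_left sc_mult_right)

lemma AQ_mult: "c \<in> AQ ==> d \<in> AQ ==> c * d \<in> AQ"
proof -
 assume cd: "c \<in> AQ" "d \<in> AQ"
 have "rh i * (c * d) = c * d * rh i" for i
  using AQ_comm[OF cd(1), of i] AQ_comm[OF cd(2), of i] by (metis mult.assoc)
 thus ?thesis unfolding AQ_def using Mat_mult[OF AQ_Mat[OF cd(1)] AQ_Mat[OF cd(2)]] by blast
qed

lemma AQ_ee: "ee m \<in> AQ"
 unfolding AQ_def using MatD[OF rh_Mat] by simp

lemma AQ_sum: "(!!s. s \<in> S ==> f s \<in> AQ) ==> sum f S \<in> AQ"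
 by (induction S rule: infinite_finite_induct) (auto simp: AQ_0 AQ_add)

lemma bx_AQ: "a \<in> FX ==> bx a \<in> AQ"
 using be_conj[of a] FX_fix[of a] FX_L[of a] bx_Mat[of a] by (auto simp: AQ_def)

lemma cf_conj: "M \<in> Mat m m ==> b < L ==> cf (be i b) (rinv i * M * rh i) = cf b M"
proof -
 assume M: "M \<in> Mat m m" and b: "b < L"
 have "rinv i * M * rh i = (\<Sum>a<L. sc (cf a M) (rinv i * bx a * rh i))"
  by (subst span[OF M, symmetric]) (simp add: sum_distrib_left sum_distrib_right sc_mult_left sc_mult_right)
 also have "... = (\<Sum>a<L. sc (cf a M) (bx (be i a)))" by (simp add: bx_conj)
 finally have "cf (be i b) (rinv i * M * rh i) = (\<Sum>a<L. cf a M * (if be i b = be i a then 1 else 0))"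
  using b by (simp add: cf_sum cf_sc cf_bx be_L)
 also have "... = (\<Sum>a<L. if a = b then cf a M else 0)"
  using CP.inj_b by (intro sum.cong) auto
 finally show ?thesis using b by simp
qed

lemma AQ_conj: "c \<in> AQ ==> rinv i * c * rh i = c"
 using AQ_comm[of c i] rinv2[of i] MatD(1)[OF AQ_Mat, of c] by (metis mult.assoc)

lemma AQ_cf: "c \<in> AQ ==> cf (be i a) c = cf a c"
 using cf_conj[OF AQ_Mat, of c a i] AQ_conj[of c i] be_out[of a i] by (cases "a < L") auto

text \<open>The fixed points of the diagonal action on pairs are the pairs of fixed indices; all
  other orbits cancel modulo \<open>p\<close>.\<close>

lemma pair_sum:
 fixes h :: "nat => nat => 'e"
 assumes "!!i a b. a < L ==> b < L ==> h (be i a) (be i b) = h a b"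
 shows "(\<Sum>a<L. \<Sum>b<L. h a b) = (\<Sum>a\<in>FX. \<Sum>b\<in>FX. h a b)"
proof -
 let ?Y = "{..<L} \<times> {..<L}" and ?b = "%i (a, b). (be i a, be i b)"
 have pw: "(?b i ^^ n) (a, b) = ((be i ^^ n) a, (be i ^^ n) b)" for i n a b
  by (induction n) auto
 have "(\<Sum>a<L. \<Sum>b<L. h a b) = (\<Sum>(a, b)\<in>?Y. h a b)" by (simp add: sum.cartesian_product)
 also have "... = (\<Sum>(a, b)\<in>{y\<in>?Y. \<forall>i<r. ?b i y = y}. h a b)"
  by (rule sum_commuting_fixed[OF prime_p pE]) (auto simp: be_L pw be_p be_comm assms)
 also have "{y\<in>?Y. \<forall>i<r. ?b i y = y} = FX \<times> FX" by (auto simp: FX_def)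
 also have "(\<Sum>(a, b)\<in>FX \<times> FX. h a b) = (\<Sum>a\<in>FX. \<Sum>b\<in>FX. h a b)" by (simp add: sum.cartesian_product)
 finally show ?thesis .
qed

lemma cf_prod_conj:
 assumes "z \<in> FX" "a < L" "b < L" "c \<in> AQ"
 shows "cf z (bx (be i a) * c * bx (be i b)) = cf z (bx a * c * bx b)"
proof -
 have "bx (be i a) * c * bx (be i b) = rinv i * bx a * (rh i * c * rinv i) * bx b * rh i"
  using assms by (simp add: mult.assoc flip: bx_conj)
 also have "rh i * c * rinv i = c"
  using AQ_comm[OF assms(4), of i] rinv1[of i] MatD(2)[OF AQ_Mat[OF assms(4)]] by (metis mult.assoc)
 finally have "bx (be i a) * c * bx (be i b) = rinv i * (bx a * c * bx b) * rh i" by (simp add: mult.assoc)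
 moreover have "bx a * c * bx b \<in> Mat m m" using assms bx_Mat AQ_Mat by blast
 ultimately show ?thesis using cf_conj[of _ z i] FX_fix[OF assms(1)] FX_L[OF assms(1)] by metis
qed

text \<open>By \<open>pair_sum\<close> a coordinate of a product at a fixed index depends only on
  the coordinates of the factors at fixed indices, and those of \<open>t\<close> vanish.\<close>

lemma TQ_ideal:
 assumes "t \<in> TQ" "c \<in> AQ"
 shows "t * c \<in> TQ" "c * t \<in> TQ"
proof -
 have t: "t \<in> AQ" "!!a. a \<in> FX ==> cf a t = 0" using assms by (auto simp: TQ_def)
 have prod: "cf z (x * y) = (\<Sum>a\<in>FX. \<Sum>b\<in>FX. cf a x * cf b y * cf z (bx a * bx b))"
  if "x \<in> AQ" "y \<in> AQ" "z \<in> FX" for x y z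
 proof -
  have "x * y = (\<Sum>a<L. sc (cf a x) (bx a)) * (\<Sum>b<L. sc (cf b y) (bx b))"
   using that by (simp add: span AQ_Mat)
  also have "... = (\<Sum>a<L. \<Sum>b<L. sc (cf a x * cf b y) (bx a * bx b))"
   by (simp add: sum_product sc_mult_left sc_mult_right mult.commute)
  finally have "cf z (x * y) = (\<Sum>a<L. \<Sum>b<L. cf a x * cf b y * cf z (bx a * bx b))"
   by (simp add: cf_sum cf_sc)
  also have "... = (\<Sum>a\<in>FX. \<Sum>b\<in>FX. cf a x * cf b y * cf z (bx a * bx b))"
  proof (rule pair_sum)
   fix i a b assume ab: "a < L" "b < L"
   have "cf z (bx (be i a) * bx (be i b)) = cf z (bx a * bx b)"
    using cf_prod_conj[OF that(3) ab AQ_ee, of i] MatD(2)[OF bx_Mat] ab be_L by simp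
   thus "cf (be i a) x * cf (be i b) y * cf z (bx (be i a) * bx (be i b)) = cf a x * cf b y * cf z (bx a * bx b)"
    using that AQ_cf by simp
  qed
  finally show ?thesis .
 qed
 show "t * c \<in> TQ" "c * t \<in> TQ"
  using AQ_mult[OF t(1) assms(2)] AQ_mult[OF assms(2) t(1)] prod t assms(2)
  by (auto simp: TQ_def intro!: sum.neutral)
qed

lemma AQ_decomp: "c \<in> AQ ==> c - (\<Sum>a\<in>FX. sc (cf a c) (bx a)) \<in> TQ"
proof -
 assume c: "c \<in> AQ"
 have "cf z (\<Sum>a\<in>FX. sc (cf a c) (bx a)) = cf z c" if z: "z \<in> FX" for z
 proof -
  have "cf z (\<Sum>a\<in>FX. sc (cf a c) (bx a)) = (\<Sum>a\<in>FX. if a = z then cf a c else 0)"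
   unfolding cf_sum cf_sc using z FX_L by (intro sum.cong) (auto simp: cf_bx)
  thus ?thesis using z finite_FX by simp
 qed
 thus ?thesis using c by (auto simp: TQ_def cf_minus intro!: AQ_minus AQ_sum AQ_sc bx_AQ)
qed

text \<open>Linear independence of the operators \<open>bx a * M * bx b\<close> in the variable
  \<open>M\<close>: the tensor square of a matrix algebra embeds into its endomorphisms. Matrix
  units in place of \<open>M\<close> separate the two factors.\<close>

lemma sandwich_unique:
 assumes "!!M. M \<in> Mat m m ==> (\<Sum>a<L. \<Sum>b<L. sc (u a b) (bx a * M * bx b)) = 0" "a < L" "b < L"
 shows "u a b = 0"
proof -
 have e: "(\<Sum>a<L. \<Sum>b<L. u a b * (ent (bx a) k i * ent (bx b) j l)) = 0" if "i < m" "j < m" for k i j l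
 proof -
  have "ent (bx a * un i j * bx b) k l = ent (bx a) k i * ent (bx b) j l" for a b
  proof -
   have "sc (ent (bx a * un i j * bx b) k l) (un k l) = un k k * (bx a * un i j * bx b) * un l l"
    by (simp add: un_sandwich)
   also have "... = (un k k * bx a * un i j) * (un j j * bx b * un l l)" by (simp add: mult.assoc)
   also have "... = sc (ent (bx a) k i * ent (bx b) j l) (un k l)"
    by (simp only: un_sandwich sc_mult_left sc_mult_right) (simp add: mult.commute)
   finally have "ent (sc (ent (bx a * un i j * bx b) k l) (un k l)) k l
     = ent (sc (ent (bx a) k i * ent (bx b) j l) (un k l :: 'e rfm)) k l" by simp
   thus ?thesis by (simp add: ent_un)
  qed
  moreover have "ent (\<Sum>a<L. \<Sum>b<L. sc (u a b) (bx a * un i j * bx b)) k l = 0"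
   using assms(1)[OF Mat_un[OF that]] by simp
  ultimately show ?thesis by (simp add: ent_sum)
 qed
 have "(\<Sum>b<L. u a b * ent (bx b) j l) = 0" if "a < L" "j < m" for a j l
 proof -
  have "(\<Sum>a<L. sc (\<Sum>b<L. u a b * ent (bx b) j l) (bx a)) = 0"
  proof (rule Mat_eqI[of _ m m])
   fix k i assume "k < m" "i < m"
   show "ent (\<Sum>a<L. sc (\<Sum>b<L. u a b * ent (bx b) j l) (bx a)) k i = ent 0 k i"
    using e[OF \<open>i < m\<close> \<open>j < m\<close>, of k l] by (simp add: ent_sum sum_distrib_left sum_distrib_right mult_ac)
  qed (auto intro!: bx_Mat Mat_sc)
  thus ?thesis using cf_lin[OF \<open>a < L\<close>, of "%a. \<Sum>b<L. u a b * ent (bx b) j l"] by simp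
 qed
 hence "(\<Sum>b<L. sc (u a b) (bx b)) = 0"
  using assms(2) by (intro Mat_eqI[of _ m m]) (auto simp: ent_sum intro!: bx_Mat Mat_sc)
 thus ?thesis using cf_lin[OF assms(3), of "u a"] by simp
qed

text \<open>The operator \<open>M \<mapsto> cf y M \<cdot> bx z\<close> on the matrix algebra is a combination of the operators
 \<open>M \<mapsto> bx a * M * bx b\<close> with unique, hence invariant coefficients. On fixed points only the terms
 with fixed \<open>a\<close>, \<open>b\<close> survive modulo \<open>TQ\<close>.\<close>

lemma simple_modulo_TQ:
 assumes c: "c \<in> AQ" "c \<notin> TQ" and z: "z \<in> FX"
 obtains u where "bx z - (\<Sum>a\<in>FX. \<Sum>b\<in>FX. sc (u a b) (bx a * c * bx b)) \<in> TQ"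
proof -
 obtain y where y: "y \<in> FX" "cf y c ~= 0" using c by (auto simp: TQ_def)
 have zM: "bx z \<in> Mat m m" using z FX_L bx_Mat by blast
 have swap_sc: "(\<Sum>a<L. \<Sum>b<L. sc (\<Sum>t<m. v t a b) (X a b)) = (\<Sum>t<m. \<Sum>a<L. \<Sum>b<L. sc (v t a b) (X a b))"
  for v :: "nat => nat => nat => 'e" and X
 proof -
  have "(\<Sum>b<L. sc (\<Sum>t<m. v t a b) (X a b)) = (\<Sum>t<m. \<Sum>b<L. sc (v t a b) (X a b))" for a
   unfolding sc_sum_left by (rule sum.swap)
  thus ?thesis by (simp only:) (rule sum.swap)
 qed
 \<comment> \<open>\<open>cf y M\<close> is a combination of the entries \<open>ent M i j\<close>,
   and such an entry times \<open>ee m\<close> is the sum over \<open>k\<close> of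
   \<open>un k i * M * un j k\<close>. Expanding \<open>bx z * un k i\<close> and
   \<open>un j k\<close> in the basis gives these coefficients.\<close>
 define u where "u a b = (\<Sum>i<m. \<Sum>j<m. \<Sum>k<m. ka y i j * (cf a (bx z * un k i) * cf b (un j k)))" for a b
 have rep: "(\<Sum>a<L. \<Sum>b<L. sc (u a b) (bx a * M * bx b)) = sc (cf y M) (bx z)" if M: "M \<in> Mat m m" for M
 proof -
  have 1: "(\<Sum>a<L. \<Sum>b<L. sc (cf a (bx z * un k i) * cf b (un j k)) (bx a * M * bx b)) = bx z * un k i * M * un j k"
   if "i < m" "j < m" "k < m" for i j k
  proof -
   have "bx z * un k i * M * un j k = (\<Sum>a<L. sc (cf a (bx z * un k i)) (bx a)) * M * (\<Sum>b<L. sc (cf b (un j k)) (bx b))"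
    using that zM by (simp add: span Mat_un Mat_mult[OF zM Mat_un])
   also have "... = (\<Sum>a<L. sc (cf a (bx z * un k i)) (bx a) * M) * (\<Sum>b<L. sc (cf b (un j k)) (bx b))"
    by (simp only: sum_distrib_right)
   also have "... = (\<Sum>a<L. \<Sum>b<L. sc (cf a (bx z * un k i) * cf b (un j k)) (bx a * M * bx b))"
    unfolding sum_product by (simp add: sc_mult_left sc_mult_right mult.commute)
   finally show ?thesis by simp
  qed
  have "(\<Sum>a<L. \<Sum>b<L. sc (u a b) (bx a * M * bx b))
    = (\<Sum>i<m. \<Sum>j<m. \<Sum>k<m. sc (ka y i j) (\<Sum>a<L. \<Sum>b<L. sc (cf a (bx z * un k i) * cf b (un j k)) (bx a * M * bx b)))"
   unfolding u_def swap_sc by (simp add: sc_sum_right)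
  also have "... = (\<Sum>i<m. \<Sum>j<m. \<Sum>k<m. sc (ka y i j) (bx z * un k i * M * un j k))"
   by (intro sum.cong refl) (simp add: 1)
  also have "... = (\<Sum>i<m. \<Sum>j<m. sc (ka y i j * ent M i j) (bx z))"
  proof (intro sum.cong refl)
   fix i j
   have "(\<Sum>k<m. sc (ka y i j) (bx z * un k i * M * un j k)) = sc (ka y i j) (bx z * (\<Sum>k<m. un k i * M * un j k))"
    by (simp add: sum_distrib_left sc_sum_right mult.assoc)
   also have "(\<Sum>k<m. un k i * M * un j k) = sc (ent M i j) (ee m)"
    by (simp add: un_sandwich ee_eq_sum sc_sum_right)
   finally show "(\<Sum>k<m. sc (ka y i j) (bx z * un k i * M * un j k)) = sc (ka y i j * ent M i j) (bx z)"
    using MatD(2)[OF zM] by (simp add: sc_mult_right)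
  qed
  also have "... = sc (cf y M) (bx z)" by (simp add: cf_def sc_sum_left)
  finally show ?thesis .
 qed
 have inv: "u (be i a) (be i b) = u a b" if ab: "a < L" "b < L" for i a b
 proof -
  define bi where "bi = be i ^^ (p - 1)"
  have bi: "bi (be i a) = a" "be i (bi a) = a" for a
   unfolding bi_def using be_p[of i a] p_pos
   by (metis Suc_pred' comp_apply funpow_Suc_right, metis Suc_pred' comp_apply funpow.simps(2))
  \<comment> \<open>Conjugation by \<open>rh i\<close> leaves the operator unchanged because
    \<open>y\<close> and \<open>z\<close> are fixed indices, so the permuted coefficients represent
    it too and uniqueness applies.\<close>
  have "(\<Sum>a<L. \<Sum>b<L. sc (u (bi a) (bi b) - u a b) (bx a * M * bx b)) = 0" if M: "M \<in> Mat m m" for M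
  proof -
   let ?M = "rh i * M * rinv i"
   have M': "?M \<in> Mat m m" using M rh_Mat rinv_Mat by blast
   have "(\<Sum>a<L. \<Sum>b<L. sc (u (bi a) (bi b)) (bx a * M * bx b))
    = (\<Sum>a<L. \<Sum>b<L. sc (u (bi (be i a)) (bi (be i b))) (bx (be i a) * M * bx (be i b)))"
    by (subst sum_reindex_be[of _ i, symmetric], rule sum.cong[OF refl], subst sum_reindex_be[of _ i, symmetric]) simp
   also have "... = (\<Sum>a<L. \<Sum>b<L. sc (u a b) (rinv i * (bx a * ?M * bx b) * rh i))"
   proof (intro sum.cong refl)
    fix a b assume "a \<in> {..<L}" "b \<in> {..<L}"
    hence "bx (be i a) * M * bx (be i b) = rinv i * (bx a * ?M * bx b) * rh i"
     by (simp add: mult.assoc flip: bx_conj)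
    thus "sc (u (bi (be i a)) (bi (be i b))) (bx (be i a) * M * bx (be i b)) = sc (u a b) (rinv i * (bx a * ?M * bx b) * rh i)"
     by (simp add: bi)
   qed
   also have "... = rinv i * (\<Sum>a<L. \<Sum>b<L. sc (u a b) (bx a * ?M * bx b)) * rh i"
    by (simp add: sum_distrib_left sum_distrib_right sc_mult_left sc_mult_right)
   also have "... = sc (cf y ?M) (rinv i * bx z * rh i)"
    unfolding rep[OF M'] by (simp add: sc_mult_left sc_mult_right)
   also have "rinv i * bx z * rh i = bx z" using bx_conj[OF FX_L[OF z]] FX_fix[OF z] by simp
   also have "cf y ?M = cf y M"
   proof -
    have "rinv i * ?M * rh i = (rinv i * rh i) * M * (rinv i * rh i)" by (simp add: mult.assoc)
    also have "... = M" using M by (simp add: rinv2 MatD)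
    finally show ?thesis using cf_conj[OF M' FX_L[OF y(1)], of i] FX_fix[OF y(1)] by simp
   qed
   also have "sc (cf y M) (bx z) = (\<Sum>a<L. \<Sum>b<L. sc (u a b) (bx a * M * bx b))" by (simp add: rep[OF M])
   finally show ?thesis by (simp add: sc_minus_left sum_subtractf)
  qed
  from sandwich_unique[OF this be_L[OF ab(1), of i] be_L[OF ab(2), of i]] show ?thesis by (simp add: bi)
 qed
 have cM: "c \<in> Mat m m" using c AQ_Mat by blast
 define f where "f = (\<Sum>a\<in>FX. \<Sum>b\<in>FX. sc (u a b) (bx a * c * bx b))"
 have fA: "f \<in> AQ" unfolding f_def using c bx_AQ by (intro AQ_sum AQ_sc AQ_mult)
 have "cf w f = cf y c * cf w (bx z)" if w: "w \<in> FX" for w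
 proof -
  have "cf w f = (\<Sum>a\<in>FX. \<Sum>b\<in>FX. u a b * cf w (bx a * c * bx b))" by (simp add: f_def cf_sum cf_sc)
  also have "... = (\<Sum>a<L. \<Sum>b<L. u a b * cf w (bx a * c * bx b))"
   by (rule pair_sum[symmetric]) (simp add: inv cf_prod_conj[OF w _ _ c(1)])
  also have "... = cf w (\<Sum>a<L. \<Sum>b<L. sc (u a b) (bx a * c * bx b))" by (simp add: cf_sum cf_sc)
  finally show ?thesis by (simp add: rep[OF cM] cf_sc)
 qed
 hence "sc (1 / cf y c) f - bx z \<in> TQ"
  using y fA z bx_AQ by (auto simp: TQ_def cf_minus cf_sc intro!: AQ_minus AQ_sc)
 hence "bx z - sc (1 / cf y c) f \<in> TQ"
  by (auto simp: TQ_def cf_minus AQ_minus) (metis AQ_sc minus_diff_eq sc_one sc_uminus)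
 moreover have "sc (1 / cf y c) f = (\<Sum>a\<in>FX. \<Sum>b\<in>FX. sc (u a b / cf y c) (bx a * c * bx b))"
  by (simp add: f_def sc_sum_right)
 ultimately show ?thesis using that[of "%a b. u a b / cf y c"] by simp
qed

text \<open>The quotient of \<open>AQ\<close> by \<open>TQ\<close> is simple: an element outside
  \<open>TQ\<close> generates all \<open>bx z\<close> modulo \<open>TQ\<close>, so a map killing it
  would kill 1. As the map is only additive and multiplicative, scalars enter through
  \<open>sc x d = sc x (ee m) * d\<close>.\<close>

lemma kernel_TQ:
 fixes ph :: "'e rfm => 'b::ring_1"
 assumes add: "!!c d. c \<in> AQ ==> d \<in> AQ ==> ph (c + d) = ph c + ph d"
  and mult: "!!c d. c \<in> AQ ==> d \<in> AQ ==> ph (c * d) = ph c * ph d"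
  and T: "!!t. t \<in> TQ ==> ph t = 0" and one: "ph (ee m) ~= 0" and c: "c \<in> AQ" "ph c = 0"
 shows "c \<in> TQ"
proof (rule ccontr)
 assume nt: "c \<notin> TQ"
 have ph0: "ph 0 = 0" using add[OF AQ_0 AQ_0] by simp
 have sum: "ph (\<Sum>s\<in>S. f s) = (\<Sum>s\<in>S. ph (f s))" if "!!s. s \<in> S ==> f s \<in> AQ" for S :: "nat set" and f
  using that
 proof (induction S rule: infinite_finite_induct)
  case (insert x F)
  thus ?case using add[OF insert.prems[of x] AQ_sum[of F f]] by auto
 qed (auto simp: ph0)
 have scm: "sc x d = sc x (ee m) * d" if "d \<in> AQ" for x d
  using AQ_Mat[OF that] by (simp add: sc_mult_left MatD)
 have z: "ph (bx z) = 0" if z: "z \<in> FX" for z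
 proof -
  obtain u where u: "bx z - (\<Sum>a\<in>FX. \<Sum>b\<in>FX. sc (u a b) (bx a * c * bx b)) \<in> TQ"
   using simple_modulo_TQ[OF c(1) nt z] by blast
  define s where "s = (\<Sum>a\<in>FX. \<Sum>b\<in>FX. sc (u a b) (bx a * c * bx b))"
  have in1: "sc (u a b) (bx a * c * bx b) \<in> AQ" if "a \<in> FX" "b \<in> FX" for a b
   using that c bx_AQ by (intro AQ_sc AQ_mult)
  have "ph (sc (u a b) (bx a * c * bx b)) = 0" if ab: "a \<in> FX" "b \<in> FX" for a b
  proof -
   have "ph (bx a * c * bx b) = 0" using ab c bx_AQ by (simp add: mult AQ_mult)
   thus ?thesis
    using ab c bx_AQ by (subst scm) (auto simp: mult AQ_mult AQ_sc AQ_ee)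
  qed
  hence "ph s = 0" unfolding s_def by (simp add: sum in1 AQ_sum)
  moreover have "s \<in> AQ" unfolding s_def using in1 by (intro AQ_sum)
  moreover have "ph (bx z) = ph (bx z - s) + ph s"
   using add[of "bx z - s" s] bx_AQ[OF z] \<open>s \<in> AQ\<close> AQ_minus by simp
  ultimately show ?thesis using T u by (simp add: s_def)
 qed
 define s where "s = (\<Sum>a\<in>FX. sc (cf a (ee m)) (bx a))"
 have sA: "s \<in> AQ" unfolding s_def by (intro AQ_sum AQ_sc bx_AQ)
 have "ph (sc x (bx a)) = 0" if "a \<in> FX" for x a
  using z[OF that] bx_AQ[OF that] by (subst scm) (auto simp: mult AQ_sc AQ_ee)
 hence "ph s = 0" unfolding s_def by (simp add: sum AQ_sc bx_AQ)
 moreover have "ph (ee m) = ph (ee m - s) + ph s" using add[of "ee m - s" s] AQ_ee sA AQ_minus by simp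
 ultimately show False using one T AQ_decomp[OF AQ_ee] by (simp add: s_def)
qed

lemma ee_notin_TQ: "ee m \<notin> TQ"
proof
 assume *: "ee m \<in> TQ"
 obtain z where z: "z \<in> FX" using FX_ne by blast
 have "ee m * bx z \<in> TQ" using TQ_ideal(1)[OF * bx_AQ[OF z]] .
 hence "cf z (bx z) = 0" using z MatD(1)[OF bx_Mat[OF FX_L[OF z]]] by (simp add: TQ_def)
 thus False using cf_bx[of z z] FX_L[OF z] by simp
qed

end

subsection \<open>The generic element of the group algebra\<close>

definition cst :: "'e::zero => 'e mp" where "cst c = msingle 0 c"
definition xv :: "nat => 'e::zero_neq_one mp" where "xv i = msingle (msingle i 1) 1"
definition jF :: "'e::field => 'e mp fract" where "jF c = fr (cst c)"

global_interpretation cst: inj_comm_ring_hom "cst :: 'e::comm_ring_1 => 'e mp"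
proof
 show "cst (1::'e) = 1" by (simp add: cst_def)
 show "cst x = 0 ==> x = 0" for x :: 'e by (metis cst_def lookup_single_eq lookup_zero)
qed (simp_all add: cst_def single_add mult_single)

global_interpretation jF: inj_comm_ring_hom "jF :: 'e::field => 'e mp fract"
 by unfold_locales (auto simp: jF_def fr.hom_add cst.hom_add fr.hom_mult cst.hom_mult)

lemma rmap_jF: "rmap jF M = rmap fr (rmap cst M)"
 by (rule rfm_eqI) (simp add: jF_def)

definition co :: "(nat \<Rightarrow>\<^sub>0 nat) => 'e::comm_ring_1 mp rfm => 'e rfm" where
 "co ny W = rmap (%f. mlook f ny) W"

lemma ent_co [simp]: "ent (co ny W) i j = mlook (ent W i j) ny"
 by (simp add: co_def ent_rmap)

lemma co_eqI: "(!!ny. co ny W = co ny V) ==> W = V"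
 by (rule rfm_eqI, rule poly_mapping_eqI) (metis ent_co)

lemma co_add: "co ny (W + V) = co ny W + co ny V" and co_minus: "co ny (W - V) = co ny W - co ny V"
 and co_0 [simp]: "co ny 0 = 0"
 by (auto intro!: rfm_eqI simp: lookup_add lookup_minus)

lemma co_sum: "co ny (sum f S) = (\<Sum>s\<in>S. co ny (f s))"
 by (induction S rule: infinite_finite_induct) (auto simp: co_add)

lemma co_single: "co (mu + ny) (sc (msingle mu c) W) = sc c (co ny W)"
 by (rule rfm_eqI) (simp add: lookup_single_mult)

lemma co_single_0: "(!!xi. mu + xi ~= ny) ==> co ny (sc (msingle mu c) W) = 0"
 by (rule rfm_eqI) (simp add: lookup_single_mult_0)

lemma co_cst_left: "co ny (rmap cst A * W) = A * co ny W"
proof (rule rfm_eqI)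
 fix i j
 have "ent (rmap cst A * W) i j = (\<Sum>k\<in>{k. ent A i k ~= 0}. ent (rmap cst A) i k * ent W k j)"
  by (rule ent_times) auto
 moreover have "ent (A * co ny W) i j = (\<Sum>k\<in>{k. ent A i k ~= 0}. ent A i k * ent (co ny W) k j)"
  by (rule ent_times) auto
 moreover have "mlook (cst c * f) ny = c * mlook f ny" for c :: 'a and f
  using lookup_single_mult[of 0 c f ny] by (simp add: cst_def)
 ultimately show "ent (co ny (rmap cst A * W)) i j = ent (A * co ny W) i j"
  by (simp add: lookup_sum)
qed

lemma co_cst_right: "co ny (W * rmap cst A) = co ny W * A"
proof (rule rfm_eqI)
 fix i j
 have "ent (W * rmap cst A) i j = (\<Sum>k\<in>{k. ent W i k ~= 0}. ent W i k * ent (rmap cst A) k j)"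
  by (rule ent_times) auto
 moreover have "ent (co ny W * A) i j = (\<Sum>k\<in>{k. ent W i k ~= 0}. ent (co ny W) i k * ent A k j)"
  by (rule ent_times) auto
 moreover have "mlook (f * cst c) ny = mlook f ny * c" for c :: 'a and f
  using lookup_single_mult[of 0 c f ny] by (simp add: cst_def mult.commute)
 ultimately show "ent (co ny (W * rmap cst A)) i j = ent (co ny W * A) i j"
  by (simp add: lookup_sum)
qed

lemma co_cst: "co ny (rmap cst A) = (if ny = 0 then A else 0)"
 by (rule rfm_eqI) (simp add: cst_def lookup_single when_def)

lemma co_mono: "co ny (sc (msingle mu c) (rmap cst A)) = (if ny = mu then sc c A else 0)"
proof (cases "\<exists>xi. mu + xi = ny")
 case True
 then obtain xi where "ny = mu + xi" by blast
 thus ?thesis by (auto simp: co_single co_cst)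
next
 case False
 hence "ny ~= mu" by (metis add.right_neutral)
 thus ?thesis using False by (simp add: co_single_0)
qed

lemma Mat_co: "W \<in> Mat m n ==> co ny W \<in> Mat m n"
 by (auto simp: Mat_iff) (metis lookup_zero)+

definition nmul :: "nat => (nat \<Rightarrow>\<^sub>0 nat) => (nat \<Rightarrow>\<^sub>0 nat)" where "nmul n mu = ((+) mu ^^ n) 0"

lemma lookup_nmul [simp]: "mlook (nmul n mu) i = n * mlook mu i"
 by (induction n) (simp_all add: nmul_def lookup_add)

lemma nmul_Suc: "nmul (Suc n) mu = mu + nmul n mu" by (simp add: nmul_def)

lemma rmap_fr_inj: "rmap fr A = rmap fr B ==> A = B"
proof (rule rfm_eqI)
 fix i j assume "rmap fr A = rmap fr B"
 hence "ent (rmap fr A) i j = ent (rmap fr B) i j" by simp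
 thus "ent A i j = ent B i j" by (simp only: fr.ent_rmap_hom fr.eq_iff)
qed

text \<open>By the Frobenius formula a \<open>p\<close>-th power is a polynomial in the
  \<open>p\<close>-th powers of the variables. The group elements have order dividing
  \<open>p\<close>, so these exponents are invisible to them.\<close>

lemma power_p_keys:
 fixes f :: "'e::comm_ring_1 mp"
 assumes p: "prime p" "of_nat p = (0::'e)" and mu: "mu \<in> mkeys (f ^ p)"
 shows "p dvd mlook mu i"
proof -
 have pU: "of_nat p = (0::'e mp)" using p(2) by (simp add: of_nat_single)
 have sp: "\<exists>ny. msingle mu c ^ n = msingle ny (c ^ n) & (\<forall>i. mlook ny i = n * mlook mu i)" for mu :: "nat \<Rightarrow>\<^sub>0 nat" and c :: 'e and n
 proof (induction n)
  case 0
  show ?case by (intro exI[of _ 0]) (simp flip: single_one)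
 next
  case (Suc n)
  then obtain ny where "msingle mu c ^ n = msingle ny (c ^ n)" "\<forall>i. mlook ny i = n * mlook mu i" by blast
  thus ?case by (intro exI[of _ "mu + ny"]) (simp add: mult_single lookup_add)
 qed
 have "f ^ p = (\<Sum>k\<in>mkeys f. msingle k (mlook f k)) ^ p" by (simp add: mp_expand)
 also have "... = (\<Sum>k\<in>mkeys f. msingle k (mlook f k) ^ p)"
  by (rule frobenius_sum[OF p(1) pU]) (auto simp: mult.commute)
 finally have "mlook (\<Sum>k\<in>mkeys f. msingle k (mlook f k) ^ p) mu ~= 0" using mu by (simp add: in_keys_iff)
 then obtain k where k: "k \<in> mkeys f" "mlook (msingle k (mlook f k) ^ p) mu ~= 0"
  by (metis (no_types, lifting) lookup_sum sum.neutral)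
 obtain ny where ny: "msingle k (mlook f k) ^ p = msingle ny (mlook f k ^ p)" "\<forall>i. mlook ny i = p * mlook k i"
  using sp by blast
 hence "mu = ny" using k(2) by (auto simp: lookup_single when_def split: if_splits)
 thus ?thesis using ny(2) by simp
qed

context stage
begin

lemma of_nat_E: "of_nat n = (0::'e) \<longleftrightarrow> p dvd n"
 using of_nat_eq_0_iff_char_dvd CHAR_prime[OF prime_p pE] by metis

lemma pU: "of_nat p = (0::'e mp)" using pE by (simp add: of_nat_single)
lemma pF: "of_nat p = (0::'e mp fract)" using pU by (metis fr.hom_of_nat fr.hom_zero)

text \<open>For \<open>k = r\<close> this is the monomial \<open>mu\<close> evaluated at the
  commuting elements \<open>rh i\<close>.\<close>

primrec pr :: "nat => (nat \<Rightarrow>\<^sub>0 nat) => 'e rfm" where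
 "pr 0 mu = ee m"
| "pr (Suc k) mu = pr k mu * rh k ^ mlook mu k"

definition rhm :: "(nat \<Rightarrow>\<^sub>0 nat) => 'e rfm" where "rhm mu = pr r mu"

lemma pr_comm: "pr k mu * rh j = rh j * pr k mu"
proof (induction k)
 case 0
 show ?case using MatD[OF rh_Mat] by simp
next
 case (Suc k)
 show ?case unfolding pr.simps
  by (rule commute_mult[OF Suc]) (rule power_commuting_commutes[OF rh_comm])
qed

lemma pr_Mat: "pr k mu \<in> Mat m m"
proof (induction k)
 case (Suc k)
 thus ?case using Mat_power[OF rh_Mat, of "mlook mu k" k] by (cases "mlook mu k = 0") auto
qed auto

lemma rhm_AQ: "rhm mu \<in> AQ"
 unfolding rhm_def AQ_def using pr_Mat pr_comm by simp

lemma pr_add: "pr k (mu + ny) = pr k mu * pr k ny"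
proof (induction k)
 case (Suc k)
 have "pr (Suc k) (mu + ny) = pr k mu * (pr k ny * rh k ^ mlook mu k) * rh k ^ mlook ny k"
  by (simp add: Suc lookup_add power_add mult.assoc)
 also have "pr k ny * rh k ^ mlook mu k = rh k ^ mlook mu k * pr k ny"
  by (rule power_commuting_commutes[OF pr_comm[symmetric], symmetric])
 finally show ?case by (simp add: mult.assoc)
qed simp

lemma pr_p: "(!!i. p dvd mlook mu i) ==> pr k mu = ee m"
proof (induction k)
 case (Suc k)
 obtain q where "mlook mu k = p * q" using Suc.prems by blast
 hence "rh k ^ mlook mu k = ee m ^ q" by (simp add: power_mult rh_p)
 moreover have "ee m * ee m ^ q = (ee m :: 'e rfm)" by (induction q) (simp_all flip: mult.assoc)
 ultimately show ?case using Suc by simp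
qed simp

lemma rhm_add: "rhm (mu + ny) = rhm mu * rhm ny"
 and rhm_p: "(!!i. p dvd mlook mu i) ==> rhm mu = ee m"
 and rhm_0 [simp]: "rhm 0 = ee m"
 by (auto simp: rhm_def pr_add pr_p)

lemma rhm_var: "i < r ==> rhm (msingle i 1) = rh i"
proof -
 have "pr k (msingle i 1) = (if i < k then rh i else ee m)" for k
  by (induction k) (use MatD[OF rh_Mat] in \<open>auto simp: lookup_single when_def less_Suc_eq\<close>)
 thus "i < r ==> rhm (msingle i 1) = rh i" by (simp add: rhm_def)
qed

lemma rhm_inv: "\<exists>N\<in>Mat m m. rhm mu * N = ee m"
proof -
 have "rhm (nmul p mu) = ee m" by (intro rhm_p) simp
 moreover have "nmul p mu = mu + nmul (p - 1) mu"
  using p_pos nmul_Suc[of "p - 1" mu] by simp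
 ultimately have "rhm mu * rhm (nmul (p - 1) mu) = ee m" by (metis rhm_add)
 thus ?thesis using rhm_AQ AQ_Mat by blast
qed

text \<open>Identifies coordinate vectors over the polynomial ring with matrices, but twists the
  coefficient of the monomial \<open>mu\<close> by \<open>rhm mu\<close>. The twist turns the
  commutator with the generic element into the permutation operator \<open>CP.NN xv\<close>, to
  which \<open>CP.acyclic\<close> applies.\<close>

definition Tw :: "'e mp rfm => 'e mp rfm" where
 "Tw w = (\<Sum>a<L. \<Sum>mu\<in>mkeys (ent w a 0). sc (msingle mu (mlook (ent w a 0) mu)) (rmap cst (bx a * rhm mu)))"

lemma co_Tw: "co ny (Tw w) = (\<Sum>a<L. sc (mlook (ent w a 0) ny) (bx a)) * rhm ny"
proof -
 have "co ny (Tw w) = (\<Sum>a<L. \<Sum>mu\<in>mkeys (ent w a 0). if ny = mu then sc (mlook (ent w a 0) ny) (bx a * rhm ny) else 0)"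
  unfolding Tw_def co_sum co_mono by (intro sum.cong) auto
 also have "... = (\<Sum>a<L. sc (mlook (ent w a 0) ny) (bx a * rhm ny))"
  by (intro sum.cong refl) (simp add: in_keys_iff)
 finally show ?thesis by (simp add: sum_distrib_right sc_mult_left)
qed

lemma Tw_add: "Tw (w + v) = Tw w + Tw v" and Tw_minus: "Tw (w - v) = Tw w - Tw v"
 by (auto intro!: co_eqI simp: co_Tw co_add co_minus lookup_add lookup_minus sc_add_left sc_minus_left
    sum.distrib sum_subtractf distrib_right left_diff_distrib)

lemma Tw_Mat: "Tw w \<in> Mat m m"
 unfolding Tw_def using bx_Mat AQ_Mat[OF rhm_AQ]
 by (intro Mat_sum Mat_sc cst.rmap_Mat) auto

definition XU :: "'e mp rfm" where "XU = (\<Sum>i<r. sc (xv i) (rmap cst (rh i) - ee m))"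

definition adU :: "'e mp rfm => 'e mp rfm" where "adU W = XU * W - W * XU"

lemma ent_NN: "ent (CP.NN t * w) a c = (\<Sum>i<r. t i * (ent w (be i a) c - ent w a c))"
 by (simp add: CP.NN_def sum_distrib_right ent_sum sc_mult_left left_diff_distrib ent_Pm_mult)

text \<open>Since \<open>rhm mu\<close> commutes with \<open>rh i\<close>, the commutator of
  \<open>rh i\<close> with \<open>bx a * rhm mu\<close> is
  \<open>(rh i * bx a - bx a * rh i) * rhm mu\<close>. Moving \<open>rh i\<close> to the right of
  the basis element permutes the basis and leaves \<open>rh i * rhm mu\<close>, which is the twist
  that belongs to the monomial multiplied by \<open>xv i\<close>.\<close>

lemma adU_Tw: "adU (Tw w) = Tw (CP.NN xv * w)"
proof (rule co_eqI)
 fix ny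
 define C where "C i = (if mlook ny i > 0 then \<Sum>a<L. sc (mlook (ent w (be i a) 0 - ent w a 0) (ny - msingle i 1)) (bx a) else 0)" for i
 have split: "ny = msingle i 1 + (ny - msingle i 1)" if "mlook ny i > 0" for i
  by (rule poly_mapping_eqI) (use that in \<open>auto simp: lookup_add lookup_minus lookup_single when_def\<close>)
 have nsplit: "msingle i 1 + xi ~= ny" if "\<not> mlook ny i > 0" for i xi
 proof
  assume "msingle i 1 + xi = ny"
  hence "mlook ny i = 1 + mlook xi i" by (metis lookup_add lookup_single_eq)
  thus False using that by simp
 qed
 have 1: "co ny (sc (xv i) ((rmap cst (rh i) - ee m) * Tw w - Tw w * (rmap cst (rh i) - ee m))) = C i * rhm ny"
  if i: "i < r" for i
 proof (cases "mlook ny i > 0")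
  case True
  let ?ny' = "ny - msingle i 1"
  have eq: "(rmap cst (rh i) - ee m) * Tw w - Tw w * (rmap cst (rh i) - ee m) = rmap cst (rh i) * Tw w - Tw w * rmap cst (rh i)"
   using MatD[OF Tw_Mat[of w]] by (simp add: algebra_simps)
  have rhny: "rhm ny = rh i * rhm ?ny'" by (subst split[OF True], subst rhm_add) (simp add: rhm_var[OF i] del: One_nat_def)
  let ?S = "\<Sum>a<L. sc (mlook (ent w a 0) ?ny') (bx a)"
  have "co ny (sc (xv i) ((rmap cst (rh i) - ee m) * Tw w - Tw w * (rmap cst (rh i) - ee m)))
   = rh i * co ?ny' (Tw w) - co ?ny' (Tw w) * rh i"
   unfolding eq by (subst split[OF True]) (simp add: xv_def co_single co_minus co_cst_left co_cst_right del: One_nat_def)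
  also have "... = (rh i * ?S - ?S * rh i) * rhm ?ny'"
   using AQ_comm[OF rhm_AQ, of i ?ny'] by (simp add: co_Tw left_diff_distrib mult.assoc)
  also have "rh i * ?S = (\<Sum>a<L. sc (mlook (ent w (be i a) 0) ?ny') (bx a)) * rh i"
  proof -
   have "rh i * ?S = (\<Sum>a<L. sc (mlook (ent w a 0) ?ny') (rh i * bx a))" by (simp add: sum_distrib_left sc_mult_right)
   also have "... = (\<Sum>a<L. sc (mlook (ent w (be i a) 0) ?ny') (rh i * bx (be i a)))" by (rule sum_reindex_be[symmetric])
   also have "... = (\<Sum>a<L. sc (mlook (ent w (be i a) 0) ?ny') (bx a * rh i))" by (simp add: be_conj)
   finally show ?thesis by (simp add: sum_distrib_right sc_mult_left)
  qed
  also have "((\<Sum>a<L. sc (mlook (ent w (be i a) 0) ?ny') (bx a)) * rh i - ?S * rh i) * rhm ?ny' = C i * rhm ny"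
   using True by (simp add: C_def rhny lookup_minus sc_minus_left sum_subtractf left_diff_distrib mult.assoc)
  finally show ?thesis .
 next
  case False
  show ?thesis unfolding xv_def using False nsplit[OF False] by (simp add: co_single_0 C_def del: One_nat_def)
 qed
 have "adU (Tw w) = (\<Sum>i<r. sc (xv i) ((rmap cst (rh i) - ee m) * Tw w - Tw w * (rmap cst (rh i) - ee m)))"
 proof -
  have "sc c A * B - B * sc c A = sc c (A * B - B * A)" for c :: "'e mp" and A B
   by (simp add: sc_mult_left sc_mult_right sc_minus_right)
  thus ?thesis unfolding adU_def XU_def sum_distrib_left sum_distrib_right sum_subtractf[symmetric] by simp
 qed
 hence "co ny (adU (Tw w)) = (\<Sum>i<r. C i * rhm ny)" by (simp add: co_sum 1)
 also have "... = (\<Sum>i<r. C i) * rhm ny" by (simp add: sum_distrib_right)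
 also have "(\<Sum>i<r. C i) = (\<Sum>a<L. sc (mlook (ent (CP.NN xv * w) a 0) ny) (bx a))"
 proof -
  have lk: "mlook (xv i * f) ny = (if mlook ny i > 0 then mlook f (ny - msingle i 1) else 0)" for i and f :: "'e mp"
  proof (cases "mlook ny i > 0")
   case True
   thus ?thesis unfolding xv_def by (subst split[OF True], subst lookup_single_mult) (simp del: One_nat_def)
  next
   case False
   thus ?thesis using nsplit[OF False] by (simp add: xv_def lookup_single_mult_0 del: One_nat_def)
  qed
  have "C i = (\<Sum>a<L. sc (mlook (xv i * (ent w (be i a) 0 - ent w a 0)) ny) (bx a))" for i
   unfolding C_def lk by simp
  hence "(\<Sum>i<r. C i) = (\<Sum>i<r. \<Sum>a<L. sc (mlook (xv i * (ent w (be i a) 0 - ent w a 0)) ny) (bx a))" by simp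
  also have "... = (\<Sum>a<L. \<Sum>i<r. sc (mlook (xv i * (ent w (be i a) 0 - ent w a 0)) ny) (bx a))" by (rule sum.swap)
  finally show ?thesis by (simp add: ent_NN lookup_sum sc_sum_left)
 qed
 finally show "co ny (adU (Tw w)) = co ny (Tw (CP.NN xv * w))" by (simp add: co_Tw)
qed

lemma Tw_inj:
 assumes "Tw w = 0" "a < L"
 shows "ent w a 0 = 0"
proof (rule poly_mapping_eqI)
 fix ny
 obtain N where N: "N \<in> Mat m m" "rhm ny * N = ee m" using rhm_inv by blast
 have "(\<Sum>a<L. sc (mlook (ent w a 0) ny) (bx a)) * rhm ny = 0" using assms(1) co_Tw[of ny w] by simp
 hence "(\<Sum>a<L. sc (mlook (ent w a 0) ny) (bx a)) * (rhm ny * N) = 0" by (simp flip: mult.assoc)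
 moreover have "(\<Sum>a<L. sc (mlook (ent w a 0) ny) (bx a)) \<in> Mat m m" using bx_Mat by (intro Mat_sum Mat_sc) auto
 ultimately have "(\<Sum>a<L. sc (mlook (ent w a 0) ny) (bx a)) = 0" by (simp add: N MatD)
 thus "mlook (ent w a 0) ny = mlook 0 ny" using cf_lin[OF assms(2)] by (metis cf_0 lookup_zero)
qed

lemma Tw_surj:
 assumes W: "W \<in> Mat m m"
 obtains w where "w \<in> Mat L 1" "Tw w = W"
proof -
 define K where "K = (\<Union>i<m. \<Union>j<m. mkeys (ent W i j))"
 have K: "finite K" by (simp add: K_def)
 have co0: "co ny W = 0" if "ny \<notin> K" for ny
 proof (rule Mat_eqI[OF Mat_co[OF W]])
  fix i j assume "i < m" "j < m"
  thus "ent (co ny W) i j = ent 0 i j" using that by (auto simp: K_def in_keys_iff)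
 qed simp
 obtain N where N: "!!ny. N ny \<in> Mat m m" "!!ny. rhm ny * N ny = ee m" using rhm_inv by metis
 have N2: "N ny * rhm ny = ee m" for ny
 proof -
  obtain N' where N': "N' \<in> Mat m m" "N ny * N' = ee m"
  proof -
   define xi where "xi = nmul (p - 1) ny"
   have "xi + ny = nmul p ny" using p_pos nmul_Suc[of "p - 1" ny] by (simp add: xi_def add.commute)
   hence "rhm xi * rhm ny = ee m" by (simp add: rhm_p flip: rhm_add)
   hence "rhm xi * rhm ny * N ny = N ny" by (simp add: MatD(1)[OF N(1)])
   hence "rhm xi = N ny" using N(2) MatD(2)[OF AQ_Mat[OF rhm_AQ]] by (metis mult.assoc)
   thus ?thesis using that[of "rhm ny"] \<open>rhm xi * rhm ny = ee m\<close> AQ_Mat[OF rhm_AQ] by simp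
  qed
  have "rhm ny = rhm ny * (N ny * N')" using N' MatD(2)[OF AQ_Mat[OF rhm_AQ]] by simp
  also have "... = N'" using N(2) N'(1) by (simp add: MatD flip: mult.assoc)
  finally show ?thesis using N' by simp
 qed
 define w where "w = mk L 1 (%a _. \<Sum>ny\<in>K. msingle ny (cf a (co ny W * N ny)))"
 have lk: "mlook (ent w a 0) ny = cf a (co ny W * N ny)" if "a < L" for a ny
 proof -
  have "mlook (ent w a 0) ny = (\<Sum>mu\<in>K. if mu = ny then cf a (co ny W * N ny) else 0)"
   using that by (simp add: w_def ent_mk lookup_sum lookup_single when_def if_distrib cong: if_cong)
  thus ?thesis using K co0[of ny] by (cases "ny \<in> K") auto
 qed
 have "Tw w = W"
 proof (rule co_eqI)
  fix ny
  have "co ny W * N ny \<in> Mat m m" using Mat_co[OF W] N by blast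
  hence "(\<Sum>a<L. sc (mlook (ent w a 0) ny) (bx a)) = co ny W * N ny" by (simp add: lk span)
  thus "co ny (Tw w) = co ny W" by (simp add: co_Tw mult.assoc N2 MatD(2)[OF Mat_co[OF W]])
 qed
 thus ?thesis using that[of w] by (simp add: w_def)
qed

text \<open>The twist spoils linearity over the polynomial ring, but \<open>rhm\<close> is trivial
  on exponents divisible by \<open>p\<close>. Denominators therefore have to be cleared by
  \<open>p\<close>-th powers.\<close>

lemma Tw_sc:
 assumes "!!mu i. mu \<in> mkeys f ==> p dvd mlook mu i"
 shows "Tw (sc f w) = sc f (Tw w)"
proof -
 have Tw_sum: "Tw (\<Sum>k\<in>K. g k) = (\<Sum>k\<in>K. Tw (g k))" for K :: "(nat \<Rightarrow>\<^sub>0 nat) set" and g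
 proof (induction K rule: infinite_finite_induct)
  case (insert x F)
  thus ?case by (simp add: Tw_add)
 qed (simp_all add: Tw_def)
 have single: "Tw (sc (msingle mu c) w) = sc (msingle mu c) (Tw w)" if mu: "!!i. p dvd mlook mu i" for mu c
 proof (rule co_eqI)
  fix ny
  show "co ny (Tw (sc (msingle mu c) w)) = co ny (sc (msingle mu c) (Tw w))"
  proof (cases "\<exists>xi. mu + xi = ny")
   case True
   then obtain xi where xi: "ny = mu + xi" by blast
   have "rhm (mu + xi) = rhm xi" using MatD(1)[OF AQ_Mat[OF rhm_AQ[of xi]]] by (simp add: rhm_add rhm_p[OF mu])
   thus ?thesis unfolding xi co_single
    by (simp add: co_Tw lookup_single_mult sc_sum_right flip: sc_mult_left)
  next
   case False
   thus ?thesis by (simp add: co_single_0 co_Tw lookup_single_mult_0)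
  qed
 qed
 have f: "(\<Sum>k\<in>mkeys f. msingle k (mlook f k)) = f" by (rule mp_expand) auto
 have "sc f w = (\<Sum>k\<in>mkeys f. sc (msingle k (mlook f k)) w)" by (subst f[symmetric]) (rule sc_sum_left)
 hence "Tw (sc f w) = (\<Sum>k\<in>mkeys f. sc (msingle k (mlook f k)) (Tw w))" by (simp add: Tw_sum single assms)
 also have "... = sc f (Tw w)" by (simp only: sc_sum_left[symmetric] f)
 finally show ?thesis .
qed

lemma Tw_sc_p: "Tw (sc (f ^ p) w) = sc (f ^ p) (Tw w)"
 by (rule Tw_sc) (rule power_p_keys[OF prime_p pE])

lemma adU_Tw_pow: "(adU ^^ k) (Tw w) = Tw (CP.NN xv ^ k * w)"
proof (induction k arbitrary: w)
 case (Suc k)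
 have "(adU ^^ Suc k) (Tw w) = (adU ^^ k) (Tw (CP.NN xv * w))" by (simp add: funpow_swap1 adU_Tw)
 also have "... = Tw (CP.NN xv ^ k * (CP.NN xv * w))" by (rule Suc)
 finally show ?case by (simp only: power_Suc2 mult.assoc)
qed simp

lemma adU_sc: "adU (sc f W) = sc f (adU W)" by (simp add: adU_def sc_mult_left sc_mult_right sc_minus_right)

lemma adU_sc_pow: "(adU ^^ k) (sc f W) = sc f ((adU ^^ k) W)"
 by (induction k) (auto simp: adU_sc)

definition fixpart :: "'e mp rfm => 'e mp rfm" where
 "fixpart w = dg (%a. if a \<in> FX then 1 else 0) * w"

lemma ent_fixpart: "ent (fixpart w) a c = (if a \<in> FX then ent w a c else 0)"
 by (simp add: fixpart_def ent_dg_mult)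

lemma common_denominator_rfm:
 fixes V :: "'e mp fract rfm"
 assumes "V \<in> Mat a b"
 obtains v w where "v ~= 0" "w \<in> Mat a b" "sc (fr v) V = rmap fr w"
proof -
 have "finite ((%(i, j). ent V i j) ` ({..<a} \<times> {..<b}))" by simp
 then obtain v where v: "v ~= 0" "!!z. z \<in> (%(i, j). ent V i j) ` ({..<a} \<times> {..<b}) ==> fr v * z \<in> range fr"
  using common_denominator by metis
 have "\<exists>u. fr v * ent V i j = fr u" if "i < a" "j < b" for i j
  using v(2)[of "ent V i j"] that by auto
 then obtain u where u: "!!i j. i < a ==> j < b ==> fr v * ent V i j = fr (u i j)" by metis
 have "sc (fr v) V = rmap fr (mk a b u)"
  by (rule Mat_eqI[of _ a b]) (use assms u in \<open>auto simp: ent_mk\<close>)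
 thus ?thesis using that v(1) by blast
qed

lemma NN_rmap: "rmap fr (CP.NN (xv :: nat => 'e mp)) = CP.NN (%i. fr (xv i))"
proof -
 have "rmap fr (Pm b :: 'e mp rfm) = Pm b" for b by (rule rfm_eqI) (simp add: ent_Pm)
 thus ?thesis by (simp add: CP.NN_def fr.rmap_sum fr.rmap_sc fr.rmap_minus)
qed

text \<open>\<open>CP.acyclic\<close> over the function field, applied to the part of
  \<open>w\<close> off the fixed indices and brought back to polynomials. The denominator occurs as
  \<open>v ^ p\<close> so that \<open>Tw\<close> can be applied to the equation.\<close>

lemma acyclic_U:
 assumes w: "w \<in> Mat L 1" "CP.NN xv * w = 0"
 obtains v w' where "v ~= 0" "w' \<in> Mat L 1"
  "sc (v ^ p) w = sc (v ^ p) (fixpart w) + CP.NN xv ^ (p - 1) * w'"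
proof -
 define N where "N = CP.NN (%i. fr (xv i :: 'e mp))"
 define V where "V = rmap fr (w - fixpart w)"
 have NV: "N * V = 0"
 proof -
  have "CP.NN xv * fixpart w = 0"
  proof (rule rfm_eqI)
   fix a c
   have "be i a \<in> FX \<longleftrightarrow> a \<in> FX" for i
   proof -
    have "be i a < L \<longleftrightarrow> a < L" using be_L be_out by (metis not_le)
    moreover have "be j (be i a) = be i a \<longleftrightarrow> be j a = a" for j using be_comm CP.inj_b by metis
    ultimately show ?thesis by (simp add: FX_def)
   qed
   thus "ent (CP.NN xv * fixpart w) a c = ent 0 a c"
    by (auto simp: ent_NN ent_fixpart FX_fix intro!: sum.neutral)
  qed
  hence "CP.NN xv * (w - fixpart w) = 0" using w by (simp add: right_diff_distrib)
  hence "rmap fr (CP.NN xv * (w - fixpart w)) = 0" by simp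
  thus ?thesis by (simp add: fr.rmap_mult NN_rmap N_def V_def)
 qed
 \<comment> \<open>The variables are linearly independent over the prime field, which is the
   nonvanishing condition of \<open>CP.acyclic\<close>.\<close>
 have lin: "(\<Sum>i<r. fr (xv i) * of_nat (ch i)) ~= (0::'e mp fract)" if ch: "\<exists>i<r. \<not> p dvd ch i" for ch :: "nat => nat"
 proof
  assume *: "(\<Sum>i<r. fr (xv i) * of_nat (ch i)) = (0::'e mp fract)"
  obtain i where i: "i < r" "\<not> p dvd ch i" using ch by blast
  have "fr (\<Sum>i<r. xv i * of_nat (ch i)) = (0::'e mp fract)"
   using * by (simp add: fr.hom_sum fr.hom_mult fr.hom_of_nat)
  hence "(\<Sum>i<r. xv i * of_nat (ch i)) = (0::'e mp)" by simp
  hence "mlook (\<Sum>j<r. xv j * of_nat (ch j) :: 'e mp) (msingle i 1) = 0" by simp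
  moreover have "mlook (xv j * of_nat (ch j) :: 'e mp) (msingle i 1) = (if j = i then of_nat (ch i) else 0)" for j
  proof -
   have "(msingle j 1 :: nat \<Rightarrow>\<^sub>0 nat) = msingle i 1 \<longleftrightarrow> j = i"
    by (metis lookup_single_eq lookup_single_not_eq zero_neq_one)
   thus ?thesis by (auto simp: xv_def mult_single lookup_single when_def simp flip: single_of_nat)
  qed
  ultimately have "of_nat (ch i) = (0::'e)" using i(1) by (simp add: lookup_sum)
  thus False using i(2) of_nat_E by blast
 qed
 have V0: "ent V a c = 0" if "\<forall>i<r. be i a = a" for a c
 proof (cases "a < L")
  case True
  hence "a \<in> FX" using that by (simp add: FX_def)
  thus ?thesis by (simp add: V_def ent_fixpart)
 next
  case False
  hence "ent w a c = 0" "a \<notin> FX" using w(1) by (auto simp: Mat_iff FX_def)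
  thus ?thesis by (simp add: V_def ent_fixpart)
 qed
 obtain V' where V': "V = N ^ (p - 1) * V'"
  using CP.acyclic[OF pF lin NV[unfolded N_def] V0] unfolding N_def by blast
 have Ne: "ee L * N = N * ee L"
 proof -
  have "ee L * Pm (be i) = Pm (be i) * (ee L :: 'e mp fract rfm)" for i
  proof (rule rfm_eqI)
   fix a c
   have "be i a < L \<longleftrightarrow> a < L" using be_L be_out by (metis not_le)
   thus "ent (ee L * Pm (be i)) a c = ent (Pm (be i) * (ee L :: 'e mp fract rfm)) a c"
    by (auto simp: ent_ee_mult ent_Pm_mult ent_Pm ent_ee)
  qed
  thus ?thesis unfolding N_def CP.NN_def
   by (simp add: sum_distrib_left sum_distrib_right sc_mult_left sc_mult_right algebra_simps)
 qed
 have Nek: "ee L * N ^ k = N ^ k * ee L" for k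
  using power_commuting_commutes[OF Ne[symmetric], of k] by simp
 \<comment> \<open>\<open>V'\<close> is an infinite matrix; cutting it down to size \<open>L\<close>
   by 1 keeps the equation because \<open>ee L\<close> commutes with \<open>N\<close>.\<close>
 define V2 where "V2 = ee L * V' * ee 1"
 have VM: "V \<in> Mat L 1"
 proof -
  have "fixpart w \<in> Mat L 1" using w(1) by (auto simp: Mat_iff ent_fixpart split: if_splits)
  thus ?thesis unfolding V_def using w(1) by (intro fr.rmap_Mat Mat_minus)
 qed
 have "V = ee L * V * ee 1" using VM by (simp add: MatD)
 also have "... = (ee L * N ^ (p - 1)) * V' * ee 1" by (simp only: V' mult.assoc)
 also have "... = N ^ (p - 1) * V2" unfolding Nek V2_def by (simp only: mult.assoc)
 finally have VV2: "V = N ^ (p - 1) * V2" .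
 have "V2 \<in> Mat L 1" unfolding V2_def by (rule Mat_mult_gen) (simp_all flip: mult.assoc)
 then obtain v w2 where v: "v ~= 0" "w2 \<in> Mat L 1" "sc (fr v) V2 = rmap fr w2"
  using common_denominator_rfm by blast
 have "rmap fr (sc (v ^ p) (w - fixpart w)) = rmap fr (CP.NN xv ^ (p - 1) * sc (v ^ (p - 1)) w2)"
 proof -
  have "rmap fr (sc (v ^ p) (w - fixpart w)) = sc (fr v ^ p) V"
   by (simp add: fr.rmap_sc V_def fr.hom_power)
  also have "... = N ^ (p - 1) * sc (fr v ^ (p - 1)) (sc (fr v) V2)"
   using power_minus_mult[OF p_pos, of "fr v"] by (simp add: VV2 sc_mult_right del: One_nat_def)
  finally show ?thesis
   by (simp add: v(3) fr.rmap_mult fr.rmap_power NN_rmap fr.rmap_sc fr.hom_power N_def)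
 qed
 hence "sc (v ^ p) (w - fixpart w) = CP.NN xv ^ (p - 1) * sc (v ^ (p - 1)) w2"
  by (rule rmap_fr_inj)
 hence "sc (v ^ p) w = sc (v ^ p) (fixpart w) + CP.NN xv ^ (p - 1) * sc (v ^ (p - 1)) w2"
  by (simp add: sc_minus_right algebra_simps)
 thus ?thesis using that v(1) Mat_sc[OF v(2)] by blast
qed

section \<open>The commutator with the generic element over the function field\<close>

definition XF :: "'e mp fract rfm" where "XF = rmap fr XU"
definition adF :: "'e mp fract rfm => 'e mp fract rfm" where "adF W = XF * W - W * XF"

lemma XU_Mat: "XU \<in> Mat m m"
 unfolding XU_def using rh_Mat by (intro Mat_sum Mat_sc Mat_minus cst.rmap_Mat) auto

lemma XF_Mat: "XF \<in> Mat m m"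
 unfolding XF_def by (rule fr.rmap_Mat[OF XU_Mat])

lemma XF_eq: "XF = (\<Sum>i<r. sc (fr (xv i)) (rmap jF (rh i) - ee m))"
 by (simp add: XF_def XU_def fr.rmap_sum fr.rmap_sc fr.rmap_minus rmap_jF)

lemma adF_rmap: "rmap fr ((adU ^^ k) W) = (adF ^^ k) (rmap fr W)"
 by (induction k) (auto simp: adU_def adF_def XF_def fr.rmap_minus fr.rmap_mult)

lemma adF_sc: "(adF ^^ k) (sc f W) = sc f ((adF ^^ k) W)"
 by (induction k) (auto simp: adF_def sc_mult_left sc_mult_right sc_minus_right)

text \<open>The span of the fixed algebra over the function field.\<close>

inductive_set AF :: "'e mp fract rfm set" where
 AF_0: "0 \<in> AF"
| AF_const: "c \<in> AQ ==> sc f (rmap jF c) \<in> AF"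
| AF_add: "x \<in> AF ==> y \<in> AF ==> x + y \<in> AF"

lemma AF_sum: "(!!s. s \<in> S ==> f s \<in> AF) ==> sum f S \<in> AF"
 by (induction S rule: infinite_finite_induct) (auto simp: AF_0 AF_add)

lemma AF_sc: "x \<in> AF ==> sc g x \<in> AF"
 by (induction rule: AF.induct) (auto simp: sc_add_right AF_0 AF_add AF_const)

lemma Tw_fixpart_AF: "rmap fr (Tw (fixpart w)) \<in> AF"
proof -
 have "rmap fr (Tw (fixpart w)) = (\<Sum>a<L. \<Sum>mu\<in>mkeys (ent (fixpart w) a 0).
  sc (fr (msingle mu (mlook (ent (fixpart w) a 0) mu))) (rmap jF (bx a * rhm mu)))"
  by (simp add: Tw_def fr.rmap_sum fr.rmap_sc rmap_jF)
 also have "... \<in> AF"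
 proof (rule AF_sum, rule AF_sum)
  fix a mu assume "mu \<in> mkeys (ent (fixpart w) a 0)"
  hence "a \<in> FX" by (auto simp: ent_fixpart split: if_splits)
  hence "bx a * rhm mu \<in> AQ" using bx_AQ rhm_AQ AQ_mult by blast
  thus "sc (fr (msingle mu (mlook (ent (fixpart w) a 0) mu))) (rmap jF (bx a * rhm mu)) \<in> AF" by (rule AF_const)
 qed
 finally show ?thesis .
qed

text \<open>Through \<open>Tw\<close> a matrix commuting with \<open>XF\<close> is, after clearing
  denominators, a vector killed by the permutation operator. Its part at the fixed indices lies in
  \<open>AF\<close>, and \<open>acyclic_U\<close> puts the rest into the image.\<close>

theorem centraliser_XF:
 assumes a: "a \<in> Mat m m" "XF * a = a * XF"
 obtains c b where "c \<in> AF" "b \<in> Mat m m" "a = c + (adF ^^ (p - 1)) b"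
proof -
 obtain v W where v: "v ~= 0" "W \<in> Mat m m" "sc (fr v) a = rmap fr W" using common_denominator_rfm[OF a(1)] by blast
 have "rmap fr (adU W) = adF (rmap fr W)" using adF_rmap[of 1 W] by simp
 also have "... = sc (fr v) (adF a)" using adF_sc[of 1 "fr v" a] v(3) by simp
 also have "adF a = 0" using a by (simp add: adF_def)
 finally have "rmap fr (adU W) = 0" by simp
 hence adW: "adU W = 0" by (intro rfm_eqI) (metis ent_zero fr.ent_rmap_hom fr.hom_0_iff)
 obtain w where w: "w \<in> Mat L 1" "Tw w = W" using Tw_surj[OF v(2)] by blast
 have "CP.NN xv * w = 0"
 proof (rule rfm_eqI)
  fix x c
  have "Tw (CP.NN xv * w) = 0" using adW w adU_Tw by metis
  hence "ent (CP.NN xv * w) x 0 = 0" if "x < L" using Tw_inj that by blast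
  moreover have "ent (CP.NN xv * w) x c = 0" if "x \<ge> L \<or> c > 0"
  proof -
   have "ent w (be i x) c = ent w x c" for i using that be_out[of x i] Mat_ent[OF w(1)] by auto
   thus ?thesis by (simp add: ent_NN)
  qed
  ultimately show "ent (CP.NN xv * w) x c = ent 0 x c" by (cases "x < L"; cases c) auto
 qed
 then obtain v' w' where v': "v' ~= 0" "w' \<in> Mat L 1"
  "sc (v' ^ p) w = sc (v' ^ p) (fixpart w) + CP.NN xv ^ (p - 1) * w'"
  using acyclic_U[OF w(1)] by blast
 have "sc (v' ^ p) W = sc (v' ^ p) (Tw (fixpart w)) + (adU ^^ (p - 1)) (Tw w')"
  using arg_cong[OF v'(3), of Tw] by (simp add: Tw_add Tw_sc_p w(2) adU_Tw_pow)
 hence "rmap fr (sc (v' ^ p) W) = rmap fr (sc (v' ^ p) (Tw (fixpart w)) + (adU ^^ (p - 1)) (Tw w'))" by simp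
 hence eq: "sc (fr v' ^ p * fr v) a = sc (fr v' ^ p) (rmap fr (Tw (fixpart w))) + (adF ^^ (p - 1)) (rmap fr (Tw w'))"
  by (simp add: fr.rmap_add fr.rmap_sc adF_rmap fr.hom_power flip: v(3))
 define g where "g = 1 / (fr v' ^ p * fr v)"
 have "a = sc g (sc (fr v' ^ p * fr v) a)" using v(1) v'(1) by (simp add: g_def)
 also have "... = sc g (sc (fr v' ^ p) (rmap fr (Tw (fixpart w)))) + (adF ^^ (p - 1)) (sc g (rmap fr (Tw w')))"
  unfolding eq by (simp only: sc_add_right adF_sc)
 finally show ?thesis
  using that AF_sc[OF AF_sc[OF Tw_fixpart_AF]] Mat_sc[OF fr.rmap_Mat[OF Tw_Mat]] by blast
qed

lemma Tw_const:
 assumes "c \<in> Mat m m"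
 shows "Tw (mk L 1 (%a _. cst (cf a c))) = rmap cst c"
proof (rule co_eqI)
 fix ny
 have "mlook (ent (mk L 1 (%a _. cst (cf a c))) a 0) ny = (if ny = 0 then cf a c else 0)" if "a < L" for a
  using that by (simp add: ent_mk cst_def lookup_single when_def)
 thus "co ny (Tw (mk L 1 (%a _. cst (cf a c)))) = co ny (rmap cst c)"
  using assms by (simp add: co_Tw co_cst span MatD)
qed

text \<open>The coordinate vector of an element of \<open>TQ\<close> is invariant and vanishes at
  the fixed indices, so \<open>acyclic_U\<close> puts all of it into the image.\<close>

theorem TQ_in_adF:
 assumes t: "t \<in> TQ"
 obtains b where "b \<in> Mat m m" "rmap jF t = (adF ^^ (p - 1)) b"
proof -
 have tA: "t \<in> AQ" and t0: "!!a. a \<in> FX ==> cf a t = 0" using t by (auto simp: TQ_def)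
 define w where "w = mk L 1 (%a _. cst (cf a t))"
 have w: "w \<in> Mat L 1" by (simp add: w_def)
 have "CP.NN xv * w = 0"
 proof (rule rfm_eqI)
  fix x c
  have "ent w (be i x) c = ent w x c" for i
   using be_L[of x i] be_out[of x i] AQ_cf[OF tA] by (cases "x < L") (auto simp: w_def ent_mk)
  thus "ent (CP.NN xv * w) x c = ent 0 x c" by (simp add: ent_NN)
 qed
 moreover have "fixpart w = 0"
  by (rule rfm_eqI) (auto simp: ent_fixpart w_def ent_mk t0)
 ultimately obtain v w' where v: "v ~= 0" "w' \<in> Mat L 1" "sc (v ^ p) w = CP.NN xv ^ (p - 1) * w'"
  using acyclic_U[OF w] by (metis add_0 sc_zero_right)
 have "sc (v ^ p) (rmap cst t) = (adU ^^ (p - 1)) (Tw w')"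
  using arg_cong[OF v(3), of Tw] Tw_const[OF AQ_Mat[OF tA]] by (simp add: Tw_sc_p adU_Tw_pow w_def)
 hence "rmap fr (sc (v ^ p) (rmap cst t)) = (adF ^^ (p - 1)) (rmap fr (Tw w'))" by (simp add: adF_rmap)
 hence "sc (fr v ^ p) (rmap jF t) = (adF ^^ (p - 1)) (rmap fr (Tw w'))"
  by (simp add: fr.rmap_sc rmap_jF fr.hom_power)
 hence "sc (1 / fr v ^ p) (sc (fr v ^ p) (rmap jF t)) = (adF ^^ (p - 1)) (sc (1 / fr v ^ p) (rmap fr (Tw w')))"
  by (simp add: adF_sc)
 hence "rmap jF t = (adF ^^ (p - 1)) (sc (1 / fr v ^ p) (rmap fr (Tw w')))" using v(1) by simp
 thus ?thesis using that Mat_sc[OF fr.rmap_Mat[OF Tw_Mat]] by blast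
qed

text \<open>Twisted coordinates of a commutator vanish at fixed indices; for the unit matrix this
  would mean membership in \<open>TQ\<close>. The lemma prevents the generic element from acting
  freely and so makes some layer below \<open>p - 1\<close> nonzero.\<close>

theorem one_notin_adF:
 assumes b: "b \<in> Mat m m"
 shows "(adF ^^ (p - 1)) b ~= ee m"
proof
 assume eq: "(adF ^^ (p - 1)) b = ee m"
 obtain v W where v: "v ~= 0" "W \<in> Mat m m" "sc (fr v) b = rmap fr W" using common_denominator_rfm[OF b] by blast
 have "rmap fr ((adU ^^ (p - 1)) W) = rmap fr (sc v (ee m))"
  using eq by (simp add: adF_rmap fr.rmap_sc adF_sc flip: v(3))
 hence adW: "(adU ^^ (p - 1)) W = sc v (ee m)" by (rule rmap_fr_inj)
 \<comment> \<open>The factor \<open>v ^ (p - 1)\<close> completes the denominator \<open>v\<close>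
   to a \<open>p\<close>-th power, over which \<open>Tw\<close> is linear.\<close>
 obtain w where w: "w \<in> Mat L 1" "Tw w = sc (v ^ (p - 1)) W" using Tw_surj[OF Mat_sc[OF v(2)]] by blast
 define e0 where "e0 = mk L 1 (%a _. cst (cf a (ee m)) :: 'e mp)"
 have "Tw (CP.NN xv ^ (p - 1) * w) = sc (v ^ (p - 1)) (sc v (ee m))"
  using adW by (simp add: adU_sc_pow w(2) flip: adU_Tw_pow)
 also have "... = sc (v ^ p) (rmap cst (ee m))" using power_minus_mult[OF p_pos, of v] by (simp del: One_nat_def)
 also have "... = Tw (sc (v ^ p) e0)" by (simp only: Tw_sc_p e0_def Tw_const[OF ee_Mat])
 finally have "Tw (CP.NN xv ^ (p - 1) * w - sc (v ^ p) e0) = 0" by (simp add: Tw_minus)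
 hence *: "ent (CP.NN xv ^ (p - 1) * w) a 0 = v ^ p * cst (cf a (ee m))" if "a < L" for a
  using Tw_inj[OF _ that, of "CP.NN xv ^ (p - 1) * w - sc (v ^ p) e0"] that by (simp add: e0_def ent_mk)
 have "cf z (ee m) = 0" if z: "z \<in> FX" for z
 proof -
  have "CP.NN xv ^ (p - 1) * w = CP.NN xv * (CP.NN xv ^ (p - 2) * w)"
   using p1_pos by (metis One_nat_def Suc_1 Suc_diff_Suc diff_Suc_1 mult.assoc power_Suc zero_less_diff)
  hence "ent (CP.NN xv ^ (p - 1) * w) z 0 = 0" using FX_fix[OF z] by (simp add: ent_NN)
  hence "cst (cf z (ee m)) = (0::'e mp)" using *[OF FX_L[OF z]] v(1) by simp
  thus ?thesis by simp
 qed
 hence "ee m \<in> TQ" using AQ_ee by (simp add: TQ_def)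
 thus False using ee_notin_TQ by blast
qed

lemma XF_power: "XF ^ p = 0"
proof -
 have pR: "of_nat p = (0::'e mp fract rfm)" by (simp add: of_nat_rfm pF)
 have ek: "ee m ^ k = (ee m :: 'e mp fract rfm)" if "k > 0" for k
  using that by (induction k rule: nat_induct_non_zero) auto
 let ?g = "%i. rmap jF (rh i) - ee m"
 have gp: "?g i ^ p = 0" for i
 proof -
  have M: "rmap jF (rh i) \<in> Mat m m" using rh_Mat by blast
  have "(?g i + ee m) ^ p = ?g i ^ p + ee m ^ p"
   by (rule frobenius_commuting[OF prime_p pR]) (use MatD[OF M] in \<open>simp add: algebra_simps\<close>)
  moreover have "(?g i + ee m) ^ p = ee m" using rh_p[of i] by (simp flip: jF.rmap_power)
  ultimately show ?thesis using ek[OF p_pos] by simp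
 qed
 have comm: "?g i * ?g j = ?g j * ?g i" for i j
 proof -
  have "rmap jF (rh i) * rmap jF (rh j) = rmap jF (rh j) * rmap jF (rh i)"
   using rh_comm[of i j] by (simp flip: jF.rmap_mult)
  moreover have "rmap jF (rh i) * ee m = rmap jF (rh i)" "ee m * rmap jF (rh i) = rmap jF (rh i)" for i
   using MatD[OF jF.rmap_Mat[OF rh_Mat]] by auto
  ultimately show ?thesis by (simp add: left_diff_distrib right_diff_distrib)
 qed
 have "XF ^ p = (\<Sum>i<r. sc (fr (xv i)) (?g i) ^ p)"
  unfolding XF_eq by (rule frobenius_sum[OF prime_p pR]) (auto simp: sc_mult_left sc_mult_right comm mult.commute)
 thus ?thesis by (simp add: sc_power gp)
qed

end

subsection \<open>Layers of a nilpotent matrix\<close>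

lemma ad_power_expand:
 fixes X b :: "'k::comm_ring_1 rfm"
 shows "((%b. X * b - b * X) ^^ k) b = (\<Sum>j\<le>k. sc ((-1) ^ (k + j) * of_nat (k choose j)) (X ^ j * b * X ^ (k - j)))"
proof (induction k)
 case (Suc k)
 define s :: "nat => nat => 'k" where "s k j = (-1) ^ (k + j) * of_nat (k choose j)" for k j
 let ?S = "\<Sum>j\<le>k. sc (s k j) (X ^ j * b * X ^ (k - j))"
 have l: "X * ?S = (\<Sum>j\<le>k. sc (s k j) (X ^ Suc j * b * X ^ (Suc k - Suc j)))"
  unfolding sum_distrib_left by (rule sum.cong) (simp_all add: sc_mult_right mult.assoc)
 have "?S * X = (\<Sum>j\<le>k. sc (s k j) (X ^ j * b * X ^ (Suc k - j)))"
  unfolding sum_distrib_right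
 proof (rule sum.cong)
  fix j assume "j \<in> {..k}"
  hence "Suc k - j = Suc (k - j)" by auto
  thus "sc (s k j) (X ^ j * b * X ^ (k - j)) * X = sc (s k j) (X ^ j * b * X ^ (Suc k - j))"
   by (simp only: sc_mult_left mult.assoc power_Suc2)
 qed simp
 also have "... = (\<Sum>j\<le>Suc k. sc (s k j) (X ^ j * b * X ^ (Suc k - j)))" unfolding sum.atMost_Suc by (simp add: s_def binomial_eq_0)
 also have "... = sc (s k 0) (X ^ 0 * b * X ^ (Suc k - 0)) + (\<Sum>j\<le>k. sc (s k (Suc j)) (X ^ Suc j * b * X ^ (Suc k - Suc j)))"
  by (rule sum.atMost_Suc_shift)
 finally have r: "?S * X = sc (s k 0) (X ^ 0 * b * X ^ (Suc k - 0)) + (\<Sum>j\<le>k. sc (s k (Suc j)) (X ^ Suc j * b * X ^ (Suc k - Suc j)))" .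
 have s0: "s (Suc k) 0 = - s k 0" and sS: "s (Suc k) (Suc j) = s k j - s k (Suc j)" for j
  by (simp_all add: s_def algebra_simps)
 have "(\<Sum>j\<le>Suc k. sc (s (Suc k) j) (X ^ j * b * X ^ (Suc k - j))) = sc (s (Suc k) 0) (X ^ 0 * b * X ^ (Suc k - 0)) + (\<Sum>j\<le>k. sc (s (Suc k) (Suc j)) (X ^ Suc j * b * X ^ (Suc k - Suc j)))"
  by (rule sum.atMost_Suc_shift)
 also have "... = X * ?S - ?S * X"
  unfolding l r s0 sS sc_minus_left sum_subtractf using sc_minus_left[of 0 "s k 0"] by simp
 finally show ?case using Suc by (simp add: s_def)
qed simp

lemma choose_p_minus_1:
 assumes p: "prime p" "of_nat p = (0::'k::comm_ring_1)" and "i \<le> p - 1"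
 shows "(-1) ^ i * of_nat ((p - 1) choose i) = (1::'k)"
 using assms(3)
proof (induction i)
 case (Suc i)
 have "p dvd (p choose Suc i)" using Suc.prems prime_gt_0_nat[OF p(1)] by (intro dvd_choose_prime p) auto
 hence "of_nat (p choose Suc i) = (0::'k)" using p(2) by (auto elim!: dvdE)
 moreover have "p choose Suc i = ((p - 1) choose i) + ((p - 1) choose Suc i)"
  using prime_gt_0_nat[OF p(1)] by (cases p) auto
 ultimately have "of_nat ((p - 1) choose i) + of_nat ((p - 1) choose Suc i) = (0::'k)" by simp
 hence "of_nat ((p - 1) choose Suc i) = - (of_nat ((p - 1) choose i) :: 'k)" by (simp add: add_eq_0_iff)
 thus ?case using Suc by simp
qed simp

text \<open>Modulo \<open>p\<close> the binomial coefficients of \<open>p - 1\<close> are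
  alternating signs, which cancel the signs of the expansion.\<close>

lemma ad_power_p_minus_1:
 fixes X b :: "'k::comm_ring_1 rfm"
 assumes p: "prime p" "of_nat p = (0::'k)"
 shows "((%b. X * b - b * X) ^^ (p - 1)) b = (\<Sum>j\<le>p - 1. X ^ j * b * X ^ (p - 1 - j))"
proof -
 have "(-1) ^ (p - 1 + j) * of_nat ((p - 1) choose j) = (1::'k)" if "j \<le> p - 1" for j
 proof -
  have "p - 1 + j = (p - 1 - j) + 2 * j" using that by simp
  hence "(-1) ^ (p - 1 + j) = ((-1) ^ (p - 1 - j) :: 'k)" by (simp only: power_add power_mult) simp
  moreover have "(p - 1) choose j = (p - 1) choose (p - 1 - j)" using that by (rule binomial_symmetric)
  ultimately show ?thesis using choose_p_minus_1[OF p, of "p - 1 - j"] by simp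
 qed
 thus ?thesis unfolding ad_power_expand by (intro sum.cong) auto
qed

text \<open>The sum telescopes. When \<open>X ^ Suc k\<close> kills \<open>b\<close> from both
  sides, the sum commutes with \<open>X\<close>; this is the source of all centralising matrices
  below.\<close>

lemma commutes_sum_powers:
 fixes X b :: "'r::ring_1"
 shows "X * (\<Sum>j\<le>k. X ^ j * b * X ^ (k - j)) - (\<Sum>j\<le>k. X ^ j * b * X ^ (k - j)) * X = X ^ Suc k * b - b * X ^ Suc k"
proof (induction k)
 case (Suc k)
 let ?S = "%k. \<Sum>j\<le>k. X ^ j * b * X ^ (k - j)"
 have "?S (Suc k) = ?S k * X + X ^ Suc k * b"
 proof -
  have "?S k * X = (\<Sum>j\<le>k. X ^ j * b * X ^ (Suc k - j))"
   unfolding sum_distrib_right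
  proof (rule sum.cong)
   fix j assume "j \<in> {..k}"
   hence "Suc k - j = Suc (k - j)" by auto
   thus "X ^ j * b * X ^ (k - j) * X = X ^ j * b * X ^ (Suc k - j)" by (simp only: mult.assoc power_Suc2)
  qed simp
  thus ?thesis by simp
 qed
 hence "X * ?S (Suc k) - ?S (Suc k) * X = (X * ?S k - ?S k * X) * X + X * (X ^ Suc k * b) - X ^ Suc k * b * X"
  by (simp only: distrib_left distrib_right left_diff_distrib mult.assoc) (simp add: algebra_simps)
 also have "... = X * (X ^ Suc k * b) - b * (X ^ Suc k * X)"
  unfolding Suc by (simp only: left_diff_distrib mult.assoc) simp
 finally show ?case by (simp only: power_Suc[of X "Suc k"] mult.assoc power_commutes)
qed simp

lemma power_intertwine: "G * Y = X * G ==> G * Y ^ k = X ^ k * (G :: 'r::monoid_mult)"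
proof (induction k)
 case (Suc k)
 have "G * Y ^ Suc k = (G * Y) * Y ^ k" by (simp only: power_Suc mult.assoc)
 also have "... = X * (G * Y ^ k)" by (simp only: Suc.prems mult.assoc)
 finally show ?case by (simp only: Suc.IH[OF Suc.prems] power_Suc mult.assoc)
qed simp

lemma Mat_sandwich:
 assumes "X \<in> Mat m m" "b \<in> Mat m m"
 shows "X ^ j * b * X ^ k \<in> Mat m m"
proof -
 have "X ^ j * b \<in> Mat m m"
  using assms Mat_mult[OF Mat_power[OF assms(1)] assms(2), of j] by (cases "j = 0") auto
 thus ?thesis using Mat_mult[OF _ Mat_power[OF assms(1)], of _ m k] by (cases "k = 0") auto
qed

text \<open>Hypothesis \<open>ker\<close> says that the space is free over the polynomials in
  \<open>X\<close> modulo \<open>X ^ p\<close>. With a generalised inverse \<open>Yi\<close> of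
  \<open>X ^ (p - 1)\<close>, the iterated commutator \<open>a\<close> of \<open>Yi\<close> commutes
  with \<open>X\<close> and is the identity on the kernel of \<open>X\<close>, so it is invertible.
  Its inverse \<open>g\<close> commutes with \<open>X\<close>, and the iterated commutator of
  \<open>Yi * g\<close> is \<open>a * g\<close>.\<close>

lemma free_nilpotent_ad_unit:
 fixes X :: "'k::field rfm"
 assumes p: "prime p" "of_nat p = (0::'k)" and X: "X \<in> Mat m m" "X ^ p = 0"
  and ker: "!!u. ee m * u = u ==> X * u = 0 ==> \<exists>v. u = X ^ (p - 1) * v"
 obtains b where "b \<in> Mat m m" "((%b. X * b - b * X) ^^ (p - 1)) b = ee m"
proof -
 have p1: "p - 1 > 0" using prime_gt_1_nat[OF p(1)] by simp
 have Sp: "Suc (p - 1) = p" using p1 by simp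
 have YM: "X ^ (p - 1) \<in> Mat m m" by (rule Mat_power[OF X(1) p1])
 obtain Yi where Yi: "Yi \<in> Mat m m" "X ^ (p - 1) * Yi * X ^ (p - 1) = X ^ (p - 1)"
  using generalised_inverse[OF YM] by blast
 define a where "a = (\<Sum>j\<le>p - 1. X ^ j * Yi * X ^ (p - 1 - j))"
 have Xe: "X * ee m = X" "ee m * X = X" using MatD[OF X(1)] by auto
 have Xke: "ee m * X ^ k = X ^ k * ee m" for k
  using power_commuting_commutes[where x = X and y = "ee m" and n = k] Xe by simp
 have aM: "a \<in> Mat m m" unfolding a_def by (intro Mat_sum Mat_sandwich X Yi)
 have aX: "X * a = a * X"
  using commutes_sum_powers[where X = X and k = "p - 1" and b = Yi] unfolding a_def[symmetric] Sp X(2) by simp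
 define h where "h = ee m - a"
 have hM: "h \<in> Mat m m" using aM by (simp add: h_def Mat_minus)
 have hX: "X * h = h * X" using aX Xe by (simp add: h_def algebra_simps)
 have hu: "h * u = 0" if u: "ee m * u = u" "X * u = 0" for u
 proof -
  obtain v where v: "u = X ^ (p - 1) * v" using ker[OF u] by blast
  have "a * u = (\<Sum>j\<le>p - 1. if j = p - 1 then X ^ (p - 1) * Yi * u else 0)"
   unfolding a_def sum_distrib_right
  proof (rule sum.cong)
   fix j assume j: "j \<in> {..p - 1}"
   show "X ^ j * Yi * X ^ (p - 1 - j) * u = (if j = p - 1 then X ^ (p - 1) * Yi * u else 0)"
   proof (cases "j = p - 1")
    case False
    hence "p - 1 - j = Suc (p - 1 - j - 1)" using j by simp
    hence "X ^ (p - 1 - j) = X ^ (p - 1 - j - 1) * X" by (metis power_Suc2)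
    thus ?thesis using u(2) False by (simp add: mult.assoc)
   qed simp
  qed simp
  also have "... = X ^ (p - 1) * Yi * u" by simp
  also have "... = u" using Yi(2) v by (metis mult.assoc)
  finally show ?thesis using u by (simp add: h_def left_diff_distrib)
 qed
 \<comment> \<open>\<open>h\<close> kills the kernel of \<open>X\<close> and commutes with
   \<open>X\<close>, so every further factor \<open>h\<close> replaces one factor \<open>X\<close>;
   for \<open>k = p\<close> this shows that \<open>h\<close> is nilpotent.\<close>
 have hp: "X ^ (p - k) * (h ^ k * ee m) = 0" if "k \<le> p" for k
  using that
 proof (induction k)
  case (Suc k)
  let ?u = "X ^ (p - Suc k) * (h ^ k * ee m)"
  have hke: "h ^ k * ee m = ee m * h ^ k" using power_commuting_commutes[of h "ee m" k] MatD[OF hM] by simp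
  have "X * ?u = X ^ (p - k) * (h ^ k * ee m)"
   using Suc.prems by (metis Suc_diff_Suc Suc_le_lessD mult.assoc power_Suc)
  also have "... = 0" using Suc by simp
  finally have 1: "X * ?u = 0" .
  have "ee m * ?u = ee m * X ^ (p - Suc k) * ee m * h ^ k" by (simp only: hke mult.assoc)
  also have "... = ?u" unfolding Xke by (simp only: hke mult.assoc ee_idem)
  finally have "h * ?u = 0" using hu 1 by blast
  moreover have "X ^ (p - Suc k) * h = h * X ^ (p - Suc k)" by (rule power_commuting_commutes[OF hX])
  ultimately show ?case by (metis mult.assoc power_Suc)
 qed (simp add: X(2))
 \<comment> \<open>The geometric series inverting \<open>a = ee m - h\<close>.\<close>
 define g where "g = (\<Sum>j<p. h ^ j) * ee m"
 have hek: "ee m * (h ^ j * ee m) = h ^ j * ee m" for j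
  using power_commuting_commutes[of h "ee m" j] MatD[OF hM] ee_idem by (metis mult.assoc)
 have ag: "a * g = ee m"
 proof -
  have "a * g = (\<Sum>j<p. a * (h ^ j * ee m))" by (simp add: g_def sum_distrib_left sum_distrib_right mult.assoc)
  also have "... = (\<Sum>j<p. h ^ j * ee m - h ^ Suc j * ee m)"
  proof (rule sum.cong)
   fix j
   have "a = ee m - h" by (simp add: h_def)
   thus "a * (h ^ j * ee m) = h ^ j * ee m - h ^ Suc j * ee m"
    using hek[of j] by (simp add: left_diff_distrib mult.assoc)
  qed simp
  also have "... = h ^ 0 * ee m - h ^ p * ee m" by (rule sum_lessThan_telescope')
  also have "h ^ p * ee m = 0" using hp[of p] by simp
  finally show ?thesis by simp
 qed
 have gM: "g \<in> Mat m m" unfolding g_def sum_distrib_right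
  by (intro Mat_sum) (use hek in \<open>simp add: Mat_def mult.assoc\<close>)
 have gX: "g * X = X * g"
 proof -
  have "h ^ j * X = X * h ^ j" for j by (rule power_commuting_commutes[OF hX[symmetric]])
  hence S: "(\<Sum>j<p. h ^ j) * X = X * (\<Sum>j<p. h ^ j)" by (simp add: sum_distrib_left sum_distrib_right)
  hence "X * ((\<Sum>j<p. h ^ j) * ee m) = (\<Sum>j<p. h ^ j) * (X * ee m)" by (simp only: mult.assoc[symmetric])
  thus ?thesis unfolding g_def by (simp only: mult.assoc Xe S)
 qed
 have "((%b. X * b - b * X) ^^ k) (b * g) = ((%b. X * b - b * X) ^^ k) b * g" for k b
 proof (induction k)
  case (Suc k)
  thus ?case by (simp add: left_diff_distrib mult.assoc gX)
 qed simp
 hence "((%b. X * b - b * X) ^^ (p - 1)) (Yi * g) = ee m"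
  using ad_power_p_minus_1[OF p, of X Yi] ag by (simp add: a_def)
 thus ?thesis using that Yi(1) gM by blast
qed

text \<open>Selects a nonzero layer: the columns of \<open>UU\<close> lift a basis of the kernel of
  \<open>X\<close> in the image of \<open>X ^ i\<close> modulo the image of
  \<open>X ^ Suc i\<close>, and \<open>Xi\<close> reads off coordinates with respect to it. If all
  layers with \<open>i < p - 1\<close> were zero, the space would be free and
  \<open>free_nilpotent_ad_unit\<close> would contradict \<open>ad\<close>.\<close>

lemma nilpotent_layer:
 fixes X :: "'k::field rfm"
 assumes p: "prime p" "of_nat p = (0::'k)" and X: "X \<in> Mat m m" "X ^ p = 0"
  and ad: "!!b. b \<in> Mat m m ==> ((%b. X * b - b * X) ^^ (p - 1)) b ~= ee m"
 obtains i n Xi UU WW where "i < p - 1" "n > 0" "Xi \<in> Mat n m" "UU \<in> Mat m n" "WW \<in> Mat m n"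
  "X * UU = 0" "UU = X ^ i * WW" "Xi * X ^ Suc i = 0" "Xi * UU = ee n"
  "!!w. ee m * w = w ==> X ^ Suc i * w = 0 ==> \<exists>v. X ^ i * w = UU * (Xi * (X ^ i * w)) + X ^ Suc i * v"
proof -
 have XS: "X ^ Suc i \<in> Mat m m" for i by (rule Mat_power[OF X(1)]) simp
 obtain Z where Z: "!!i. Z i \<in> Mat m m" "!!i. X ^ Suc i * Z i * X ^ Suc i = X ^ Suc i"
 proof -
  have "\<exists>Z. Z \<in> Mat m m & X ^ Suc i * Z * X ^ Suc i = X ^ Suc i" for i
   using generalised_inverse[OF XS[of i]] by blast
  thus ?thesis using that by metis
 qed
 \<comment> \<open>\<open>k i\<close> projects onto the kernel of \<open>X ^ Suc i\<close>, and
   \<open>c0 i\<close> is a projection whose kernel is the image of \<open>X ^ Suc i\<close>; hence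
   \<open>c0 i * (X ^ i * k i)\<close> has the dimension of the layer as its rank.\<close>
 define k where "k i = ee m - Z i * X ^ Suc i" for i
 define c0 where "c0 i = ee m - X ^ Suc i * Z i" for i
 have kM: "k i \<in> Mat m m" and cM: "c0 i \<in> Mat m m" for i
  unfolding k_def c0_def by (rule Mat_minus[OF ee_Mat Mat_mult[OF Z(1) XS]], rule Mat_minus[OF ee_Mat Mat_mult[OF XS Z(1)]])
 have Xk: "X ^ Suc i * k i = 0" for i
  unfolding k_def right_diff_distrib using Z(2)[of i] MatD(2)[OF XS[of i]] by (simp add: mult.assoc del: power_Suc)
 have cX: "c0 i * X ^ Suc i = 0" for i
  unfolding c0_def left_diff_distrib using Z(2)[of i] MatD(1)[OF XS[of i]] by (simp add: mult.assoc del: power_Suc)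
 have YM: "X ^ i * k i \<in> Mat m m" for i
  using kM[of i] Mat_power[OF X(1), of i] by (cases "i = 0") (auto intro: Mat_mult)
 have kw: "k i * w = w" if "ee m * w = w" "X ^ Suc i * w = 0" for i w
  unfolding k_def left_diff_distrib mult.assoc that by simp
 have cz: "u = X ^ Suc i * (Z i * u)" if "ee m * u = u" "c0 i * u = 0" for i u
  using that unfolding c0_def by (simp add: left_diff_distrib mult.assoc)
 show ?thesis
 proof (cases "\<forall>i<p - 1. c0 i * (X ^ i * k i) = 0")
  case True
  \<comment> \<open>When all these layers vanish, a vector in the kernel of \<open>X\<close> climbs
    through the images of the powers of \<open>X\<close> up to that of
    \<open>X ^ (p - 1)\<close>.\<close>
  have "\<exists>v. u = X ^ i * v" if "i \<le> p - 1" "ee m * u = u" "X * u = 0" for i u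
   using that(1)
  proof (induction i)
   case 0
   show ?case by simp
  next
   case (Suc i)
   then obtain v0 where v0: "u = X ^ i * v0" by auto
   define v where "v = ee m * v0"
   have v: "u = X ^ i * v"
   proof -
    have "ee m * X ^ i = X ^ i * ee m" using power_commuting_commutes[of "X" "ee m" i] MatD[OF X(1)] by simp
    thus ?thesis using v0 that(2) by (metis mult.assoc v_def)
   qed
   have "X ^ Suc i * v = 0" using that(3) v by (simp add: mult.assoc)
   hence "k i * v = v" by (intro kw) (simp_all add: v_def flip: mult.assoc)
   hence "u = X ^ i * k i * v" using v by (simp add: mult.assoc)
   hence "c0 i * u = 0" using True Suc.prems by (simp flip: mult.assoc)
   thus ?case using cz that(2) by blast
  qed
  then obtain b where "b \<in> Mat m m" "((%b. X * b - b * X) ^^ (p - 1)) b = ee m"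
   using free_nilpotent_ad_unit[OF p X] by blast
  thus ?thesis using ad by blast
 next
  case False
  then obtain i where i: "i < p - 1" "c0 i * (X ^ i * k i) ~= 0" by blast
  have "c0 i * (X ^ i * k i) \<in> Mat m m" using cM YM by blast
  from rank_factorisation[OF this] obtain n C D C' D' where
   *: "C \<in> Mat m n" "D \<in> Mat n m" "C' \<in> Mat n m" "D' \<in> Mat m n"
   "c0 i * (X ^ i * k i) = C * D" "C' * C = ee n" "D * D' = ee n" .
  define Xi where "Xi = C' * c0 i"
  define WW where "WW = k i * D'"
  define UU where "UU = X ^ i * WW"
  show ?thesis
  proof (rule that[OF i(1), of n Xi UU WW])
   have "n ~= 0"
   proof
    assume "n = 0"
    hence "C = 0" using MatD(2)[OF *(1)] by simp
    thus False using i(2) *(5) by simp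
   qed
   thus "n > 0" by simp
   show "Xi \<in> Mat n m" "WW \<in> Mat m n" using * cM kM by (auto simp: Xi_def WW_def)
   have "UU = X ^ i * k i * D'" by (simp add: UU_def WW_def mult.assoc)
   thus "UU \<in> Mat m n" using YM[of i] *(4) by blast
   show "X * UU = 0" using Xk[of i] by (simp add: UU_def WW_def flip: mult.assoc)
   show "UU = X ^ i * WW" by (fact UU_def)
   show "Xi * X ^ Suc i = 0" using cX[of i] by (simp add: Xi_def mult.assoc del: power_Suc)
   have "Xi * UU = C' * (c0 i * (X ^ i * k i)) * D'" by (simp only: Xi_def UU_def WW_def mult.assoc)
   also have "... = (C' * C) * (D * D')" by (simp only: *(5) mult.assoc)
   finally show "Xi * UU = ee n" using * by simp
   fix w assume w: "ee m * w = w" "X ^ Suc i * w = 0"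
   have kww: "k i * w = w" by (rule kw[OF w])
   have cu: "c0 i * (X ^ i * w) = C * (D * w)"
   proof -
    have "c0 i * (X ^ i * w) = c0 i * (X ^ i * k i) * w" using kww by (simp only: mult.assoc)
    thus ?thesis by (simp only: *(5) mult.assoc)
   qed
   have Xiu: "Xi * (X ^ i * w) = D * w"
   proof -
    have "Xi * (X ^ i * w) = (C' * C) * D * w" by (simp only: Xi_def mult.assoc cu)
    thus ?thesis using * by (simp add: MatD)
   qed
   let ?u = "X ^ i * w - UU * (D * w)"
   have "c0 i * (UU * (D * w)) = c0 i * (X ^ i * k i) * D' * (D * w)" by (simp only: UU_def WW_def mult.assoc)
   also have "... = C * (D * D') * D * w" by (simp only: *(5) mult.assoc)
   also have "... = C * (D * w)" using *(1) by (simp add: *(7) MatD mult.assoc)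
   finally have "c0 i * ?u = 0" by (simp add: right_diff_distrib cu)
   moreover have "ee m * ?u = ?u"
   proof -
    have "ee m * (X ^ i * k i) = X ^ i * k i" by (rule MatD(1)[OF YM])
    hence e: "ee m * (X ^ i * (k i * z)) = X ^ i * (k i * z)" for z by (simp only: mult.assoc[symmetric])
    have "ee m * (X ^ i * w) = X ^ i * w" using e[of w] kww by simp
    moreover have "ee m * UU = UU" using e[of D'] by (simp only: UU_def WW_def)
    ultimately
    show ?thesis by (simp add: right_diff_distrib flip: mult.assoc)
   qed
   ultimately have "?u = X ^ Suc i * (Z i * ?u)" by (intro cz)
   thus "\<exists>v. X ^ i * w = UU * (Xi * (X ^ i * w)) + X ^ Suc i * v"
    unfolding Xiu by (metis add.commute diff_add_cancel)
  qed
 qed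
qed

context stage
begin

text \<open>\<open>Xi * G * rmap og UU\<close> is the matrix of the semilinear action of
  \<open>G\<close> on the layer, whence the twisted product rule. Images of \<open>TQ\<close> act by
  zero because \<open>i < p - 1\<close>. Every linear map of the layer extends to a matrix commuting
  with \<open>XF\<close>, hence comes from \<open>AF\<close> by
  \<open>centraliser_XF\<close>.\<close>

theorem layer:
 obtains n Xi UU where "n > 0" "Xi \<in> Mat n m" "UU \<in> Mat m n" "Xi * UU = ee n"
  "!!t. t \<in> TQ ==> Xi * rmap jF t * UU = 0"
  "!!og1 og2 G1 G2. comm_ring_hom og1 ==> comm_ring_hom og2 ==> G1 \<in> Mat m m ==> G2 \<in> Mat m m ==>
    G1 * rmap og1 XF = XF * G1 ==> G2 * rmap og2 XF = XF * G2 ==>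
    Xi * G1 * rmap og1 UU * rmap og1 (Xi * G2 * rmap og2 UU) = Xi * (G1 * rmap og1 G2) * rmap og1 (rmap og2 UU)"
  "!!S. S \<in> Mat n n ==> \<exists>c\<in>AF. S = Xi * c * UU"
proof -
 have ad: "adF = (%b. XF * b - b * XF)" by (rule ext) (simp add: adF_def)
 obtain i n Xi UU WW where *: "i < p - 1" "n > 0" "Xi \<in> Mat n m" "UU \<in> Mat m n" "WW \<in> Mat m n"
  "XF * UU = 0" "UU = XF ^ i * WW" "Xi * XF ^ Suc i = 0" "Xi * UU = ee n"
  and split: "!!w. ee m * w = w ==> XF ^ Suc i * w = 0 ==> \<exists>v. XF ^ i * w = UU * (Xi * (XF ^ i * w)) + XF ^ Suc i * v"
  using nilpotent_layer[OF prime_p pF XF_Mat XF_power] one_notin_adF[unfolded ad] by blast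
 have XiX: "Xi * XF ^ k = 0" if "Suc i \<le> k" for k
 proof -
  have "XF ^ k = XF ^ Suc i * XF ^ (k - Suc i)" using that by (metis le_add_diff_inverse power_add)
  hence "Xi * XF ^ k = (Xi * XF ^ Suc i) * XF ^ (k - Suc i)" by (simp only: mult.assoc)
  thus ?thesis using *(8) by simp
 qed
 have adU0: "(adF ^^ k) b * UU = XF ^ k * b * UU" for k b
 proof (induction k)
  case (Suc k)
  thus ?case using *(6) by (simp add: adF_def left_diff_distrib mult.assoc)
 qed simp
 \<comment> \<open>On the kernel of \<open>XF\<close> only the term with all powers on the left
   survives, and \<open>Xi\<close> kills it because the power \<open>p - 1\<close> exceeds
   \<open>i\<close>.\<close>
 have kill: "Xi * (adF ^^ (p - 1)) b * UU = 0" for b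
 proof -
  have "Xi * (adF ^^ (p - 1)) b * UU = Xi * ((adF ^^ (p - 1)) b * UU)" by (simp only: mult.assoc)
  also have "... = (Xi * XF ^ (p - 1)) * b * UU" by (simp only: adU0 mult.assoc)
  also have "Xi * XF ^ (p - 1) = 0" using XiX *(1) by simp
  finally show ?thesis by simp
 qed
 show ?thesis
 proof (rule that[OF *(2,3,4,9)])
  show "Xi * rmap jF t * UU = 0" if "t \<in> TQ" for t
   using TQ_in_adF[OF that] kill by metis
 next
  fix og1 og2 :: "'e mp fract => 'e mp fract" and G1 G2
  assume og: "comm_ring_hom og1" "comm_ring_hom og2" and G: "G1 \<in> Mat m m" "G2 \<in> Mat m m"
   "G1 * rmap og1 XF = XF * G1" "G2 * rmap og2 XF = XF * G2"
  interpret w1: comm_ring_hom og1 by (fact og)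
  interpret w2: comm_ring_hom og2 by (fact og)
  have GX1: "G1 * rmap og1 XF ^ k = XF ^ k * G1" for k
   by (rule power_intertwine[OF G(3)])
  have GX2: "G2 * rmap og2 XF ^ k = XF ^ k * G2" for k
   by (rule power_intertwine[OF G(4)])
  define w where "w = G2 * rmap og2 WW"
  have u: "XF ^ i * w = G2 * rmap og2 UU"
  proof -
   have "rmap og2 UU = rmap og2 XF ^ i * rmap og2 WW" unfolding *(7) by (simp only: w2.rmap_mult w2.rmap_power)
   hence "G2 * rmap og2 UU = G2 * rmap og2 XF ^ i * rmap og2 WW" by (simp only: mult.assoc)
   thus ?thesis unfolding GX2 by (simp only: w_def mult.assoc)
  qed
  have "XF ^ Suc i * w = XF * (G2 * rmap og2 UU)" by (simp only: power_Suc mult.assoc u)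
  also have "... = G2 * rmap og2 (XF * UU)" by (simp only: mult.assoc[symmetric] G(4)[symmetric] w2.rmap_mult)
  also have "... = 0" using *(6) by simp
  finally have "XF ^ Suc i * w = 0" .
  moreover have "ee m * w = w" using MatD(1)[OF G(2)] by (simp add: w_def flip: mult.assoc)
  ultimately obtain v where v: "G2 * rmap og2 UU = UU * (Xi * (G2 * rmap og2 UU)) + XF ^ Suc i * v"
   using split u by metis
  have "Xi * (G1 * rmap og1 G2) * rmap og1 (rmap og2 UU) = Xi * G1 * rmap og1 (G2 * rmap og2 UU)"
   by (simp only: w1.rmap_mult mult.assoc)
  also have "... = Xi * G1 * (rmap og1 UU * rmap og1 (Xi * (G2 * rmap og2 UU))) + Xi * (G1 * rmap og1 XF ^ Suc i) * rmap og1 v"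
   by (subst v) (simp only: w1.rmap_add w1.rmap_mult w1.rmap_power distrib_left mult.assoc)
  also have "Xi * (G1 * rmap og1 XF ^ Suc i) = (Xi * XF ^ Suc i) * G1" unfolding GX1 by (simp only: mult.assoc)
  finally show "Xi * G1 * rmap og1 UU * rmap og1 (Xi * G2 * rmap og2 UU) = Xi * (G1 * rmap og1 G2) * rmap og1 (rmap og2 UU)"
   unfolding *(8) by (simp add: mult.assoc)
 next
  fix S :: "'e mp fract rfm" assume S: "S \<in> Mat n n"
  \<comment> \<open>\<open>b\<close> takes coordinates in the layer, applies \<open>S\<close> and
    lifts by \<open>WW\<close>, a preimage of \<open>UU\<close> under \<open>XF ^ i\<close>. The sum
    \<open>a\<close> then commutes with \<open>XF\<close> and satisfies
    \<open>a * UU = UU * S\<close>.\<close>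
  define b where "b = WW * S * Xi"
  define a where "a = (\<Sum>j\<le>i. XF ^ j * b * XF ^ (i - j))"
  have bM: "b \<in> Mat m m" unfolding b_def using * S by blast
  have bX: "b * XF ^ Suc i = 0" using *(8) by (simp only: b_def mult.assoc) simp
  have "XF ^ Suc i * b = XF * UU * (S * Xi)" unfolding *(7) by (simp only: b_def power_Suc mult.assoc)
  hence Xb: "XF ^ Suc i * b = 0" using *(6) by simp
  have aX: "XF * a = a * XF"
   using commutes_sum_powers[where X = XF and k = i and b = b] unfolding a_def[symmetric] Xb bX by simp
  have aM: "a \<in> Mat m m" unfolding a_def by (intro Mat_sum Mat_sandwich XF_Mat bM)
  obtain c d where cd: "c \<in> AF" "a = c + (adF ^^ (p - 1)) d" using centraliser_XF[OF aM aX] by metis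
  have "a * UU = (\<Sum>j\<le>i. if j = i then XF ^ i * b * UU else 0)"
   unfolding a_def sum_distrib_right
  proof (rule sum.cong)
   fix j assume j: "j \<in> {..i}"
   show "XF ^ j * b * XF ^ (i - j) * UU = (if j = i then XF ^ i * b * UU else 0)"
   proof (cases "j = i")
    case False
    hence "i - j = Suc (i - j - 1)" using j by simp
    hence "XF ^ (i - j) = XF ^ (i - j - 1) * XF" by (metis power_Suc2)
    thus ?thesis using *(6) False by (simp add: mult.assoc)
   qed simp
  qed simp
  also have "... = XF ^ i * b * UU" by simp
  also have "... = UU * S * (Xi * UU)" unfolding *(7) b_def by (simp only: mult.assoc)
  also have "... = UU * S" using MatD(2)[OF S] *(9) by (simp add: mult.assoc)
  finally have aU: "a * UU = UU * S" .
  have "Xi * c * UU = Xi * a * UU" unfolding cd(2) distrib_left distrib_right kill by simp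
  also have "... = (Xi * UU) * S" by (simp only: mult.assoc aU)
  also have "... = S" using MatD(1)[OF S] *(9) by simp
  finally show "\<exists>c\<in>AF. S = Xi * c * UU" using cd(1) by metis
 qed
qed

end

subsection \<open>Bases over the valuation ring\<close>

global_interpretation rv: vector_space "sc :: 'k::field => 'k rfm => 'k rfm"
 by unfold_locales (auto intro!: rfm_eqI simp: algebra_simps)

definition inO :: "'e::field mp fract => bool" where "inO q \<longleftrightarrow> (\<exists>e. isres q e)"

lemma isres_jF: "isres (jF c) c"
 unfolding jF_def cst_def by (rule isres_const)

lemma isres_0: "isres 0 0" using isres_jF[of 0] by simp

lemma isres_sum: "finite S ==> (!!s. s \<in> S ==> isres (f s) (g s)) ==> isres (sum f S) (sum g S)"
 by (induction S rule: finite_induct) (auto simp: isres_0 isres_add)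

lemma inO_add: "inO a ==> inO b ==> inO (a + b)" and inO_mult: "inO a ==> inO b ==> inO (a * b)"
 unfolding inO_def using isres_add isres_mult by blast+

lemma inO_jF: "inO (jF c)" unfolding inO_def using isres_jF by blast

lemma inO_uminus: "inO a ==> inO (- a)"
 using inO_mult[OF inO_jF[of "-1"], of a] by (simp add: jF.hom_uminus)

text \<open>A coefficient of least value: of two nonzero fractions one divides the other in the
  valuation ring.\<close>

lemma dominant_coefficient:
 assumes "finite J" "x \<in> J" "f x ~= 0"
 obtains v0 where "v0 \<in> J" "f v0 ~= 0" "!!v. v \<in> J ==> inO (f v / f v0)"
proof -
 have "finite K ==> K ~= {} ==> (\<forall>v\<in>K. f v ~= 0) ==> \<exists>v0\<in>K. \<forall>v\<in>K. inO (f v / f v0)" for K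
 proof (induction K rule: finite_ne_induct)
  case (singleton x)
  thus ?case using inO_jF[of 1] by simp
 next
  case (insert x K)
  then obtain v0 where v0: "v0 \<in> K" "\<forall>v\<in>K. inO (f v / f v0)" by auto
  have nz: "f x ~= 0" "f v0 ~= 0" using insert v0 by auto
  show ?case
  proof (cases "inO (f x / f v0)")
   case True
   thus ?thesis using v0 by blast
  next
   case False
   hence *: "inO (f v0 / f x)" using isres_total[of "f x / f v0"] nz by (auto simp: inO_def)
   have "inO (f v / f x)" if "v \<in> insert x K" for v
   proof (cases "v = x")
    case True
    thus ?thesis using inO_jF[of 1] nz by simp
   next
    case False
    hence "inO (f v / f v0 * (f v0 / f x))" using * v0 that by (intro inO_mult) auto
    thus ?thesis using nz by simp
   qed
   thus ?thesis by blast
  qed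
 qed
 moreover have "finite {v\<in>J. f v ~= 0}" "{v\<in>J. f v ~= 0} ~= {}" "\<forall>v\<in>{v\<in>J. f v ~= 0}. f v ~= 0" using assms by auto
 ultimately have "\<exists>v0\<in>{v\<in>J. f v ~= 0}. \<forall>v\<in>{v\<in>J. f v ~= 0}. inO (f v / f v0)" by blast
 then obtain v0 where v0: "v0 \<in> J" "f v0 ~= 0" "!!v. v \<in> J ==> f v ~= 0 ==> inO (f v / f v0)" by blast
 have "inO (f v / f v0)" if "v \<in> J" for v
  using v0(3)[OF that] inO_jF[of 0] by (cases "f v = 0") auto
 thus ?thesis using that v0 by blast
qed

text \<open>A finitely generated torsion-free module over a valuation ring is free. In a linear
  relation among the members of a smallest generating subset, division by a dominant coefficient
  would express one generator integrally by the others.\<close>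

lemma valuation_basis:
 fixes W :: "'e::field mp fract rfm set"
 assumes "finite W"
 obtains J where "J \<subseteq> W" "rv.independent J" "!!w. w \<in> W ==> \<exists>f. (\<forall>v. inO (f v)) & w = (\<Sum>v\<in>J. sc (f v) v)"
proof -
 define P where "P J \<longleftrightarrow> J \<subseteq> W & (\<forall>w\<in>W. \<exists>f. (\<forall>v. inO (f v)) & w = (\<Sum>v\<in>J. sc (f v) v))" for J
 have "P W" unfolding P_def
 proof (intro conjI ballI)
  fix w assume w: "w \<in> W"
  have "(\<Sum>v\<in>W. sc (if v = w then 1 else 0) v) = (\<Sum>v\<in>W. if v = w then w else 0)" by (intro sum.cong) auto
  also have "... = w" using w assms by simp
  finally have "w = (\<Sum>v\<in>W. sc (if v = w then 1 else 0) v)" ..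
  moreover have "inO (if v = w then 1 else 0 :: 'e mp fract)" for v using inO_jF[of 0] inO_jF[of 1] by auto
  ultimately show "\<exists>f. (\<forall>v. inO (f v)) & w = (\<Sum>v\<in>W. sc (f v) v)"
   by (intro exI[of _ "%v. if v = w then 1 else 0"]) auto
 qed simp
 then obtain J where J: "P J" "!!K. P K ==> card J \<le> card K" using ex_has_least_nat[of P W card] by blast
 have fJ: "finite J" using J(1) assms by (auto simp: P_def intro: finite_subset)
 have "rv.independent J"
 proof (rule rv.independent_if_scalars_zero[OF fJ], rule ccontr)
  fix f x assume s0: "(\<Sum>v\<in>J. sc (f v) v) = 0" and x: "x \<in> J" "f x ~= 0"
  obtain v0 where v0: "v0 \<in> J" "f v0 ~= 0" "!!v. v \<in> J ==> inO (f v / f v0)"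
   using dominant_coefficient[of J x f] fJ x by metis
  have eq: "v0 = (\<Sum>v\<in>J - {v0}. sc (- (f v / f v0)) v)"
  proof -
   have "sc (f v0) v0 + (\<Sum>v\<in>J - {v0}. sc (f v) v) = 0" using s0 sum.remove[OF fJ v0(1), of "%v. sc (f v) v"] by simp
   hence "sc (1 / f v0) (sc (f v0) v0 + (\<Sum>v\<in>J - {v0}. sc (f v) v)) = 0" by simp
   hence "v0 + (\<Sum>v\<in>J - {v0}. sc (f v / f v0) v) = 0" using v0(2) by (simp add: sc_add_right sc_sum_right)
   hence "v0 = - (\<Sum>v\<in>J - {v0}. sc (f v / f v0) v)" by (rule eq_neg_iff_add_eq_0[THEN iffD2])
   thus ?thesis by (simp add: sum_negf[symmetric] rv.scale_minus_left)
  qed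
  have "P (J - {v0})" unfolding P_def
  proof (intro conjI ballI)
   show "J - {v0} \<subseteq> W" using J(1) by (auto simp: P_def)
   fix w assume "w \<in> W"
   then obtain g where g: "\<forall>v. inO (g v)" "w = (\<Sum>v\<in>J. sc (g v) v)" using J(1) by (auto simp: P_def)
   have "w = sc (g v0) v0 + (\<Sum>v\<in>J - {v0}. sc (g v) v)" using g(2) sum.remove[OF fJ v0(1), of "%v. sc (g v) v"] by simp
   also have "sc (g v0) v0 = (\<Sum>v\<in>J - {v0}. sc (g v0 * - (f v / f v0)) v)"
    by (subst eq) (simp only: sc_sum_right rv.scale_scale)
   also have "... + (\<Sum>v\<in>J - {v0}. sc (g v) v) = (\<Sum>v\<in>J - {v0}. sc (g v0 * - (f v / f v0) + g v) v)"
    by (simp only: sum.distrib[symmetric] sc_add_left)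
   also have "... = (\<Sum>v\<in>J - {v0}. sc (if v \<in> J then g v0 * - (f v / f v0) + g v else 0) v)" by (intro sum.cong) auto
   finally have w: "w = ..." .
   moreover have "inO (if v \<in> J then g v0 * - (f v / f v0) + g v else 0)" for v
   proof (cases "v \<in> J")
    case True
    have "inO (g v0 * - (f v / f v0) + g v)" by (intro inO_add inO_mult inO_uminus v0(3) True) (use g(1) in auto)
    thus ?thesis using True by simp
   qed (use inO_jF[of 0] in simp)
   ultimately show "\<exists>h. (\<forall>v. inO (h v)) & w = (\<Sum>v\<in>J - {v0}. sc (h v) v)"
    by (intro exI[of _ "%v. if v \<in> J then g v0 * - (f v / f v0) + g v else 0"]) auto
  qed
  hence "card J \<le> card (J - {v0})" by (rule J(2))
  thus False using fJ v0(1) by (metis card_Diff1_less not_le)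
 qed
 thus ?thesis using that J(1) unfolding P_def by blast
qed

lemma card_Mat: "card (Mat a b :: 'e::{finite,ring_1} rfm set) = card (UNIV :: 'e set) ^ (a * b)"
 and finite_Mat: "finite (Mat a b :: 'e rfm set)"
proof -
 define F :: "(nat \<times> nat => 'e) set" where "F = ({..<a} \<times> {..<b}) \<rightarrow>\<^sub>E UNIV"
 have bij: "bij_betw (%g. mk a b (%i j. g (i, j))) F (Mat a b :: 'e rfm set)"
 proof (rule bij_betwI')
  fix g h assume g: "g \<in> F" "h \<in> F"
  show "(mk a b (%i j. g (i, j)) = mk a b (%i j. h (i, j))) = (g = h)"
  proof
   assume eq: "mk a b (%i j. g (i, j)) = mk a b (%i j. h (i, j))"
   show "g = h"
   proof (rule PiE_ext[OF g[unfolded F_def]])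
    fix x assume "x \<in> {..<a} \<times> {..<b}"
    then obtain i j where x: "x = (i, j)" "i < a" "j < b" by auto
    have "ent (mk a b (%i j. g (i, j))) i j = ent (mk a b (%i j. h (i, j))) i j" by (simp only: eq)
    thus "g x = h x" using x by (simp add: ent_mk)
   qed
  qed simp
 next
  fix A :: "'e rfm" assume A: "A \<in> Mat a b"
  have "A = mk a b (%i j. restrict (%(i, j). ent A i j) ({..<a} \<times> {..<b}) (i, j))"
   by (rule Mat_eqI[OF A]) (auto simp: ent_mk)
  thus "\<exists>g\<in>F. A = mk a b (%i j. g (i, j))"
   by (intro bexI[of _ "restrict (%(i, j). ent A i j) ({..<a} \<times> {..<b})"]) (auto simp: F_def)
 qed simp
 have "finite F" "card F = card (UNIV :: 'e set) ^ (a * b)" unfolding F_def by (auto intro!: finite_PiE simp: card_PiE)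
 thus "card (Mat a b :: 'e rfm set) = card (UNIV :: 'e set) ^ (a * b)" "finite (Mat a b :: 'e rfm set)"
  using bij_betw_same_card[OF bij] bij_betw_finite[OF bij] by auto
qed

lemma un_inj: "(un i j :: 'a::ring_1 rfm) = un k l \<longleftrightarrow> i = k & j = l"
proof
 assume "(un i j :: 'a rfm) = un k l"
 hence "ent (un i j :: 'a rfm) i j = ent (un k l :: 'a rfm) i j" by simp
 thus "i = k & j = l" by (auto simp: ent_un split: if_splits)
qed simp

lemma independent_un: "rv.independent ((%(k, l). un k l :: 'k::field rfm) ` ({..<n} \<times> {..<q}))"
proof (rule rv.independent_if_scalars_zero)
 fix f :: "'k rfm => 'k" and x :: "'k rfm"
 let ?I = "{..<n} \<times> {..<q}"
 assume s: "(\<Sum>x\<in>(%(k, l). un k l) ` ?I. sc (f x) x) = 0" and "x \<in> (%(k, l). un k l) ` ?I"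
 then obtain k l where x: "x = un k l" "k < n" "l < q" by auto
 have inj: "inj_on (%(k, l). un k l :: 'k rfm) ?I" by (auto simp: inj_on_def un_inj)
 have "0 = ent (\<Sum>x\<in>(%(k, l). un k l) ` ?I. sc (f x) x) k l" using s by simp
 also have "... = (\<Sum>(a, b)\<in>?I. if (a, b) = (k, l) then f (un k l) else 0)"
  unfolding sum.reindex[OF inj] ent_sum by (intro sum.cong) (auto simp: ent_un)
 also have "... = (\<Sum>ab\<in>?I. if ab = (k, l) then f (un k l) else 0)" by (intro sum.cong refl) (auto split: prod.splits)
 also have "... = f (un k l)" using x by simp
 finally show "f x = 0" using x by simp
qed simp

lemma un00_ee: "(un 0 0 :: 'a::ring_1 rfm) = ee 1" by (rule rfm_eqI) (auto simp: ent_un ent_ee)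

lemma ent_mult_un: "ent (A * un l b) i j = (if j = b then ent A i l else (0::'a::ring_1))"
proof -
 have "un i i * A * un l b = sc (ent A i l) (un i b)" by (rule un_sandwich)
 hence "ent (un i i * (A * un l b)) i j = ent A i l * ent (un i b) i j" by (simp add: mult.assoc)
 moreover have "ent (un i i * B) i j = ent B i j" for B :: "'a rfm"
  by (subst ent_times[of "{i}"]) (auto simp: ent_un)
 ultimately show ?thesis by (auto simp: ent_un)
qed

lemma Mat_columns_eqI:
 assumes "A \<in> Mat n j" "B \<in> Mat n j" "!!l. l < j ==> A * un l 0 = B * un l (0::nat)"
 shows "A = (B :: 'a::ring_1 rfm)"
proof (rule Mat_eqI[OF assms(1,2)])
 fix i l assume "l < j"
 hence "ent (A * un l 0) i 0 = ent (B * un l 0) i 0" using assms(3) by simp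
 thus "ent A i l = ent B i l" by (simp add: ent_mult_un)
qed

context stage
begin

definition comb :: "(nat => 'e) => 'e rfm" where "comb g = (\<Sum>z\<in>FX. sc (g z) (bx z))"

lemma comb_AQ: "comb g \<in> AQ" unfolding comb_def by (intro AQ_sum AQ_sc bx_AQ)

lemma cf_comb: "z \<in> FX ==> cf z (comb g) = g z"
proof -
 assume z: "z \<in> FX"
 have "cf z (comb g) = (\<Sum>a\<in>FX. if a = z then g z else 0)"
  unfolding comb_def cf_sum cf_sc by (intro sum.cong) (auto simp: cf_bx FX_L z)
 thus ?thesis using z finite_FX by simp
qed

lemma finite_AQ: "finite AQ" using finite_subset[OF _ finite_Mat[of m m]] AQ_Mat by blast

end

text \<open>A homomorphism from the fixed algebra whose image spans the matrices over the rational
 function field is conjugate to one that is defined over the constants.\<close>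

locale split_stage = stage p m r L rh bx be ka cf
 for p m r L and rh bx :: "nat => 'e::{finite,field} rfm" and be ka cf +
 fixes n :: nat and N :: "'e rfm => 'e mp fract rfm"
 assumes n: "n > 0" and N_Mat: "c \<in> AQ ==> N c \<in> Mat n n"
  and N_add: "c \<in> AQ ==> d \<in> AQ ==> N (c + d) = N c + N d"
  and N_mult: "c \<in> AQ ==> d \<in> AQ ==> N (c * d) = N c * N d"
  and N_sc: "c \<in> AQ ==> N (sc x c) = sc (jF x) (N c)"
  and N_ee: "N (ee m) = ee n" and N_T: "t \<in> TQ ==> N t = 0"
  and N_span: "S \<in> Mat n n ==> S \<in> rv.span (N ` AQ)"
begin

lemma N_0: "N 0 = 0" using N_sc[OF AQ_0, of 0] by simp

lemma N_minus: "c \<in> AQ ==> d \<in> AQ ==> N (c - d) = N c - N d"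
 using N_add[of "c - d" d] AQ_minus[of c d] by (simp add: algebra_simps)

lemma N_sum: "(!!s. s \<in> S ==> f s \<in> AQ) ==> N (sum f S) = (\<Sum>s\<in>S. N (f s))"
 by (induction S rule: infinite_finite_induct) (auto simp: N_0 N_add AQ_sum)

lemma N_comb: "c \<in> AQ ==> N c = (\<Sum>z\<in>FX. sc (jF (cf z c)) (N (bx z)))"
proof -
 assume c: "c \<in> AQ"
 have "N (c - comb (%z. cf z c)) = 0" using AQ_decomp[OF c] N_T by (simp add: comb_def)
 hence "N c = N (comb (%z. cf z c))" using N_minus[OF c comb_AQ] by simp
 thus ?thesis unfolding comb_def by (simp add: N_sum N_sc AQ_sc bx_AQ)
qed

text \<open>Modulo \<open>TQ\<close> the fixed algebra is spanned by the fixed basis elements, so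
  their images span all matrices of size \<open>n\<close>.\<close>

lemma n_le_FX: "n * n \<le> card FX"
proof -
 let ?U = "(%(k, l). un k l :: 'e mp fract rfm) ` ({..<n} \<times> {..<n})"
 let ?B = "(%z. N (bx z)) ` FX"
 have "N c \<in> rv.span ?B" if "c \<in> AQ" for c
  unfolding N_comb[OF that] by (intro rv.span_sum rv.span_scale rv.span_base) auto
 hence "rv.span (N ` AQ) \<subseteq> rv.span ?B" by (intro rv.span_minimal) auto
 hence "?U \<subseteq> rv.span ?B" using N_span by (auto intro!: Mat_un)
 hence "card ?U \<le> card ?B" using rv.independent_span_bound[OF _ independent_un] finite_FX by blast
 also have "... \<le> card FX" by (rule card_image_le[OF finite_FX])
 also have "card ?U = n * n" by (subst card_image) (auto simp: inj_on_def un_inj)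
 finally show ?thesis .
qed

text \<open>The fixed algebra stabilises a lattice over the valuation ring; the matrices
  \<open>M c\<close> of its action have integral entries, and \<open>R c\<close> is their reduction
  to the residue field. Simplicity of the quotient by \<open>TQ\<close> and a count then show that
  the lattice has full rank and that \<open>R\<close> is onto.\<close>

lemma residue_hom:
 obtains R where "!!c. c \<in> AQ ==> R c \<in> Mat n n" "!!c d. c \<in> AQ ==> d \<in> AQ ==> R (c + d) = R c + R d"
  "!!c d. c \<in> AQ ==> d \<in> AQ ==> R (c * d) = R c * R d" "!!c x. c \<in> AQ ==> R (sc x c) = sc x (R c)"
  "R (ee m) = ee n" "!!c. c \<in> AQ ==> R c = 0 \<longleftrightarrow> c \<in> TQ" "!!c. c \<in> AQ ==> N c = 0 ==> R c = 0"
  "!!S. S \<in> Mat n n ==> \<exists>c\<in>AQ. R c = S"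
proof -
 \<comment> \<open>The orbit of the first unit vector is finite and stable under the fixed algebra,
   so it generates a stable lattice.\<close>
 define W where "W = (%c. N c * un 0 0) ` AQ"
 have "finite W" using finite_AQ by (simp add: W_def)
 from this obtain J where J: "J \<subseteq> W" "rv.independent J"
  "!!w. w \<in> W ==> \<exists>f. (\<forall>v. inO (f v)) & w = (\<Sum>v\<in>J. sc (f v) v)" by (rule valuation_basis) blast
 have fJ: "finite J" using J(1) \<open>finite W\<close> finite_subset by blast
 define j where "j = card J"
 obtain v where v: "bij_betw v {..<j} J" using ex_bij_betw_nat_finite[OF fJ] by (auto simp: j_def atLeast0LessThan)
 have vJ: "v k \<in> J" if "k < j" for k using v that by (auto simp: bij_betw_def)
 have WM: "w \<in> Mat n 1" if "w \<in> W" for w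
  using that N_Mat Mat_un[of 0 n 0 1] n unfolding W_def by (auto intro!: Mat_mult[of _ n n])
 have vM: "v k \<in> Mat n 1" if "k < j" for k using WM J(1) vJ[OF that] by blast
 have sumJ: "(\<Sum>u\<in>J. h u) = (\<Sum>k<j. h (v k))" for h :: "'e mp fract rfm => 'e mp fract rfm"
  by (rule sum.reindex_bij_betw[OF v, symmetric])
 have indep: "g k = 0" if g0: "(\<Sum>k<j. sc (g k) (v k)) = 0" and k: "k < j" for g k
 proof -
  let ?f = "%u. g (inv_into {..<j} v u)"
  have iv: "inv_into {..<j} v (v k) = k" if "k < j" for k
   using v that by (intro inv_into_f_f) (auto simp: bij_betw_def)
  have "(\<Sum>u\<in>J. sc (?f u) u) = 0" using g0 unfolding sumJ by (simp add: iv)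
  hence "?f (v k) = 0" using J(2) rv.dependent_finite[OF fJ] vJ[OF k] by auto
  thus ?thesis using iv[OF k] by simp
 qed
 define V where "V = (\<Sum>k<j. v k * un 0 k)"
 have VM: "V \<in> Mat n j" unfolding V_def using vM by (intro Mat_sum Mat_mult[of _ n 1] Mat_un) auto
 have col: "V * A * un l 0 = (\<Sum>k<j. sc (ent A k l) (v k))" for A l
 proof -
  have "V * A * un l 0 = (\<Sum>k<j. v k * (un 0 k * A * un l 0))" by (simp add: V_def sum_distrib_right mult.assoc)
  also have "... = (\<Sum>k<j. sc (ent A k l) (v k * un 0 0))" by (simp only: un_sandwich sc_mult_right)
  finally show ?thesis using MatD(2)[OF vM] by (simp add: un00_ee)
 qed
 have V_inj: "A = B" if "V * A = V * B" "A \<in> Mat j q" "B \<in> Mat j q" for A B q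
 proof (rule Mat_eqI[OF that(2,3)])
  fix k l assume "k < j"
  have "V * (A - B) * un l 0 = 0" using that(1) by (simp add: right_diff_distrib)
  hence "(\<Sum>k<j. sc (ent (A - B) k l) (v k)) = 0" by (simp only: col)
  hence "ent (A - B) k l = 0" using \<open>k < j\<close> by (rule indep)
  thus "ent A k l = ent B k l" by simp
 qed
 have Vun: "V * un l 0 = v l" if "l < j" for l
 proof -
  have "V * un l 0 = (\<Sum>k<j. v k * (un 0 k * un l 0))" by (simp add: V_def sum_distrib_right mult.assoc)
  also have "... = (\<Sum>k<j. if k = l then v l * un 0 0 else 0)" by (intro sum.cong) (auto simp: un_mult_un)
  also have "... = v l" using that MatD(2)[OF vM[OF that]] by (simp add: un00_ee)
  finally show ?thesis .
 qed
 have "\<exists>f. (\<forall>u. inO (f u)) & N c * v l = (\<Sum>u\<in>J. sc (f u) u)" if c: "c \<in> AQ" and l: "l < j" for c l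
 proof (rule J(3))
  obtain d where "d \<in> AQ" "v l = N d * un 0 0" using vJ[OF l] J(1) by (auto simp: W_def)
  thus "N c * v l \<in> W" unfolding W_def using c
   by (intro image_eqI[of _ _ "c * d"]) (auto simp: N_mult AQ_mult mult.assoc)
 qed
 hence "\<forall>c l. \<exists>f. c \<in> AQ --> l < j --> (\<forall>u. inO (f u)) & N c * v l = (\<Sum>u\<in>J. sc (f u) u)" by blast
 then obtain F where "\<forall>c l. c \<in> AQ --> l < j --> (\<forall>u. inO (F c l u)) & N c * v l = (\<Sum>u\<in>J. sc (F c l u) u)"
  unfolding choice_iff by blast
 hence F: "!!c l u. c \<in> AQ ==> l < j ==> inO (F c l u)"
  "!!c l. c \<in> AQ ==> l < j ==> N c * v l = (\<Sum>u\<in>J. sc (F c l u) u)" by blast+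
 define M where "M c = mk j j (%k l. F c l (v k))" for c
 have MM: "M c \<in> Mat j j" for c by (simp add: M_def)
 have NV: "N c * V = V * M c" if c: "c \<in> AQ" for c
 proof (rule Mat_columns_eqI[of _ n j])
  show "N c * V \<in> Mat n j" "V * M c \<in> Mat n j" using N_Mat[OF c] VM MM by blast+
  fix l assume l: "l < j"
  have "N c * V * un l 0 = N c * v l" using Vun[OF l] by (simp add: mult.assoc)
  also have "... = (\<Sum>k<j. sc (F c l (v k)) (v k))" unfolding F(2)[OF c l] sumJ ..
  also have "... = V * M c * un l 0" unfolding col using l by (intro sum.cong) (auto simp: M_def ent_mk)
  finally show "N c * V * un l 0 = V * M c * un l 0" .
 qed
 have M_eq: "M c = A" if "c \<in> AQ" "A \<in> Mat j j" "N c * V = V * A" for c A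
  using V_inj[of "M c" A j] that NV MM by metis
 have M_add: "M (c + d) = M c + M d" and M_mult: "M (c * d) = M c * M d" if cd: "c \<in> AQ" "d \<in> AQ" for c d
 proof -
  show "M (c + d) = M c + M d"
   by (rule M_eq) (use cd MM NV[OF cd(1)] NV[OF cd(2)] in \<open>auto simp: N_add AQ_add distrib_left distrib_right intro: Mat_add\<close>)
  have "N c * N d * V = (N c * V) * M d" by (simp only: mult.assoc NV[OF cd(2)])
  hence "N c * N d * V = V * (M c * M d)" by (simp only: mult.assoc NV[OF cd(1)])
  thus "M (c * d) = M c * M d"
   using cd MM by (intro M_eq) (auto simp: N_mult AQ_mult)
 qed
 have M_sc: "M (sc x c) = sc (jF x) (M c)" if c: "c \<in> AQ" for c x
  by (rule M_eq) (use c MM NV[OF c] in \<open>auto simp: N_sc AQ_sc sc_mult_left sc_mult_right\<close>)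
 have M_ee: "M (ee m) = ee j"
  by (rule M_eq) (use AQ_ee MatD[OF VM] N_ee in auto)
 have M_0: "M c = 0" if "c \<in> AQ" "N c = 0" for c by (rule M_eq) (use that in auto)
 define R where "R c = mk j j (%k l. SOME e. isres (ent (M c) k l) e)" for c
 have RM: "R c \<in> Mat j j" for c by (simp add: R_def)
 have res: "isres (ent (M c) k l) (ent (R c) k l)" if "c \<in> AQ" for c k l
 proof (cases "k < j & l < j")
  case True
  hence "\<exists>e. isres (ent (M c) k l) e" using F(1)[OF that] by (auto simp: M_def ent_mk inO_def)
  hence "isres (ent (M c) k l) (SOME e. isres (ent (M c) k l) e)" by (rule someI_ex)
  thus ?thesis using True by (simp add: R_def ent_mk)
 next
  case False
  thus ?thesis using Mat_ent[OF MM] Mat_ent[OF RM] isres_0 by metis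
 qed
 have R_eq: "R c = A" if "c \<in> AQ" "!!k l. isres (ent (M c) k l) (ent A k l)" for c A
  using res[OF that(1)] that(2) isres_unique by (intro rfm_eqI) blast
 have R_add: "R (c + d) = R c + R d" and R_mult: "R (c * d) = R c * R d" if cd: "c \<in> AQ" "d \<in> AQ" for c d
 proof -
  show "R (c + d) = R c + R d"
   by (rule R_eq) (use cd in \<open>auto simp: AQ_add M_add intro!: isres_add res\<close>)
  show "R (c * d) = R c * R d"
  proof (rule R_eq)
   fix k l
   show "isres (ent (M (c * d)) k l) (ent (R c * R d) k l)"
    unfolding M_mult[OF cd] ent_mult_Mat[OF MM] ent_mult_Mat[OF RM]
    by (intro isres_sum isres_mult res cd) auto
  qed (use cd AQ_mult in auto)
 qed
 have R_sc: "R (sc x c) = sc x (R c)" if c: "c \<in> AQ" for c x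
  by (rule R_eq) (use c in \<open>auto simp: AQ_sc M_sc intro!: isres_mult isres_jF res\<close>)
 have R_ee: "R (ee m) = ee j"
  by (rule R_eq[OF AQ_ee]) (use isres_jF[of 1] isres_0 in \<open>auto simp: M_ee ent_ee\<close>)
 have R_N: "R c = 0" if "c \<in> AQ" "N c = 0" for c
  by (rule R_eq) (use that M_0 isres_0 in auto)
 have "j ~= 0"
 proof
  assume "j = 0"
  hence "J = {}" using fJ by (simp add: j_def)
  moreover have "un 0 0 \<in> W" unfolding W_def
   using AQ_ee n N_ee by (intro image_eqI[of _ _ "ee m"]) (auto simp: MatD(1)[OF Mat_un[of 0 n 0 1]])
  ultimately have "un 0 0 = (0 :: 'e mp fract rfm)" using J(3) by fastforce
  hence "ent (un 0 0 :: 'e mp fract rfm) 0 0 = 0" by simp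
  thus False by (simp add: ent_un)
 qed
 hence R1: "R (ee m) ~= 0"
 proof -
  have "ent (ee j :: 'e rfm) 0 0 = 1" using \<open>j ~= 0\<close> by (simp add: ent_ee)
  thus ?thesis unfolding R_ee by auto
 qed
 \<comment> \<open>\<open>R\<close> is a homomorphism that vanishes on \<open>TQ\<close> and does
   not kill 1, so simplicity determines its kernel.\<close>
 have ker: "R c = 0 \<longleftrightarrow> c \<in> TQ" if c: "c \<in> AQ" for c
  using kernel_TQ[of R c, OF R_add R_mult _ R1 c] R_N N_T TQ_def c by blast
 have R_minus: "R (c - d) = R c - R d" if "c \<in> AQ" "d \<in> AQ" for c d
  using R_add[of "c - d" d] AQ_minus[OF that] that by (simp add: algebra_simps)
 let ?G = "FX \<rightarrow>\<^sub>E (UNIV :: 'e set)"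
 \<comment> \<open>Combinations of fixed basis elements with different coordinates differ modulo
   \<open>TQ\<close>, hence have different residues. Counting gives
   \<open>card FX \<le> j * j\<close>; together with \<open>n * n \<le> card FX\<close> and
   \<open>j \<le> n\<close> all of these are equalities, which forces surjectivity.\<close>
 have inj: "inj_on (%g. R (comb g)) ?G"
 proof (rule inj_onI)
  fix g h assume g: "g \<in> ?G" "h \<in> ?G" and eq: "R (comb g) = R (comb h)"
  have "comb g - comb h \<in> TQ"
   using R_minus[OF comb_AQ comb_AQ] eq ker[OF AQ_minus[OF comb_AQ comb_AQ]] by simp
  hence "g z = h z" if "z \<in> FX" for z using that by (auto simp: TQ_def cf_minus cf_comb)
  thus "g = h" using g by (intro PiE_ext) auto
 qed
 have cG: "card ?G = card (UNIV :: 'e set) ^ card FX" using finite_FX by (simp add: card_PiE)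
 have sub: "(%g. R (comb g)) ` ?G \<subseteq> Mat j j" using RM by blast
 have q: "card (UNIV :: 'e set) > 1"
 proof -
  have "card {0, 1 :: 'e} \<le> card (UNIV :: 'e set)" by (rule card_mono) auto
  thus ?thesis by simp
 qed
 have "card ?G \<le> card (Mat j j :: 'e rfm set)" by (rule card_inj_on_le[OF inj sub finite_Mat])
 hence "card FX \<le> j * j" unfolding cG card_Mat by (rule power_le_imp_le_exp[OF q])
 moreover have "j \<le> n"
 proof -
  have "J \<subseteq> rv.span ((%k. un k 0) ` {..<n})"
  proof
   fix u assume "u \<in> J"
   hence u: "u \<in> Mat n 1" using J(1) WM by blast
   have "u = (\<Sum>i<n. sc (ent u i 0) (un i 0))" by (subst Mat_expand[OF u]) simp
   also have "... \<in> rv.span ((%k. un k 0) ` {..<n})" by (intro rv.span_sum rv.span_scale rv.span_base) auto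
   finally show "u \<in> rv.span ((%k. un k 0) ` {..<n})" .
  qed
  hence "card J \<le> card ((%k. un k 0 :: 'e mp fract rfm) ` {..<n})"
   using rv.independent_span_bound[OF _ J(2)] by blast
  also have "... \<le> n" using card_image_le[of "{..<n}" "%k. un k 0 :: 'e mp fract rfm"] by simp
  finally show ?thesis by (simp add: j_def)
 qed
 moreover have "j * j < n * n" if "j < n" using that by (intro mult_strict_mono) auto
 ultimately have jn: "j = n" and FXn: "card FX = n * n"
  using n_le_FX by (force, cases "j < n", auto)
 have surj: "(%g. R (comb g)) ` ?G = Mat j j"
 proof (rule card_subset_eq[OF finite_Mat sub])
  show "card ((%g. R (comb g)) ` ?G) = card (Mat j j :: 'e rfm set)"
   unfolding card_image[OF inj] cG card_Mat jn FXn ..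
 qed
 show ?thesis
 proof (rule that[of R])
  show "\<exists>c\<in>AQ. R c = S" if "S \<in> Mat n n" for S
  proof -
   have "S \<in> (%g. R (comb g)) ` ?G" using that surj jn by simp
   thus ?thesis using comb_AQ by blast
  qed
 qed (use RM R_add R_mult R_sc R_ee ker R_N jn in auto)
qed

text \<open>A Skolem-Noether argument. \<open>N\<close> factors through \<open>R\<close>, so
  preimages under \<open>R\<close> of the matrix units are mapped by \<open>N\<close> to a second
  system of matrix units \<open>E k l\<close>, and two such systems of the same size are
  conjugate.\<close>

theorem splitting:
 obtains R P P' where "!!c. c \<in> AQ ==> R c \<in> Mat n n"
  "!!c. c \<in> AQ ==> R c = 0 \<longleftrightarrow> c \<in> TQ" "!!S. S \<in> Mat n n ==> \<exists>c\<in>AQ. R c = S"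
  "P \<in> Mat n n" "P' \<in> Mat n n" "P * P' = ee n" "P' * P = ee n"
  "!!c. c \<in> AQ ==> P * N c * P' = rmap jF (R c)"
proof -
 obtain R where RM: "!!c. c \<in> AQ ==> R c \<in> Mat n n" and R_add: "!!c d. c \<in> AQ ==> d \<in> AQ ==> R (c + d) = R c + R d"
  and R_mult: "!!c d. c \<in> AQ ==> d \<in> AQ ==> R (c * d) = R c * R d" and R_sc: "!!c x. c \<in> AQ ==> R (sc x c) = sc x (R c)"
  and R_ee: "R (ee m) = ee n" and ker: "!!c. c \<in> AQ ==> R c = 0 \<longleftrightarrow> c \<in> TQ" and R_N: "!!c. c \<in> AQ ==> N c = 0 ==> R c = 0"
  and surj: "!!S. S \<in> Mat n n ==> \<exists>c\<in>AQ. R c = S" by (rule residue_hom) blast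
 have R_minus: "R (c - d) = R c - R d" if "c \<in> AQ" "d \<in> AQ" for c d
  using R_add[of "c - d" d] AQ_minus[OF that] that by (simp add: algebra_simps)
 have R_sum: "(!!s. s \<in> S ==> f s \<in> AQ) ==> R (sum f S) = (\<Sum>s\<in>S. R (f s))" for S :: "'i set" and f
  using R_sc[OF AQ_0, of 0] by (induction S rule: infinite_finite_induct) (auto simp: R_add AQ_sum)
 have NR: "N c = N d" if "c \<in> AQ" "d \<in> AQ" "R c = R d" for c d
 proof -
  have "c - d \<in> TQ" using that ker[OF AQ_minus[OF that(1,2)]] by (simp add: R_minus)
  thus ?thesis using N_T N_minus[OF that(1,2)] by fastforce
 qed
 obtain ep where ep: "!!k l. k < n ==> l < n ==> ep k l \<in> AQ" "!!k l. k < n ==> l < n ==> R (ep k l) = un k l"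
  using surj[OF Mat_un] by metis
 define E where "E k l = N (ep k l)" for k l
 have EM: "E k l \<in> Mat n n" if "k < n" "l < n" for k l using N_Mat ep(1) that by (simp add: E_def)
 have EE: "E k l * E l q = E k q" if "k < n" "l < n" "q < n" for k l q
  unfolding E_def using that ep by (subst N_mult[symmetric]) (auto intro!: NR simp: AQ_mult R_mult)
 have EE0: "E k l * E l' q = 0" if "k < n" "l < n" "l' < n" "q < n" "l ~= l'" for k l l' q
 proof -
  have "N (ep k l * ep l' q) = N 0"
   using that ep R_sc[OF AQ_0, of 0] by (intro NR) (auto simp: AQ_mult AQ_0 R_mult un_mult_un)
  thus ?thesis using that ep by (simp add: E_def N_mult N_0)
 qed
 have NE: "N c = (\<Sum>k<n. \<Sum>l<n. sc (jF (ent (R c) k l)) (E k l))" if c: "c \<in> AQ" for c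
 proof -
  let ?d = "\<Sum>k<n. \<Sum>l<n. sc (ent (R c) k l) (ep k l)"
  have d: "?d \<in> AQ" by (intro AQ_sum AQ_sc) (use ep in auto)
  have "R ?d = (\<Sum>k<n. \<Sum>l<n. sc (ent (R c) k l) (un k l))"
   by (subst R_sum, (intro AQ_sum AQ_sc; use ep in auto), intro sum.cong refl, subst R_sum) (auto simp: AQ_sc ep R_sc)
  also have "... = R c" using Mat_expand[OF RM[OF c]] by simp
  finally have "N c = N ?d" using NR[OF d c] by simp
  also have "... = (\<Sum>k<n. N (\<Sum>l<n. sc (ent (R c) k l) (ep k l)))"
   by (rule N_sum) (intro AQ_sum AQ_sc; use ep in auto)
  also have "... = (\<Sum>k<n. \<Sum>l<n. sc (jF (ent (R c) k l)) (E k l))"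
   by (intro sum.cong refl, subst N_sum) (auto simp: AQ_sc ep N_sc E_def)
  finally show ?thesis .
 qed
 have E00: "E 0 0 ~= 0"
 proof
  assume "E 0 0 = 0"
  hence "R (ep 0 0) = 0" using R_N ep(1) n by (simp add: E_def)
  hence "ent (un 0 0 :: 'e rfm) 0 0 = 0" using ep(2)[OF n n] by simp
  thus False by (simp add: ent_un)
 qed
 \<comment> \<open>From the factors of the nonzero idempotent \<open>E 0 0\<close> one takes a
   column \<open>u\<close> and a row \<open>et\<close> with
   \<open>et * E 0 0 * u = un 0 0\<close>.\<close>
 from rank_factorisation[OF EM[OF n n]] obtain q C D C' D' where
  *: "C \<in> Mat n q" "D \<in> Mat q n" "C' \<in> Mat q n" "D' \<in> Mat n q"
  "E 0 0 = C * D" "C' * C = ee q" "D * D' = ee q" .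
 have q: "q > 0"
 proof (rule ccontr)
  assume "\<not> q > 0"
  hence "C = 0" using MatD(2)[OF *(1)] by simp
  thus False using E00 *(5) by simp
 qed
 have DC: "D * C = ee q"
 proof -
  have "C' * (C * D * (C * D)) * D' = C' * (C * D) * D'" using EE[OF n n n] *(5) by simp
  hence "(C' * C) * (D * C) * (D * D') = (C' * C) * (D * D')" by (simp only: mult.assoc)
  moreover have "D * C \<in> Mat q q" using * by blast
  ultimately show ?thesis by (simp add: * MatD)
 qed
 define u where "u = C * un 0 0"
 define et where "et = un 0 0 * D"
 have uM: "u \<in> Mat n 1" and etM: "et \<in> Mat 1 n"
  unfolding u_def et_def using * q Mat_un[of 0 q 0 1] Mat_un[of 0 1 0 q] by blast+
 have Eu: "et * E 0 0 * u = un 0 0"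
 proof -
  have "et * E 0 0 * u = un 0 0 * (D * C) * (D * C) * un 0 0" by (simp only: et_def u_def *(5) mult.assoc)
  also have "... = un 0 0 * (ee q * (ee q * un 0 0))" by (simp only: DC mult.assoc)
  also have "ee q * un 0 0 = (un 0 0 :: 'e mp fract rfm)" by (rule MatD(1)[OF Mat_un[of 0 q 0 1]]) (use q in auto)
  finally show ?thesis by (simp add: \<open>ee q * un 0 0 = un 0 0\<close>)
 qed
 define P' where "P' = (\<Sum>k<n. E k 0 * u * un 0 k)"
 define P where "P = (\<Sum>k<n. un k 0 * et * E 0 k)"
 have PM: "P \<in> Mat n n" "P' \<in> Mat n n" unfolding P_def P'_def
  by (intro Mat_sum Mat_mult[of _ n 1 _ n] Mat_mult[of _ n n _ n] Mat_mult[of _ n n _ 1] Mat_mult[of _ n 1 _ n] Mat_un EM n uM etM; simp)+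
 have PE: "P * E k l = un k l * P" if kl: "k < n" "l < n" for k l
 proof -
  have "P * E k l = (\<Sum>i<n. if i = k then un k 0 * et * E 0 l else 0)"
   unfolding P_def sum_distrib_right by (intro sum.cong refl) (use EE EE0 kl n in \<open>auto simp: mult.assoc\<close>)
  moreover have "un k l * P = (\<Sum>i<n. if i = l then un k 0 * et * E 0 l else 0)"
   unfolding P_def sum_distrib_left by (intro sum.cong refl) (auto simp: un_mult_un simp flip: mult.assoc)
  ultimately show ?thesis using kl by simp
 qed
 have EP: "E k l * P' = P' * un k l" if kl: "k < n" "l < n" for k l
 proof -
  have "E k l * P' = (\<Sum>i<n. if i = l then E k 0 * u * un 0 l else 0)"
   unfolding P'_def sum_distrib_left by (intro sum.cong refl) (use EE EE0 kl n in \<open>auto simp flip: mult.assoc\<close>)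
  moreover have "P' * un k l = (\<Sum>i<n. if i = k then E k 0 * u * un 0 l else 0)"
   unfolding P'_def sum_distrib_right by (intro sum.cong refl) (auto simp: un_mult_un mult.assoc)
  ultimately show ?thesis using kl by simp
 qed
 have PP': "P * P' = ee n"
 proof -
  have "P * P' = (\<Sum>k<n. P * E k 0 * u * un 0 k)" by (simp add: P'_def sum_distrib_left mult.assoc)
  also have "... = (\<Sum>k<n. un k k)"
  proof (rule sum.cong)
   fix k assume "k \<in> {..<n}"
   hence k: "k < n" by simp
   have "un k 0 * P = un k 0 * et * E 0 0"
   proof -
    have "un k 0 * P = (\<Sum>i<n. if i = 0 then un k 0 * et * E 0 0 else 0)"
     unfolding P_def sum_distrib_left by (intro sum.cong refl) (auto simp: un_mult_un simp flip: mult.assoc)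
    thus ?thesis using n by simp
   qed
   hence "P * E k 0 * u * un 0 k = un k 0 * (et * E 0 0 * u) * un 0 k" using PE[OF k n] by (simp add: mult.assoc)
   thus "P * E k 0 * u * un 0 k = un k k" by (simp add: Eu)
  qed simp
  finally show ?thesis by (simp add: ee_eq_sum)
 qed
 \<comment> \<open>\<open>Z\<close> commutes with the image of \<open>N\<close>, which spans all
   matrices, so it is a scalar matrix; \<open>P * P' = ee n\<close> makes the scalar 1.\<close>
 define Z where "Z = P' * P"
 have ZM: "Z \<in> Mat n n" using PM by (auto simp: Z_def)
 have ZE: "Z * E k l = E k l * Z" if "k < n" "l < n" for k l
 proof -
  have "Z * E k l = P' * (un k l * P)" by (simp only: Z_def mult.assoc PE[OF that])
  also have "... = (P' * un k l) * P" by (simp only: mult.assoc)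
  finally show ?thesis by (simp only: Z_def EP[OF that, symmetric] mult.assoc)
 qed
 have "Z * S = S * Z" if "S \<in> rv.span (N ` AQ)" for S
  using that
 proof (induction rule: rv.span_induct_alt)
  case (step x y z)
  then obtain c where c: "c \<in> AQ" "y = N c" by auto
  have "Z * N c = N c * Z"
   unfolding NE[OF c(1)] by (simp add: sum_distrib_left sum_distrib_right sc_mult_left sc_mult_right ZE)
  thus ?case using step c by (simp add: distrib_left distrib_right sc_mult_left sc_mult_right)
 qed simp
 hence Zun: "Z * un k l = un k l * Z" if "k < n" "l < n" for k l
  using N_span[OF Mat_un[OF that]] by blast
 have Zs: "Z = sc (ent Z 0 0) (ee n)"
 proof -
  have "Z = (\<Sum>k<n. Z * un k k)" using MatD(2)[OF ZM] by (simp add: ee_eq_sum sum_distrib_left)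
  also have "... = (\<Sum>k<n. sc (ent Z 0 0) (un k k))"
  proof (rule sum.cong)
   fix k assume "k \<in> {..<n}"
   hence "Z * un k 0 * un 0 k = un k 0 * Z * un 0 k" using Zun n by simp
   thus "Z * un k k = sc (ent Z 0 0) (un k k)" by (simp add: un_sandwich) (simp add: mult.assoc)
  qed simp
  finally show ?thesis by (simp add: ee_eq_sum sc_sum_right)
 qed
 have "ent Z 0 0 = 1"
 proof -
  have "P * Z * P' = (P * P') * (P * P')" by (simp only: Z_def mult.assoc)
  hence "P * sc (ent Z 0 0) (ee n) * P' = ee n" using Zs PP' by simp
  hence "sc (ent Z 0 0) (ee n) = (ee n :: 'e mp fract rfm)"
   using MatD(2)[OF PM(1)] PP' by (simp add: sc_mult_left sc_mult_right)
  hence "ent (sc (ent Z 0 0) (ee n)) 0 0 = ent (ee n :: 'e mp fract rfm) 0 0" by simp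
  thus ?thesis using n by (simp add: ent_ee)
 qed
 hence P'P: "P' * P = ee n" using Zs by (simp add: Z_def)
 show ?thesis
 proof (rule that[of R P P'])
  fix c assume c: "c \<in> AQ"
  have "P * N c * P' = (\<Sum>k<n. \<Sum>l<n. sc (jF (ent (R c) k l)) (P * E k l * P'))"
   unfolding NE[OF c] by (simp add: sum_distrib_left sum_distrib_right sc_mult_left sc_mult_right)
  also have "... = (\<Sum>k<n. \<Sum>l<n. sc (jF (ent (R c) k l)) (un k l))"
  proof (intro sum.cong refl)
   fix k l assume kl: "k \<in> {..<n}" "l \<in> {..<n}"
   hence "P * E k l * P' = un k l * (P * P')" using PE by (simp add: mult.assoc)
   also have "... = un k l" using PP' MatD(2)[OF Mat_un[of k n l n]] kl by simp
   finally show "sc (jF (ent (R c) k l)) (P * E k l * P') = sc (jF (ent (R c) k l)) (un k l)" by simp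
  qed
  also have "... = rmap jF (R c)"
   using arg_cong[OF Mat_expand[OF RM[OF c]], of "rmap jF"] by (simp add: jF.rmap_sum jF.rmap_sc)
  finally show "P * N c * P' = rmap jF (R c)" .
 qed (use RM ker surj PM PP' P'P in auto)
qed

end

subsection \<open>Semilinear substitutions\<close>

definition om :: "('e::field => 'e) => (nat => nat) => 'e mp fract => 'e mp fract" where
 "om ta pm = extF (msub (ren pm) ta)"

lemma field_hom_inj:
 assumes "comm_ring_hom (ta :: 'e::field => 'e)"
 shows "inj ta"
proof -
 interpret comm_ring_hom ta by fact
 show ?thesis
 proof (rule injI)
  fix x y assume "ta x = ta y"
  hence 0: "ta (x - y) = 0" by (simp add: hom_minus)
  show "x = y"
  proof (rule ccontr)
   assume "x ~= y"
   hence "ta ((x - y) * (1 / (x - y))) = 1" by simp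
   thus False unfolding hom_mult using 0 by simp
  qed
 qed
qed

lemma monomial_sub_om: "comm_ring_hom (ta :: 'e::field => 'e) ==> inj pm ==> monomial_sub ta (ren pm)"
 by (intro monomial_sub_ren field_hom_inj)

lemma msub_inj_hom: "comm_ring_hom (ta :: 'e::field => 'e) ==> inj pm ==> inj_comm_ring_hom (msub (ren pm) ta)"
proof -
 assume "comm_ring_hom ta" "inj pm"
 then interpret monomial_sub ta "ren pm" by (rule monomial_sub_om)
 show "inj_comm_ring_hom (msub (ren pm) ta)" by unfold_locales
qed

lemma om_hom: "comm_ring_hom (ta :: 'e::field => 'e) ==> inj pm ==> inj_comm_ring_hom (om ta pm)"
 unfolding om_def by (intro extF_hom msub_inj_hom)

lemma om_fr: "comm_ring_hom (ta :: 'e::field => 'e) ==> inj pm ==> om ta pm (fr u) = fr (msub (ren pm) ta u)"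
 unfolding om_def by (intro extF_fr msub_inj_hom)

lemma om_jF: "comm_ring_hom (ta :: 'e::field => 'e) ==> inj pm ==> om ta pm (jF c) = jF (ta c)"
proof -
 assume *: "comm_ring_hom ta" "inj pm"
 then interpret monomial_sub ta "ren pm" by (rule monomial_sub_om)
 show ?thesis unfolding jF_def om_fr[OF *] cst_def by simp
qed

lemma om_xv: "comm_ring_hom (ta :: 'e::field => 'e) ==> inj pm ==> om ta pm (fr (xv i)) = fr (xv (pm i))"
proof -
 assume *: "comm_ring_hom ta" "inj pm"
 then interpret monomial_sub ta "ren pm" by (rule monomial_sub_om)
 show ?thesis unfolding om_fr[OF *] xv_def by simp
qed

lemma comp_comm_ring_hom: "comm_ring_hom ta ==> comm_ring_hom ta' ==> comm_ring_hom (ta \<circ> ta')"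
proof -
 assume "comm_ring_hom ta" "comm_ring_hom ta'"
 then interpret a: comm_ring_hom ta + b: comm_ring_hom ta' by auto
 show ?thesis by unfold_locales (auto simp: a.hom_add b.hom_add a.hom_mult b.hom_mult)
qed

lemma id_comm_ring_hom: "comm_ring_hom (id :: 'a::comm_ring_1 => 'a)" by unfold_locales auto

lemma om_comp:
 assumes "comm_ring_hom (ta :: 'e::field => 'e)" "inj pm" "comm_ring_hom ta'" "inj pm'"
 shows "om ta pm (om ta' pm' q) = om (ta \<circ> ta') (pm \<circ> pm') q"
proof -
 interpret a: monomial_sub ta "ren pm" by (rule monomial_sub_om[OF assms(1,2)])
 interpret b: monomial_sub ta' "ren pm'" by (rule monomial_sub_om[OF assms(3,4)])
 have c: "comm_ring_hom (ta \<circ> ta')" "inj (pm \<circ> pm')"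
  by (rule comp_comm_ring_hom[OF assms(1,3)], rule inj_compose[OF assms(2,4)])
 have ms: "msub (ren pm) ta (msub (ren pm') ta' u) = msub (ren (pm \<circ> pm')) (ta \<circ> ta') u" for u
 proof -
  have "msub (ren pm) ta (msub (ren pm') ta' u) = (\<Sum>k\<in>mkeys u. msub (ren pm) ta (msingle (ren pm' k) (ta' (mlook u k))))"
   unfolding msub_def[of "ren pm'"] psum_def by (rule a.msub_sum)
  thus ?thesis by (simp add: msub_def[of "ren (pm \<circ> pm')"] psum_def ren_comp)
 qed
 interpret oa: inj_comm_ring_hom "om ta pm" by (rule om_hom[OF assms(1,2)])
 obtain x y where q: "y ~= 0" "q = fr x / fr y" by (rule fract_cases_fr)
 have "om ta' pm' q = fr (msub (ren pm') ta' x) / fr (msub (ren pm') ta' y)"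
  unfolding om_def q(2) by (rule extF_frac[OF msub_inj_hom[OF assms(3,4)] q(1)])
 moreover have "msub (ren pm') ta' y ~= 0" using q(1) by simp
 ultimately have "om ta pm (om ta' pm' q) = fr (msub (ren pm) ta (msub (ren pm') ta' x)) / fr (msub (ren pm) ta (msub (ren pm') ta' y))"
  using extF_frac[OF msub_inj_hom[OF assms(1,2)]] by (simp add: om_def)
 thus ?thesis unfolding ms q(2) om_def extF_frac[OF msub_inj_hom[OF c] q(1)] .
qed

lemma om_id: "om (id :: 'e::field => 'e) id q = q"
proof -
 have ms: "msub (ren id) id u = u" for u :: "'e mp" by (simp add: msub_def psum_def mp_expand)
 obtain x y where q: "y ~= 0" "q = fr x / fr y" by (rule fract_cases_fr)
 show ?thesis unfolding om_def q(2) extF_frac[OF msub_inj_hom[OF id_comm_ring_hom inj_on_id] q(1)] ms ..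
qed

lemma om_id_fun: "om (id :: 'e::field => 'e) id = id" by (rule ext) (simp add: om_id)

lemma om_PS: "comm_ring_hom (ta :: 'e::field => 'e) ==> inj pm ==> q \<in> PS ==> om ta pm q \<in> PS"
 by (auto simp: PS_def om_fr)

lemma inv_comm_ring_hom:
 assumes "comm_ring_hom (ta :: 'e::{finite,field} => 'e)"
 shows "comm_ring_hom (inv_into UNIV ta)" "inv_into UNIV ta \<circ> ta = id" "ta \<circ> inv_into UNIV ta = id"
proof -
 interpret comm_ring_hom ta by fact
 have inj: "inj ta" by (rule field_hom_inj[OF assms])
 have surj: "surj ta" using inj by (simp add: finite_UNIV_inj_surj)
 show c: "inv_into UNIV ta \<circ> ta = id" "ta \<circ> inv_into UNIV ta = id" using inj surj by (simp_all add: inv_o_cancel surj_iff)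
 have i: "inv_into UNIV ta (ta x) = x" and s: "ta (inv_into UNIV ta x) = x" for x using c by (auto simp: fun_eq_iff)
 show "comm_ring_hom (inv_into UNIV ta)"
 proof
  fix x y
  show "inv_into UNIV ta (x + y) = inv_into UNIV ta x + inv_into UNIV ta y" by (rule injD[OF inj]) (simp add: s hom_add)
  show "inv_into UNIV ta (x * y) = inv_into UNIV ta x * inv_into UNIV ta y" by (rule injD[OF inj]) (simp add: s hom_mult)
  show "inv_into UNIV ta 1 = 1" "inv_into UNIV ta 0 = 0" using i[of 1] i[of 0] by auto
 qed
qed

text \<open>Meaningful on \<open>PS\<close> only, where injectivity of \<open>fr\<close> makes the
  polynomial unique.\<close>

definition evF :: "'e::field mp fract => 'e" where "evF q = ev0 (THE u. fr u = q)"

lemma evF_fr [simp]: "evF (fr u) = ev0 u"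
 unfolding evF_def by (simp add: fr.eq_iff)

lemma evF_add: "a \<in> PS ==> b \<in> PS ==> evF (a + b) = evF a + evF b"
 and evF_mult: "a \<in> PS ==> b \<in> PS ==> evF (a * b) = evF a * evF b"
 by (auto simp: PS_def ev0.hom_add ev0.hom_mult simp flip: fr.hom_add fr.hom_mult)

lemma evF_jF [simp]: "evF (jF c) = c" by (simp add: jF_def cst_def ev0_def)

lemma evF_0 [simp]: "evF 0 = 0" using evF_jF[of 0] by simp

lemma evF_sum: "(!!s. s \<in> S ==> f s \<in> PS) ==> evF (sum f S) = (\<Sum>s\<in>S. evF (f s))"
 by (induction S rule: infinite_finite_induct) (auto simp: evF_add PS.S_sum)

text \<open>Permuting the variables does not move the origin, so only the field automorphism
  remains.\<close>

lemma evF_om: "comm_ring_hom (ta :: 'e::field => 'e) ==> inj pm ==> q \<in> PS ==> evF (om ta pm q) = ta (evF q)"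
proof -
 assume *: "comm_ring_hom ta" "inj pm" and "q \<in> PS"
 then interpret monomial_sub ta "ren pm" by (intro monomial_sub_om)
 obtain u where "q = fr u" using \<open>q \<in> PS\<close> by (auto simp: PS_def)
 thus ?thesis using lookup_msub[of u 0] by (simp add: om_fr[OF *] ev0_def)
qed

section \<open>Semilinear intertwiners\<close>

context stage
begin

text \<open>The relation says that the semilinear map with matrix \<open>G\<close> carries the
  action of \<open>rh i\<close> to that of \<open>rh (pm i)\<close>. Invertibility is not imposed,
  because the semilinear components of an invertible additive map can be singular.\<close>

definition GG :: "('e => 'e) => (nat => nat) => 'e rfm set" where
 "GG ta pm = {G \<in> Mat m m. \<forall>i. G * rmap ta (rh i) = rh (pm i) * G}"

lemma GG_Mat: "G \<in> GG ta pm ==> G \<in> Mat m m" and GG_rel: "G \<in> GG ta pm ==> G * rmap ta (rh i) = rh (pm i) * G"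
 by (auto simp: GG_def)

lemma GG_add: "G \<in> GG ta pm ==> H \<in> GG ta pm ==> G + H \<in> GG ta pm"
 by (auto simp: GG_def distrib_left distrib_right intro: Mat_add)

lemma GG_id: "GG id id = AQ" by (auto simp: GG_def AQ_def)

lemma GG_mult:
 assumes "comm_ring_hom ta1" "comm_ring_hom ta2" "G1 \<in> GG ta1 pm1" "G2 \<in> GG ta2 pm2"
 shows "G1 * rmap ta1 G2 \<in> GG (ta1 \<circ> ta2) (pm1 \<circ> pm2)"
proof -
 interpret a: comm_ring_hom ta1 by fact
 interpret b: comm_ring_hom ta2 by fact
 have "G1 * rmap ta1 G2 * rmap (ta1 \<circ> ta2) (rh i) = rh ((pm1 \<circ> pm2) i) * (G1 * rmap ta1 G2)" for i
 proof -
  have "rmap (ta1 \<circ> ta2) (rh i) = rmap ta1 (rmap ta2 (rh i))" by (simp add: rmap_comp)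
  hence "G1 * rmap ta1 G2 * rmap (ta1 \<circ> ta2) (rh i) = G1 * rmap ta1 (G2 * rmap ta2 (rh i))"
   by (simp only: a.rmap_mult mult.assoc)
  also have "... = (G1 * rmap ta1 (rh (pm2 i))) * rmap ta1 G2"
   by (simp only: GG_rel[OF assms(4)] a.rmap_mult mult.assoc)
  finally show ?thesis by (simp only: GG_rel[OF assms(3)] mult.assoc comp_apply)
 qed
 moreover have "G1 * rmap ta1 G2 \<in> Mat m m" using assms(3,4) GG_Mat a.rmap_Mat by blast
 ultimately show ?thesis by (simp add: GG_def)
qed

text \<open>Moving \<open>G\<close> past \<open>XF\<close> permutes the group elements, and
  \<open>om ta pm\<close> permutes the variables in the same way, so the sum is merely
  reordered.\<close>

lemma GG_XF:
 assumes ta: "comm_ring_hom ta" and pm: "pm permutes {..<r}" and G: "G \<in> GG ta pm"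
 shows "rmap jF G * rmap (om ta pm) XF = XF * rmap jF G"
proof -
 have inj: "inj pm" using permutes_inj[OF pm] .
 interpret t: comm_ring_hom ta by fact
 interpret o: inj_comm_ring_hom "om ta pm" by (rule om_hom[OF ta inj])
 have oj: "rmap (om ta pm) (rmap jF A) = rmap jF (rmap ta A)" for A
  by (rule rfm_eqI) (simp add: om_jF[OF ta inj])
 have "rmap jF G * rmap (om ta pm) XF = (\<Sum>i<r. sc (fr (xv (pm i))) (rmap jF (G * rmap ta (rh i)) - rmap jF G))"
  unfolding XF_eq o.rmap_sum o.rmap_sc o.rmap_minus oj sum_distrib_left sc_mult_right om_xv[OF ta inj] o.rmap_ee
  by (simp only: right_diff_distrib jF.rmap_mult MatD(2)[OF jF.rmap_Mat[OF GG_Mat[OF G]]])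
 also have "... = (\<Sum>i<r. sc (fr (xv (pm i))) (rmap jF (rh (pm i) * G) - rmap jF G))"
  by (simp only: GG_rel[OF G])
 also have "... = (\<Sum>i<r. sc (fr (xv i)) (rmap jF (rh i * G) - rmap jF G))"
  by (rule sum.reindex_bij_betw[OF permutes_imp_bij[OF pm]])
 also have "... = XF * rmap jF G"
  unfolding XF_eq sum_distrib_right sc_mult_left
  by (simp only: left_diff_distrib jF.rmap_mult MatD(1)[OF jF.rmap_Mat[OF GG_Mat[OF G]]])
 finally show ?thesis .
qed

end

text \<open>The goal for one elementary abelian group. \<open>Ta ta pm G\<close> is the matrix of a
  \<open>ta\<close>-semilinear map, whence the factor \<open>rmap ta1\<close> in the product rule.
  On \<open>AQ\<close> it realises the Brauer quotient, with kernel \<open>TQ\<close> and all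
  matrices as image.\<close>

locale stage_fun = stage p m r L rh bx be ka cf
 for p m r L and rh bx :: "nat => 'e::{finite,field} rfm" and be ka cf +
 fixes n :: nat and Ta :: "('e => 'e) => (nat => nat) => 'e rfm => 'e rfm"
 assumes n: "n > 0"
  and Mat: "comm_ring_hom ta ==> pm permutes {..<r} ==> G \<in> GG ta pm ==> Ta ta pm G \<in> Mat n n"
  and add: "comm_ring_hom ta ==> pm permutes {..<r} ==> G \<in> GG ta pm ==> H \<in> GG ta pm ==>
    Ta ta pm (G + H) = Ta ta pm G + Ta ta pm H"
  and mult: "comm_ring_hom ta1 ==> comm_ring_hom ta2 ==> pm1 permutes {..<r} ==> pm2 permutes {..<r} ==>
    G1 \<in> GG ta1 pm1 ==> G2 \<in> GG ta2 pm2 ==>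
    Ta (ta1 \<circ> ta2) (pm1 \<circ> pm2) (G1 * rmap ta1 G2) = Ta ta1 pm1 G1 * rmap ta1 (Ta ta2 pm2 G2)"
  and sc: "c \<in> AQ ==> Ta id id (sc x c) = sc x (Ta id id c)" and ee: "Ta id id (ee m) = ee n"
  and ker: "c \<in> AQ ==> Ta id id c = 0 \<longleftrightarrow> c \<in> TQ" and surj: "S \<in> Mat n n ==> \<exists>c\<in>AQ. Ta id id c = S"

theorem (in stage) stage_functor: "\<exists>n Ta. stage_fun p m r L rh bx be ka cf n Ta"
proof -
 obtain n Xi UU where n: "n > 0" and Xi: "Xi \<in> Mat n m" and UU: "UU \<in> Mat m n" and XiU: "Xi * UU = ee n"
  and kill: "!!t. t \<in> TQ ==> Xi * rmap jF t * UU = 0"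
  and mult: "!!og1 og2 G1 G2. comm_ring_hom og1 ==> comm_ring_hom og2 ==> G1 \<in> Mat m m ==> G2 \<in> Mat m m ==>
    G1 * rmap og1 XF = XF * G1 ==> G2 * rmap og2 XF = XF * G2 ==>
    Xi * G1 * rmap og1 UU * rmap og1 (Xi * G2 * rmap og2 UU) = Xi * (G1 * rmap og1 G2) * rmap og1 (rmap og2 UU)"
  and sp: "!!S. S \<in> Mat n n ==> \<exists>c\<in>AF. S = Xi * c * UU"
  by (rule layer) blast
 define N where "N c = Xi * rmap jF c * UU" for c
 have AX: "rmap jF c * rmap id XF = XF * rmap jF c" if "c \<in> AQ" for c
  using GG_XF[OF id_comm_ring_hom permutes_id, of c] that by (simp add: GG_id om_id_fun)
 interpret S: split_stage p m r L rh bx be ka cf n N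
 proof
  show "n > 0" by (fact n)
  show "N c \<in> Mat n n" if "c \<in> AQ" for c
   unfolding N_def by (rule Mat_mult[OF Mat_mult[OF Xi jF.rmap_Mat[OF AQ_Mat[OF that]]] UU])
  show "N (c + d) = N c + N d" for c d by (simp only: N_def jF.rmap_add distrib_left distrib_right)
  show "N (c * d) = N c * N d" if "c \<in> AQ" "d \<in> AQ" for c d
   using mult[OF id_comm_ring_hom id_comm_ring_hom jF.rmap_Mat[OF AQ_Mat[OF that(1)]] jF.rmap_Mat[OF AQ_Mat[OF that(2)]] AX[OF that(1)] AX[OF that(2)]]
   by (simp add: N_def jF.rmap_mult)
  show "N (sc x c) = sc (jF x) (N c)" for x c by (simp only: N_def jF.rmap_sc sc_mult_left sc_mult_right)
  show "N (ee m) = ee n" using XiU MatD(2)[OF Xi] by (simp add: N_def)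
  show "N t = 0" if "t \<in> TQ" for t using kill[OF that] by (simp add: N_def)
  show "S \<in> rv.span (N ` AQ)" if S: "S \<in> Mat n n" for S
  proof -
   obtain c where c: "c \<in> AF" "S = Xi * c * UU" using sp[OF S] by blast
   have "Xi * c * UU \<in> rv.span (N ` AQ)" using c(1)
   proof (induction rule: AF.induct)
    case (AF_const c f)
    have "Xi * sc f (rmap jF c) * UU = sc f (N c)" by (simp only: N_def sc_mult_left sc_mult_right)
    moreover have "sc f (N c) \<in> rv.span (N ` AQ)" by (intro rv.span_scale rv.span_base imageI AF_const)
    ultimately show ?case by (simp only:)
   next
    case (AF_add x y)
    thus ?case by (simp add: distrib_left distrib_right rv.span_add)
   qed (simp add: rv.span_zero)
   thus ?thesis using c(2) by simp
  qed
 qed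
 obtain R P P' where RM: "!!c. c \<in> AQ ==> R c \<in> Mat n n" and ker: "!!c. c \<in> AQ ==> R c = 0 \<longleftrightarrow> c \<in> TQ"
  and surj: "!!S. S \<in> Mat n n ==> \<exists>c\<in>AQ. R c = S"
  and PM: "P \<in> Mat n n" "P' \<in> Mat n n" and PP: "P * P' = ee n" "P' * P = ee n"
  and PN: "!!c. c \<in> AQ ==> P * N c * P' = rmap jF (R c)" by (rule S.splitting) blast
 \<comment> \<open>The action on the layer in a basis in which the fixed algebra acts by constant
   matrices.\<close>
 define Gp where "Gp ta pm G = P * Xi * rmap jF G * rmap (om ta pm) (UU * P')" for ta pm G
 have GpM: "Gp ta pm G \<in> Mat n n" if "comm_ring_hom ta" "inj pm" "G \<in> Mat m m" for ta pm G
 proof -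
  interpret o: inj_comm_ring_hom "om ta pm" by (rule om_hom[OF that(1,2)])
  show ?thesis unfolding Gp_def
   by (rule Mat_mult[OF Mat_mult[OF Mat_mult[OF PM(1) Xi] jF.rmap_Mat[OF that(3)]] o.rmap_Mat[OF Mat_mult[OF UU PM(2)]]])
 qed
 have Gp_add: "Gp ta pm (G + H) = Gp ta pm G + Gp ta pm H" for ta pm G H
  by (simp only: Gp_def jF.rmap_add distrib_left distrib_right)
 have Gp_mult: "Gp ta1 pm1 G1 * rmap (om ta1 pm1) (Gp ta2 pm2 G2) = Gp (ta1 \<circ> ta2) (pm1 \<circ> pm2) (G1 * rmap ta1 G2)"
  if ta: "comm_ring_hom ta1" "comm_ring_hom ta2" and pm: "pm1 permutes {..<r}" "pm2 permutes {..<r}"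
   and G: "G1 \<in> GG ta1 pm1" "G2 \<in> GG ta2 pm2" for ta1 ta2 pm1 pm2 G1 G2
 proof -
  note inj = permutes_inj[OF pm(1)] permutes_inj[OF pm(2)]
  interpret t1: comm_ring_hom ta1 by fact
  interpret o1: inj_comm_ring_hom "om ta1 pm1" by (rule om_hom[OF ta(1) inj(1)])
  interpret o2: inj_comm_ring_hom "om ta2 pm2" by (rule om_hom[OF ta(2) inj(2)])
  have oj: "rmap (om ta1 pm1) (rmap jF A) = rmap jF (rmap ta1 A)" for A
   by (rule rfm_eqI) (simp add: om_jF[OF ta(1) inj(1)])
  have oo: "rmap (om ta1 pm1) (rmap (om ta2 pm2) A) = rmap (om (ta1 \<circ> ta2) (pm1 \<circ> pm2)) A" for A
   using om_comp[OF ta(1) inj(1) ta(2) inj(2)] by (subst rmap_comp) (auto simp: comp_def)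
  let ?A = "Xi * rmap jF G1 * rmap (om ta1 pm1) UU"
  let ?B = "Xi * rmap jF G2 * rmap (om ta2 pm2) UU"
  have e1: "Gp ta1 pm1 G1 = P * ?A * rmap (om ta1 pm1) P'"
   by (simp only: Gp_def o1.rmap_mult mult.assoc)
  have e2: "Gp ta2 pm2 G2 = P * (?B * rmap (om ta2 pm2) P')"
   by (simp only: Gp_def o2.rmap_mult mult.assoc)
  have "Gp ta1 pm1 G1 * rmap (om ta1 pm1) (Gp ta2 pm2 G2)
   = P * ?A * rmap (om ta1 pm1) (P' * P) * rmap (om ta1 pm1) ?B * rmap (om ta1 pm1) (rmap (om ta2 pm2) P')"
   unfolding e1 e2 by (simp only: o1.rmap_mult mult.assoc)
  also have "P * ?A * rmap (om ta1 pm1) (P' * P) = P * ?A"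
  proof -
   have "rmap (om ta1 pm1) UU * ee n = rmap (om ta1 pm1) UU" by (rule MatD(2)[OF o1.rmap_Mat[OF UU]])
   thus ?thesis unfolding PP by (simp only: o1.rmap_ee mult.assoc)
  qed
  also have "P * ?A * rmap (om ta1 pm1) ?B * rmap (om ta1 pm1) (rmap (om ta2 pm2) P')
   = P * (?A * rmap (om ta1 pm1) ?B) * rmap (om ta1 pm1) (rmap (om ta2 pm2) P')" by (simp only: mult.assoc)
  also have "?A * rmap (om ta1 pm1) ?B = Xi * (rmap jF G1 * rmap (om ta1 pm1) (rmap jF G2)) * rmap (om ta1 pm1) (rmap (om ta2 pm2) UU)"
   by (rule mult[OF o1.comm_ring_hom_axioms o2.comm_ring_hom_axioms jF.rmap_Mat[OF GG_Mat[OF G(1)]] jF.rmap_Mat[OF GG_Mat[OF G(2)]]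
      GG_XF[OF ta(1) pm(1) G(1)] GG_XF[OF ta(2) pm(2) G(2)]])
  also have "P * ... * rmap (om ta1 pm1) (rmap (om ta2 pm2) P')
   = P * Xi * rmap jF (G1 * rmap ta1 G2) * (rmap (om ta1 pm1) (rmap (om ta2 pm2) (UU * P')))"
   unfolding oj by (simp only: o1.rmap_mult o2.rmap_mult jF.rmap_mult mult.assoc)
  also have "... = Gp (ta1 \<circ> ta2) (pm1 \<circ> pm2) (G1 * rmap ta1 G2)" unfolding oo Gp_def ..
  finally show ?thesis .
 qed
 have Gp_id: "Gp id id c = rmap jF (R c)" if "c \<in> AQ" for c
  using PN[OF that] by (simp add: Gp_def om_id_fun N_def mult.assoc)
 define ok where "ok ta pm G \<longleftrightarrow> comm_ring_hom ta & pm permutes {..<r} & G \<in> GG ta pm" for ta pm G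
 \<comment> \<open>The set is chosen to be closed in the following sense: an entry of the matrix of
   \<open>G\<close> times the image under \<open>om ta pm\<close> of a member of \<open>Z\<close> is
   again in \<open>Z\<close>, because a matrix unit from \<open>AQ\<close> can be inserted between
   the two factors.\<close>
 define Z where "Z = {ent (Gp ta pm G) h 0 | ta pm G h. ok ta pm G & h < n}"
 have ok1: "ok id id c" if "c \<in> AQ" for c using that GG_id id_comm_ring_hom permutes_id by (auto simp: ok_def)
 have finZ: "finite Z"
 proof (rule finite_subset)
  show "Z \<subseteq> (%(ta, pm, G, h). ent (Gp ta pm G) h 0) ` (UNIV \<times> {pm. pm permutes {..<r}} \<times> Mat m m \<times> {..<n})"
  proof
   fix z assume "z \<in> Z"
   then obtain ta pm G h where "z = ent (Gp ta pm G) h 0" "ok ta pm G" "h < n" by (auto simp: Z_def)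
   thus "z \<in> (%(ta, pm, G, h). ent (Gp ta pm G) h 0) ` (UNIV \<times> {pm. pm permutes {..<r}} \<times> Mat m m \<times> {..<n})"
    by (intro image_eqI[of _ _ "(ta, pm, G, h)"]) (auto simp: ok_def GG_Mat)
  qed
  show "finite ((%(ta, pm, G, h). ent (Gp ta pm G) h 0) ` ((UNIV :: ('e => 'e) set) \<times> {pm. pm permutes {..<r}} \<times> Mat m m \<times> {..<n}))"
   by (intro finite_imageI finite_cartesian_product finite_permutations finite_Mat finite_lessThan) auto
 qed
 have R_ee: "R (ee m) = ee n"
 proof -
  have "rmap jF (R (ee m)) = P * ee n * P'" using PN[OF AQ_ee] S.N_ee by simp
  also have "... = rmap jF (ee n)" using MatD(2)[OF PM(1)] PP(1) by simp
  finally have "ent (rmap jF (R (ee m))) i j = ent (rmap jF (ee n)) i j" for i j by simp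
  thus ?thesis by (intro rfm_eqI) (simp only: jF.ent_rmap_hom jF.eq_iff)
 qed
 have Z1: "1 \<in> Z"
 proof -
  have "ent (Gp id id (ee m)) 0 0 = 1" using n by (simp add: Gp_id[OF AQ_ee] R_ee ent_ee)
  thus ?thesis unfolding Z_def using ok1[OF AQ_ee] n by (intro CollectI exI[of _ id] exI[of _ "ee m"] exI[of _ 0]) auto
 qed
 obtain d where d: "d ~= 0" "!!w. (\<forall>z\<in>Z. w * z \<in> PS) \<longleftrightarrow> w * d \<in> PS"
  using fractional_gcdE[OF fractional_gcd_mp finZ _ Z1] by auto
 \<comment> \<open>The rescaling is a coboundary, so products are preserved; on \<open>AQ\<close>
   the factor is 1.\<close>
 define H where "H ta pm G = sc (om ta pm d / d) (Gp ta pm G)" for ta pm G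
 have HM: "H ta pm G \<in> Mat n n" if "ok ta pm G" for ta pm G
 proof -
  have "comm_ring_hom ta" "pm permutes {..<r}" "G \<in> GG ta pm" using that by (auto simp: ok_def)
  thus ?thesis unfolding H_def by (intro Mat_sc GpM permutes_inj[of pm] GG_Mat[of G ta pm])
 qed
 have H_PS: "ent (H ta pm G) h i \<in> PS" if ok: "ok ta pm G" for ta pm G h i
 proof (cases "h < n & i < n")
  case True
  have ta: "comm_ring_hom ta" and pm: "pm permutes {..<r}" and G: "G \<in> GG ta pm" using ok by (auto simp: ok_def)
  note inj = permutes_inj[OF pm]
  have pm': "inv_into UNIV pm permutes {..<r}" "inv_into UNIV pm \<circ> pm = id" "pm \<circ> inv_into UNIV pm = id"
   using permutes_inv[OF pm] permutes_inv_o[OF pm] by auto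
  note ta' = inv_comm_ring_hom[OF ta]
  interpret t: comm_ring_hom ta by fact
  interpret o: inj_comm_ring_hom "om ta pm" by (rule om_hom[OF ta inj])
  interpret o': inj_comm_ring_hom "om (inv_into UNIV ta) (inv_into UNIV pm)" by (rule om_hom[OF ta'(1) permutes_inj[OF pm'(1)]])
  have oo': "om ta pm (om (inv_into UNIV ta) (inv_into UNIV pm) q) = q" and o'o: "om (inv_into UNIV ta) (inv_into UNIV pm) (om ta pm q) = q" for q
   using om_comp[OF ta inj ta'(1) permutes_inj[OF pm'(1)], of q] om_comp[OF ta'(1) permutes_inj[OF pm'(1)] ta inj, of q] ta' pm' om_id
   by auto
  let ?g = "ent (Gp ta pm G) h i"
  \<comment> \<open>The factor \<open>om ta pm d\<close> in \<open>H\<close> is reached by pulling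
    the multiplier back along the inverse substitution, applying the defining property of
    \<open>d\<close> there, and pushing the result forward again.\<close>
  have "om (inv_into UNIV ta) (inv_into UNIV pm) (?g / d) * z \<in> PS" if zZ: "z \<in> Z" for z
  proof -
   obtain ta2 pm2 G2 k where z: "z = ent (Gp ta2 pm2 G2) k 0" "ok ta2 pm2 G2" "k < n"
    using zZ unfolding Z_def by blast
   have 2: "comm_ring_hom ta2" "pm2 permutes {..<r}" "G2 \<in> GG ta2 pm2" using z by (auto simp: ok_def)
   obtain ep where ep: "ep \<in> AQ" "R ep = un i k" using surj[OF Mat_un] True z(3) by blast
   have epG: "ep * G2 \<in> GG ta2 pm2"
    using GG_mult[OF id_comm_ring_hom 2(1) _ 2(3), of ep id] ep(1) GG_id by simp
   have "Gp ta2 pm2 (ep * G2) = un i k * Gp ta2 pm2 G2"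
    using Gp_mult[OF id_comm_ring_hom 2(1) permutes_id 2(2) _ 2(3), of ep] ep GG_id Gp_id[OF ep(1)] by (simp add: om_id_fun)
   hence "Gp (ta \<circ> ta2) (pm \<circ> pm2) (G * rmap ta (ep * G2)) = Gp ta pm G * un i k * rmap (om ta pm) (Gp ta2 pm2 G2)"
    using Gp_mult[OF ta 2(1) pm 2(2) G epG] by (simp add: o.rmap_mult mult.assoc)
   moreover have "ent (A * un i k * B) h 0 = ent A h i * ent B k 0" for A B :: "'e mp fract rfm"
    by (subst ent_times[of "{k}"]) (auto simp: ent_mult_un)
   ultimately have "?g * om ta pm z = ent (Gp (ta \<circ> ta2) (pm \<circ> pm2) (G * rmap ta (ep * G2))) h 0" using z(1) by simp
   moreover have "ok (ta \<circ> ta2) (pm \<circ> pm2) (G * rmap ta (ep * G2))"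
    unfolding ok_def using comp_comm_ring_hom[OF ta 2(1)] permutes_compose[OF 2(2) pm] GG_mult[OF ta 2(1) G epG] by simp
   ultimately have "?g * om ta pm z \<in> Z" unfolding Z_def using True by blast
   moreover have "\<forall>z\<in>Z. (1 / d) * z \<in> PS" unfolding d(2) using d(1) by simp
   ultimately have "(1 / d) * (?g * om ta pm z) \<in> PS" by blast
   hence "om (inv_into UNIV ta) (inv_into UNIV pm) (?g / d * om ta pm z) \<in> PS"
    using om_PS[OF ta'(1) permutes_inj[OF pm'(1)]] by (simp add: mult.commute mult.left_commute)
   thus ?thesis by (simp only: o'.hom_mult o'o)
  qed
  hence "om (inv_into UNIV ta) (inv_into UNIV pm) (?g / d) * d \<in> PS" using d(2) by blast
  hence "om ta pm (om (inv_into UNIV ta) (inv_into UNIV pm) (?g / d) * d) \<in> PS" by (rule om_PS[OF ta inj])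
  hence "?g / d * om ta pm d \<in> PS" by (simp only: o.hom_mult oo')
  thus ?thesis by (simp add: H_def mult.commute)
 next
  case False
  thus ?thesis using Mat_ent[OF HM[OF ok], of h i] by simp
 qed
 have H_mult: "H ta1 pm1 G1 * rmap (om ta1 pm1) (H ta2 pm2 G2) = H (ta1 \<circ> ta2) (pm1 \<circ> pm2) (G1 * rmap ta1 G2)"
  if ok: "ok ta1 pm1 G1" "ok ta2 pm2 G2" for ta1 ta2 pm1 pm2 G1 G2
 proof -
  have 1: "comm_ring_hom ta1" "pm1 permutes {..<r}" "G1 \<in> GG ta1 pm1" and 2: "comm_ring_hom ta2" "pm2 permutes {..<r}" "G2 \<in> GG ta2 pm2"
   using ok by (auto simp: ok_def)
  interpret o1: inj_comm_ring_hom "om ta1 pm1" by (rule om_hom[OF 1(1) permutes_inj[OF 1(2)]])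
  have "om ta1 pm1 (om ta2 pm2 d / d) * om ta1 pm1 d = om ta1 pm1 (om ta2 pm2 d)"
   unfolding o1.hom_mult[symmetric] using d(1) by simp
  hence "om ta1 pm1 d / d * om ta1 pm1 (om ta2 pm2 d / d) = om (ta1 \<circ> ta2) (pm1 \<circ> pm2) d / d"
   using om_comp[OF 1(1) permutes_inj[OF 1(2)] 2(1) permutes_inj[OF 2(2)], of d] by (simp add: mult.commute)
  thus ?thesis unfolding H_def o1.rmap_sc sc_mult_left sc_mult_right Gp_mult[OF 1(1) 2(1) 1(2) 2(2) 1(3) 2(3)]
   by (simp add: rv.scale_scale mult.commute)
 qed
 define Ta where "Ta ta pm G = mk n n (%h i. evF (ent (H ta pm G) h i))" for ta pm G
 have TaM: "Ta ta pm G \<in> Mat n n" for ta pm G by (simp add: Ta_def)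
 have Tae: "ent (Ta ta pm G) h i = evF (ent (H ta pm G) h i)" if "ok ta pm G" for ta pm G h i
  using Mat_ent[OF HM[OF that], of h i] by (simp add: Ta_def ent_mk)
 have TaR: "Ta id id c = R c" if "c \<in> AQ" for c
  using d(1) by (intro rfm_eqI) (simp add: Tae[OF ok1[OF that]] H_def om_id Gp_id[OF that])
 show ?thesis
 proof (rule exI[of _ n], rule exI[of _ Ta], unfold_locales)
  show "n > 0" by (fact n)
  show "Ta ta pm G \<in> Mat n n" for ta pm G by (fact TaM)
 next
  fix ta pm G G' assume *: "comm_ring_hom ta" "pm permutes {..<r}" "G \<in> GG ta pm" "G' \<in> GG ta pm"
  hence ok: "ok ta pm G" "ok ta pm G'" "ok ta pm (G + G')" using GG_add by (auto simp: ok_def)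
  have "H ta pm (G + G') = H ta pm G + H ta pm G'" by (simp only: H_def Gp_add sc_add_right)
  thus "Ta ta pm (G + G') = Ta ta pm G + Ta ta pm G'"
   using ok H_PS by (intro rfm_eqI) (simp add: Tae evF_add)
 next
  fix ta1 ta2 pm1 pm2 G1 G2
  assume *: "comm_ring_hom ta1" "comm_ring_hom ta2" "pm1 permutes {..<r}" "pm2 permutes {..<r}"
    "G1 \<in> GG ta1 pm1" "G2 \<in> GG ta2 pm2"
  hence ok: "ok ta1 pm1 G1" "ok ta2 pm2 G2" by (auto simp: ok_def)
  have ok3: "ok (ta1 \<circ> ta2) (pm1 \<circ> pm2) (G1 * rmap ta1 G2)"
   unfolding ok_def using comp_comm_ring_hom[OF *(1,2)] permutes_compose[OF *(4,3)] GG_mult[OF *(1,2,5,6)] by simp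
  note inj = permutes_inj[OF *(3)]
  interpret t1: comm_ring_hom ta1 by fact
  interpret o1: inj_comm_ring_hom "om ta1 pm1" by (rule om_hom[OF *(1) inj])
  show "Ta (ta1 \<circ> ta2) (pm1 \<circ> pm2) (G1 * rmap ta1 G2) = Ta ta1 pm1 G1 * rmap ta1 (Ta ta2 pm2 G2)"
  proof (rule rfm_eqI)
   fix h i
   have "ent (Ta (ta1 \<circ> ta2) (pm1 \<circ> pm2) (G1 * rmap ta1 G2)) h i = evF (ent (H ta1 pm1 G1 * rmap (om ta1 pm1) (H ta2 pm2 G2)) h i)"
    by (simp only: Tae[OF ok3] H_mult[OF ok])
   also have "... = evF (\<Sum>k<n. ent (H ta1 pm1 G1) h k * om ta1 pm1 (ent (H ta2 pm2 G2) k i))"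
    by (simp only: ent_mult_Mat[OF HM[OF ok(1)]] o1.ent_rmap_hom)
   also have "... = (\<Sum>k<n. evF (ent (H ta1 pm1 G1) h k * om ta1 pm1 (ent (H ta2 pm2 G2) k i)))"
    by (rule evF_sum) (intro PS.S_mult om_PS H_PS ok *(1) inj)
   also have "... = (\<Sum>k<n. ent (Ta ta1 pm1 G1) h k * ta1 (ent (Ta ta2 pm2 G2) k i))"
    by (simp only: evF_mult[OF H_PS[OF ok(1)] om_PS[OF *(1) inj H_PS[OF ok(2)]]] evF_om[OF *(1) inj H_PS[OF ok(2)]] Tae[OF ok(1)] Tae[OF ok(2)])
   also have "... = ent (Ta ta1 pm1 G1 * rmap ta1 (Ta ta2 pm2 G2)) h i"
    by (simp only: ent_mult_Mat[OF TaM] t1.ent_rmap_hom)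
   finally show "ent (Ta (ta1 \<circ> ta2) (pm1 \<circ> pm2) (G1 * rmap ta1 G2)) h i = ent (Ta ta1 pm1 G1 * rmap ta1 (Ta ta2 pm2 G2)) h i" .
  qed
 next
  fix x c assume c: "c \<in> AQ"
  have "rmap jF (R (sc x c)) = rmap jF (sc x (R c))"
   using PN[OF AQ_sc[OF c, of x]] PN[OF c] by (simp add: S.N_sc[OF c] sc_mult_left sc_mult_right jF.rmap_sc)
  hence "ent (rmap jF (R (sc x c))) i j = ent (rmap jF (sc x (R c))) i j" for i j by simp
  hence "R (sc x c) = sc x (R c)" by (intro rfm_eqI) (simp only: jF.ent_rmap_hom jF.eq_iff)
  thus "Ta id id (sc x c) = sc x (Ta id id c)" by (simp add: TaR c AQ_sc)
 next
  show "Ta id id (ee m) = ee n" by (simp add: TaR AQ_ee R_ee)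
  show "Ta id id c = 0 \<longleftrightarrow> c \<in> TQ" if "c \<in> AQ" for c using ker[OF that] by (simp add: TaR that)
  show "\<exists>c\<in>AQ. Ta id id c = S" if "S \<in> Mat n n" for S using surj[OF that] TaR by metis
 qed
qed

subsection \<open>Central series of a p-group\<close>

text \<open>Class equation: otherwise all conjugacy classes except that of the identity would have
  size divisible by \<open>p\<close>, and so would the number 1.\<close>

lemma (in group) p_group_central_element:
 assumes p: "prime p" "card (carrier G) = p ^ k" "k > 0"
 obtains x where "x \<in> carrier G" "x ~= \<one>" "!!y. y \<in> carrier G ==> x \<otimes> y = y \<otimes> x"
proof -
 have "\<exists>x\<in>carrier G. x ~= \<one> & (\<forall>y\<in>carrier G. x \<otimes> y = y \<otimes> x)"
 proof (rule ccontr)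
  assume *: "\<not> (\<exists>x\<in>carrier G. x ~= \<one> & (\<forall>y\<in>carrier G. x \<otimes> y = y \<otimes> x))"
  let ?ph = "%g. \<lambda>h\<in>carrier G. g \<otimes> h \<otimes> inv g"
  let ?O = "orbits G (carrier G) ?ph"
  interpret A: group_action G "carrier G" ?ph by (rule action_by_conjugation)
  have fin: "finite (carrier G)" using p prime_gt_0_nat[OF p(1)] by (auto simp: Coset.order_def intro: card_ge_0_finite)
  have fO: "finite ?O"
  proof -
   have "?O = orbit G ?ph ` carrier G" by (auto simp: orbits_def)
   thus ?thesis using fin by simp
  qed
  have orb: "p dvd card orb" if orbO: "orb \<in> ?O" and orb1: "orb ~= {\<one>}" for orb
  proof -
   obtain x where x: "x \<in> carrier G" "orb = orbit G ?ph x" using orbO by (auto simp: orbits_def)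
   have "card orb * card (stabilizer G ?ph x) = p ^ k"
    using A.orbit_stabilizer_theorem[OF x(1)] x(2) p(2) unfolding Coset.order_def by simp
   hence "card orb dvd p ^ k" by (rule dvdI[OF sym])
   then obtain i where i: "card orb = p ^ i" using divides_primepow_nat[OF p(1)] by blast
   have "i ~= 0"
   proof
    assume "i = 0"
    moreover have xo: "x \<in> orb" using A.orbit_refl[OF x(1)] x(2) by simp
    ultimately have o1: "orb = {x}" using i by (metis card_1_singletonE power_0 singletonD)
    have "x \<otimes> y = y \<otimes> x" if y: "y \<in> carrier G" for y
    proof -
     have "y \<otimes> x \<otimes> inv y \<in> orb" unfolding x(2) orbit_def using x(1) y by force
     hence "y \<otimes> x \<otimes> inv y = x" using o1 by simp
     hence "y \<otimes> x \<otimes> inv y \<otimes> y = x \<otimes> y" by simp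
     thus ?thesis using x(1) y by (simp add: m_assoc)
    qed
    hence "x = \<one>" using * x(1) by blast
    thus False using orb1 o1 by simp
   qed
   thus ?thesis using i by simp
  qed
  have "{\<one>} \<in> ?O"
  proof -
   have "orbit G ?ph \<one> = {\<one>}" unfolding orbit_def using one_closed by (auto intro!: exI[of _ \<one>])
   thus ?thesis unfolding orbits_def using one_closed by blast
  qed
  have "p ^ k = (\<Sum>x\<in>carrier G. 1)" using p(2) by (simp add: order_def)
  also have "... = (\<Sum>orb\<in>?O. \<Sum>x\<in>orb. 1)" by (rule A.disjoint_sum[OF fin, symmetric])
  also have "... = (\<Sum>orb\<in>?O. card orb)" by simp
  also have "... = card {\<one>} + (\<Sum>orb\<in>?O - {{\<one>}}. card orb)" by (rule sum.remove[OF fO \<open>{\<one>} \<in> ?O\<close>])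
  finally have "p ^ k = 1 + (\<Sum>orb\<in>?O - {{\<one>}}. card orb)" by simp
  moreover have "p dvd (\<Sum>orb\<in>?O - {{\<one>}}. card orb)" by (intro dvd_sum orb) auto
  moreover have "p dvd p ^ k" using p(3) by simp
  ultimately have "p dvd 1 + (\<Sum>orb\<in>?O - {{\<one>}}. card orb)" "p dvd (\<Sum>orb\<in>?O - {{\<one>}}. card orb)" by simp_all
  hence "p dvd 1" using dvd_add_left_iff by blast
  thus False using prime_gt_1_nat[OF p(1)] by simp
 qed
 thus ?thesis using that by blast
qed

text \<open>The elements of order dividing \<open>p\<close> in the centre: an elementary abelian
  characteristic subgroup.\<close>

definition socle :: "nat => ('g, 'b) monoid_scheme => 'g set" where
 "socle p G = {x \<in> carrier G. (\<forall>y\<in>carrier G. x \<otimes>\<^bsub>G\<^esub> y = y \<otimes>\<^bsub>G\<^esub> x) & x [^]\<^bsub>G\<^esub> p = \<one>\<^bsub>G\<^esub>}"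

lemma (in group) socle_nontrivial:
 assumes p: "prime p" "card (carrier G) = p ^ k" "k > 0"
 shows "\<exists>x\<in>socle p G. x ~= \<one>"
proof -
 obtain x where x: "x \<in> carrier G" "x ~= \<one>" "!!y. y \<in> carrier G ==> x \<otimes> y = y \<otimes> x"
  using p_group_central_element[OF p] by blast
 have "ord x dvd p ^ k" using ord_dvd_group_order[OF x(1)] p(2) by (simp add: Coset.order_def)
 then obtain i where i: "ord x = p ^ i" using divides_primepow_nat[OF p(1)] by blast
 have i0: "i > 0" using ord_eq_1[OF x(1)] x(2) i by (cases i) auto
 define y where "y = x [^] (p ^ (i - 1))"
 have "y [^] p = x [^] (p ^ i)" using i0 x(1) unfolding y_def by (simp add: nat_pow_pow power_minus_mult flip: power_Suc2)
 hence "y [^] p = \<one>" using i x(1) by (metis pow_ord_eq_1)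
 moreover have "y ~= \<one>"
 proof
  assume "y = \<one>"
  hence "p ^ i dvd p ^ (i - 1)" using pow_eq_id[OF x(1)] i by (simp add: y_def)
  thus False using i0 prime_gt_1_nat[OF p(1)] by (simp add: dvd_power_iff_le)
 qed
 moreover have "y \<otimes> z = z \<otimes> y" if "z \<in> carrier G" for z
  unfolding y_def using x(1) that x(3) by (intro group_commutes_pow) auto
 ultimately show ?thesis using x(1) by (intro bexI[of _ y]) (auto simp: socle_def y_def)
qed

context group
begin

lemma socleD:
 assumes "x \<in> socle p G"
 shows "x \<in> carrier G" "y \<in> carrier G ==> x \<otimes> y = y \<otimes> x" "x [^] p = \<one>"
 using assms by (auto simp: socle_def)

lemma socle_one: "\<one> \<in> socle p G" by (auto simp: socle_def)

lemma socle_mult: "x \<in> socle p G ==> y \<in> socle p G ==> x \<otimes> y \<in> socle p G"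
proof -
 assume xy: "x \<in> socle p G" "y \<in> socle p G"
 note x = socleD[OF xy(1)] and y = socleD[OF xy(2)]
 have "(x \<otimes> y) \<otimes> z = z \<otimes> (x \<otimes> y)" if z: "z \<in> carrier G" for z
 proof -
  have "(x \<otimes> y) \<otimes> z = x \<otimes> (z \<otimes> y)" using x(1) y z by (simp add: m_assoc)
  also have "... = (x \<otimes> z) \<otimes> y" using x(1) y(1) z by (simp add: m_assoc)
  finally show ?thesis using x(1,2) y(1) z by (simp add: m_assoc)
 qed
 moreover have "(x \<otimes> y) [^] p = \<one>" using pow_mult_distrib[OF x(2)[OF y(1)] x(1) y(1)] x(3) y(3) by simp
 ultimately show ?thesis using x(1) y(1) by (simp add: socle_def)
qed

lemma socle_inv: "x \<in> socle p G ==> inv x \<in> socle p G"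
proof -
 assume x': "x \<in> socle p G"
 note x = socleD[OF x']
 have "inv x \<otimes> z = z \<otimes> inv x" if z: "z \<in> carrier G" for z
 proof -
  have "inv x \<otimes> z = inv x \<otimes> (z \<otimes> x) \<otimes> inv x" using x(1) z by (simp add: m_assoc)
  also have "... = inv x \<otimes> (x \<otimes> z) \<otimes> inv x" using x(2)[OF z] by simp
  also have "... = z \<otimes> inv x" using x(1) z by (simp flip: m_assoc)
  finally show ?thesis .
 qed
 moreover have "(inv x) [^] p = \<one>" using nat_pow_inv[OF x(1), of p] x(3) by simp
 ultimately show ?thesis using x(1) by (simp add: socle_def)
qed

lemma socle_conj: "x \<in> socle p G ==> y \<in> carrier G ==> y \<otimes> x \<otimes> inv y = x"
proof -
 assume x': "x \<in> socle p G" and y: "y \<in> carrier G"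
 note x = socleD[OF x']
 have "y \<otimes> x \<otimes> inv y = x \<otimes> y \<otimes> inv y" using x(2)[OF y] by simp
 thus ?thesis using x(1) y by (simp add: m_assoc)
qed

end

text \<open>The preimage of the socle of the quotient by \<open>K\<close>. It is written with
  commutators and powers instead of cosets, so that invariance under automorphisms and the effect on
  a representation trivial on \<open>K\<close> can be read off elementwise.\<close>

definition upper :: "nat => ('g, 'b) monoid_scheme => 'g set => 'g set" where
 "upper p G K = {g \<in> carrier G. (\<forall>h\<in>carrier G. (g \<otimes>\<^bsub>G\<^esub> h) \<otimes>\<^bsub>G\<^esub> inv\<^bsub>G\<^esub> (h \<otimes>\<^bsub>G\<^esub> g) \<in> K) & g [^]\<^bsub>G\<^esub> p \<in> K}"

context normal
begin

lemma coset_eq_iff: "x \<in> carrier G ==> y \<in> carrier G ==> H #> x = H #> y \<longleftrightarrow> x \<otimes> inv y \<in> H"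
proof
 assume xy: "x \<in> carrier G" "y \<in> carrier G"
 show "x \<otimes> inv y \<in> H" if "H #> x = H #> y"
  using that xy by (metis is_group rcos_module rcos_self subgroup_axioms group.rcos_self)
 show "H #> x = H #> y" if "x \<otimes> inv y \<in> H"
  using that xy by (metis is_group rcos_module repr_independence subgroup_axioms)
qed

lemma upper_eq: "upper p G H = {g \<in> carrier G. H #> g \<in> socle p (G Mod H)}"
proof -
 interpret Q: group "G Mod H" by (rule factorgroup_is_group)
 interpret h: group_hom G "G Mod H" "%x. H #> x"
  by (rule group_hom.intro) (auto simp: is_group Q.is_group group_hom_axioms_def r_coset_hom_Mod)
 have one: "\<one>\<^bsub>G Mod H\<^esub> = H" by (simp add: FactGroup_def)
 have "(\<forall>h\<in>carrier G. (g \<otimes> h) \<otimes> inv (h \<otimes> g) \<in> H) & g [^] p \<in> H \<longleftrightarrow> H #> g \<in> socle p (G Mod H)"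
  if g: "g \<in> carrier G" for g
 proof -
  have "(g \<otimes> h) \<otimes> inv (h \<otimes> g) \<in> H \<longleftrightarrow> (H #> g) \<otimes>\<^bsub>G Mod H\<^esub> (H #> h) = (H #> h) \<otimes>\<^bsub>G Mod H\<^esub> (H #> g)"
   if "h \<in> carrier G" for h
   using coset_eq_iff[of "g \<otimes> h" "h \<otimes> g"] g that by simp
  moreover have "g [^] p \<in> H \<longleftrightarrow> (H #> g) [^]\<^bsub>G Mod H\<^esub> p = \<one>\<^bsub>G Mod H\<^esub>"
   using coset_eq_iff[of "g [^] p" \<one>] g one by (simp add: h.hom_nat_pow[symmetric])
  moreover have "carrier (G Mod H) = (%x. H #> x) ` carrier G" by (auto simp: FactGroup_def RCOSETS_def)
  ultimately show ?thesis using g by (auto simp: socle_def)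
 qed
 thus ?thesis by (auto simp: upper_def)
qed

lemma upper_normal: "normal (upper p G H) G"
proof -
 interpret Q: group "G Mod H" by (rule factorgroup_is_group)
 interpret h: group_hom G "G Mod H" "%x. H #> x"
  by (rule group_hom.intro) (auto simp: is_group Q.is_group group_hom_axioms_def r_coset_hom_Mod)
 let ?S = "socle p (G Mod H)"
 have "subgroup (upper p G H) G"
 proof (rule subgroupI)
  show "upper p G H ~= {}" unfolding upper_eq using Q.socle_one[of p] h.hom_one one_closed by (metis (mono_tags, lifting) empty_iff mem_Collect_eq)
  show "inv a \<in> upper p G H" if "a \<in> upper p G H" for a
   using that Q.socle_inv[of "H #> a" p] h.hom_inv[of a] unfolding upper_eq by (metis (mono_tags, lifting) inv_closed mem_Collect_eq)
  show "a \<otimes> b \<in> upper p G H" if "a \<in> upper p G H" "b \<in> upper p G H" for a b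
   using that Q.socle_mult[of "H #> a" p "H #> b"] h.hom_mult[of a b] unfolding upper_eq by (metis (mono_tags, lifting) m_closed mem_Collect_eq)
 qed (auto simp: upper_def)
 moreover have "x \<otimes> h \<otimes> inv x \<in> upper p G H" if x: "x \<in> carrier G" and h: "h \<in> upper p G H" for x h
 proof -
  have h': "h \<in> carrier G" "H #> h \<in> ?S" using h unfolding upper_eq by auto
  have "H #> (x \<otimes> h \<otimes> inv x) = (H #> x) \<otimes>\<^bsub>G Mod H\<^esub> (H #> h) \<otimes>\<^bsub>G Mod H\<^esub> inv\<^bsub>G Mod H\<^esub> (H #> x)"
   using x h'(1) by (simp only: h.hom_mult h.hom_inv m_closed inv_closed)
  also have "... = H #> h" by (rule Q.socle_conj[OF h'(2) h.hom_closed[OF x]])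
  finally show ?thesis using h' x unfolding upper_eq by simp
 qed
 ultimately show ?thesis by (simp add: normal_inv_iff)
qed

lemma subset_upper: "H \<subseteq> upper p G H"
proof
 fix x assume x: "x \<in> H"
 interpret Q: group "G Mod H" by (rule factorgroup_is_group)
 have xG: "x \<in> carrier G" using x subset by blast
 have "H #> x = \<one>\<^bsub>G Mod H\<^esub>" using coset_join2[OF xG subgroup_axioms x] by (simp add: FactGroup_def)
 thus "x \<in> upper p G H" using xG Q.socle_one[of p] unfolding upper_eq by (metis (mono_tags, lifting) mem_Collect_eq)
qed

lemma upper_strict:
 assumes p: "prime p" "finite (carrier G)" "card (carrier G) = p ^ k" and ne: "H ~= carrier G"
 shows "upper p G H ~= H"
proof -
 interpret Q: group "G Mod H" by (rule factorgroup_is_group)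
 have lag: "card (carrier (G Mod H)) * card H = p ^ k"
  unfolding FactGroup_def using lagrange[OF subgroup_axioms] p(3) by (simp add: Coset.order_def FactGroup_def)
 hence "card (carrier (G Mod H)) dvd p ^ k" by (metis dvd_triv_left)
 then obtain i where i: "card (carrier (G Mod H)) = p ^ i" using divides_primepow_nat[OF p(1)] by blast
 have "i > 0"
 proof (rule ccontr)
  assume "\<not> i > 0"
  hence "card H = card (carrier G)" using lag i p(3) by simp
  thus False using ne card_subset_eq[OF p(2) subset] by blast
 qed
 then obtain x where x: "x \<in> socle p (G Mod H)" "x ~= \<one>\<^bsub>G Mod H\<^esub>" using Q.socle_nontrivial[OF p(1) i] by blast
 then obtain g where g: "g \<in> carrier G" "x = H #> g" by (auto simp: socle_def FactGroup_def RCOSETS_def)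
 hence "g \<in> upper p G H" using x(1) by (simp add: upper_eq)
 moreover have "g \<notin> H" using x(2) g coset_join2[OF g(1) subgroup_axioms] by (auto simp: FactGroup_def)
 ultimately show ?thesis by blast
qed

end

section \<open>The Brauer functor of a p-group\<close>

text \<open>Automorphisms are the identity outside the carrier, so that their equality and
  composition are those of total functions.\<close>

definition aut :: "('g, 'z) monoid_scheme => ('g => 'g) => bool" where
 "aut P pm \<longleftrightarrow> pm permutes carrier P & (\<forall>x\<in>carrier P. \<forall>y\<in>carrier P. pm (x \<otimes>\<^bsub>P\<^esub> y) = pm x \<otimes>\<^bsub>P\<^esub> pm y)"

definition AP :: "('g, 'z) monoid_scheme => nat => ('g => 'e::ring_1 rfm) => 'e rfm set" where
 "AP P m rh = {c \<in> Mat m m. \<forall>g\<in>carrier P. rh g * c = c * rh g}"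

definition XP :: "('g, 'z) monoid_scheme => nat => ('g => nat => nat) => nat set" where
 "XP P L b = {a. a < L & (\<forall>g\<in>carrier P. b g a = a)}"

definition GP :: "('g, 'z) monoid_scheme => nat => ('g => 'e::ring_1 rfm) => ('e => 'e) => ('g => 'g) => 'e rfm set" where
 "GP P m rh ta pm = {G \<in> Mat m m. \<forall>g\<in>carrier P. G * rmap ta (rh g) = rh (pm g) * G}"

text \<open>A semilinear extension of the Brauer homomorphism, whose kernel is described by the coordinates
 at the fixed basis elements as for \<open>TQ\<close>.\<close>

definition is_functor :: "('g, 'z) monoid_scheme => nat => nat => ('g => 'e::field rfm) => ('g => nat => nat) =>
  (nat => 'e rfm => 'e) => nat => (('e => 'e) => ('g => 'g) => 'e rfm => 'e rfm) => bool" where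
 "is_functor P m L rh b cf n Ta \<longleftrightarrow>
  (\<forall>ta pm G. comm_ring_hom ta --> aut P pm --> G \<in> GP P m rh ta pm --> Ta ta pm G \<in> Mat n n) &
  (\<forall>ta pm G H. comm_ring_hom ta --> aut P pm --> G \<in> GP P m rh ta pm --> H \<in> GP P m rh ta pm -->
    Ta ta pm (G + H) = Ta ta pm G + Ta ta pm H) &
  (\<forall>ta1 ta2 pm1 pm2 G1 G2. comm_ring_hom ta1 --> comm_ring_hom ta2 --> aut P pm1 --> aut P pm2 -->
    G1 \<in> GP P m rh ta1 pm1 --> G2 \<in> GP P m rh ta2 pm2 -->
    Ta (ta1 \<circ> ta2) (pm1 \<circ> pm2) (G1 * rmap ta1 G2) = Ta ta1 pm1 G1 * rmap ta1 (Ta ta2 pm2 G2)) &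
  (\<forall>x. \<forall>c\<in>AP P m rh. Ta id id (sc x c) = sc x (Ta id id c)) & Ta id id (ee m) = ee n &
  (\<forall>c\<in>AP P m rh. Ta id id c = 0 \<longleftrightarrow> (\<forall>a\<in>XP P L b. cf a c = 0)) &
  (\<forall>S\<in>Mat n n. \<exists>c\<in>AP P m rh. Ta id id c = S)"

lemma aut_closed: "aut P pm ==> g \<in> carrier P ==> pm g \<in> carrier P"
 by (auto simp: aut_def permutes_in_image)

lemma aut_id: "aut P id" by (auto simp: aut_def permutes_id)

lemma aut_comp: "aut P pm ==> aut P pm' ==> aut P (pm \<circ> pm')"
 unfolding aut_def by (auto intro: permutes_compose simp: permutes_in_image)

lemma central_scalar:
 fixes Z :: "'e::comm_ring_1 rfm"
 assumes Z: "Z \<in> Mat n n" and comm: "!!k l. k < n ==> l < n ==> Z * un k l = un k l * Z"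
 shows "Z = sc (ent Z 0 0) (ee n)"
proof -
 have "Z = (\<Sum>k<n. Z * un k k)" using MatD(2)[OF Z] by (simp add: ee_eq_sum sum_distrib_left)
 also have "... = (\<Sum>k<n. sc (ent Z 0 0) (un k k))"
 proof (rule sum.cong)
  fix k assume "k \<in> {..<n}"
  hence "Z * un k 0 * un 0 k = un k 0 * Z * un 0 k" using comm by simp
  thus "Z * un k k = sc (ent Z 0 0) (un k k)" by (simp add: un_sandwich) (simp add: mult.assoc)
 qed simp
 finally show ?thesis by (simp add: ee_eq_sum sc_sum_right)
qed

text \<open>A matrix algebra with a basis permuted under conjugation by \<open>P\<close>.
  Faithfulness is left open: \<open>P\<close> stays the same throughout the induction while the
  subgroup acting trivially grows.\<close>

locale drep = group P for P :: "('g, 'z) monoid_scheme" (structure) +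
 fixes p m L :: nat and rh :: "'g => 'e::{finite,field} rfm" and bx :: "nat => 'e rfm"
  and b :: "'g => nat => nat" and ka :: "nat => nat => nat => 'e" and cf :: "nat => 'e rfm => 'e"
 assumes prime_p: "prime p" and pE: "of_nat p = (0::'e)"
  and rh_Mat: "g \<in> carrier P ==> rh g \<in> Mat m m"
  and rh_mult: "g \<in> carrier P ==> h \<in> carrier P ==> rh (g \<otimes> h) = rh g * rh h"
  and rh_one: "rh \<one> = ee m"
  and bx_Mat: "a < L ==> bx a \<in> Mat m m"
  and cf_def: "cf a M = (\<Sum>i<m. \<Sum>j<m. ka a i j * ent M i j)"
  and cf_bx: "a < L ==> a' < L ==> cf a (bx a') = (if a = a' then 1 else 0)"
  and span: "M \<in> Mat m m ==> (\<Sum>a<L. sc (cf a M) (bx a)) = M"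
  and b_L: "g \<in> carrier P ==> a < L ==> b g a < L"
  and b_conj: "g \<in> carrier P ==> a < L ==> rh g * bx (b g a) = bx a * rh g"
  and fixpt: "\<exists>a<L. \<forall>g\<in>carrier P. b g a = a"
begin

text \<open>The case without generators, through which the coordinate lemmas of \<open>stage\<close>
  become available here.\<close>

lemma trivial_stage: "stage p m 0 L (%_. ee m) bx (%_ a. a) ka cf"
proof -
 have "ee m ^ p = (ee m :: 'e rfm)"
  using prime_gt_0_nat[OF prime_p] by (induction p rule: nat_induct_non_zero) auto
 thus ?thesis
  by unfold_locales (use prime_p pE bx_Mat cf_def cf_bx span fixpt MatD[OF bx_Mat] in \<open>auto\<close>)
qed

lemma rh_inv: "g \<in> carrier P ==> rh (inv g) * rh g = ee m" and rh_inv': "g \<in> carrier P ==> rh g * rh (inv g) = ee m"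
 using rh_mult[of "inv g" g] rh_mult[of g "inv g"] rh_one by auto

lemma rh_cancel: "g \<in> carrier P ==> rh g * x = rh g * y ==> ee m * x = ee m * y"
 using rh_inv[of g] by (metis mult.assoc)

lemma b_eqI: "g \<in> carrier P ==> a < L ==> a' < L ==> rh g * bx a' = bx a * rh g ==> b g a = a'"
proof -
 assume *: "g \<in> carrier P" "a < L" "a' < L" "rh g * bx a' = bx a * rh g"
 interpret S: stage p m 0 L "%_. ee m" bx "%_ a. a" ka cf by (rule trivial_stage)
 have "ee m * bx (b g a) = ee m * bx a'" using * b_conj by (intro rh_cancel[of g]) auto
 thus ?thesis using * S.bx_inj[OF b_L] MatD(1)[OF bx_Mat] b_L by metis
qed

lemma b_inj: "g \<in> carrier P ==> a < L ==> a' < L ==> b g a = b g a' ==> a = a'"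
proof -
 assume *: "g \<in> carrier P" "a < L" "a' < L" "b g a = b g a'"
 interpret S: stage p m 0 L "%_. ee m" bx "%_ a. a" ka cf by (rule trivial_stage)
 have "bx a * rh g * rh (inv g) = bx a' * rh g * rh (inv g)" using * b_conj[of g a] b_conj[of g a'] by simp
 hence "bx a = bx a'" using * rh_inv' MatD(2)[OF bx_Mat] by (simp add: mult.assoc)
 thus ?thesis using * S.bx_inj by blast
qed

lemma b_bij: "g \<in> carrier P ==> bij_betw (b g) {..<L} {..<L}"
proof -
 assume g: "g \<in> carrier P"
 have inj: "inj_on (b g) {..<L}" using b_inj[OF g] by (auto simp: inj_on_def)
 moreover have "b g ` {..<L} \<subseteq> {..<L}" using b_L[OF g] by auto
 hence "b g ` {..<L} = {..<L}" using inj by (intro endo_inj_surj) auto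
 ultimately show ?thesis by (simp add: bij_betw_def)
qed

lemma cf_lin: "a < L ==> cf a (\<Sum>j<L. sc (u j) (bx j)) = u a"
proof -
 assume a: "a < L"
 interpret S: stage p m 0 L "%_. ee m" bx "%_ a. a" ka cf by (rule trivial_stage)
 show ?thesis by (rule S.cf_lin[OF a])
qed

lemma cf_fixed:
 assumes c: "c \<in> AP P m rh" and g: "g \<in> carrier P" and a: "a < L"
 shows "cf (b g a) c = cf a c"
proof -
 have cM: "c \<in> Mat m m" using c by (simp add: AP_def)
 have "rh g * c = rh g * (\<Sum>a<L. sc (cf (b g a) c) (bx (b g a)))"
  using sum.reindex_bij_betw[OF b_bij[OF g], of "%a. sc (cf a c) (bx a)"] span[OF cM] by simp
 moreover have "c * rh g = rh g * (\<Sum>a<L. sc (cf a c) (bx (b g a)))"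
 proof -
  have "c * rh g = (\<Sum>a<L. sc (cf a c) (bx a * rh g))"
   by (subst span[OF cM, symmetric]) (simp add: sum_distrib_right sc_mult_left)
  also have "... = (\<Sum>a<L. sc (cf a c) (rh g * bx (b g a)))" using b_conj[OF g] by simp
  finally show ?thesis by (simp add: sum_distrib_left sc_mult_right)
 qed
 ultimately have "rh g * (\<Sum>a<L. sc (cf (b g a) c) (bx (b g a))) = rh g * (\<Sum>a<L. sc (cf a c) (bx (b g a)))"
  using c g by (simp add: AP_def)
 hence "ee m * (\<Sum>a<L. sc (cf (b g a) c) (bx (b g a))) = ee m * (\<Sum>a<L. sc (cf a c) (bx (b g a)))"
  by (rule rh_cancel[OF g])
 moreover have sM: "(\<Sum>a<L. sc (u a) (bx (b g a))) \<in> Mat m m" for u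
  using bx_Mat b_L[OF g] by (intro Mat_sum Mat_sc) auto
 ultimately have eq: "(\<Sum>a<L. sc (cf (b g a) c) (bx (b g a))) = (\<Sum>a<L. sc (cf a c) (bx (b g a)))"
  by (simp only: MatD(1)[OF sM])
 let ?i = "inv_into {..<L} (b g)"
 have i: "?i (b g a) = a" if "a < L" for a
  using bij_betw_inv_into_left[OF b_bij[OF g]] that by simp
 have "(\<Sum>a<L. sc (cf a c) (bx a)) = (\<Sum>a<L. sc (cf (?i a) c) (bx a))"
  using eq sum.reindex_bij_betw[OF b_bij[OF g], of "%a. sc (cf a c) (bx a)"]
   sum.reindex_bij_betw[OF b_bij[OF g], of "%a. sc (cf (?i a) c) (bx a)"] by (simp add: i)
 hence "cf (b g a) (\<Sum>a<L. sc (cf a c) (bx a)) = cf (b g a) (\<Sum>a<L. sc (cf (?i a) c) (bx a))" by simp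
 thus ?thesis using cf_lin[OF b_L[OF g a]] i[OF a] by simp
qed

lemma functor_trivial:
 assumes "!!g. g \<in> carrier P ==> rh g = ee m"
 shows "is_functor P m L rh b cf m (%ta pm G. G)"
proof -
 interpret S: stage p m 0 L "%_. ee m" bx "%_ a. a" ka cf by (rule trivial_stage)
 have "rh g * c = c * rh g" if "c \<in> Mat m m" "g \<in> carrier P" for c g
  using assms[OF that(2)] MatD[OF that(1)] by simp
 hence A: "AP P m rh = Mat m m" by (auto simp: AP_def)
 have "b g a = a" if "g \<in> carrier P" "a < L" for g a
  using assms[OF that(1)] that MatD[OF bx_Mat[OF that(2)]] by (intro b_eqI) auto
 hence X: "XP P L b = {..<L}" by (auto simp: XP_def)
 have "c = 0 \<longleftrightarrow> (\<forall>a\<in>{..<L}. cf a c = 0)" if "c \<in> Mat m m" for c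
  using span[OF that] S.cf_0 by auto
 thus ?thesis unfolding is_functor_def A X by (auto simp: GP_def)
qed

end

text \<open>\<open>Q\<close> acts centrally and with exponent dividing \<open>p\<close>. All its
  elements are listed as generators by \<open>q\<close>, so that every automorphism of
  \<open>P\<close> permutes the generators and with them the variables.\<close>

locale dstep = drep P p m L rh bx b ka cf
 for P :: "('g, 'z) monoid_scheme" (structure) and p m L and rh :: "'g => 'e::{finite,field} rfm" and bx b ka cf +
 fixes Q :: "'g set" and r :: nat and q :: "nat => 'g"
 assumes Q_sub: "Q \<subseteq> carrier P" and Q_aut: "aut P pm ==> g \<in> Q ==> pm g \<in> Q"
  and Q_comm: "g \<in> Q ==> h \<in> carrier P ==> rh g * rh h = rh h * rh g" and Q_p: "g \<in> Q ==> rh g ^ p = ee m"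
  and q_bij: "bij_betw q {..<r} Q"
begin

lemma q_Q: "i < r ==> q i \<in> Q" and q_P: "i < r ==> q i \<in> carrier P"
 using q_bij Q_sub by (auto simp: bij_betw_def)

definition rhs :: "nat => 'e rfm" where "rhs i = (if i < r then rh (q i) else ee m)"
definition bes :: "nat => nat => nat" where "bes i a = (if i < r & a < L then b (q i) a else a)"

sublocale S: stage p m r L rhs bx bes ka cf
proof
 have eep: "ee m ^ p = (ee m :: 'e rfm)"
  using prime_gt_0_nat[OF prime_p] by (induction p rule: nat_induct_non_zero) auto
 show "prime p" "of_nat p = (0::'e)" by (fact prime_p pE)+
 show "rhs i \<in> Mat m m" for i using rh_Mat q_P by (simp add: rhs_def)
 show "i \<ge> r ==> rhs i = ee m" for i by (simp add: rhs_def)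
 show "rhs i * rhs j = rhs j * rhs i" for i j
  using Q_comm[OF q_Q q_P] MatD[OF rh_Mat[OF q_P]] by (simp add: rhs_def)
 show "rhs i ^ p = ee m" for i using Q_p q_Q eep by (simp add: rhs_def)
 show "a < L ==> bx a \<in> Mat m m" for a by (rule bx_Mat)
 show "cf a M = (\<Sum>i<m. \<Sum>j<m. ka a i j * ent M i j)" for a M by (rule cf_def)
 show "a < L ==> a' < L ==> cf a (bx a') = (if a = a' then 1 else 0)" for a a' by (rule cf_bx)
 show "M \<in> Mat m m ==> (\<Sum>a<L. sc (cf a M) (bx a)) = M" for M by (rule span)
 show "a < L ==> bes i a < L" for a i using b_L q_P by (simp add: bes_def)
 show "L \<le> a ==> bes i a = a" for a i by (simp add: bes_def)
 show "a < L ==> rhs i * bx (bes i a) = bx a * rhs i" for a i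
  using b_conj[OF q_P] MatD[OF bx_Mat[of a]] by (simp add: rhs_def bes_def)
 show "\<exists>a<L. \<forall>i<r. bes i a = a" using fixpt q_P by (auto simp: bes_def)
qed

lemma AQ_iff: "c \<in> S.AQ \<longleftrightarrow> c \<in> Mat m m & (\<forall>g\<in>Q. rh g * c = c * rh g)"
proof -
 have "(\<forall>i. rhs i * c = c * rhs i) \<longleftrightarrow> (\<forall>g\<in>Q. rh g * c = c * rh g)" if c: "c \<in> Mat m m"
 proof -
  have "(\<forall>g\<in>Q. rh g * c = c * rh g) \<longleftrightarrow> (\<forall>i<r. rh (q i) * c = c * rh (q i))"
   using q_bij by (auto simp: bij_betw_def)
  thus ?thesis using MatD[OF c] by (auto simp: rhs_def)
 qed
 thus ?thesis by (auto simp: S.AQ_def)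
qed

lemma AP_AQ: "c \<in> AP P m rh ==> c \<in> S.AQ" using Q_sub by (auto simp: AP_def AQ_iff)

lemma rh_AQ: "g \<in> carrier P ==> rh g \<in> S.AQ" using Q_comm rh_Mat by (auto simp: AQ_iff)

lemma FX_iff: "a \<in> S.FX \<longleftrightarrow> a < L & (\<forall>g\<in>Q. b g a = a)"
proof -
 have "(\<forall>g\<in>Q. b g a = a) \<longleftrightarrow> (\<forall>i<r. b (q i) a = a)" using q_bij by (auto simp: bij_betw_def)
 thus ?thesis by (auto simp: S.FX_def bes_def)
qed

text \<open>The action of \<open>Q\<close> is central, so conjugation by \<open>P\<close> preserves
  \<open>AQ\<close> and hence the set of basis elements fixed by \<open>Q\<close>.\<close>

lemma b_FX: "g \<in> carrier P ==> a \<in> S.FX ==> b g a \<in> S.FX"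
proof -
 assume g: "g \<in> carrier P" and a: "a \<in> S.FX"
 have aL: "a < L" using a FX_iff by simp
 have "bx (b g a) = rh (inv g) * (rh g * bx (b g a))"
  using rh_inv[OF g] MatD(1)[OF bx_Mat[OF b_L[OF g aL]]] by (simp flip: mult.assoc)
 also have "... = rh (inv g) * bx a * rh g" using b_conj[OF g aL] by (simp add: mult.assoc)
 finally have "bx (b g a) \<in> S.AQ" using S.AQ_mult rh_AQ S.bx_AQ[OF a] g by simp
 hence "b h (b g a) = b g a" if "h \<in> Q" for h
  using that AQ_iff Q_sub b_L[OF g aL] by (intro b_eqI) auto
 thus ?thesis using FX_iff b_L[OF g aL] by simp
qed

definition ix :: "('g => 'g) => nat => nat" where
 "ix pm i = (if i < r then inv_into {..<r} q (pm (q i)) else i)"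

lemma inv_q: "i < r ==> inv_into {..<r} q (q i) = i"
 using bij_betw_inv_into_left[OF q_bij] by simp

lemma q_inv: "g \<in> Q ==> q (inv_into {..<r} q g) = g" "g \<in> Q ==> inv_into {..<r} q g < r"
 using bij_betw_inv_into_right[OF q_bij] bij_betw_inv_into[OF q_bij] by (auto simp: bij_betw_def)

lemma q_ix: "aut P pm ==> i < r ==> q (ix pm i) = pm (q i)" and ix_r: "aut P pm ==> i < r ==> ix pm i < r"
 using q_inv Q_aut q_Q by (auto simp: ix_def)

lemma ix_id: "ix id = id" by (rule ext) (simp add: ix_def inv_q)

lemma ix_comp: "aut P pm ==> aut P pm' ==> ix (pm \<circ> pm') = ix pm \<circ> ix pm'"
proof
 fix i assume *: "aut P pm" "aut P pm'"
 show "ix (pm \<circ> pm') i = (ix pm \<circ> ix pm') i"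
 proof (cases "i < r")
  case True
  have "q (ix (pm \<circ> pm') i) = q (ix pm (ix pm' i))"
   using q_ix[OF aut_comp[OF *] True] q_ix[OF *(2) True] q_ix[OF *(1) ix_r[OF *(2) True]] by simp
  thus ?thesis using inv_q ix_r[OF aut_comp[OF *] True] ix_r[OF *(1) ix_r[OF *(2) True]] by (metis comp_apply)
 qed (simp add: ix_def)
qed

lemma ix_permutes: "aut P pm ==> ix pm permutes {..<r}"
proof (rule bij_imp_permutes)
 assume pm: "aut P pm"
 have inj: "inj_on (ix pm) {..<r}"
 proof (rule inj_onI)
  fix i j assume ij: "i \<in> {..<r}" "j \<in> {..<r}" "ix pm i = ix pm j"
  hence "pm (q i) = pm (q j)" using q_ix[OF pm, of i] q_ix[OF pm, of j] by simp
  hence "q i = q j" using pm permutes_inj[of pm "carrier P"] by (auto simp: aut_def inj_def)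
  hence "inv_into {..<r} q (q i) = inv_into {..<r} q (q j)" by simp
  thus "i = j" using ij by (simp add: inv_q)
 qed
 moreover have "ix pm ` {..<r} \<subseteq> {..<r}" using ix_r[OF pm] by auto
 hence "ix pm ` {..<r} = {..<r}" using inj by (intro endo_inj_surj) auto
 ultimately show "bij_betw (ix pm) {..<r} {..<r}" by (simp add: bij_betw_def)
qed (simp add: ix_def)

lemma GP_GG: "aut P pm ==> comm_ring_hom ta ==> G \<in> GP P m rh ta pm ==> G \<in> S.GG ta (ix pm)"
proof -
 assume pm: "aut P pm" and ta: "comm_ring_hom ta" and G: "G \<in> GP P m rh ta pm"
 interpret t: comm_ring_hom ta by fact
 have GM: "G \<in> Mat m m" using G by (simp add: GP_def)
 have "G * rmap ta (rhs i) = rhs (ix pm i) * G" for i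
 proof (cases "i < r")
  case True
  thus ?thesis using G q_P[OF True] ix_r[OF pm True] q_ix[OF pm True] by (simp add: GP_def rhs_def)
 next
  case False
  thus ?thesis using MatD[OF GM] by (simp add: rhs_def ix_def)
 qed
 thus ?thesis using GM by (simp add: S.GG_def)
qed

end

locale dfun = dstep P p m L rh bx b ka cf Q r q
 for P :: "('g, 'z) monoid_scheme" (structure) and p m L and rh :: "'g => 'e::{finite,field} rfm" and bx b ka cf Q r q +
 fixes n1 :: nat and Ta1 :: "('e => 'e) => (nat => nat) => 'e rfm => 'e rfm" and L1 :: nat and e :: "nat => nat"
 assumes fn: "stage_fun p m r L rhs bx bes ka cf n1 Ta1"
  and e_bij: "bij_betw e {..<L1} S.FX"
begin

lemmas n1 = stage_fun.n[OF fn] and Ta1_Mat = stage_fun.Mat[OF fn] and Ta1_add = stage_fun.add[OF fn]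
 and Ta1_mult = stage_fun.mult[OF fn] and Ta0_sc = stage_fun.sc[OF fn] and Ta0_ee = stage_fun.ee[OF fn]
 and Ta0_ker = stage_fun.ker[OF fn] and Ta0_surj = stage_fun.surj[OF fn]

abbreviation Ta0 :: "'e rfm => 'e rfm" where "Ta0 \<equiv> Ta1 id id"

lemma Ta0_Mat: "c \<in> S.AQ ==> Ta0 c \<in> Mat n1 n1"
 and Ta0_add: "c \<in> S.AQ ==> d \<in> S.AQ ==> Ta0 (c + d) = Ta0 c + Ta0 d"
 and Ta0_mult: "c \<in> S.AQ ==> d \<in> S.AQ ==> Ta0 (c * d) = Ta0 c * Ta0 d"
 using Ta1_Mat[OF id_comm_ring_hom permutes_id, of c] Ta1_add[OF id_comm_ring_hom permutes_id, of c d]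
  Ta1_mult[OF id_comm_ring_hom id_comm_ring_hom permutes_id permutes_id, of c d] by (simp_all add: S.GG_id)

lemma Ta0_0: "Ta0 0 = 0" using Ta0_sc[OF S.AQ_0, of 0] by simp

lemma Ta0_minus: "c \<in> S.AQ ==> d \<in> S.AQ ==> Ta0 (c - d) = Ta0 c - Ta0 d"
 using Ta0_add[of "c - d" d] S.AQ_minus[of c d] by (simp add: algebra_simps)

lemma Ta0_sum: "(!!s. s \<in> I ==> f s \<in> S.AQ) ==> Ta0 (sum f I) = (\<Sum>s\<in>I. Ta0 (f s))"
 by (induction I rule: infinite_finite_induct) (auto simp: Ta0_0 Ta0_add S.AQ_sum)

lemma Ta0_power: "k > 0 ==> c \<in> S.AQ ==> c ^ k \<in> S.AQ & Ta0 (c ^ k) = Ta0 c ^ k"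
 by (induction k rule: nat_induct_non_zero) (auto simp: S.AQ_mult Ta0_mult)

definition rh1 :: "'g => 'e rfm" where "rh1 g = Ta0 (rh g)"

text \<open>The image of \<open>Q\<close> is central, hence scalar, and the only \<open>p\<close>-th root of unity is 1.\<close>

lemma rh1_Q: "g \<in> Q ==> rh1 g = ee n1"
proof -
 assume g: "g \<in> Q"
 hence gP: "g \<in> carrier P" using Q_sub by blast
 let ?Z = "rh1 g"
 have ZM: "?Z \<in> Mat n1 n1" unfolding rh1_def by (rule Ta0_Mat[OF rh_AQ[OF gP]])
 have "?Z * T = T * ?Z" if T: "T \<in> Mat n1 n1" for T
 proof -
  obtain c where c: "c \<in> S.AQ" "Ta0 c = T" using Ta0_surj[OF T] by blast
  have "rh g * c = c * rh g" using c(1) g AQ_iff by blast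
  thus ?thesis unfolding rh1_def c(2)[symmetric] using Ta0_mult[OF c(1) rh_AQ[OF gP]] Ta0_mult[OF rh_AQ[OF gP] c(1)] by simp
 qed
 hence Zs: "?Z = sc (ent ?Z 0 0) (ee n1)" using ZM by (intro central_scalar) (auto intro: Mat_un)
 define z where "z = ent ?Z 0 0"
 have "?Z ^ p = ee n1"
  unfolding rh1_def using Ta0_power[OF prime_gt_0_nat[OF prime_p] rh_AQ[OF gP]] Q_p[OF g] Ta0_ee by simp
 moreover have "sc z (ee n1) ^ k = sc (z ^ k) (ee n1)" if "k > 0" for k
  using that by (induction k rule: nat_induct_non_zero) (auto simp: sc_mult_left sc_mult_right)
 ultimately have "sc (z ^ p) (ee n1) = (ee n1 :: 'e rfm)" using Zs prime_gt_0_nat[OF prime_p] by (simp add: z_def)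
 hence "ent (sc (z ^ p) (ee n1)) 0 0 = ent (ee n1 :: 'e rfm) 0 0" by simp
 hence "z ^ p = 1" using n1 by (simp add: ent_ee)
 moreover have "((z - 1) + 1) ^ p = (z - 1) ^ p + 1 ^ p" by (rule frobenius_commuting[OF prime_p pE]) simp
 ultimately have "z = 1" by simp
 thus ?thesis using Zs by (simp add: z_def)
qed

text \<open>An arbitrary section of the surjection \<open>Ta0\<close>. Its ambiguity lies in
  \<open>TQ\<close>, so the coordinates at \<open>FX\<close>, from which \<open>cf1\<close> is
  built, do not see it.\<close>

definition si :: "'e rfm => 'e rfm" where "si M = (SOME c. c \<in> S.AQ & Ta0 c = M)"

lemma si: "M \<in> Mat n1 n1 ==> si M \<in> S.AQ & Ta0 (si M) = M"
proof -
 assume "M \<in> Mat n1 n1"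
 hence "\<exists>c. c \<in> S.AQ & Ta0 c = M" using Ta0_surj[of M] by blast
 thus ?thesis unfolding si_def by (rule someI_ex)
qed

definition ka1 :: "nat => nat => nat => 'e" where "ka1 j i k = cf (e j) (si (un i k))"
definition cf1 :: "nat => 'e rfm => 'e" where "cf1 j M = (\<Sum>i<n1. \<Sum>k<n1. ka1 j i k * ent M i k)"
definition bx1 :: "nat => 'e rfm" where "bx1 j = Ta0 (bx (e j))"
definition b1 :: "'g => nat => nat" where "b1 g j = inv_into {..<L1} e (b g (e j))"

lemma e_FX: "j < L1 ==> e j \<in> S.FX" using e_bij by (auto simp: bij_betw_def)

lemma Ta0_combination: "Ta0 (\<Sum>j<L1. sc (u j) (bx (e j))) = (\<Sum>j<L1. sc (u j) (bx1 j))"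
proof -
 have A: "bx (e j) \<in> S.AQ" if "j < L1" for j using S.bx_AQ e_FX that by blast
 have "Ta0 (\<Sum>j<L1. sc (u j) (bx (e j))) = (\<Sum>j<L1. Ta0 (sc (u j) (bx (e j))))"
  by (rule Ta0_sum) (use A S.AQ_sc in simp)
 also have "... = (\<Sum>j<L1. sc (u j) (bx1 j))" by (intro sum.cong refl) (use A Ta0_sc in \<open>simp add: bx1_def\<close>)
 finally show ?thesis .
qed

lemma cf1_Ta0: "c \<in> S.AQ ==> j < L1 ==> cf1 j (Ta0 c) = cf (e j) c"
proof -
 assume c: "c \<in> S.AQ" and j: "j < L1"
 let ?d = "\<Sum>i<n1. \<Sum>k<n1. sc (ent (Ta0 c) i k) (si (un i k))"
 have siA: "si (un i k) \<in> S.AQ" "Ta0 (si (un i k)) = un i k" if "i < n1" "k < n1" for i k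
  using si[OF Mat_un[OF that]] by auto
 have inner: "(\<Sum>k<n1. sc (ent (Ta0 c) i k) (si (un i k))) \<in> S.AQ" if "i < n1" for i
  using that siA by (intro S.AQ_sum S.AQ_sc) auto
 have d: "?d \<in> S.AQ" by (rule S.AQ_sum) (use inner in simp)
 have "Ta0 ?d = (\<Sum>i<n1. Ta0 (\<Sum>k<n1. sc (ent (Ta0 c) i k) (si (un i k))))" by (rule Ta0_sum) (use inner in auto)
 also have "... = (\<Sum>i<n1. \<Sum>k<n1. sc (ent (Ta0 c) i k) (un i k))"
  by (intro sum.cong refl, subst Ta0_sum) (auto simp: S.AQ_sc siA Ta0_sc)
 also have "... = Ta0 c" using Mat_expand[OF Ta0_Mat[OF c]] by simp
 finally have "c - ?d \<in> S.TQ" using Ta0_ker[OF S.AQ_minus[OF c d]] Ta0_minus[OF c d] by simp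
 hence "cf (e j) (c - ?d) = 0" using e_FX[OF j] by (simp add: S.TQ_def)
 thus ?thesis unfolding cf1_def ka1_def by (simp add: S.cf_minus S.cf_sum S.cf_sc mult.commute)
qed

lemma e_b1: "g \<in> carrier P ==> j < L1 ==> e (b1 g j) = b g (e j)" and b1_L: "g \<in> carrier P ==> j < L1 ==> b1 g j < L1"
 using bij_betw_inv_into_right[OF e_bij b_FX[OF _ e_FX]] bij_betwE[OF bij_betw_inv_into[OF e_bij]] b_FX[OF _ e_FX]
 by (auto simp: b1_def)

lemma e_L: "j < L1 ==> e j < L" using e_FX FX_iff by blast

lemma e_inj: "j < L1 ==> k < L1 ==> e j = e k ==> j = k" using e_bij by (auto simp: bij_betw_def inj_on_def)

lemma e_surj: "a \<in> S.FX ==> \<exists>j<L1. a = e j" using e_bij by (auto simp: bij_betw_def)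

lemma XP_FX: "a \<in> XP P L b ==> a \<in> S.FX" using Q_sub by (auto simp: XP_def FX_iff)

text \<open>The Brauer quotient for \<open>Q\<close> inherits the whole structure: the images of the
  basis elements fixed by \<open>Q\<close> form a basis permuted by \<open>P\<close>, and an element
  of it fixed by all of \<open>P\<close> remains.\<close>

lemma drep1: "drep P p n1 L1 rh1 bx1 b1 ka1 cf1"
proof (intro drep.intro drep_axioms.intro)
 show "group P" by (fact is_group)
 show "prime p" "of_nat p = (0::'e)" by (fact prime_p pE)+
 show "rh1 g \<in> Mat n1 n1" if "g \<in> carrier P" for g unfolding rh1_def by (rule Ta0_Mat[OF rh_AQ[OF that]])
 show "rh1 (g \<otimes> h) = rh1 g * rh1 h" if "g \<in> carrier P" "h \<in> carrier P" for g h
  unfolding rh1_def rh_mult[OF that] by (rule Ta0_mult[OF rh_AQ rh_AQ]) (fact that)+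
 show "rh1 \<one> = ee n1" by (simp add: rh1_def rh_one Ta0_ee)
 show "bx1 a \<in> Mat n1 n1" if "a < L1" for a unfolding bx1_def by (rule Ta0_Mat[OF S.bx_AQ[OF e_FX[OF that]]])
 show "cf1 a M = (\<Sum>i<n1. \<Sum>j<n1. ka1 a i j * ent M i j)" for a M by (fact cf1_def)
 show "cf1 a (bx1 a') = (if a = a' then 1 else 0)" if "a < L1" "a' < L1" for a a'
  unfolding bx1_def cf1_Ta0[OF S.bx_AQ[OF e_FX[OF that(2)]] that(1)] cf_bx[OF e_L[OF that(1)] e_L[OF that(2)]]
  using e_inj[OF that] by auto
 show "(\<Sum>a<L1. sc (cf1 a M) (bx1 a)) = M" if M: "M \<in> Mat n1 n1" for M
 proof -
  obtain c where c: "c \<in> S.AQ" "Ta0 c = M" using Ta0_surj[OF M] by blast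
  let ?d = "\<Sum>a\<in>S.FX. sc (cf a c) (bx a)"
  have "?d = (\<Sum>j<L1. sc (cf (e j) c) (bx (e j)))" by (rule sum.reindex_bij_betw[OF e_bij, symmetric])
  hence "Ta0 ?d = (\<Sum>j<L1. sc (cf (e j) c) (bx1 j))" using Ta0_combination[of "%j. cf (e j) c"] by simp
  moreover have dA: "?d \<in> S.AQ" by (intro S.AQ_sum S.AQ_sc S.bx_AQ)
  moreover have "Ta0 (c - ?d) = 0" using S.AQ_decomp[OF c(1)] Ta0_ker[OF S.AQ_minus[OF c(1) dA]] by simp
  ultimately show ?thesis using c cf1_Ta0[OF c(1)] Ta0_minus[OF c(1) dA] by simp
 qed
 show "b1 g a < L1" if "g \<in> carrier P" "a < L1" for g a by (rule b1_L[OF that])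
 show "rh1 g * bx1 (b1 g a) = bx1 a * rh1 g" if "g \<in> carrier P" "a < L1" for g a
 proof -
  have "bx (b g (e a)) \<in> S.AQ" "bx (e a) \<in> S.AQ" using S.bx_AQ b_FX e_FX that by auto
  thus ?thesis unfolding rh1_def bx1_def e_b1[OF that]
   using Ta0_mult rh_AQ[OF that(1)] b_conj[OF that(1) e_L[OF that(2)]] by metis
 qed
 obtain a where a: "a < L" "\<forall>g\<in>carrier P. b g a = a" using fixpt by blast
 obtain j where j: "j < L1" "a = e j" using e_surj XP_FX a by (auto simp: XP_def)
 have "b1 g j = j" if "g \<in> carrier P" for g
  using e_inj[OF b1_L[OF that j(1)] j(1)] e_b1[OF that j(1)] a j that by simp
 thus "\<exists>a<L1. \<forall>g\<in>carrier P. b1 g a = a" using j(1) by blast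
qed

lemma Ta1_GP:
 assumes ta: "comm_ring_hom ta" and pm: "aut P pm" and G: "G \<in> GP P m rh ta pm"
 shows "Ta1 ta (ix pm) G \<in> GP P n1 rh1 ta pm"
proof -
 note pm' = ix_permutes[OF pm] and G' = GP_GG[OF pm ta G]
 have "Ta1 ta (ix pm) G * rmap ta (rh1 g) = rh1 (pm g) * Ta1 ta (ix pm) G" if g: "g \<in> carrier P" for g
 proof -
  have "Ta1 ta (ix pm) G * rmap ta (rh1 g) = Ta1 ta (ix pm) (G * rmap ta (rh g))"
   unfolding rh1_def using Ta1_mult[OF ta id_comm_ring_hom pm' permutes_id G', of "rh g"] rh_AQ[OF g] by (simp add: S.GG_id)
  also have "G * rmap ta (rh g) = rh (pm g) * G" using G g by (simp add: GP_def)
  also have "Ta1 ta (ix pm) (rh (pm g) * G) = rh1 (pm g) * Ta1 ta (ix pm) G"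
   unfolding rh1_def using Ta1_mult[OF id_comm_ring_hom ta permutes_id pm' _ G', of "rh (pm g)"] rh_AQ[OF aut_closed[OF pm g]] by (simp add: S.GG_id)
  finally show ?thesis .
 qed
 thus ?thesis using Ta1_Mat[OF ta pm' G'] by (simp add: GP_def)
qed

lemma AP_GP: "AP P m rh = GP P m rh id id" by (auto simp: AP_def GP_def)

text \<open>Transitivity of the Brauer construction. Indices fixed by \<open>P\<close> in the new
  basis correspond to those in the old one, and \<open>cf1_Ta0\<close> preserves the coordinates
  there, so the kernels match.\<close>

theorem functor_comp:
 assumes F: "is_functor P n1 L1 rh1 b1 cf1 n Ta2"
 shows "is_functor P m L rh b cf n (%ta pm G. Ta2 ta pm (Ta1 ta (ix pm) G))"
proof -
 interpret D: drep P p n1 L1 rh1 bx1 b1 ka1 cf1 by (rule drep1)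
 note F = F[unfolded is_functor_def]
 have A1: "Ta0 c \<in> AP P n1 rh1" if "c \<in> AP P m rh" for c
 proof -
  have "Ta0 c \<in> GP P n1 rh1 id id" using Ta1_GP[OF id_comm_ring_hom aut_id] that AP_GP by (simp add: ix_id)
  thus ?thesis by (auto simp: AP_def GP_def)
 qed
 have X1: "j \<in> XP P L1 b1 \<longleftrightarrow> j < L1 & e j \<in> XP P L b" for j
 proof (cases "j < L1")
  case True
  have "b1 g j = j \<longleftrightarrow> b g (e j) = e j" if "g \<in> carrier P" for g
   using e_b1[OF that True] e_inj[OF b1_L[OF that True] True] by metis
  thus ?thesis using True e_L by (auto simp: XP_def)
 qed (simp add: XP_def)
 show ?thesis unfolding is_functor_def
 proof (intro conjI allI impI ballI)
  fix ta pm G assume *: "comm_ring_hom ta" "aut P pm" "G \<in> GP P m rh ta pm"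
  show "Ta2 ta pm (Ta1 ta (ix pm) G) \<in> Mat n n" using F Ta1_GP[OF *] * by blast
 next
  fix ta pm G H assume *: "comm_ring_hom ta" "aut P pm" "G \<in> GP P m rh ta pm" "H \<in> GP P m rh ta pm"
  show "Ta2 ta pm (Ta1 ta (ix pm) (G + H)) = Ta2 ta pm (Ta1 ta (ix pm) G) + Ta2 ta pm (Ta1 ta (ix pm) H)"
   unfolding Ta1_add[OF *(1) ix_permutes[OF *(2)] GP_GG[OF *(2,1,3)] GP_GG[OF *(2,1,4)]]
   using F Ta1_GP[OF *(1,2,3)] Ta1_GP[OF *(1,2,4)] * by blast
 next
  fix ta1 ta2 pm1 pm2 G1 G2
  assume *: "comm_ring_hom ta1" "comm_ring_hom ta2" "aut P pm1" "aut P pm2" "G1 \<in> GP P m rh ta1 pm1" "G2 \<in> GP P m rh ta2 pm2"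
  have "Ta1 (ta1 \<circ> ta2) (ix (pm1 \<circ> pm2)) (G1 * rmap ta1 G2) = Ta1 ta1 (ix pm1) G1 * rmap ta1 (Ta1 ta2 (ix pm2) G2)"
   unfolding ix_comp[OF *(3,4)]
   by (rule Ta1_mult[OF *(1,2) ix_permutes[OF *(3)] ix_permutes[OF *(4)] GP_GG[OF *(3,1,5)] GP_GG[OF *(4,2,6)]])
  thus "Ta2 (ta1 \<circ> ta2) (pm1 \<circ> pm2) (Ta1 (ta1 \<circ> ta2) (ix (pm1 \<circ> pm2)) (G1 * rmap ta1 G2)) =
    Ta2 ta1 pm1 (Ta1 ta1 (ix pm1) G1) * rmap ta1 (Ta2 ta2 pm2 (Ta1 ta2 (ix pm2) G2))"
   using F Ta1_GP[OF *(1,3,5)] Ta1_GP[OF *(2,4,6)] *(1-4) by simp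
 next
  fix x c assume c: "c \<in> AP P m rh"
  show "Ta2 id id (Ta1 id (ix id) (sc x c)) = sc x (Ta2 id id (Ta1 id (ix id) c))"
   unfolding ix_id Ta0_sc[OF AP_AQ[OF c]] using F A1[OF c] by blast
 next
  show "Ta2 id id (Ta1 id (ix id) (ee m)) = ee n" unfolding ix_id Ta0_ee using F by blast
 next
  fix c assume c: "c \<in> AP P m rh"
  have "Ta2 id id (Ta0 c) = 0 \<longleftrightarrow> (\<forall>j\<in>XP P L1 b1. cf1 j (Ta0 c) = 0)" using F A1[OF c] by blast
  also have "... \<longleftrightarrow> (\<forall>j<L1. e j \<in> XP P L b --> cf (e j) c = 0)" using cf1_Ta0[OF AP_AQ[OF c]] by (auto simp: X1)
  also have "... \<longleftrightarrow> (\<forall>a\<in>XP P L b. cf a c = 0)" using e_surj[OF XP_FX] by metis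
  finally show "Ta2 id id (Ta1 id (ix id) c) = 0 \<longleftrightarrow> (\<forall>a\<in>XP P L b. cf a c = 0)" unfolding ix_id .
 next
  fix T :: "'e rfm" assume "T \<in> Mat n n"
  then obtain c1 where c1: "c1 \<in> AP P n1 rh1" "Ta2 id id c1 = T" using F by blast
  have c1M: "c1 \<in> Mat n1 n1" using c1 by (simp add: AP_def)
  \<comment> \<open>A \<open>P\<close>-fixed matrix of the quotient is lifted through its
    coordinates; these are constant on orbits of \<open>P\<close>, so the lift is
    \<open>P\<close>-fixed as well.\<close>
  define c where "c = (\<Sum>j<L1. sc (cf1 j c1) (bx (e j)))"
  have cA: "c \<in> S.AQ" unfolding c_def by (intro S.AQ_sum S.AQ_sc S.bx_AQ e_FX) auto
  have "rh g * c = c * rh g" if g: "g \<in> carrier P" for g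
  proof -
   have "rh g * c = (\<Sum>j<L1. sc (cf1 j c1) (rh g * bx (e j)))" by (simp add: c_def sum_distrib_left sc_mult_right)
   also have "... = (\<Sum>j<L1. sc (cf1 (b1 g j) c1) (rh g * bx (e (b1 g j))))"
    by (rule sum.reindex_bij_betw[OF D.b_bij[OF g], symmetric])
   also have "... = (\<Sum>j<L1. sc (cf1 j c1) (bx (e j) * rh g))"
    by (intro sum.cong refl) (use D.cf_fixed[OF c1(1) g] e_b1[OF g] b_conj[OF g] e_L in simp)
   finally show ?thesis by (simp add: c_def sum_distrib_right sc_mult_left)
  qed
  hence cP: "c \<in> AP P m rh" using S.AQ_Mat[OF cA] by (simp add: AP_def)
  have "Ta0 c = (\<Sum>j<L1. sc (cf1 j c1) (bx1 j))" unfolding c_def by (rule Ta0_combination)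
  also have "... = c1" by (rule D.span[OF c1M])
  finally show "\<exists>c\<in>AP P m rh. Ta2 id id (Ta1 id (ix id) c) = T" using cP c1(2) by (auto simp: ix_id)
 qed
qed

end

text \<open>Induction on how much of \<open>P\<close> acts nontrivially.
  \<open>Q = upper p P K\<close> is strictly larger than \<open>K\<close>; commutators with
  \<open>Q\<close> and \<open>p\<close>-th powers of its elements lie in \<open>K\<close>, so
  \<open>rh\<close> makes \<open>Q\<close> central of exponent dividing \<open>p\<close>. One stage
  makes \<open>Q\<close> act trivially, and the induction hypothesis supplies the functor to compose
  with.\<close>

theorem brauer_functor_aux:
 fixes P :: "('g, 'z) monoid_scheme" (structure)
 assumes fin: "finite (carrier P)" and card: "card (carrier P) = p ^ k"
 shows "drep P p m L rh bx b ka cf ==> normal K P ==> (!!pm g. aut P pm ==> g \<in> K ==> pm g \<in> K) ==>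
  (!!g. g \<in> K ==> rh g = ee m) ==> \<exists>n Ta. is_functor P m L rh b cf n Ta"
proof (induction "card (carrier P) - card K" arbitrary: K m L rh bx b ka cf rule: less_induct)
 case less
 interpret drep P p m L rh bx b ka cf by fact
 interpret N: normal K P by fact
 show ?case
 proof (cases "K = carrier P")
  case True
  thus ?thesis using functor_trivial less.prems(4) by blast
 next
  case False
  define Q where "Q = upper p P K"
  have Qn: "normal Q P" unfolding Q_def by (rule N.upper_normal)
  have KQ: "K \<subset> Q" using N.subset_upper N.upper_strict[OF prime_p fin card False] by (auto simp: Q_def)
  have Qsub: "Q \<subseteq> carrier P" by (auto simp: Q_def upper_def)
  have finQ: "finite Q" using finite_subset[OF Qsub fin] .
  obtain q where q: "bij_betw q {..<card Q} Q" using ex_bij_betw_nat_finite[OF finQ] by (auto simp: atLeast0LessThan)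
  have Qaut: "pm g \<in> Q" if pm: "aut P pm" and g: "g \<in> Q" for pm g
  proof -
   have gP: "g \<in> carrier P" using g Qsub by blast
   have hom: "pm (x \<otimes> y) = pm x \<otimes> pm y" if "x \<in> carrier P" "y \<in> carrier P" for x y using pm that by (simp add: aut_def)
   note cl = aut_closed[OF pm]
   have one: "pm \<one> = \<one>" using hom[OF one_closed one_closed] cl[OF one_closed] by (simp add: l_cancel_one' eq_commute)
   have inv: "pm (inv x) = inv (pm x)" if x: "x \<in> carrier P" for x
   proof -
    have "pm (inv x) \<otimes> pm x = \<one>" using hom[OF inv_closed[OF x] x] one x by simp
    thus ?thesis using inv_equality[OF _ cl[OF x] cl[OF inv_closed[OF x]]] by simp
   qed
   have pow: "pm (g [^] k) = pm g [^] k" for k :: nat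
    by (induction k) (auto simp: one hom gP)
   have "(pm g \<otimes> h) \<otimes> inv (h \<otimes> pm g) \<in> K" if h: "h \<in> carrier P" for h
   proof -
    obtain h' where h': "h' \<in> carrier P" "h = pm h'"
    proof -
     have "h \<in> pm ` carrier P" using pm h permutes_image[of pm "carrier P"] unfolding aut_def by blast
     thus ?thesis using that by blast
    qed
    have "(g \<otimes> h') \<otimes> inv (h' \<otimes> g) \<in> K" using g h'(1) by (simp add: Q_def upper_def)
    hence "pm ((g \<otimes> h') \<otimes> inv (h' \<otimes> g)) \<in> K" by (rule less.prems(3)[OF pm])
    thus ?thesis using gP h' by (simp add: hom inv)
   qed
   moreover have "pm g [^] p \<in> K" using less.prems(3)[OF pm, of "g [^] p"] g by (simp add: Q_def upper_def pow)
   ultimately show ?thesis using cl[OF gP] by (simp add: Q_def upper_def)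
  qed
  have Qcomm: "rh g * rh h = rh h * rh g" if g: "g \<in> Q" and h: "h \<in> carrier P" for g h
  proof -
   have gP: "g \<in> carrier P" using g Qsub by blast
   let ?k = "(g \<otimes> h) \<otimes> inv (h \<otimes> g)"
   have "?k \<in> K" using g h by (simp add: Q_def upper_def)
   hence "rh ?k = ee m" by (rule less.prems(4))
   have "?k \<otimes> (h \<otimes> g) = g \<otimes> h" using gP h by (simp add: m_assoc)
   hence "rh (g \<otimes> h) = rh ?k * rh (h \<otimes> g)" using rh_mult[of ?k "h \<otimes> g"] gP h by simp
   also have "... = rh (h \<otimes> g)" unfolding \<open>rh ?k = ee m\<close> by (rule MatD(1)[OF rh_Mat]) (use gP h in simp)
   finally show ?thesis using rh_mult gP h by simp
  qed
  have Qp: "rh g ^ p = ee m" if g: "g \<in> Q" for g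
  proof -
   have gP: "g \<in> carrier P" using g Qsub by blast
   have "rh (g [^] j) = rh g ^ j" if "j > 0" for j :: nat
    using that
   proof (induction j rule: nat_induct_non_zero)
    case 1
    show ?case using gP by simp
   next
    case (Suc j)
    have "rh (g [^] Suc j) = rh (g [^] j) * rh g" using gP by (simp add: rh_mult)
    thus ?case using Suc by (simp add: power_commutes)
   qed
   moreover have "g [^] p \<in> K" using g by (simp add: Q_def upper_def)
   ultimately show ?thesis using less.prems(4)[of "g [^] p"] prime_gt_0_nat[OF prime_p] by simp
  qed
  interpret dstep P p m L rh bx b ka cf Q "card Q" q
   by unfold_locales (use Qsub Qaut Qcomm Qp q in auto)
  obtain n1 Ta1 where *: "stage_fun p m (card Q) L rhs bx bes ka cf n1 Ta1" using S.stage_functor by blast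
  obtain e where e: "bij_betw e {..<card S.FX} S.FX" using ex_bij_betw_nat_finite[OF S.finite_FX] by (auto simp: atLeast0LessThan)
  interpret dfun P p m L rh bx b ka cf Q "card Q" q n1 Ta1 "card S.FX" e
   by (intro dfun.intro dstep_axioms dfun_axioms.intro) (fact * e)+
  have "card K < card Q" by (rule psubset_card_mono[OF finQ KQ])
  moreover have "card Q \<le> card (carrier P)" by (rule card_mono[OF fin Qsub])
  ultimately have "card (carrier P) - card Q < card (carrier P) - card K" by simp
  hence "\<exists>n Ta2. is_functor P n1 (card S.FX) rh1 b1 cf1 n Ta2"
   by (rule less.hyps[where K = Q, OF _ drep1 Qn]) (fact Qaut rh1_Q)+
  then obtain n Ta2 where "is_functor P n1 (card S.FX) rh1 b1 cf1 n Ta2" by blast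
  thus ?thesis using functor_comp by blast
 qed
qed

theorem (in drep) brauer_functor:
 assumes fin: "finite (carrier P)" and card: "card (carrier P) = p ^ k"
 shows "\<exists>n Ta. is_functor P m L rh b cf n Ta"
proof (rule brauer_functor_aux[OF fin card drep_axioms one_is_normal])
 fix pm g assume pm: "aut P pm" and "g \<in> {\<one>}"
 moreover have "pm (\<one> \<otimes> \<one>) = pm \<one> \<otimes> pm \<one>" using pm one_closed unfolding aut_def by blast
 hence "pm \<one> \<otimes> pm \<one> = pm \<one>" by simp
 ultimately show "pm g \<in> {\<one>}" using aut_closed[OF pm one_closed] by (simp add: l_cancel_one')
next
 show "rh g = ee m" if "g \<in> {\<one>}" for g using that rh_one by simp
qed

section \<open>Additive endomorphisms as sums of semilinear maps\<close>

definition FA :: "('e::comm_ring_1 => 'e) set" where "FA = {ta. comm_ring_hom ta}"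

lemma FA_id: "id \<in> FA" by (simp add: FA_def id_comm_ring_hom)

lemma FA_comp: "si \<in> FA ==> ta \<in> FA ==> si \<circ> ta \<in> FA"
 by (simp add: FA_def comp_comm_ring_hom)

lemma of_nat_card_UNIV: "of_nat (card (UNIV :: 'a set)) = (0::'a::{finite,ring_1})"
proof -
 have "bij (%x::'a. x + 1)" by (rule bij_betw_byWitness[of _ "%x. x - 1"]) auto
 hence "(\<Sum>x\<in>UNIV. x + 1) = (\<Sum>x\<in>(UNIV :: 'a set). x)" by (rule sum.reindex_bij_betw)
 thus ?thesis by (simp add: sum.distrib)
qed

text \<open>Reindexing by a factor on which the two maps differ multiplies the sum by something
  other than 1. For equal maps the sum counts the nonzero elements, which is \<open>-1\<close>
  because the order of the field vanishes in it.\<close>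

lemma character_orthogonality:
 fixes ta ta0 :: "'e::{finite,field} => 'e"
 assumes "ta \<in> FA" "ta0 \<in> FA"
 shows "(\<Sum>x\<in>UNIV - {0}. ta x / ta0 x) = (if ta = ta0 then - 1 else 0)"
proof -
 interpret t: comm_ring_hom ta using assms by (simp add: FA_def)
 interpret t0: comm_ring_hom ta0 using assms by (simp add: FA_def)
 have nz: "ta0 x ~= 0" if "x ~= 0" for x
  using that field_hom_inj[OF t0.comm_ring_hom_axioms] by (metis injD t0.hom_zero)
 show ?thesis
 proof (cases "ta = ta0")
  case True
  have "(\<Sum>x\<in>UNIV - {0}. ta x / ta0 x) = (\<Sum>x\<in>UNIV - {0::'e}. 1)" using nz True by (intro sum.cong) auto
  also have "... = of_nat (card (UNIV :: 'e set) - 1)" by (simp add: card_Diff_singleton)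
  also have "... = of_nat (card (UNIV :: 'e set)) - 1" by (subst of_nat_diff) (auto simp: Suc_leI card_gt_0_iff)
  finally show ?thesis using True by (simp add: of_nat_card_UNIV)
 next
  case False
  then obtain f where f: "ta f ~= ta0 f" by auto
  hence f0: "f ~= 0" by auto
  let ?S = "\<Sum>x\<in>UNIV - {0}. ta x / ta0 x"
  have "bij_betw (%x. f * x) (UNIV - {0}) (UNIV - {0})"
   by (rule bij_betw_byWitness[of _ "%x. x / f"]) (use f0 in auto)
  hence "?S = (\<Sum>x\<in>UNIV - {0}. ta (f * x) / ta0 (f * x))" by (rule sum.reindex_bij_betw[symmetric])
  also have "... = ta f / ta0 f * ?S" by (simp add: t.hom_mult t0.hom_mult sum_distrib_left)
  finally have "(ta f / ta0 f - 1) * ?S = 0" by (simp add: left_diff_distrib)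
  moreover have "ta f / ta0 f - 1 ~= 0" using f nz[OF f0] by simp
  ultimately have "?S = 0" using mult_eq_0_iff by blast
  thus ?thesis using False by simp
 qed
qed

lemma frobenius_FA:
 assumes "prime p" "of_nat p = (0::'e::comm_ring_1)"
 shows "(%x::'e. x ^ (p ^ i)) \<in> FA"
proof (induction i)
 case 0
 show ?case using FA_id by (simp add: id_def)
next
 case (Suc i)
 have p0: "p > 0" using prime_gt_0_nat[OF assms(1)] .
 have "comm_ring_hom (%x::'e. x ^ p)"
  by unfold_locales (use frobenius_commuting[OF assms] p0 in \<open>auto simp: power_mult_distrib mult.commute zero_power\<close>)
 hence "(%x::'e. x ^ p) \<circ> (%x. x ^ (p ^ i)) \<in> FA" using Suc by (intro FA_comp) (auto simp: FA_def)
 thus ?case by (simp add: comp_def mult.commute flip: power_mult)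
qed

text \<open>The first \<open>s\<close> powers of Frobenius are distinct, since the difference of two
  of them is a polynomial with fewer roots than the field has elements. This bound drives the count
  in \<open>rep_exists\<close>.\<close>

lemma card_FA_ge:
 assumes p: "prime p" "of_nat p = (0::'e::{finite,field})" and card: "card (UNIV :: 'e set) = p ^ s"
 shows "s \<le> card (FA :: ('e => 'e) set)"
proof -
 have lt: False if ij: "i < j" "j < s" and eq: "!!x::'e. x ^ (p ^ i) = x ^ (p ^ j)" for i j
 proof -
  define P where "P = Polynomial.monom (1::'e) (p ^ j) - Polynomial.monom 1 (p ^ i)"
  have pij: "p ^ i < p ^ j" using ij(1) prime_gt_1_nat[OF p(1)] by simp
  have "Polynomial.coeff P (p ^ j) = 1" using pij by (simp add: P_def)
  hence P0: "P ~= 0" by auto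
  have "degree P \<le> p ^ j" unfolding P_def
   using pij by (intro degree_diff_le order.trans[OF degree_monom_le]) auto
  moreover have "card {x. poly P x = 0} \<le> degree P" by (rule card_poly_roots_bound[OF P0])
  moreover have "{x. poly P x = 0} = UNIV" using eq by (auto simp: P_def poly_monom)
  ultimately have "p ^ s \<le> p ^ j" using card by simp
  thus False using ij(2) prime_gt_1_nat[OF p(1)] by (simp add: power_increasing_iff)
 qed
 let ?f = "%i x. (x::'e) ^ (p ^ i)"
 have "inj_on ?f {..<s}"
 proof (rule inj_onI)
  fix i j assume ij: "i \<in> {..<s}" "j \<in> {..<s}" "?f i = ?f j"
  have "!!x. ?f i x = ?f j x" using ij(3) by meson
  thus "i = j" using lt[of i j] lt[of j i] ij(1,2) by (metis lessThan_iff nat_neq_iff)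
 qed
 moreover have "?f ` {..<s} \<subseteq> FA" using frobenius_FA[OF p] by blast
 ultimately show ?thesis using card_inj_on_le[of ?f "{..<s}" FA] by simp
qed

text \<open>\<open>'f\<close> is the prime field, by its cardinality. The size \<open>m * s\<close>
  is chosen so that columns over \<open>'f\<close> are as numerous as columns of length
  \<open>m\<close> over \<open>'e\<close>, which identifies the two modules.\<close>

locale emb =
 fixes p s m :: nat and io :: "'e::{finite,field} rfm => 'f::{finite,field} rfm"
 assumes prime_p: "prime p" and pE: "of_nat p = (0::'e)" and cardE: "card (UNIV :: 'e set) = p ^ s"
  and cardF: "card (UNIV :: 'f set) = p"
  and io_Mat: "A \<in> Mat m m ==> io A \<in> Mat (m * s) (m * s)"
  and io_add: "A \<in> Mat m m ==> B \<in> Mat m m ==> io (A + B) = io A + io B"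
  and io_mult: "A \<in> Mat m m ==> B \<in> Mat m m ==> io (A * B) = io A * io B"
  and io_ee: "io (ee m) = ee (m * s)"
  and io_inj: "A \<in> Mat m m ==> io A = 0 ==> A = 0"
begin

abbreviation k where "k \<equiv> m * s"

lemma F_of_nat: "\<exists>t. x = of_nat t" for x :: 'f
proof -
 have pF: "of_nat p = (0::'f)" using of_nat_card_UNIV[where 'a = 'f] cardF by simp
 have "inj_on (of_nat :: nat => 'f) {..<p}"
  by (rule inj_onI) (simp add: of_nat_eq_iff_cong_CHAR CHAR_prime[OF prime_p pF] cong_less_modulus_unique_nat)
 hence "of_nat ` {..<p} = (UNIV :: 'f set)" by (intro card_subset_eq) (auto simp: card_image cardF)
 thus ?thesis by (metis UNIV_I imageE)
qed

text \<open>A column of length \<open>m\<close> is itself a square matrix supported in column 0, so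
  \<open>io\<close> applies to it, and \<open>ps v\<close> is \<open>io v\<close> applied to a
  nonzero vector \<open>u0\<close> fixed by \<open>io (un 0 0)\<close>. Injectivity holds because a
  nonzero column can be multiplied to \<open>un 0 0\<close>, bijectivity by counting. For
  \<open>m = 0\<close> there is no \<open>un 0 0\<close> in the algebra, so that case is
  separate.\<close>

lemma psi_exists:
 "\<exists>ps. bij_betw ps (Mat m 1) (Mat k 1) & (\<forall>v\<in>Mat m 1. \<forall>w\<in>Mat m 1. ps (v + w) = ps v + ps w) &
  (\<forall>A\<in>Mat m m. \<forall>v\<in>Mat m 1. ps (A * v) = io A * ps v)"
proof (cases "m = 0")
 case True
 have M0: "(Mat 0 q :: 'a::ring_1 rfm set) = {0}" for q by (auto simp: Mat_def)
 show ?thesis unfolding True by (intro exI[of _ "%_. 0"]) (auto simp: M0 bij_betw_def)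
next
 case False
 have "(un 0 0 :: 'e rfm) ~= 0" using un_inj[of 0 0 1 1] by (metis ent_un ent_zero zero_neq_one)
 hence "io (un 0 0) ~= 0" using io_inj[OF Mat_un[of 0 m 0 m]] False by auto
 then obtain i j where ij: "ent (io (un 0 0)) i j ~= 0" by (metis ent_zero rfm_eqI)
 have iou: "io (un 0 0) \<in> Mat k k" using io_Mat[OF Mat_un[of 0 m 0 m]] False by auto
 have jk: "j < k" using ij iou by (auto simp: Mat_iff)
 define u0 where "u0 = io (un 0 0) * un j 0"
 have u0M: "u0 \<in> Mat k 1" unfolding u0_def using iou Mat_un[OF jk, of 0 1] by auto
 have u00: "u0 ~= 0"
 proof
  assume "u0 = 0"
  hence "ent (io (un 0 0) * un j 0) i 0 = 0" by (simp add: u0_def)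
  thus False using ij by (simp add: ent_mult_un)
 qed
 have uu: "io (un 0 0) * u0 = u0"
  unfolding u0_def using io_mult[OF Mat_un[of 0 m 0 m] Mat_un[of 0 m 0 m]] False by (simp flip: mult.assoc)
 have sub: "v \<in> Mat m m" if "v \<in> Mat m 1" for v :: "'e rfm" using that False by (force simp: Mat_iff)
 define ps where "ps v = io v * u0" for v
 have add: "ps (v + w) = ps v + ps w" if "v \<in> Mat m 1" "w \<in> Mat m 1" for v w
  using io_add[OF sub sub] that by (simp add: ps_def distrib_right)
 have act: "ps (A * v) = io A * ps v" if "A \<in> Mat m m" "v \<in> Mat m 1" for A v
  using io_mult[OF that(1) sub[OF that(2)]] by (simp add: ps_def mult.assoc)
 have inj: "inj_on ps (Mat m 1)"
 proof (rule inj_onI)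
  fix v w assume vw: "v \<in> Mat m 1" "w \<in> Mat m 1" "ps v = ps w"
  define d where "d = v - w"
  have dM: "d \<in> Mat m 1" using vw by (auto simp: d_def intro: Mat_minus)
  have "ps (d + w) = ps d + ps w" by (rule add[OF dM vw(2)])
  hence d0: "ps d = 0" using vw(3) by (simp add: d_def)
  have "ent d i 0 = 0" if i: "i < m" for i
  proof (rule ccontr)
   assume nz: "ent d i 0 ~= 0"
   have "un 0 i * d = sc (ent d i 0) (un 0 0)"
   proof -
    have "d * un 0 0 = d" using MatD(2)[OF dM] by (simp add: un00_ee)
    thus ?thesis using un_sandwich[of 0 i d 0 0] by (simp add: mult.assoc)
   qed
   hence eq: "sc (1 / ent d i 0) (un 0 i) * d = un 0 0" using nz by (simp add: sc_mult_left)
   have "ps (sc (1 / ent d i 0) (un 0 i) * d) = 0"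
    using act[OF Mat_sc[OF Mat_un[of 0 m i m]] dM] i d0 False by simp
   hence "ps (un 0 0) = 0" by (simp only: eq)
   thus False using uu u00 by (simp add: ps_def)
  qed
  hence "d = 0" by (intro Mat_eqI[OF dM Mat_0]) auto
  thus "v = w" by (simp add: d_def)
 qed
 have into: "ps ` Mat m 1 \<subseteq> Mat k 1" using io_Mat[OF sub] u0M by (auto simp: ps_def)
 have "ps ` Mat m 1 = Mat k 1"
 proof (rule card_subset_eq[OF finite_Mat into])
  show "card (ps ` Mat m 1) = card (Mat k 1 :: 'f rfm set)"
   unfolding card_image[OF inj] card_Mat cardE cardF by (simp add: mult.commute flip: power_mult)
 qed
 hence "bij_betw ps (Mat m 1) (Mat k 1)" using inj by (simp add: bij_betw_def)
 thus ?thesis using add act by blast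
qed

definition ps :: "'e rfm => 'f rfm" where
 "ps = (SOME ps. bij_betw ps (Mat m 1) (Mat k 1) & (\<forall>v\<in>Mat m 1. \<forall>w\<in>Mat m 1. ps (v + w) = ps v + ps w) &
  (\<forall>A\<in>Mat m m. \<forall>v\<in>Mat m 1. ps (A * v) = io A * ps v))"

lemma ps_bij: "bij_betw ps (Mat m 1) (Mat k 1)"
 and ps_add: "v \<in> Mat m 1 ==> w \<in> Mat m 1 ==> ps (v + w) = ps v + ps w"
 and ps_act: "A \<in> Mat m m ==> v \<in> Mat m 1 ==> ps (A * v) = io A * ps v"
 using someI_ex[OF psi_exists] unfolding ps_def[symmetric] by blast+

lemma ps_Mat: "v \<in> Mat m 1 ==> ps v \<in> Mat k 1" using ps_bij by (auto simp: bij_betw_def)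

lemma ps_inj: "v \<in> Mat m 1 ==> w \<in> Mat m 1 ==> ps v = ps w ==> v = w"
 using ps_bij by (auto simp: bij_betw_def inj_on_def)

lemma ps_surj: "y \<in> Mat k 1 ==> \<exists>v\<in>Mat m 1. y = ps v" using ps_bij by (auto simp: bij_betw_def)

text \<open>Over the prime field additive maps are linear.\<close>

lemma matrix_of_additive:
 assumes M: "!!w. w \<in> Mat k 1 ==> al w \<in> Mat k 1"
  and add: "!!v w. v \<in> Mat k 1 ==> w \<in> Mat k 1 ==> al (v + w) = al v + (al w :: 'f rfm)"
 obtains ga where "ga \<in> Mat k k" "!!w. w \<in> Mat k 1 ==> ga * w = al w"
proof -
 have a0: "al 0 = 0" using add[of 0 0] by simp
 have asc: "al (sc x w) = sc x (al w)" if w: "w \<in> Mat k 1" for x w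
 proof -
  have "al (sc (of_nat t) w) = sc (of_nat t) (al w)" for t
   by (induction t) (use w in \<open>auto simp: a0 sc_add_left add Mat_sc\<close>)
  thus ?thesis using F_of_nat[of x] by metis
 qed
 have asum: "al (sum f S) = (\<Sum>s\<in>S. al (f s))" if "!!s. s \<in> S ==> f s \<in> Mat k 1" for S :: "nat set" and f
  using that by (induction S rule: infinite_finite_induct) (auto simp: a0 add Mat_sum)
 define ga where "ga = (\<Sum>j<k. al (un j 0) * un 0 j)"
 have uM: "(un j 0 :: 'f rfm) \<in> Mat k 1" if "j < k" for j using that by auto
 have "ga \<in> Mat k k" unfolding ga_def by (intro Mat_sum Mat_mult[OF M[OF uM] Mat_un]) auto
 moreover have "ga * w = al w" if w: "w \<in> Mat k 1" for w
 proof -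
  have w00: "w * un 0 0 = w" using MatD(2)[OF w] by (simp add: un00_ee)
  have "ga * w = (\<Sum>j<k. al (un j 0) * (un 0 j * w * un 0 0))"
   by (simp add: ga_def sum_distrib_right mult.assoc w00)
  also have "... = (\<Sum>j<k. sc (ent w j 0) (al (un j 0)))"
  proof (rule sum.cong)
   fix j assume "j \<in> {..<k}"
   hence "al (un j 0) * un 0 0 = al (un j 0)" using MatD(2)[OF M[OF uM]] by (simp add: un00_ee)
   thus "al (un j 0) * (un 0 j * w * un 0 0) = sc (ent w j 0) (al (un j 0))"
    unfolding un_sandwich by (simp add: sc_mult_right)
  qed simp
  also have "... = al (\<Sum>j<k. sc (ent w j 0) (un j 0))"
  proof -
   have "al (\<Sum>j<k. sc (ent w j 0) (un j 0)) = (\<Sum>j<k. al (sc (ent w j 0) (un j 0)))"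
    by (rule asum) (use uM in \<open>auto intro!: Mat_sc\<close>)
   also have "... = (\<Sum>j<k. sc (ent w j 0) (al (un j 0)))" by (rule sum.cong[OF refl], rule asc, rule uM) simp
   finally show ?thesis ..
  qed
  also have "(\<Sum>j<k. sc (ent w j 0) (un j 0)) = w" using Mat_expand[OF w] by simp
  finally show ?thesis .
 qed
 ultimately show ?thesis using that by blast
qed

definition fam :: "(('e => 'e) => 'e rfm) => 'e rfm => 'e rfm" where
 "fam G v = (\<Sum>ta\<in>FA. G ta * rmap ta v)"

text \<open>\<open>ga\<close> and \<open>G\<close> describe the same additive endomorphism,
  transported by \<open>ps\<close>: as a matrix over the prime field and as a sum of semilinear
  maps.\<close>

definition rep :: "'f rfm => (('e => 'e) => 'e rfm) => bool" where
 "rep ga G \<longleftrightarrow> ga \<in> Mat k k & (\<forall>ta\<in>FA. G ta \<in> Mat m m) & (\<forall>v\<in>Mat m 1. ga * ps v = ps (fam G v))"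

lemma rmap_FA_Mat: "ta \<in> FA ==> v \<in> Mat a c ==> rmap ta v \<in> Mat a c"
proof -
 assume "ta \<in> FA" and v: "v \<in> Mat a c"
 then interpret comm_ring_hom ta by (simp add: FA_def)
 show ?thesis by (rule rmap_Mat[OF v])
qed

lemma fam_Mat: "(!!ta. ta \<in> FA ==> G ta \<in> Mat m m) ==> v \<in> Mat m 1 ==> fam G v \<in> Mat m 1"
 unfolding fam_def by (intro Mat_sum Mat_mult[of _ m m] rmap_FA_Mat) auto

lemma fam_add: "fam G (v + w) = fam G v + fam G w"
proof -
 have "rmap ta (v + w) = rmap ta v + rmap ta w" if "ta \<in> FA" for ta
  using that comm_ring_hom.rmap_add[of ta] by (simp add: FA_def)
 thus ?thesis by (simp add: fam_def distrib_left sum.distrib)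
qed

lemma rep_matrix_exists:
 assumes G: "!!ta. ta \<in> FA ==> G ta \<in> Mat m m"
 obtains ga where "rep ga G"
proof -
 define al where "al w = ps (fam G (inv_into (Mat m 1) ps w))" for w
 have i: "inv_into (Mat m 1) ps (ps v) = v" if "v \<in> Mat m 1" for v
  using bij_betw_inv_into_left[OF ps_bij that] .
 have alps: "al (ps v) = ps (fam G v)" if "v \<in> Mat m 1" for v unfolding al_def i[OF that] ..
 have M: "al w \<in> Mat k 1" if w: "w \<in> Mat k 1" for w
 proof -
  obtain v where "v \<in> Mat m 1" "w = ps v" using ps_surj[OF w] by blast
  thus ?thesis using alps ps_Mat[OF fam_Mat[OF G]] by simp
 qed
 moreover have "al (x + y) = al x + al y" if xy: "x \<in> Mat k 1" "y \<in> Mat k 1" for x y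
 proof -
  obtain v w where vw: "v \<in> Mat m 1" "x = ps v" "w \<in> Mat m 1" "y = ps w" using ps_surj xy by metis
  have "al (x + y) = al (ps (v + w))" using vw by (simp add: ps_add)
  also have "... = ps (fam G v + fam G w)" using alps[OF Mat_add[OF vw(1,3)]] by (simp add: fam_add)
  also have "... = ps (fam G v) + ps (fam G w)" by (rule ps_add[OF fam_Mat[OF G vw(1)] fam_Mat[OF G vw(3)]])
  finally show ?thesis using vw alps by simp
 qed
 ultimately obtain ga where "ga \<in> Mat k k" "!!w. w \<in> Mat k 1 ==> ga * w = al w" using matrix_of_additive by blast
 hence "rep ga G" using G ps_Mat alps by (simp add: rep_def)
 thus ?thesis by (rule that)
qed

lemma rep_matrix_unique: "rep ga G ==> rep ga' G' ==> (!!ta. ta \<in> FA ==> G ta = G' ta) ==> ga = ga'"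
proof -
 assume r: "rep ga G" "rep ga' G'" and eq: "!!ta. ta \<in> FA ==> G ta = G' ta"
 have f: "fam G v = fam G' v" for v unfolding fam_def by (rule sum.cong[OF refl]) (simp add: eq)
 show ?thesis
 proof (rule Mat_columns_eqI)
  show "ga \<in> Mat k k" "ga' \<in> Mat k k" using r by (auto simp: rep_def)
  fix j assume "j < k"
  then obtain v where "v \<in> Mat m 1" "un j 0 = ps v" using ps_surj[OF Mat_un[of j k 0 1]] by auto
  thus "ga * un j 0 = ga' * un j 0" using r f by (simp add: rep_def)
 qed
qed

text \<open>Dedekind independence: replacing \<open>v\<close> by its multiples \<open>sc x v\<close>
  and summing with weights \<open>1 / ta0 x\<close> isolates the component at
  \<open>ta0\<close>.\<close>

lemma rep_unique:
 assumes r: "rep ga G" "rep ga G'" and ta0: "ta0 \<in> FA"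
 shows "G ta0 = G' ta0"
proof -
 have GM: "G ta \<in> Mat m m" "G' ta \<in> Mat m m" if "ta \<in> FA" for ta using r that by (auto simp: rep_def)
 define D where "D ta = G ta - G' ta" for ta
 have S0: "(\<Sum>ta\<in>FA. D ta * rmap ta v) = 0" if v: "v \<in> Mat m 1" for v
 proof -
  have "ps (fam G v) = ps (fam G' v)" using r v by (simp add: rep_def)
  moreover have "fam G v \<in> Mat m 1" by (rule fam_Mat[OF _ v]) (rule GM(1))
  moreover have "fam G' v \<in> Mat m 1" by (rule fam_Mat[OF _ v]) (rule GM(2))
  ultimately have "fam G v = fam G' v" by (intro ps_inj)
  thus ?thesis by (simp add: D_def fam_def left_diff_distrib sum_subtractf)
 qed
 have D0: "D ta0 * rmap ta0 v = 0" if v: "v \<in> Mat m 1" for v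
 proof -
  have rs: "rmap ta (sc x v) = sc (ta x) (rmap ta v)" if "ta \<in> FA" for ta x
   using that comm_ring_hom.rmap_sc[of ta] by (simp add: FA_def)
  have "0 = (\<Sum>x\<in>UNIV - {0}. sc (1 / ta0 x) (\<Sum>ta\<in>FA. D ta * rmap ta (sc x v)))"
   using S0[OF Mat_sc[OF v]] by simp
  also have "... = (\<Sum>x\<in>UNIV - {0}. \<Sum>ta\<in>FA. sc (ta x / ta0 x) (D ta * rmap ta v))"
   by (simp add: rs sc_mult_right sc_sum_right)
  also have "... = (\<Sum>ta\<in>FA. \<Sum>x\<in>UNIV - {0}. sc (ta x / ta0 x) (D ta * rmap ta v))" by (rule sum.swap)
  also have "... = (\<Sum>ta\<in>FA. sc (\<Sum>x\<in>UNIV - {0}. ta x / ta0 x) (D ta * rmap ta v))" by (simp only: sc_sum_left)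
  also have "... = (\<Sum>ta\<in>FA. if ta = ta0 then sc (-1) (D ta0 * rmap ta0 v) else 0)"
   by (intro sum.cong refl) (simp add: character_orthogonality ta0)
  also have "... = sc (-1) (D ta0 * rmap ta0 v)" using ta0 by (simp add: finite_subset[OF subset_UNIV finite])
  finally have "sc (-1) (sc (-1) (D ta0 * rmap ta0 v)) = 0" by simp
  thus ?thesis by simp
 qed
 have "D ta0 = 0"
 proof (rule Mat_columns_eqI)
  show "D ta0 \<in> Mat m m" unfolding D_def using GM[OF ta0] by (intro Mat_minus)
  fix j assume "j < m"
  moreover have "rmap ta0 (un j 0) = un j 0" using ta0 comm_ring_hom.rmap_un[of ta0] by (simp add: FA_def)
  ultimately show "D ta0 * un j 0 = 0 * un j 0" using D0[OF Mat_un[of j m 0 1]] by simp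
 qed simp
 thus ?thesis by (simp add: D_def)
qed

text \<open>By uniqueness the families inject into the matrices, and \<open>card_FA_ge\<close> shows
  that there are at least as many families as matrices.\<close>

theorem rep_exists:
 assumes ga: "ga \<in> Mat k k"
 obtains G where "rep ga G"
proof -
 let ?F = "FA \<rightarrow>\<^sub>E (Mat m m :: 'e rfm set)"
 define Ga where "Ga G = (SOME ga. rep ga G)" for G
 have Ga: "rep (Ga G) G" if G: "G \<in> ?F" for G
 proof -
  obtain ga where "rep ga G" using rep_matrix_exists[of G] G by auto
  thus ?thesis unfolding Ga_def by (rule someI)
 qed
 have finFA: "finite (FA :: ('e => 'e) set)" by (rule finite_subset[OF subset_UNIV finite])
 have inj: "inj_on Ga ?F"
 proof (rule inj_onI)
  fix G H assume GH: "G \<in> ?F" "H \<in> ?F" "Ga G = Ga H"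
  have "rep (Ga G) H" using Ga[OF GH(2)] GH(3) by simp
  hence "G ta = H ta" if "ta \<in> FA" for ta using rep_unique[OF Ga[OF GH(1)] _ that] by blast
  thus "G = H" using GH by (intro PiE_ext[OF GH(1,2)]) auto
 qed
 have into: "Ga ` ?F \<subseteq> Mat k k" using Ga by (auto simp: rep_def)
 have "card (Mat k k :: 'f rfm set) \<le> card (Ga ` ?F)"
 proof -
  have "card (Ga ` ?F) = (p ^ s) ^ (m * m * card (FA :: ('e => 'e) set))"
   unfolding card_image[OF inj] using finFA by (simp add: card_PiE card_Mat cardE power_mult)
  moreover have "card (Mat k k :: 'f rfm set) = (p ^ s) ^ (m * m * s)"
   unfolding card_Mat cardF by (simp add: power_mult[symmetric] mult.commute mult.left_commute mult.assoc)
  moreover have "(p ^ s) ^ (m * m * s) \<le> (p ^ s) ^ (m * m * card (FA :: ('e => 'e) set))"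
   using card_FA_ge[OF prime_p pE cardE] prime_gt_0_nat[OF prime_p] by (intro power_increasing mult_le_mono2) auto
  ultimately show ?thesis by simp
 qed
 hence "Ga ` ?F = Mat k k" by (intro card_seteq finite_Mat into)
 then obtain G where "G \<in> ?F" "ga = Ga G" using ga by blast
 thus ?thesis using Ga that by blast
qed

text \<open>Composing semilinear maps composes their automorphisms, so products of endomorphisms
  correspond to convolutions of families.\<close>

lemma rep_mult:
 assumes "rep ga G" "rep ga' G'"
 shows "rep (ga * ga') (%rh. \<Sum>(si, ta)\<in>{(si, ta)\<in>FA \<times> FA. si \<circ> ta = rh}. G si * rmap si (G' ta))"
proof -
 let ?H = "%rh. \<Sum>(si, ta)\<in>{(si, ta)\<in>FA \<times> FA. si \<circ> ta = rh}. G si * rmap si (G' ta)"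
 have GM: "G ta \<in> Mat m m" "G' ta \<in> Mat m m" if "ta \<in> FA" for ta using assms that by (auto simp: rep_def)
 have finFA: "finite (FA :: ('e => 'e) set)" by (rule finite_subset[OF subset_UNIV finite])
 have HM: "?H rh \<in> Mat m m" for rh by (intro Mat_sum) (auto intro!: Mat_mult[of _ m m] GM rmap_FA_Mat)
 have "fam G (fam G' v) = fam ?H v" if v: "v \<in> Mat m 1" for v
 proof -
  have "fam G (fam G' v) = (\<Sum>si\<in>FA. \<Sum>ta\<in>FA. G si * rmap si (G' ta) * rmap (si \<circ> ta) v)"
   unfolding fam_def
  proof (intro sum.cong refl)
   fix si :: "'e => 'e" assume "si \<in> FA"
   then interpret s: comm_ring_hom si by (simp add: FA_def)
   have "rmap si (G' ta * rmap ta v) = rmap si (G' ta) * rmap (si \<circ> ta) v" if "ta \<in> FA" for ta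
   proof -
    interpret t: comm_ring_hom ta using that by (simp add: FA_def)
    show ?thesis by (simp add: s.rmap_mult rmap_comp)
   qed
   thus "G si * rmap si (\<Sum>ta\<in>FA. G' ta * rmap ta v) = (\<Sum>ta\<in>FA. G si * rmap si (G' ta) * rmap (si \<circ> ta) v)"
    by (simp add: s.rmap_sum sum_distrib_left mult.assoc)
  qed
  also have "... = (\<Sum>(si, ta)\<in>FA \<times> FA. G si * rmap si (G' ta) * rmap (si \<circ> ta) v)" by (rule sum.cartesian_product)
  also have "... = (\<Sum>rh\<in>FA. \<Sum>x\<in>{x\<in>FA \<times> FA. fst x \<circ> snd x = rh}. case x of (si, ta) => G si * rmap si (G' ta) * rmap (si \<circ> ta) v)"
   by (rule sum.group[symmetric]) (use finFA FA_comp in auto)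
  also have "... = fam ?H v" unfolding fam_def sum_distrib_right
   by (intro sum.cong) (auto simp: case_prod_unfold)
  finally show ?thesis .
 qed
 moreover have "ga * ga' * ps v = ps (fam G (fam G' v))" if v: "v \<in> Mat m 1" for v
  using assms v fam_Mat[OF GM(2) v] by (simp add: rep_def mult.assoc)
 moreover have "ga * ga' \<in> Mat k k" using assms by (auto simp: rep_def)
 ultimately show ?thesis using HM by (simp add: rep_def)
qed

lemma rep_io: "A \<in> Mat m m ==> rep (io A) (%ta. if ta = id then A else 0)"
proof -
 assume A: "A \<in> Mat m m"
 have "fam (%ta. if ta = id then A else 0) v = A * v" for v
 proof -
  have "fam (%ta. if ta = id then A else 0) v = (\<Sum>ta\<in>(FA :: ('e => 'e) set). if ta = id then A * v else 0)"
   unfolding fam_def by (rule sum.cong[OF refl]) simp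
  thus ?thesis using FA_id[where 'a = 'e] finite_subset[OF subset_UNIV finite, of "FA :: ('e => 'e) set"] by simp
 qed
 thus ?thesis using A io_Mat ps_act by (auto simp: rep_def)
qed

end

section \<open>Dade algebras\<close>

text \<open>\<open>rf\<close> and \<open>tm\<close> translate between the matrices of the statement
  and the corners of the ring \<open>rfm\<close>.\<close>

definition rf :: "'a::zero mat => 'a rfm" where "rf M = mk (dim_row M) (dim_col M) (%i j. M $$ (i, j))"
definition tm :: "nat => 'a::zero rfm => 'a mat" where "tm n A = mat n n (%(i, j). ent A i j)"

lemma ent_rf: "M \<in> carrier_mat n n ==> ent (rf M) i j = (if i < n & j < n then M $$ (i, j) else 0)"
 by (auto simp: rf_def ent_mk)

lemma rf_Mat: "M \<in> carrier_mat n n ==> rf M \<in> Mat n n" by (auto simp: Mat_iff ent_rf split: if_splits)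

lemma tm_carrier [simp]: "tm n A \<in> carrier_mat n n" by (simp add: tm_def)

lemma tm_rf: "M \<in> carrier_mat n n ==> tm n (rf M) = M" by (auto simp: tm_def ent_rf)

lemma rf_tm: "A \<in> Mat n n ==> rf (tm n A) = A"
proof -
 assume A: "A \<in> Mat n n"
 show ?thesis
 proof (rule Mat_eqI[OF rf_Mat[OF tm_carrier] A])
  fix i j assume "i < n" "j < n"
  thus "ent (rf (tm n A)) i j = ent A i j" unfolding ent_rf[OF tm_carrier] by (simp add: tm_def)
 qed
qed

lemma rf_inj: "M \<in> carrier_mat n n ==> N \<in> carrier_mat n n ==> rf M = rf N ==> M = N"
 by (metis tm_rf)

lemma rf_add: "M \<in> carrier_mat n n ==> N \<in> carrier_mat n n ==> rf (M + N) = rf M + rf (N :: 'a::ring_1 mat)"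
 by (rule rfm_eqI) (auto simp: ent_rf[of _ n])

lemma rf_mult: "M \<in> carrier_mat n n ==> N \<in> carrier_mat n n ==> rf (M * N) = rf M * rf (N :: 'a::ring_1 mat)"
proof -
 assume MN: "M \<in> carrier_mat n n" "N \<in> carrier_mat n n"
 show ?thesis
 proof (rule Mat_eqI[of _ n n])
  show "rf (M * N) \<in> Mat n n" by (rule rf_Mat[OF mult_carrier_mat[OF MN]])
  show "rf M * rf N \<in> Mat n n" by (rule Mat_mult[OF rf_Mat[OF MN(1)] rf_Mat[OF MN(2)]])
  fix i j assume ij: "i < n" "j < n"
  have "ent (rf M * rf N) i j = (\<Sum>k<n. M $$ (i, k) * N $$ (k, j))"
   unfolding ent_mult_Mat[OF rf_Mat[OF MN(1)]] using MN ij by (simp add: ent_rf[of _ n])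
  thus "ent (rf (M * N)) i j = ent (rf M * rf N) i j"
   using MN ij by (simp add: ent_rf[of _ n] scalar_prod_def atLeast0LessThan)
 qed
qed

lemma rf_one: "rf (1\<^sub>m n) = ee n" by (rule rfm_eqI) (auto simp: ent_rf[of _ n] ent_ee)

lemma rf_zero: "rf (0\<^sub>m n n) = (0 :: 'a::ring_1 rfm)" by (rule rfm_eqI) (auto simp: ent_rf[of _ n])

lemma (in group_hom) card_image_dvd:
 assumes "h ` carrier G = carrier H"
 shows "card (carrier H) dvd card (carrier G)"
proof -
 interpret K: normal "kernel G H h" G by (rule normal_kernel)
 have "(%X. the_elem (h ` X)) \<in> iso (G Mod (kernel G H h)) H" by (rule FactGroup_iso_set[OF assms])
 hence "card (carrier (G Mod (kernel G H h))) = card (carrier H)" by (auto simp: iso_def bij_betw_same_card)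
 moreover have "card (carrier (G Mod (kernel G H h))) * card (kernel G H h) = card (carrier G)"
  unfolding FactGroup_def using G.lagrange[OF K.subgroup_axioms] by (simp add: Coset.order_def)
 ultimately show ?thesis by (metis dvd_triv_left)
qed

locale dade = group D for D :: "'d monoid" (structure) +
 fixes p m :: nat and act :: "'d => 'e::{finite,field} mat => 'e mat" and rh :: "'d => 'e mat"
  and X :: "'e mat set" and bX :: "nat => 'e mat"
 assumes prime_p: "prime p" and finD: "finite (carrier D)" and cardD: "\<exists>n. card (carrier D) = p ^ n"
  and pE: "of_nat p = (0::'e)" and basis: "E_basis m X" and stable: "d \<in> carrier D ==> act d ` X = X"
  and fixed: "\<exists>b\<in>X. \<forall>d\<in>carrier D. act d b = b"
  and rh_hom: "rh \<in> hom D (units_of (ring_mat TYPE('e) m ()))"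
  and act: "d \<in> carrier D ==> x \<in> carrier_mat m m ==> act d x = inv\<^bsub>ring_mat TYPE('e) m ()\<^esub> (rh d) * x * rh d"
  and bX_bij: "bij_betw bX {..<card X} X"
begin

abbreviation L where "L \<equiv> card X"
definition R :: "'d => 'e rfm" where "R d = rf (rh d)"
text \<open>The group is replaced by its image under the representation. This makes the action
  faithful by construction, so that a normalising matrix determines an automorphism.\<close>

definition P :: "'e rfm monoid" where "P = \<lparr>carrier = R ` carrier D, mult = (*), one = ee m\<rparr>"
definition bx :: "nat => 'e rfm" where "bx a = rf (bX a)"

lemma P_simps [simp]: "carrier P = R ` carrier D" "x \<otimes>\<^bsub>P\<^esub> y = x * y" "\<one>\<^bsub>P\<^esub> = ee m"
 by (auto simp: P_def)

lemma rh_carrier: "d \<in> carrier D ==> rh d \<in> carrier_mat m m"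
 using rh_hom by (auto simp: hom_def units_of_def Units_def ring_mat_simps)

lemma rh_mult: "d \<in> carrier D ==> e \<in> carrier D ==> rh (d \<otimes> e) = rh d * rh e"
 using rh_hom by (auto simp: hom_def units_of_def ring_mat_simps)

lemma rh_one: "rh \<one> = 1\<^sub>m m"
proof -
 interpret M: ring "ring_mat TYPE('e) m ()" by (rule ring_mat)
 interpret group_hom D "units_of (ring_mat TYPE('e) m ())" rh
  by (rule group_hom.intro) (auto simp: is_group M.units_group group_hom_axioms_def rh_hom)
 show ?thesis using hom_one by (simp add: units_of_def ring_mat_simps)
qed

lemma rh_inv: "d \<in> carrier D ==> inv\<^bsub>ring_mat TYPE('e) m ()\<^esub> (rh d) = rh (inv d)"
proof -
 assume d: "d \<in> carrier D"
 interpret M: ring "ring_mat TYPE('e) m ()" by (rule ring_mat)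
 have "rh d * rh (inv d) = 1\<^sub>m m" "rh (inv d) * rh d = 1\<^sub>m m"
  using d rh_mult[of d "inv d"] rh_mult[of "inv d" d] rh_one by auto
 thus ?thesis using M.inv_unique'[of "rh d" "rh (inv d)"] rh_carrier d by (simp add: ring_mat_simps)
qed

lemma R_Mat: "d \<in> carrier D ==> R d \<in> Mat m m" by (simp add: R_def rf_Mat rh_carrier)

lemma R_mult: "d \<in> carrier D ==> e \<in> carrier D ==> R (d \<otimes> e) = R d * R e"
 by (simp add: R_def rh_mult rf_mult[of _ m] rh_carrier)

lemma R_one: "R \<one> = ee m" by (simp add: R_def rh_one rf_one)

lemma R_inv: "d \<in> carrier D ==> R (inv d) * R d = ee m" "d \<in> carrier D ==> R d * R (inv d) = ee m"
 by (simp_all add: R_one flip: R_mult)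

definition cj :: "'d => 'e rfm => 'e rfm" where "cj d A = R (inv d) * A * R d"

lemma rf_act: "d \<in> carrier D ==> x \<in> carrier_mat m m ==> rf (act d x) = cj d (rf x)"
proof -
 assume d: "d \<in> carrier D" and x: "x \<in> carrier_mat m m"
 note c = rh_carrier[OF d] rh_carrier[OF inv_closed[OF d]]
 have "rf (act d x) = rf (rh (inv d) * x) * rf (rh d)"
  unfolding act[OF d x] rh_inv[OF d] by (rule rf_mult[OF mult_carrier_mat[OF c(2) x] c(1)])
 thus ?thesis unfolding rf_mult[OF c(2) x] by (simp add: cj_def R_def)
qed

lemma act_carrier: "d \<in> carrier D ==> x \<in> carrier_mat m m ==> act d x \<in> carrier_mat m m"
 unfolding act rh_inv by (intro mult_carrier_mat[of _ m m] rh_carrier inv_closed)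

lemma cj_Mat: "d \<in> carrier D ==> A \<in> Mat m m ==> cj d A \<in> Mat m m"
 unfolding cj_def using R_Mat[of d] R_Mat[of "inv d"] by blast

lemma cj_add: "cj d (A + B) = cj d A + cj d B" and cj_0: "cj d 0 = 0" and cj_sc: "cj d (sc x A) = sc x (cj d A)"
 by (simp_all add: cj_def distrib_left distrib_right sc_mult_left sc_mult_right)

lemma cj_sum: "cj d (sum f S) = (\<Sum>s\<in>S. cj d (f s))"
 by (simp add: cj_def sum_distrib_left sum_distrib_right)

lemma cj_mult: "d \<in> carrier D ==> e \<in> carrier D ==> cj (d \<otimes> e) A = cj e (cj d A)"
 by (simp add: cj_def inv_mult_group R_mult mult.assoc)

lemma cj_iff: "d \<in> carrier D ==> A \<in> Mat m m ==> B \<in> Mat m m ==> cj d A = B \<longleftrightarrow> R d * B = A * R d"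
proof
 assume *: "d \<in> carrier D" "A \<in> Mat m m" "B \<in> Mat m m"
 have AR: "A * R d \<in> Mat m m" using * R_Mat by blast
 show "R d * B = A * R d" if "cj d A = B"
 proof -
  have "R d * B = (R d * R (inv d)) * (A * R d)" unfolding that[symmetric] cj_def by (simp only: mult.assoc)
  thus ?thesis using R_inv(2)[OF *(1)] MatD(1)[OF AR] by simp
 qed
 show "cj d A = B" if "R d * B = A * R d"
 proof -
  have "cj d A = (R (inv d) * R d) * B" using that by (simp only: cj_def mult.assoc)
  thus ?thesis using R_inv(1)[OF *(1)] MatD(1)[OF *(3)] by simp
 qed
qed

lemma group_P: "group P"
proof (rule groupI)
 show "!!x y. x \<in> carrier P ==> y \<in> carrier P ==> x \<otimes>\<^bsub>P\<^esub> y \<in> carrier P"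
  by (auto simp: R_mult[symmetric])
 show "\<one>\<^bsub>P\<^esub> \<in> carrier P" using R_one by (auto intro!: image_eqI[of _ R \<one>])
 show "!!x y z. x \<otimes>\<^bsub>P\<^esub> y \<otimes>\<^bsub>P\<^esub> z = x \<otimes>\<^bsub>P\<^esub> (y \<otimes>\<^bsub>P\<^esub> z)" by (simp add: mult.assoc)
 show "\<one>\<^bsub>P\<^esub> \<otimes>\<^bsub>P\<^esub> x = x" if "x \<in> carrier P" for x using that MatD(1)[OF R_Mat] by auto
 show "\<exists>y\<in>carrier P. y \<otimes>\<^bsub>P\<^esub> x = \<one>\<^bsub>P\<^esub>" if "x \<in> carrier P" for x using that R_inv(1) by fastforce
qed

lemma card_P: "\<exists>k. card (carrier P) = p ^ k"
proof -
 interpret group_hom D P R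
  by (rule group_hom.intro) (auto simp: is_group group_P group_hom_axioms_def hom_def R_mult)
 have "card (carrier P) dvd card (carrier D)" by (rule card_image_dvd) simp
 thus ?thesis using cardD divides_primepow_nat[OF prime_p] by metis
qed

lemma bX_X: "a < L ==> bX a \<in> X" using bX_bij by (auto simp: bij_betw_def)

lemma X_carrier: "x \<in> X ==> x \<in> carrier_mat m m" using basis by (auto simp: E_basis_def)

lemma bx_Mat: "a < L ==> bx a \<in> Mat m m" by (simp add: bx_def rf_Mat X_carrier bX_X)

lemma bX_surj: "x \<in> X ==> \<exists>a<L. x = bX a" using bX_bij by (auto simp: bij_betw_def)

lemma bX_inj: "a < L ==> a' < L ==> bX a = bX a' ==> a = a'" using bX_bij by (auto simp: bij_betw_def inj_on_def)

lemma basis_expansion: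
 assumes A: "A \<in> Mat m m"
 shows "\<exists>u. A = (\<Sum>a<L. sc (u a) (bx a))"
proof -
 have "\<exists>!c. (\<forall>b. b \<notin> X --> c b = 0) & (\<forall>i<m. \<forall>j<m. tm m A $$ (i, j) = (\<Sum>b\<in>X. c b * b $$ (i, j)))"
  using basis tm_carrier[of m A] unfolding E_basis_def by blast
 then obtain c where c: "\<forall>i<m. \<forall>j<m. tm m A $$ (i, j) = (\<Sum>b\<in>X. c b * b $$ (i, j))"
  by (elim ex1E conjE)
 have "A = (\<Sum>a<L. sc (c (bX a)) (bx a))"
 proof (rule Mat_eqI[OF A])
  show "(\<Sum>a<L. sc (c (bX a)) (bx a)) \<in> Mat m m" using bx_Mat by (intro Mat_sum Mat_sc) auto
  fix i j assume ij: "i < m" "j < m"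
  have "ent A i j = (\<Sum>b\<in>X. c b * b $$ (i, j))" using c ij by (simp add: tm_def)
  also have "... = (\<Sum>a<L. c (bX a) * bX a $$ (i, j))" by (rule sum.reindex_bij_betw[OF bX_bij, symmetric])
  also have "... = (\<Sum>a<L. c (bX a) * ent (bx a) i j)"
   using ij ent_rf[OF X_carrier[OF bX_X]] by (intro sum.cong) (auto simp: bx_def)
  finally show "ent A i j = ent (\<Sum>a<L. sc (c (bX a)) (bx a)) i j" by (simp add: ent_sum)
 qed
 thus ?thesis by (intro exI[of _ "%a. c (bX a)"])
qed

lemma basis_independent:
 assumes u: "(\<Sum>a<L. sc (u a) (bx a)) = 0" and a: "a < L"
 shows "u a = 0"
proof -
 let ?i = "inv_into {..<L} bX"
 have i: "?i (bX a) = a" if "a < L" for a using bij_betw_inv_into_left[OF bX_bij] that by simp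
 define c where "c b = (if b \<in> X then u (?i b) else 0)" for b
 have "(\<Sum>b\<in>X. c b * b $$ (i, j)) = 0" if ij: "i < m" "j < m" for i j
 proof -
  have "(\<Sum>b\<in>X. c b * b $$ (i, j)) = (\<Sum>a<L. c (bX a) * bX a $$ (i, j))"
   by (rule sum.reindex_bij_betw[OF bX_bij, symmetric])
  also have "... = (\<Sum>a<L. u a * ent (bx a) i j)"
   using ij ent_rf[OF X_carrier[OF bX_X]] by (intro sum.cong) (auto simp: bx_def c_def i bX_X)
  also have "... = ent (\<Sum>a<L. sc (u a) (bx a)) i j" by (simp add: ent_sum)
  finally show ?thesis using u by simp
 qed
 moreover define good where "good c \<longleftrightarrow> (\<forall>b. b \<notin> X --> c b = 0) & (\<forall>i<m. \<forall>j<m. 0\<^sub>m m m $$ (i, j) = (\<Sum>b\<in>X. c b * b $$ (i, j)))"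
  for c :: "'e mat => 'e"
 ultimately have "good c" "good (%_. 0)" by (simp_all add: c_def)
 moreover have "\<exists>!c. good c" using basis zero_carrier_mat[of m m] unfolding E_basis_def good_def by blast
 ultimately have "c = (%_. 0)" by blast
 hence "c (bX a) = 0" by simp
 thus ?thesis using i[OF a] bX_X[OF a] by (simp add: c_def)
qed

lemma basis_unique: "(\<Sum>a<L. sc (u a) (bx a)) = (\<Sum>a<L. sc (w a) (bx a)) ==> a < L ==> u a = w a"
 using basis_independent[of "%a. u a - w a" a] by (simp add: sc_minus_left sum_subtractf)

definition ka :: "nat => nat => nat => 'e" where
 "ka a i j = (SOME u. un i j = (\<Sum>a<L. sc (u a) (bx a))) a"
definition cf :: "nat => 'e rfm => 'e" where "cf a M = (\<Sum>i<m. \<Sum>j<m. ka a i j * ent M i j)"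
text \<open>The permutation is a function of the matrix \<open>g\<close> alone and does not refer to
  an element of \<open>D\<close> above it.\<close>

definition b :: "'e rfm => nat => nat" where "b g a = (SOME a'. a' < L & g * bx a' = bx a * g)"

lemma ka: "i < m ==> j < m ==> un i j = (\<Sum>a<L. sc (ka a i j) (bx a))"
 unfolding ka_def using basis_expansion[OF Mat_un] by (rule someI_ex) auto

lemma cf_span: "M \<in> Mat m m ==> (\<Sum>a<L. sc (cf a M) (bx a)) = M"
proof -
 assume M: "M \<in> Mat m m"
 have "(\<Sum>a<L. sc (cf a M) (bx a)) = (\<Sum>a<L. \<Sum>i<m. \<Sum>j<m. sc (ka a i j * ent M i j) (bx a))"
  by (simp add: cf_def sc_sum_left)
 also have "... = (\<Sum>i<m. \<Sum>a<L. \<Sum>j<m. sc (ka a i j * ent M i j) (bx a))" by (rule sum.swap)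
 also have "... = (\<Sum>i<m. \<Sum>j<m. \<Sum>a<L. sc (ka a i j * ent M i j) (bx a))" by (rule sum.cong[OF refl]) (rule sum.swap)
 also have "... = (\<Sum>i<m. \<Sum>j<m. sc (ent M i j) (un i j))"
 proof (intro sum.cong refl)
  fix i j assume "i \<in> {..<m}" "j \<in> {..<m}"
  hence "sc (ent M i j) (un i j) = sc (ent M i j) (\<Sum>a<L. sc (ka a i j) (bx a))" using ka by simp
  also have "... = (\<Sum>a<L. sc (ka a i j * ent M i j) (bx a))" by (simp add: sc_sum_right mult.commute)
  finally show "(\<Sum>a<L. sc (ka a i j * ent M i j) (bx a)) = sc (ent M i j) (un i j)" ..
 qed
 also have "... = M" using Mat_expand[OF M] by simp
 finally show ?thesis .
qed

lemma cf_bx: "a < L ==> a' < L ==> cf a (bx a') = (if a = a' then 1 else 0)"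
proof -
 assume *: "a < L" "a' < L"
 have "(\<Sum>j<L. sc (if j = a' then 1 else 0) (bx j)) = (\<Sum>j<L. if j = a' then bx a' else 0)" by (intro sum.cong) auto
 also have "... = bx a'" using *(2) by simp
 also have "... = (\<Sum>j<L. sc (cf j (bx a')) (bx j))" using cf_span[OF bx_Mat[OF *(2)]] by simp
 finally have "(if a = a' then 1 else 0) = cf a (bx a')" using *(1) by (rule basis_unique)
 thus ?thesis by simp
qed

lemma bx_inj: "a < L ==> a' < L ==> bx a = bx a' ==> a = a'"
 using bX_inj rf_inj[OF X_carrier[OF bX_X] X_carrier[OF bX_X]] by (simp add: bx_def)

lemma b_exists: "d \<in> carrier D ==> a < L ==> \<exists>a'. a' < L & R d * bx a' = bx a * R d"
proof -
 assume *: "d \<in> carrier D" "a < L"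
 have "act d (bX a) \<in> X" using stable[OF *(1)] bX_X[OF *(2)] by blast
 then obtain a' where a': "a' < L" "act d (bX a) = bX a'" using bX_surj by blast
 hence "cj d (bx a) = bx a'" using rf_act[OF *(1) X_carrier[OF bX_X[OF *(2)]]] by (simp add: bx_def)
 thus ?thesis using cj_iff[OF *(1) bx_Mat[OF *(2)] bx_Mat[OF a'(1)]] a'(1) by blast
qed

lemma b_R: "d \<in> carrier D ==> a < L ==> b (R d) a < L & R d * bx (b (R d) a) = bx a * R d"
 unfolding b_def by (rule someI_ex[OF b_exists])

lemma cj_bx: "d \<in> carrier D ==> a < L ==> cj d (bx a) = bx (b (R d) a)"
 using cj_iff[OF _ bx_Mat bx_Mat] b_R by blast

lemma b_fixed: "\<exists>a<L. \<forall>g\<in>carrier P. b g a = a"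
proof -
 obtain x where x: "x \<in> X" "\<forall>d\<in>carrier D. act d x = x" using fixed by blast
 obtain a where a: "a < L" "x = bX a" using bX_surj[OF x(1)] by blast
 have "b (R d) a = a" if d: "d \<in> carrier D" for d
 proof -
  have "cj d (bx a) = bx a" using rf_act[OF d X_carrier[OF x(1)]] x(2) d a by (simp add: bx_def)
  thus ?thesis using cj_bx[OF d a(1)] bx_inj[of "b (R d) a" a] b_R[OF d a(1)] a(1) by simp
 qed
 thus ?thesis using a(1) by auto
qed

sublocale dr: drep P p m L "%g. g" bx b ka cf
proof (intro drep.intro drep_axioms.intro)
 show "group P" by (rule group_P)
 show "prime p" "of_nat p = (0::'e)" by (fact prime_p pE)+
qed (use R_Mat bx_Mat cf_def cf_bx cf_span b_R b_fixed in auto)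

abbreviation AD :: "'e rfm set" where "AD \<equiv> AP P m (%g. g)"
abbreviation XD :: "nat set" where "XD \<equiv> XP P L b"

lemma AD_iff: "A \<in> AD \<longleftrightarrow> A \<in> Mat m m & (\<forall>d\<in>carrier D. cj d A = A)"
 using cj_iff by (auto simp: AP_def)

lemma AD_fixed: "x \<in> carrier_mat m m ==> rf x \<in> AD \<longleftrightarrow> x \<in> fixed_pts act m (carrier D)"
 using rf_act rf_inj[OF act_carrier] by (auto simp: AD_iff fixed_pts_def rf_Mat) metis

lemma cf_fixed_cj: "d \<in> carrier D ==> a \<in> XD ==> A \<in> Mat m m ==> cf a (cj d A) = cf a A"
proof -
 assume d: "d \<in> carrier D" and a: "a \<in> XD" and A: "A \<in> Mat m m"
 have aL: "a < L" "b (R d) a = a" using a d by (auto simp: XP_def)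
 let ?i = "inv_into {..<L} (b (R d))"
 have bij: "bij_betw (b (R d)) {..<L} {..<L}" using dr.b_bij d by simp
 have i: "?i (b (R d) a) = a" if "a < L" for a using bij_betw_inv_into_left[OF bij] that by simp
 have "cj d A = (\<Sum>j<L. sc (cf j A) (bx (b (R d) j)))"
  by (subst cf_span[OF A, symmetric]) (simp add: cj_sum cj_sc cj_bx d)
 also have "... = (\<Sum>j<L. sc (cf (?i (b (R d) j)) A) (bx (b (R d) j)))" by (simp add: i)
 also have "... = (\<Sum>j<L. sc (cf (?i j) A) (bx j))" by (rule sum.reindex_bij_betw[OF bij])
 finally have "cf a (cj d A) = cf (?i a) A" using dr.cf_lin[OF aL(1)] by simp
 thus ?thesis using i[OF aL(1)] aL(2) by simp
qed

section \<open>Relative traces and the Brauer kernel\<close>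

definition dC :: "'d set => 'd" where "dC C = (SOME d. d \<in> C)"
definition tr :: "'d set => 'e rfm => 'e rfm" where "tr Q A = (\<Sum>C\<in>rcosets Q. cj (dC C) A)"
definition Fix :: "'d set => 'e rfm set" where "Fix Q = {A \<in> Mat m m. \<forall>q\<in>Q. cj q A = A}"

lemma rcosets_carrier: "subgroup Q D ==> C \<in> rcosets Q ==> C \<subseteq> carrier D"
 unfolding RCOSETS_def using r_coset_subset_G[OF subgroup.subset] by blast

lemma dC: "subgroup Q D ==> C \<in> rcosets Q ==> dC C \<in> C" "subgroup Q D ==> C \<in> rcosets Q ==> dC C \<in> carrier D"
proof -
 assume Q: "subgroup Q D" and C: "C \<in> rcosets Q"
 have "C ~= {}" using C subgroup.rcosets_non_empty[OF Q] by blast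
 thus 1: "dC C \<in> C" unfolding dC_def by (simp add: some_in_eq)
 show "dC C \<in> carrier D" using 1 rcosets_carrier[OF Q C] by blast
qed

lemma coset_of: "subgroup Q D ==> C \<in> rcosets Q ==> h \<in> C ==> C = Q #> h"
 unfolding RCOSETS_def using repr_independence by auto

lemma cj_coset:
 assumes Q: "subgroup Q D" and A: "A \<in> Fix Q" and C: "C \<in> rcosets Q" "h \<in> C" "h' \<in> C"
 shows "cj h A = cj h' A"
proof -
 have "h \<in> carrier D" using rcosets_carrier[OF Q C(1)] C(2) by blast
 obtain q where q: "q \<in> Q" "h' = q \<otimes> h" using coset_of[OF Q C(1,2)] C(3) by (auto simp: r_coset_def)
 have "q \<in> carrier D" using q(1) subgroup.subset[OF Q] by blast
 thus ?thesis using cj_mult[of q h A] q A \<open>h \<in> carrier D\<close> by (simp add: Fix_def)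
qed

lemma tr_Mat: "subgroup Q D ==> A \<in> Mat m m ==> tr Q A \<in> Mat m m"
 unfolding tr_def using dC by (intro Mat_sum cj_Mat) auto

lemma tr_add: "tr Q (A + B) = tr Q A + tr Q B" and tr_0: "tr Q 0 = 0"
 by (simp_all add: tr_def cj_add cj_0 sum.distrib)

lemma tr_AD:
 assumes Q: "subgroup Q D" and A: "A \<in> Fix Q"
 shows "tr Q A \<in> AD"
proof -
 have AM: "A \<in> Mat m m" using A by (simp add: Fix_def)
 have "cj e (tr Q A) = tr Q A" if e: "e \<in> carrier D" for e
 proof -
  have Qs: "Q \<subseteq> carrier D" by (rule subgroup.subset[OF Q])
  have cl: "C #> g \<in> rcosets Q" if C: "C \<in> rcosets Q" and g: "g \<in> carrier D" for C g
  proof -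
   obtain x where x: "x \<in> carrier D" "C = Q #> x" using C by (auto simp: RCOSETS_def)
   thus ?thesis using coset_mult_assoc[OF Qs x(1) g] g by (auto simp: RCOSETS_def)
  qed
  have inv: "C #> g #> inv g = C" if C: "C \<in> rcosets Q" and g: "g \<in> carrier D" for C g
   using coset_mult_assoc[of C g "inv g"] rcosets_carrier[OF Q C] g by simp
  have bij: "bij_betw (%C. C #> e) (rcosets Q) (rcosets Q)"
  proof (rule bij_betw_byWitness[of _ "%C. C #> inv e"])
   show "\<forall>C\<in>rcosets Q. C #> e #> inv e = C" using inv e by blast
   show "\<forall>C\<in>rcosets Q. C #> inv e #> e = C" using inv[of _ "inv e"] e by simp
  qed (use cl e in auto)
  have "cj e (tr Q A) = (\<Sum>C\<in>rcosets Q. cj (dC C \<otimes> e) A)"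
   unfolding tr_def cj_sum using dC[OF Q] e by (intro sum.cong) (auto simp: cj_mult)
  also have "... = (\<Sum>C\<in>rcosets Q. cj (dC (C #> e)) A)"
  proof (rule sum.cong[OF refl])
   fix C assume C: "C \<in> rcosets Q"
   have "dC C \<otimes> e \<in> C #> e" using dC(1)[OF Q C] by (auto simp: r_coset_def)
   thus "cj (dC C \<otimes> e) A = cj (dC (C #> e)) A"
    using cj_coset[OF Q A cl[OF C e] _ dC(1)[OF Q cl[OF C e]]] by blast
  qed
  also have "... = tr Q A" unfolding tr_def by (rule sum.reindex_bij_betw[OF bij])
  finally show ?thesis .
 qed
 thus ?thesis using tr_Mat[OF Q AM] by (simp add: AD_iff)
qed

lemma index_p: "Q \<in> proper_subgroups D ==> p dvd card (rcosets Q)"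
proof -
 assume "Q \<in> proper_subgroups D"
 hence Q: "subgroup Q D" "Q ~= carrier D" by (auto simp: proper_subgroups_def)
 obtain k where k: "card (carrier D) = p ^ k" using cardD by blast
 have lag: "card (rcosets Q) * card Q = p ^ k" using lagrange[OF Q(1)] k by (simp add: Coset.order_def)
 hence "card (rcosets Q) dvd p ^ k" by (metis dvd_triv_left)
 then obtain i where i: "card (rcosets Q) = p ^ i" using divides_primepow_nat[OF prime_p] by blast
 have "i ~= 0"
 proof
  assume "i = 0"
  hence "card Q = card (carrier D)" using lag i k by simp
  thus False using Q(2) card_subset_eq[OF finD subgroup.subset[OF Q(1)]] by blast
 qed
 thus ?thesis using i by simp
qed

lemma cf_linear: "cf a (A + B) = cf a A + cf a B" "cf a (A - B) = cf a A - cf a B" "cf a (sc x A) = x * cf a A" "cf a 0 = 0"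
 by (simp_all add: cf_def algebra_simps sum.distrib sum_subtractf sum_distrib_left)

lemma cf_sum: "cf a (sum f S) = (\<Sum>s\<in>S. cf a (f s))"
 by (induction S rule: infinite_finite_induct) (auto simp: cf_linear)

text \<open>At a fixed index all conjugates have the same coordinate, so the trace multiplies it by
  the index of \<open>Q\<close>, which \<open>p\<close> divides.\<close>

lemma cf_tr:
 assumes Q: "Q \<in> proper_subgroups D" and A: "A \<in> Mat m m" and a: "a \<in> XD"
 shows "cf a (tr Q A) = 0"
proof -
 have Qs: "subgroup Q D" using Q by (simp add: proper_subgroups_def)
 have "cf a (tr Q A) = (\<Sum>C\<in>rcosets Q. cf a A)"
  unfolding tr_def cf_sum using cf_fixed_cj[OF dC(2)[OF Qs] a A] by (intro sum.cong) auto
 also have "... = of_nat (card (rcosets Q)) * cf a A" by simp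
 also have "of_nat (card (rcosets Q)) = (0::'e)" using index_p[OF Q] pE by (auto elim!: dvdE)
 finally show ?thesis by simp
qed

definition BK :: "'e rfm set" where
 "BK = {A. \<exists>F. (\<forall>Q\<in>proper_subgroups D. F Q \<in> Fix Q) & A = (\<Sum>Q\<in>proper_subgroups D. tr Q (F Q))}"

lemma finite_proper: "finite (proper_subgroups D)"
 using finD by (auto simp: proper_subgroups_def intro!: finite_subset[of _ "Pow (carrier D)"] dest: subgroup.subset)

lemma rf_rel_trace:
 assumes "Q \<in> proper_subgroups D" "y \<in> carrier_mat m m"
 shows "rf (rel_trace D act m Q y) = tr Q (rf y)"
proof (rule Mat_eqI[of _ m m])
 have Q: "subgroup Q D" using assms by (simp add: proper_subgroups_def)
 have c: "rel_trace D act m Q y \<in> carrier_mat m m" by (simp add: rel_trace_def)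
 show "rf (rel_trace D act m Q y) \<in> Mat m m" "tr Q (rf y) \<in> Mat m m"
  using rf_Mat[OF c] tr_Mat[OF Q rf_Mat[OF assms(2)]] by auto
 fix i j assume ij: "i < m" "j < m"
 have "ent (rf (rel_trace D act m Q y)) i j = (\<Sum>C\<in>rcosets Q. act (dC C) y $$ (i, j))"
  using ij ent_rf[OF c] by (simp add: rel_trace_def dC_def)
 also have "... = (\<Sum>C\<in>rcosets Q. ent (cj (dC C) (rf y)) i j)"
 proof (rule sum.cong[OF refl])
  fix C assume "C \<in> rcosets Q"
  note d = dC(2)[OF Q this]
  show "act (dC C) y $$ (i, j) = ent (cj (dC C) (rf y)) i j"
   using rf_act[OF d assms(2)] ent_rf[OF act_carrier[OF d assms(2)], of i j] ij by simp
 qed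
 finally show "ent (rf (rel_trace D act m Q y)) i j = ent (tr Q (rf y)) i j" by (simp add: tr_def ent_sum)
qed

lemma Fix_fixed: "Q \<in> proper_subgroups D ==> x \<in> carrier_mat m m ==> rf x \<in> Fix Q \<longleftrightarrow> x \<in> fixed_pts act m Q"
proof -
 assume Q: "Q \<in> proper_subgroups D" and x: "x \<in> carrier_mat m m"
 have "cj q (rf x) = rf x \<longleftrightarrow> act q x = x" if "q \<in> Q" for q
 proof -
  have q: "q \<in> carrier D" using that Q subgroup.subset by (auto simp: proper_subgroups_def)
  show ?thesis using rf_act[OF q x] rf_inj[OF act_carrier[OF q x] x] by auto
 qed
 thus ?thesis using x by (auto simp: Fix_def fixed_pts_def rf_Mat)
qed

lemma brauer_kernel_BK: "x \<in> brauer_kernel D act m \<longleftrightarrow> x \<in> carrier_mat m m & rf x \<in> BK"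
proof -
 let ?S = "proper_subgroups D"
 have rs: "rf (mat m m (%(i, j). \<Sum>Q\<in>?S. f Q $$ (i, j))) = (\<Sum>Q\<in>?S. rf (f Q))"
  if f: "!!Q. Q \<in> ?S ==> f Q \<in> carrier_mat m m" for f :: "'d set => 'e mat"
 proof (rule Mat_eqI[of _ m m])
  show "rf (mat m m (%(i, j). \<Sum>Q\<in>?S. f Q $$ (i, j))) \<in> Mat m m" by (rule rf_Mat) simp
  show "(\<Sum>Q\<in>?S. rf (f Q)) \<in> Mat m m" by (intro Mat_sum rf_Mat f)
  fix i j assume ij: "i < m" "j < m"
  show "ent (rf (mat m m (%(i, j). \<Sum>Q\<in>?S. f Q $$ (i, j)))) i j = ent (\<Sum>Q\<in>?S. rf (f Q)) i j"
   unfolding ent_sum using ij f by (subst ent_rf[of _ m]) (auto simp: ent_rf[of _ m] intro!: sum.cong)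
 qed
 show ?thesis
 proof
  assume "x \<in> brauer_kernel D act m"
  then obtain f where f: "\<forall>Q\<in>?S. f Q \<in> trace_image D act m Q" "x = mat m m (%(i, j). \<Sum>Q\<in>?S. f Q $$ (i, j))"
   and x: "x \<in> carrier_mat m m" by (auto simp: brauer_kernel_def)
  have "\<forall>Q\<in>?S. \<exists>y. y \<in> fixed_pts act m Q & f Q = rel_trace D act m Q y" using f(1) by (auto simp: trace_image_def)
  then obtain y where y: "\<forall>Q\<in>?S. y Q \<in> fixed_pts act m Q & f Q = rel_trace D act m Q (y Q)" by metis
  have yc: "y Q \<in> carrier_mat m m" if "Q \<in> ?S" for Q using y that by (auto simp: fixed_pts_def)
  have "rf x = (\<Sum>Q\<in>?S. rf (f Q))" unfolding f(2) by (rule rs) (use y in \<open>simp add: rel_trace_def\<close>)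
  also have "... = (\<Sum>Q\<in>?S. tr Q (rf (y Q)))" using y rf_rel_trace yc by (intro sum.cong) auto
  finally have "rf x \<in> BK" unfolding BK_def using y yc Fix_fixed by (intro CollectI exI[of _ "%Q. rf (y Q)"]) auto
  thus "x \<in> carrier_mat m m & rf x \<in> BK" using x by simp
 next
  assume *: "x \<in> carrier_mat m m & rf x \<in> BK"
  then obtain F where F: "\<forall>Q\<in>?S. F Q \<in> Fix Q" "rf x = (\<Sum>Q\<in>?S. tr Q (F Q))" by (auto simp: BK_def)
  define f where "f Q = rel_trace D act m Q (tm m (F Q))" for Q
  have FM: "F Q \<in> Mat m m" if "Q \<in> ?S" for Q using F that by (auto simp: Fix_def)
  have "tm m (F Q) \<in> fixed_pts act m Q" if "Q \<in> ?S" for Q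
   using Fix_fixed[OF that tm_carrier[of m "F Q"]] F that by (simp add: rf_tm[OF FM])
  hence "\<forall>Q\<in>?S. f Q \<in> trace_image D act m Q" by (auto simp: trace_image_def f_def)
  moreover have "x = mat m m (%(i, j). \<Sum>Q\<in>?S. f Q $$ (i, j))"
  proof (rule rf_inj[of _ m])
   have "(\<Sum>Q\<in>?S. rf (f Q)) = (\<Sum>Q\<in>?S. tr Q (F Q))"
    using rf_rel_trace[OF _ tm_carrier] rf_tm[OF FM] by (intro sum.cong) (auto simp: f_def)
   thus "rf x = rf (mat m m (%(i, j). \<Sum>Q\<in>?S. f Q $$ (i, j)))"
    using F(2) rs[of f] by (simp add: f_def rel_trace_def)
  qed (use * in auto)
  ultimately show "x \<in> brauer_kernel D act m" using * by (auto simp: brauer_kernel_def)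
 qed
qed

lemma BK_0: "0 \<in> BK" unfolding BK_def by (intro CollectI exI[of _ "%_. 0"]) (auto simp: tr_0 Fix_def cj_0)

lemma BK_add: "A \<in> BK ==> B \<in> BK ==> A + B \<in> BK"
proof -
 assume "A \<in> BK" "B \<in> BK"
 then obtain F G where "\<forall>Q\<in>proper_subgroups D. F Q \<in> Fix Q" "A = (\<Sum>Q\<in>proper_subgroups D. tr Q (F Q))"
  "\<forall>Q\<in>proper_subgroups D. G Q \<in> Fix Q" "B = (\<Sum>Q\<in>proper_subgroups D. tr Q (G Q))" by (auto simp: BK_def)
 thus ?thesis unfolding BK_def
  by (intro CollectI exI[of _ "%Q. F Q + G Q"]) (auto simp: tr_add sum.distrib Fix_def cj_add intro: Mat_add)
qed

lemma BK_tr: "Q \<in> proper_subgroups D ==> A \<in> Fix Q ==> tr Q A \<in> BK"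
proof -
 assume Q: "Q \<in> proper_subgroups D" and A: "A \<in> Fix Q"
 have "(\<Sum>Q'\<in>proper_subgroups D. tr Q' (if Q' = Q then A else 0)) = (\<Sum>Q'\<in>proper_subgroups D. if Q' = Q then tr Q A else 0)"
  by (rule sum.cong[OF refl]) (simp add: tr_0)
 also have "... = tr Q A" using Q finite_proper by simp
 finally show ?thesis unfolding BK_def using A
  by (intro CollectI exI[of _ "%Q'. if Q' = Q then A else 0"]) (auto simp: Fix_def cj_0)
qed

lemma b_mult: "d \<in> carrier D ==> e \<in> carrier D ==> a < L ==> b (R (d \<otimes> e)) a = b (R e) (b (R d) a)"
proof -
 assume *: "d \<in> carrier D" "e \<in> carrier D" "a < L"
 have bd: "b (R d) a < L" using b_R * by blast
 have "bx (b (R (d \<otimes> e)) a) = bx (b (R e) (b (R d) a))"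
  using cj_mult[OF *(1,2), of "bx a"] * bd by (simp add: cj_bx)
 thus ?thesis using bx_inj b_R[OF m_closed[OF *(1,2)] *(3)] b_R[OF *(2) bd] by blast
qed

text \<open>Induction on the number of nonzero coordinates. A nonzero coordinate sits at an index
  \<open>a\<close> that is not fixed; its stabiliser \<open>Q\<close> is proper, and the multiple of
  the orbit sum to be subtracted is the trace from \<open>Q\<close> of a multiple of
  \<open>bx a\<close>.\<close>

lemma TT_BK: "c \<in> AD ==> (!!a. a \<in> XD ==> cf a c = 0) ==> c \<in> BK"
proof (induction "card {a. a < L & cf a c ~= 0}" arbitrary: c rule: less_induct)
 case (less c)
 have cM: "c \<in> Mat m m" using less.prems by (simp add: AP_def)
 show ?case
 proof (cases "\<exists>a<L. cf a c ~= 0")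
  case False
  hence "(\<Sum>a<L. sc (cf a c) (bx a)) = 0" by (intro sum.neutral) auto
  thus ?thesis using cf_span[OF cM] BK_0 by simp
 next
  case True
  then obtain a where a: "a < L" "cf a c ~= 0" by blast
  define Q where "Q = {d \<in> carrier D. b (R d) a = a}"
  have b1: "b (R \<one>) a = a"
   using cj_bx[OF one_closed a(1)] MatD[OF bx_Mat[OF a(1)]] bx_inj b_R[OF one_closed a(1)] a(1) by (simp add: cj_def R_one)
  have Q: "subgroup Q D"
  proof (rule subgroupI)
   show "Q ~= {}" using b1 by (auto simp: Q_def)
   show "inv d \<in> Q" if "d \<in> Q" for d
   proof -
    have d: "d \<in> carrier D" "b (R d) a = a" using that by (auto simp: Q_def)
    have "b (R (d \<otimes> inv d)) a = b (R (inv d)) (b (R d) a)" by (rule b_mult) (use d a in auto)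
    thus ?thesis using d b1 by (simp add: Q_def)
   qed
   show "d \<otimes> e \<in> Q" if "d \<in> Q" "e \<in> Q" for d e using that a b_mult by (auto simp: Q_def)
  qed (auto simp: Q_def)
  have aX: "a \<notin> XD" using a(2) less.prems(2) by blast
  hence Qp: "Q \<in> proper_subgroups D" using Q a(1) by (auto simp: proper_subgroups_def Q_def XP_def)
  let ?A = "sc (cf a c) (bx a)"
  have A: "?A \<in> Fix Q" using a(1) by (auto simp: Fix_def Q_def cj_sc cj_bx bx_Mat intro!: Mat_sc)
  define t where "t = tr Q ?A"
  define O' where "O' = (%C. b (R (dC C)) a) ` (rcosets Q)"
  have injO: "inj_on (%C. b (R (dC C)) a) (rcosets Q)"
  proof (rule inj_onI)
   fix C C' assume C: "C \<in> rcosets Q" "C' \<in> rcosets Q" and eq: "b (R (dC C)) a = b (R (dC C')) a"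
   note d = dC(2)[OF Q C(1)] and d' = dC(2)[OF Q C(2)]
   have "b (R (dC C \<otimes> inv (dC C'))) a = b (R (inv (dC C'))) (b (R (dC C)) a)" by (rule b_mult) (use d d' a in auto)
   also have "... = b (R (dC C' \<otimes> inv (dC C'))) a" unfolding eq by (rule b_mult[symmetric]) (use d' a in auto)
   finally have q: "dC C \<otimes> inv (dC C') \<in> Q" using d d' b1 by (simp add: Q_def)
   have "dC C = dC C \<otimes> inv (dC C') \<otimes> dC C'" using d d' by (simp add: m_assoc)
   hence "dC C \<in> Q #> dC C'" using q unfolding r_coset_def by blast
   hence "dC C \<in> C'" using coset_of[OF Q C(2) dC(1)[OF Q C(2)]] by simp
   thus "C = C'" using coset_of[OF Q C(1) dC(1)[OF Q C(1)]] coset_of[OF Q C(2)] by simp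
  qed
  have finC: "finite (rcosets Q)"
   using finD by (simp add: RCOSETS_def)
  have cft: "cf a' t = (if a' \<in> O' then cf a c else 0)" if a': "a' < L" for a'
  proof -
   have "cf a' t = (\<Sum>C\<in>rcosets Q. cf a c * (if b (R (dC C)) a = a' then 1 else 0))"
    unfolding t_def tr_def cf_sum
    using dC(2)[OF Q] b_R a(1) a' by (intro sum.cong) (auto simp: cj_sc cj_bx cf_linear cf_bx)
   also have "... = (\<Sum>x\<in>O'. cf a c * (if x = a' then 1 else 0))" unfolding O'_def by (rule sum.reindex[OF injO, symmetric, unfolded comp_def])
   also have "... = (\<Sum>x\<in>O'. if x = a' then cf a c else 0)" by (rule sum.cong[OF refl]) simp
   also have "... = (if a' \<in> O' then cf a c else 0)" using finC by (simp add: O'_def)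
   finally show ?thesis .
  qed
  have cO: "cf a' c = cf a c" if "a' \<in> O'" for a'
   using that dr.cf_fixed[OF less.prems(1) _ a(1)] dC(2)[OF Q] by (auto simp: O'_def)
  have tA: "t \<in> AD" unfolding t_def by (rule tr_AD[OF Q A])
  have cfd: "cf a' (c - t) = (if a' \<in> O' then 0 else cf a' c)" if "a' < L" for a'
   using cft[OF that] cO by (simp add: cf_linear)
  have aO: "a \<in> O'"
  proof -
   have C: "Q \<in> rcosets Q" using subgroup.subgroup_in_rcosets[OF Q is_group] .
   have "dC Q \<in> Q" by (rule dC(1)[OF Q C])
   thus ?thesis unfolding O'_def by (intro image_eqI[OF _ C]) (simp add: Q_def)
  qed
  have "card {a'. a' < L & cf a' (c - t) ~= 0} < card {a'. a' < L & cf a' c ~= 0}"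
  proof (rule psubset_card_mono)
   show "{a'. a' < L & cf a' (c - t) ~= 0} \<subset> {a'. a' < L & cf a' c ~= 0}"
   proof (rule psubsetI)
    have "cf a' c ~= 0" if "a' < L" "cf a' (c - t) ~= 0" for a' using cfd[OF that(1)] that(2) by presburger
    thus "{a'. a' < L & cf a' (c - t) ~= 0} \<subseteq> {a'. a' < L & cf a' c ~= 0}" by blast
    have "cf a (c - t) = 0" using cfd[OF a(1)] aO by simp
    thus "{a'. a' < L & cf a' (c - t) ~= 0} ~= {a'. a' < L & cf a' c ~= 0}" using a by blast
   qed
  qed simp
  moreover have "c - t \<in> AD" using less.prems(1) tA by (auto simp: AP_def algebra_simps intro: Mat_minus)
  moreover have "cf a' (c - t) = 0" if "a' \<in> XD" for a'
   using cfd[of a'] less.prems(2)[OF that] that by (simp add: XP_def)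
  ultimately have "c - t \<in> BK" using less.hyps by blast
  moreover have "t \<in> BK" unfolding t_def by (rule BK_tr[OF Qp A])
  ultimately show ?thesis using BK_add by fastforce
 qed
qed

theorem BK_iff: "c \<in> BK \<longleftrightarrow> c \<in> AD & (\<forall>a\<in>XD. cf a c = 0)"
proof
 assume "c \<in> BK"
 then obtain F where F: "\<forall>Q\<in>proper_subgroups D. F Q \<in> Fix Q" "c = (\<Sum>Q\<in>proper_subgroups D. tr Q (F Q))"
  by (auto simp: BK_def)
 have sub: "subgroup Q D" if "Q \<in> proper_subgroups D" for Q using that by (simp add: proper_subgroups_def)
 have t: "tr Q (F Q) \<in> AD" if "Q \<in> proper_subgroups D" for Q using tr_AD[OF sub[OF that]] F(1) that by blast
 have "c \<in> AD" unfolding F(2) AD_iff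
 proof (intro conjI ballI)
  show "(\<Sum>Q\<in>proper_subgroups D. tr Q (F Q)) \<in> Mat m m" using t by (intro Mat_sum) (simp add: AD_iff)
  fix d assume "d \<in> carrier D"
  thus "cj d (\<Sum>Q\<in>proper_subgroups D. tr Q (F Q)) = (\<Sum>Q\<in>proper_subgroups D. tr Q (F Q))"
   unfolding cj_sum using t by (intro sum.cong) (auto simp: AD_iff)
 qed
 moreover have "cf a c = 0" if "a \<in> XD" for a
  unfolding F(2) cf_sum using F(1) cf_tr that by (intro sum.neutral) (auto simp: Fix_def)
 ultimately show "c \<in> AD & (\<forall>a\<in>XD. cf a c = 0)" by blast
qed (use TT_BK in blast)

end

section \<open>The homomorphism on the normaliser\<close>

context emb
begin

lemma rep_mult_io: "rep ga G ==> A \<in> Mat m m ==> rep (ga * io A) (%ta. G ta * rmap ta A)"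
proof -
 assume r: "rep ga G" and A: "A \<in> Mat m m"
 have "fam G (A * v) = fam (%ta. G ta * rmap ta A) v" for v
  unfolding fam_def
 proof (rule sum.cong[OF refl])
  fix ta :: "'e => 'e" assume "ta \<in> FA"
  then interpret comm_ring_hom ta by (simp add: FA_def)
  show "G ta * rmap ta (A * v) = G ta * rmap ta A * rmap ta v" by (simp add: rmap_mult mult.assoc)
 qed
 moreover have "ga * io A * ps v = ps (fam G (A * v))" if "v \<in> Mat m 1" for v
 proof -
  have "ga * ps (A * v) = ps (fam G (A * v))" using r Mat_mult[OF A that] unfolding rep_def by blast
  thus ?thesis by (simp only: ps_act[OF A that] mult.assoc)
 qed
 moreover have "ga * io A \<in> Mat k k" using r io_Mat[OF A] by (auto simp: rep_def)
 moreover have "G ta * rmap ta A \<in> Mat m m" if "ta \<in> FA" for ta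
  using r that rmap_FA_Mat[OF that A] by (auto simp: rep_def)
 ultimately show ?thesis by (simp add: rep_def)
qed

lemma rep_io_mult: "rep ga G ==> A \<in> Mat m m ==> rep (io A * ga) (%ta. A * G ta)"
proof -
 assume r: "rep ga G" and A: "A \<in> Mat m m"
 have "A * fam G v = fam (%ta. A * G ta) v" for v by (simp add: fam_def sum_distrib_left mult.assoc)
 moreover have "io A * ga * ps v = ps (A * fam G v)" if "v \<in> Mat m 1" for v
  using r ps_act[OF A fam_Mat[OF _ that]] that by (simp add: rep_def mult.assoc)
 moreover have "io A * ga \<in> Mat k k" using r io_Mat[OF A] by (auto simp: rep_def)
 moreover have "A * G ta \<in> Mat m m" if "ta \<in> FA" for ta using r that A by (auto simp: rep_def)
 ultimately show ?thesis by (simp add: rep_def)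
qed

lemma io_eq: "A \<in> Mat m m ==> B \<in> Mat m m ==> io A = io B ==> A = B"
proof -
 assume *: "A \<in> Mat m m" "B \<in> Mat m m" "io A = io B"
 have "io (A - B + B) = io (A - B) + io B" by (rule io_add[OF Mat_minus[OF *(1,2)] *(2)])
 hence "io (A - B) = 0" using *(3) by simp
 thus ?thesis using io_inj[OF Mat_minus[OF *(1,2)]] by simp
qed

end

text \<open>Joins the embeddings of the algebra and of its Brauer quotient over the same prime field
  through the functor \<open>Ta\<close>.\<close>

locale nrm = drep P p m L rh bx b ka cf + E1: emb p s m io1 + E2: emb p s n io2
 for P :: "('g, 'z) monoid_scheme" (structure) and p m L and rh :: "'g => 'e::{finite,field} rfm" and bx b ka cf
  and s n :: nat and io1 io2 :: "'e rfm => 'f::{finite,field} rfm" +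
 fixes Ta
 assumes F: "is_functor P m L rh b cf n Ta" and rh_inj: "inj_on rh (carrier P)" and finP: "finite (carrier P)"
begin

lemma F_Mat: "ta \<in> FA ==> aut P pm ==> G \<in> GP P m rh ta pm ==> Ta ta pm G \<in> Mat n n"
 and F_add: "ta \<in> FA ==> aut P pm ==> G \<in> GP P m rh ta pm ==> H \<in> GP P m rh ta pm ==>
    Ta ta pm (G + H) = Ta ta pm G + Ta ta pm H"
 and F_mult: "ta1 \<in> FA ==> ta2 \<in> FA ==> aut P pm1 ==> aut P pm2 ==> G1 \<in> GP P m rh ta1 pm1 ==> G2 \<in> GP P m rh ta2 pm2 ==>
    Ta (ta1 \<circ> ta2) (pm1 \<circ> pm2) (G1 * rmap ta1 G2) = Ta ta1 pm1 G1 * rmap ta1 (Ta ta2 pm2 G2)"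
 and F_ee: "Ta id id (ee m) = ee n"
 using F unfolding is_functor_def FA_def mem_Collect_eq by blast+

lemma GP_0: "ta \<in> FA ==> 0 \<in> GP P m rh ta pm" by (simp add: GP_def)

lemma GP_add: "G \<in> GP P m rh ta pm ==> H \<in> GP P m rh ta pm ==> G + H \<in> GP P m rh ta pm"
 by (auto simp: GP_def distrib_left distrib_right intro: Mat_add)

lemma F_0: "ta \<in> FA ==> aut P pm ==> Ta ta pm 0 = 0"
 using F_add[OF _ _ GP_0 GP_0, of ta pm] by simp

lemma F_sum:
 assumes "ta \<in> FA" "aut P pm" "!!i. i \<in> I ==> f i \<in> GP P m rh ta pm"
 shows "Ta ta pm (sum f I) = (\<Sum>i\<in>I. Ta ta pm (f i)) & sum f I \<in> GP P m rh ta pm"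
 using assms(3) by (induction I rule: infinite_finite_induct) (auto simp: F_0 GP_0 GP_add F_add assms(1,2))

definition NN :: "'f rfm set" where
 "NN = {ga \<in> Mat (m * s) (m * s). (\<exists>ga'\<in>Mat (m * s) (m * s). ga * ga' = ee (m * s) & ga' * ga = ee (m * s)) &
   (\<forall>g\<in>carrier P. \<exists>h\<in>carrier P. ga * io1 (rh g) = io1 (rh h) * ga)}"

definition pi :: "'f rfm => 'g => 'g" where
 "pi ga g = (if g \<in> carrier P then SOME h. h \<in> carrier P & ga * io1 (rh g) = io1 (rh h) * ga else g)"

lemma pi: "ga \<in> NN ==> g \<in> carrier P ==> pi ga g \<in> carrier P & ga * io1 (rh g) = io1 (rh (pi ga g)) * ga"
proof -
 assume "ga \<in> NN" "g \<in> carrier P"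
 hence "\<exists>h. h \<in> carrier P & ga * io1 (rh g) = io1 (rh h) * ga" by (auto simp: NN_def)
 thus ?thesis unfolding pi_def using \<open>g \<in> carrier P\<close> someI_ex[of "%h. h \<in> carrier P & ga * io1 (rh g) = io1 (rh h) * ga"] by simp
qed

lemma pi_unique:
 assumes ga: "ga \<in> NN" and h: "h \<in> carrier P" "h' \<in> carrier P" and eq: "io1 (rh h) * ga = io1 (rh h') * ga"
 shows "h = h'"
proof -
 obtain ga' where ga': "ga * ga' = ee (m * s)" using ga by (auto simp: NN_def)
 have "io1 (rh h) * (ga * ga') = io1 (rh h') * (ga * ga')" using eq by (simp flip: mult.assoc)
 hence "io1 (rh h) = io1 (rh h')" using MatD(2)[OF E1.io_Mat[OF rh_Mat[OF h(1)]]] MatD(2)[OF E1.io_Mat[OF rh_Mat[OF h(2)]]] ga' by simp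
 hence "rh h = rh h'" by (rule E1.io_eq[OF rh_Mat[OF h(1)] rh_Mat[OF h(2)]])
 thus ?thesis using rh_inj h by (auto simp: inj_on_def)
qed

lemma aut_pi: "ga \<in> NN ==> aut P (pi ga)"
proof -
 assume ga: "ga \<in> NN"
 have GM: "ga \<in> Mat (m * s) (m * s)" using ga by (simp add: NN_def)
 obtain ga' where ga': "ga' * ga = ee (m * s)" using ga by (auto simp: NN_def)
 have inj: "inj_on (pi ga) (carrier P)"
 proof (rule inj_onI)
  fix g h assume gh: "g \<in> carrier P" "h \<in> carrier P" "pi ga g = pi ga h"
  have "ga * io1 (rh g) = ga * io1 (rh h)" using pi[OF ga gh(1)] pi[OF ga gh(2)] gh(3) by simp
  hence "(ga' * ga) * io1 (rh g) = (ga' * ga) * io1 (rh h)" by (simp add: mult.assoc)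
  hence "io1 (rh g) = io1 (rh h)" using MatD(1)[OF E1.io_Mat[OF rh_Mat[OF gh(1)]]] MatD(1)[OF E1.io_Mat[OF rh_Mat[OF gh(2)]]] ga' by simp
  hence "rh g = rh h" by (rule E1.io_eq[OF rh_Mat[OF gh(1)] rh_Mat[OF gh(2)]])
  thus "g = h" using rh_inj gh by (auto simp: inj_on_def)
 qed
 moreover have "pi ga ` carrier P \<subseteq> carrier P" using pi[OF ga] by auto
 hence "pi ga ` carrier P = carrier P" using inj finP by (intro endo_inj_surj) auto
 ultimately have "pi ga permutes carrier P" by (intro bij_imp_permutes) (auto simp: bij_betw_def pi_def)
 moreover have "pi ga (g \<otimes> h) = pi ga g \<otimes> pi ga h" if gh: "g \<in> carrier P" "h \<in> carrier P" for g h
 proof (rule pi_unique[OF ga])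
  note a = pi[OF ga gh(1)] and c = pi[OF ga gh(2)] and ac = pi[OF ga m_closed[OF gh]]
  show "pi ga (g \<otimes> h) \<in> carrier P" "pi ga g \<otimes> pi ga h \<in> carrier P" using a c ac by auto
  have "io1 (rh (pi ga (g \<otimes> h))) * ga = ga * io1 (rh (g \<otimes> h))" using ac by simp
  also have "... = ga * io1 (rh g) * io1 (rh h)" using gh by (simp add: rh_mult E1.io_mult rh_Mat mult.assoc)
  also have "... = io1 (rh (pi ga g)) * (ga * io1 (rh h))" using a by (simp add: mult.assoc)
  also have "... = io1 (rh (pi ga g)) * io1 (rh (pi ga h)) * ga" using c by (simp add: mult.assoc)
  also have "... = io1 (rh (pi ga g \<otimes> pi ga h)) * ga" using a c by (simp add: rh_mult E1.io_mult rh_Mat)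
  finally show "io1 (rh (pi ga (g \<otimes> h))) * ga = io1 (rh (pi ga g \<otimes> pi ga h)) * ga" .
 qed
 ultimately show ?thesis by (simp add: aut_def)
qed

lemma NN_mult: "ga1 \<in> NN ==> ga2 \<in> NN ==> ga1 * ga2 \<in> NN & pi (ga1 * ga2) = pi ga1 \<circ> pi ga2"
proof -
 assume 1: "ga1 \<in> NN" and 2: "ga2 \<in> NN"
 have M: "ga1 \<in> Mat (m * s) (m * s)" "ga2 \<in> Mat (m * s) (m * s)" using 1 2 by (auto simp: NN_def)
 obtain ga1' where g1: "ga1' \<in> Mat (m * s) (m * s)" "ga1 * ga1' = ee (m * s)" "ga1' * ga1 = ee (m * s)" using 1 by (auto simp: NN_def)
 obtain ga2' where g2: "ga2' \<in> Mat (m * s) (m * s)" "ga2 * ga2' = ee (m * s)" "ga2' * ga2 = ee (m * s)" using 2 by (auto simp: NN_def)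
 have eq: "ga1 * ga2 * io1 (rh g) = io1 (rh (pi ga1 (pi ga2 g))) * (ga1 * ga2)" if g: "g \<in> carrier P" for g
 proof -
  have "ga1 * ga2 * io1 (rh g) = ga1 * io1 (rh (pi ga2 g)) * ga2" using pi[OF 2 g] by (simp add: mult.assoc)
  thus ?thesis using pi[OF 1, of "pi ga2 g"] pi[OF 2 g] by (simp add: mult.assoc)
 qed
 have cl: "pi ga1 (pi ga2 g) \<in> carrier P" if "g \<in> carrier P" for g using pi[OF 1] pi[OF 2] that by blast
 have "ga1 * ga2 * (ga2' * ga1') = ee (m * s)"
 proof -
  have "ga1 * ga2 * (ga2' * ga1') = ga1 * (ga2 * ga2') * ga1'" by (simp only: mult.assoc)
  thus ?thesis using g1 g2 MatD(2)[OF M(1)] by simp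
 qed
 moreover have "ga2' * ga1' * (ga1 * ga2) = ee (m * s)"
 proof -
  have "ga2' * ga1' * (ga1 * ga2) = ga2' * (ga1' * ga1) * ga2" by (simp only: mult.assoc)
  thus ?thesis using g1 g2 MatD(2)[OF g2(1)] by simp
 qed
 moreover have "ga2' * ga1' \<in> Mat (m * s) (m * s)" "ga1 * ga2 \<in> Mat (m * s) (m * s)" using g1 g2 M by auto
 ultimately have N: "ga1 * ga2 \<in> NN" unfolding NN_def using eq cl by blast
 moreover have "pi (ga1 * ga2) g = (pi ga1 \<circ> pi ga2) g" for g
 proof (cases "g \<in> carrier P")
  case True
  have "pi (ga1 * ga2) g = pi ga1 (pi ga2 g)"
  proof (rule pi_unique[OF N])
   show "io1 (rh (pi (ga1 * ga2) g)) * (ga1 * ga2) = io1 (rh (pi ga1 (pi ga2 g))) * (ga1 * ga2)"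
    using pi[OF N True] eq[OF True] by simp
  qed (use pi[OF N True] cl[OF True] in auto)
  thus ?thesis by simp
 qed (simp add: pi_def)
 ultimately show ?thesis by auto
qed

lemma NN_inverse:
 assumes "ga \<in> NN" "ga' \<in> Mat (m * s) (m * s)" "ga * ga' = ee (m * s)" "ga' * ga = ee (m * s)"
 shows "ga' \<in> NN"
proof -
 have "\<exists>h\<in>carrier P. ga' * io1 (rh g) = io1 (rh h) * ga'" if g: "g \<in> carrier P" for g
 proof -
  have "pi ga ` carrier P = carrier P" using aut_pi[OF assms(1)] permutes_image unfolding aut_def by blast
  then obtain h where h: "h \<in> carrier P" "g = pi ga h" using g by blast
  have "ga' * (ga * io1 (rh h)) * ga' = ga' * (io1 (rh g) * ga) * ga'" using pi[OF assms(1) h(1)] h(2) by simp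
  hence "(ga' * ga) * io1 (rh h) * ga' = ga' * io1 (rh g) * (ga * ga')" by (simp only: mult.assoc)
  hence "io1 (rh h) * ga' = ga' * io1 (rh g)"
   using assms(3,4) MatD(1)[OF E1.io_Mat[OF rh_Mat[OF h(1)]]] MatD(2)[OF E1.io_Mat[OF rh_Mat[OF g]]] by (simp add: mult.assoc)
  thus ?thesis using h(1) by metis
 qed
 moreover have "ga \<in> Mat (m * s) (m * s)" using assms(1) by (simp add: NN_def)
 ultimately show ?thesis unfolding NN_def using assms(2,3,4) by blast
qed

definition Gf :: "'f rfm => ('e => 'e) => 'e rfm" where "Gf ga = (SOME G. E1.rep ga G)"

lemma Gf: "ga \<in> NN ==> E1.rep ga (Gf ga)"
proof -
 assume "ga \<in> NN"
 then obtain G where "E1.rep ga G" using E1.rep_exists by (auto simp: NN_def)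
 thus ?thesis unfolding Gf_def by (rule someI[where P = "E1.rep ga"])
qed

text \<open>The two sides of the normalising relation are decomposed into semilinear components; by
  uniqueness they agree component by component.\<close>

lemma Gf_GP: "ga \<in> NN ==> ta \<in> FA ==> Gf ga ta \<in> GP P m rh ta (pi ga)"
proof -
 assume ga: "ga \<in> NN" and ta: "ta \<in> FA"
 have "Gf ga ta * rmap ta (rh g) = rh (pi ga g) * Gf ga ta" if g: "g \<in> carrier P" for g
 proof -
  note pg = pi[OF ga g]
  have "E1.rep (ga * io1 (rh g)) (%ta. Gf ga ta * rmap ta (rh g))" by (rule E1.rep_mult_io[OF Gf[OF ga] rh_Mat[OF g]])
  moreover have "E1.rep (ga * io1 (rh g)) (%ta. rh (pi ga g) * Gf ga ta)"
   using E1.rep_io_mult[OF Gf[OF ga] rh_Mat, of "pi ga g"] pg by simp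
  ultimately show ?thesis using ta E1.rep_unique by blast
 qed
 moreover have "Gf ga ta \<in> Mat m m" using Gf[OF ga] ta by (simp add: E1.rep_def)
 ultimately show ?thesis by (simp add: GP_def)
qed

text \<open>The functor is applied to each semilinear component of \<open>ga\<close>;
  \<open>Ph\<close> reassembles the results into a matrix over the prime field and is the
  homomorphism sought.\<close>

definition HH :: "'f rfm => ('e => 'e) => 'e rfm" where "HH ga ta = Ta ta (pi ga) (Gf ga ta)"
definition Ph :: "'f rfm => 'f rfm" where "Ph ga = (SOME de. E2.rep de (HH ga))"

lemma Ph: "ga \<in> NN ==> E2.rep (Ph ga) (HH ga)"
proof -
 assume ga: "ga \<in> NN"
 have "HH ga ta \<in> Mat n n" if "ta \<in> FA" for ta unfolding HH_def by (rule F_Mat[OF that aut_pi[OF ga] Gf_GP[OF ga that]])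
 then obtain de where "E2.rep de (HH ga)" using E2.rep_matrix_exists by blast
 thus ?thesis unfolding Ph_def by (rule someI)
qed

text \<open>Decompositions multiply by convolution on both sides. All terms of one component
  intertwine through the same automorphism \<open>pi ga1 \<circ> pi ga2\<close>, so additivity and
  the product rule of the functor apply.\<close>

theorem Ph_mult:
 assumes 1: "ga1 \<in> NN" and 2: "ga2 \<in> NN"
 shows "Ph (ga1 * ga2) = Ph ga1 * Ph ga2"
proof (rule E2.rep_matrix_unique)
 have N: "ga1 * ga2 \<in> NN" and pm: "pi (ga1 * ga2) = pi ga1 \<circ> pi ga2" using NN_mult[OF 1 2] by auto
 show "E2.rep (Ph (ga1 * ga2)) (HH (ga1 * ga2))" by (rule Ph[OF N])
 show "E2.rep (Ph ga1 * Ph ga2) (%r. \<Sum>(si, ta)\<in>{(si, ta)\<in>FA \<times> FA. si \<circ> ta = r}. HH ga1 si * rmap si (HH ga2 ta))"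
  by (rule E2.rep_mult[OF Ph[OF 1] Ph[OF 2]])
 fix r :: "'e => 'e" assume r: "r \<in> FA"
 let ?I = "{(si, ta)\<in>FA \<times> FA. si \<circ> ta = r}"
 have "Gf (ga1 * ga2) r = (\<Sum>(si, ta)\<in>?I. Gf ga1 si * rmap si (Gf ga2 ta))"
  using E1.rep_unique[OF Gf[OF N] E1.rep_mult[OF Gf[OF 1] Gf[OF 2]] r] .
 hence "HH (ga1 * ga2) r = Ta r (pi ga1 \<circ> pi ga2) (\<Sum>x\<in>?I. Gf ga1 (fst x) * rmap (fst x) (Gf ga2 (snd x)))"
  by (simp add: HH_def pm case_prod_unfold)
 also have "... = (\<Sum>x\<in>?I. Ta r (pi ga1 \<circ> pi ga2) (Gf ga1 (fst x) * rmap (fst x) (Gf ga2 (snd x))))"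
 proof (rule F_sum[OF r aut_comp[OF aut_pi[OF 1] aut_pi[OF 2]], THEN conjunct1])
  fix x assume "x \<in> ?I"
  then obtain si ta where x: "x = (si, ta)" "si \<in> FA" "ta \<in> FA" "r = si \<circ> ta" by auto
  interpret a: comm_ring_hom si using x by (simp add: FA_def)
  interpret c: comm_ring_hom ta using x by (simp add: FA_def)
  note G1 = Gf_GP[OF 1 x(2)] and G2 = Gf_GP[OF 2 x(3)]
  have "Gf ga1 si * rmap si (Gf ga2 ta) * rmap (si \<circ> ta) (rh g) = rh (pi ga1 (pi ga2 g)) * (Gf ga1 si * rmap si (Gf ga2 ta))"
   if g: "g \<in> carrier P" for g
  proof -
   have "rmap (si \<circ> ta) (rh g) = rmap si (rmap ta (rh g))" by (simp add: rmap_comp)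
   hence "Gf ga1 si * rmap si (Gf ga2 ta) * rmap (si \<circ> ta) (rh g) = Gf ga1 si * rmap si (Gf ga2 ta * rmap ta (rh g))"
    by (simp only: a.rmap_mult mult.assoc)
   also have "Gf ga2 ta * rmap ta (rh g) = rh (pi ga2 g) * Gf ga2 ta" using G2 g by (simp add: GP_def)
   also have "Gf ga1 si * rmap si ... = (Gf ga1 si * rmap si (rh (pi ga2 g))) * rmap si (Gf ga2 ta)" by (simp only: a.rmap_mult mult.assoc)
   also have "Gf ga1 si * rmap si (rh (pi ga2 g)) = rh (pi ga1 (pi ga2 g)) * Gf ga1 si" using G1 pi[OF 2 g] by (simp add: GP_def)
   finally show ?thesis by (simp only: mult.assoc)
  qed
  moreover have "Gf ga1 si * rmap si (Gf ga2 ta) \<in> Mat m m" using G1 G2 a.rmap_Mat by (auto simp: GP_def)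
  ultimately show "Gf ga1 (fst x) * rmap (fst x) (Gf ga2 (snd x)) \<in> GP P m rh r (pi ga1 \<circ> pi ga2)"
   using x by (simp add: GP_def)
 qed
 also have "... = (\<Sum>(si, ta)\<in>?I. HH ga1 si * rmap si (HH ga2 ta))"
 proof (rule sum.cong[OF refl])
  fix x assume "x \<in> ?I"
  then obtain si ta where x: "x = (si, ta)" "si \<in> FA" "ta \<in> FA" "r = si \<circ> ta" by auto
  thus "Ta r (pi ga1 \<circ> pi ga2) (Gf ga1 (fst x) * rmap (fst x) (Gf ga2 (snd x))) = (case x of (si, ta) => HH ga1 si * rmap si (HH ga2 ta))"
   using F_mult[OF x(2,3) aut_pi[OF 1] aut_pi[OF 2] Gf_GP[OF 1 x(2)] Gf_GP[OF 2 x(3)]] by (simp add: HH_def)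
 qed
 finally show "HH (ga1 * ga2) r = (\<Sum>(si, ta)\<in>?I. HH ga1 si * rmap si (HH ga2 ta))" .
qed

lemma NN_io:
 assumes c: "c \<in> AP P m rh" "c' \<in> Mat m m" "c * c' = ee m" "c' * c = ee m"
 shows "io1 c \<in> NN" "pi (io1 c) = id"
proof -
 have cM: "c \<in> Mat m m" using c by (simp add: AP_def)
 have eq: "io1 c * io1 (rh g) = io1 (rh g) * io1 c" if g: "g \<in> carrier P" for g
  using E1.io_mult[OF cM rh_Mat[OF g]] E1.io_mult[OF rh_Mat[OF g] cM] c(1) g by (simp add: AP_def)
 have "io1 c * io1 c' = ee (m * s)" "io1 c' * io1 c = ee (m * s)"
  using E1.io_mult[OF cM c(2)] E1.io_mult[OF c(2) cM] c(3,4) E1.io_ee by auto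
 thus N: "io1 c \<in> NN" unfolding NN_def using eq E1.io_Mat[OF cM] E1.io_Mat[OF c(2)] by blast
 show "pi (io1 c) = id"
 proof
  fix g
  show "pi (io1 c) g = id g"
  proof (cases "g \<in> carrier P")
   case True
   have "pi (io1 c) g = g"
    by (rule pi_unique[OF N]) (use pi[OF N True] eq[OF True] True in auto)
   thus ?thesis by simp
  qed (simp add: pi_def)
 qed
qed

text \<open>\<open>io1 c\<close> induces the trivial automorphism and its only component is
  \<open>c\<close> at the identity.\<close>

theorem Ph_io:
 assumes c: "c \<in> AP P m rh" "c' \<in> Mat m m" "c * c' = ee m" "c' * c = ee m"
 shows "Ph (io1 c) = io2 (Ta id id c)"
proof (rule E2.rep_matrix_unique)
 note N = NN_io[OF c]
 have cM: "c \<in> Mat m m" using c by (simp add: AP_def)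
 have cG: "c \<in> GP P m rh id id" using c(1) by (auto simp: AP_def GP_def)
 show "E2.rep (Ph (io1 c)) (HH (io1 c))" by (rule Ph[OF N(1)])
 show "E2.rep (io2 (Ta id id c)) (%ta. if ta = id then Ta id id c else 0)"
  by (rule E2.rep_io[OF F_Mat[OF FA_id aut_id cG]])
 fix ta :: "'e => 'e" assume ta: "ta \<in> FA"
 have "Gf (io1 c) ta = (if ta = id then c else 0)" by (rule E1.rep_unique[OF Gf[OF N(1)] E1.rep_io[OF cM] ta])
 thus "HH (io1 c) ta = (if ta = id then Ta id id c else 0)" using F_0[OF ta aut_id] by (simp add: HH_def N(2))
qed

lemma Ph_ee: "Ph (ee (m * s)) = ee (n * s)"
proof -
 have A: "ee m \<in> AP P m rh" using MatD[OF rh_Mat] by (auto simp: AP_def)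
 show "Ph (ee (m * s)) = ee (n * s)" using Ph_io[OF A ee_Mat] by (simp add: E1.io_ee E2.io_ee F_ee)
qed

end

section \<open>Return to the matrices of the statement\<close>

lemma tm_mult: "A \<in> Mat n n ==> B \<in> Mat n n ==> tm n (A * B) = tm n A * tm n (B :: 'a::ring_1 rfm)"
proof -
 assume A: "A \<in> Mat n n" and B: "B \<in> Mat n n"
 show ?thesis
  by (rule rf_inj[OF tm_carrier mult_carrier_mat[OF tm_carrier tm_carrier]])
   (simp only: rf_mult[OF tm_carrier tm_carrier] rf_tm[OF A] rf_tm[OF B] rf_tm[OF Mat_mult[OF A B]])
qed

lemma tm_add: "A \<in> Mat n n ==> B \<in> Mat n n ==> tm n (A + B) = tm n A + tm n (B :: 'a::ring_1 rfm)"
proof -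
 assume A: "A \<in> Mat n n" and B: "B \<in> Mat n n"
 show ?thesis
  by (rule rf_inj[OF tm_carrier add_carrier_mat[OF tm_carrier]])
   (simp only: rf_add[OF tm_carrier tm_carrier] rf_tm[OF A] rf_tm[OF B] rf_tm[OF Mat_add[OF A B]])
qed

lemma tm_ee: "tm n (ee n) = (1\<^sub>m n :: 'a::ring_1 mat)"
 by (rule rf_inj[OF tm_carrier one_carrier_mat]) (simp only: rf_tm[OF ee_Mat] rf_one)

lemma emb_of_ring_hom:
 fixes ch :: "'e::{finite,field} mat => 'f::{finite,field} mat"
 assumes "prime p" "of_nat p = (0::'e)" "card (UNIV :: 'e set) = p ^ s" "card (UNIV :: 'f set) = p"
  and ch: "ch \<in> ring_hom (ring_mat TYPE('e) m ()) (ring_mat TYPE('f) (m * s) ())" and inj: "inj_on ch (carrier_mat m m)"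
 shows "emb p s m (%A. rf (ch (tm m A)))"
proof -
 have c: "ch x \<in> carrier_mat (m * s) (m * s)" if "x \<in> carrier_mat m m" for x
  using ring_hom_closed[OF ch, of x] that by (simp add: ring_mat_simps)
 have add: "rf (ch (tm m (A + B))) = rf (ch (tm m A)) + rf (ch (tm m B))" if "A \<in> Mat m m" "B \<in> Mat m m" for A B
 proof -
  show ?thesis unfolding tm_add[OF that] using ring_hom_add[OF ch, of "tm m A" "tm m B"] by (simp add: ring_mat_simps rf_add[OF c c])
 qed
 have mult: "rf (ch (tm m (A * B))) = rf (ch (tm m A)) * rf (ch (tm m B))" if "A \<in> Mat m m" "B \<in> Mat m m" for A B
 proof -
  show ?thesis unfolding tm_mult[OF that] using ring_hom_mult[OF ch, of "tm m A" "tm m B"] by (simp add: ring_mat_simps rf_mult[OF c c])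
 qed
 have ee: "rf (ch (tm m (ee m))) = ee (m * s)"
 proof -
  show ?thesis unfolding tm_ee using ring_hom_one[OF ch] by (simp add: ring_mat_simps rf_one)
 qed
 have inj': "A = 0" if A: "A \<in> Mat m m" and 0: "rf (ch (tm m A)) = 0" for A
 proof -
  have "rf (ch (tm m 0)) = 0" using add[of 0 0] by simp
  hence "ch (tm m A) = ch (tm m 0)" using 0 by (intro rf_inj[OF c c]) auto
  hence "tm m A = tm m 0" using inj by (auto simp: inj_on_def)
  hence "rf (tm m A) = rf (tm m 0)" by simp
  thus ?thesis using rf_tm[OF A] rf_tm[of "0 :: 'e rfm" m] by simp
 qed
 show ?thesis by unfold_locales (use assms(1-4) add mult ee inj' rf_Mat[OF c] in auto)
qed

theorem mainTheorem14:
  fixes p m s l :: nat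
    and D :: "'d monoid"
    and act :: "'d \<Rightarrow> 'e::{finite,field} mat \<Rightarrow> 'e mat"
    and \<rho> :: "'d \<Rightarrow> 'e mat"
    and \<iota> :: "'e mat \<Rightarrow> 'f::{finite,field} mat"
    and \<iota>' :: "'e mat set \<Rightarrow> 'f mat"
  assumes "prime p"
    and "group D" and "finite (carrier D)" and "\<exists>n. card (carrier D) = p ^ n"
    and "CHAR('e) = p" and "card (UNIV :: 'e set) = p ^ s"
    and "card (UNIV :: 'f set) = p"
    and "Dade_algebra D act m"
    and "\<rho> \<in> hom D (units_of (ring_mat TYPE('e) m ()))"
    and "\<forall>d\<in>carrier D. \<forall>x\<in>carrier_mat m m.
           act d x = inv\<^bsub>ring_mat TYPE('e) m ()\<^esub> (\<rho> d) * x * \<rho> d"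
    and "card (carrier (brauer_quotient D act m)) = card (UNIV :: 'e set) ^ (l ^ 2)"
    and "\<iota> \<in> ring_hom (ring_mat TYPE('e) m ()) (ring_mat TYPE('f) (m * s) ())"
    and "inj_on \<iota> (carrier_mat m m)"
    and "\<iota>' \<in> ring_hom (brauer_quotient D act m) (ring_mat TYPE('f) (l * s) ())"
    and "inj_on \<iota>' (carrier (brauer_quotient D act m))"
  shows "\<exists>\<phi>. \<phi> \<in> hom ((units_of (ring_mat TYPE('f) (m * s) ()))
                      \<lparr>carrier := normalizer (units_of (ring_mat TYPE('f) (m * s) ())) (\<iota> ` \<rho> ` carrier D)\<rparr>)
                   (units_of (ring_mat TYPE('f) (l * s) ())) \<and>
             (\<forall>c\<in>Units (fixed_alg D act m). \<phi> (\<iota> c) = \<iota>' (brD D act m c))"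
proof -
 obtain X where X: "E_basis m X" "\<forall>d\<in>carrier D. act d ` X = X" "\<exists>b\<in>X. \<forall>d\<in>carrier D. act d b = b"
  using assms(8) by (auto simp: Dade_algebra_def)
 have "finite X" using X(1) by (simp add: E_basis_def)
 then obtain bX where bX: "bij_betw bX {..<card X} X" using ex_bij_betw_nat_finite by (metis atLeast0LessThan)
 have pE: "of_nat p = (0::'e)" using of_nat_CHAR[where 'a = 'e] assms(5) by simp
 interpret dade D p m act \<rho> X bX
  by (intro dade.intro dade_axioms.intro) (use assms X pE bX in auto)
 obtain k where k: "card (carrier P) = p ^ k" using card_P by blast
 have finP: "finite (carrier P)" using finD by simp
 obtain n Ta where F: "is_functor P m L (%g. g) b cf n Ta"
  using dr.brauer_functor[OF finP k] by blast
 note F' = F[unfolded is_functor_def]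
 let ?R = "fixed_alg D act m" and ?S = "ring_mat TYPE('e) n ()" and ?B = "brauer_quotient D act m"
 have R_simps: "carrier ?R = fixed_pts act m (carrier D)" "x \<otimes>\<^bsub>?R\<^esub> y = x * y" "x \<oplus>\<^bsub>?R\<^esub> y = x + y"
  "\<one>\<^bsub>?R\<^esub> = 1\<^sub>m m" "\<zero>\<^bsub>?R\<^esub> = 0\<^sub>m m m" for x y
  by (simp_all add: fixed_alg_def ring_mat_simps)
 have Rc: "x \<in> carrier_mat m m" "rf x \<in> AD" if "x \<in> carrier ?R" for x
  using that AD_fixed[of x] by (auto simp: R_simps fixed_pts_def)
 have RI: "x \<in> carrier ?R" if "x \<in> carrier_mat m m" "rf x \<in> AD" for x using that AD_fixed by (simp add: R_simps)
 have AD_mult: "A * B \<in> AD" and AD_add: "A + B \<in> AD" if "A \<in> AD" "B \<in> AD" for A B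
 proof -
  have M: "A \<in> Mat m m" "B \<in> Mat m m" using that by (auto simp: AP_def)
  have cA: "g * A = A * g" and cB: "g * B = B * g" if "g \<in> carrier P" for g
   using \<open>A \<in> AD\<close> \<open>B \<in> AD\<close> that unfolding AP_def by blast+
  have "g * (A * B) = A * B * g" if g: "g \<in> carrier P" for g
  proof -
   have "g * (A * B) = (g * A) * B" by (simp only: mult.assoc)
   also have "... = A * (g * B)" by (simp only: cA[OF g] mult.assoc)
   finally show ?thesis by (simp only: cB[OF g] mult.assoc)
  qed
  thus "A * B \<in> AD" using Mat_mult[OF M] unfolding AP_def by blast
  show "A + B \<in> AD" using that by (auto simp: AP_def distrib_left distrib_right intro: Mat_add)
 qed
 have AD_ee: "ee m \<in> AD" using MatD[OF R_Mat] by (auto simp: AP_def)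
 have AD_uminus: "- A \<in> AD" if "A \<in> AD" for A
  using that Mat_minus[of 0 m m A] by (auto simp: AP_def)
 have ringR: "ring ?R" unfolding fixed_alg_def
 proof (rule ring.subring_is_ring[OF ring_mat])
  interpret M: ring "ring_mat TYPE('e) m ()" by (rule ring_mat)
  show "subring (fixed_pts act m (carrier D)) (ring_mat TYPE('e) m ())"
  proof (rule M.subringI)
   show "fixed_pts act m (carrier D) \<subseteq> carrier (ring_mat TYPE('e) m ())" by (auto simp: fixed_pts_def ring_mat_simps)
   show "\<one>\<^bsub>ring_mat TYPE('e) m ()\<^esub> \<in> fixed_pts act m (carrier D)"
    using AD_fixed[of "1\<^sub>m m"] AD_ee by (simp add: ring_mat_simps rf_one)
   fix x y assume x: "x \<in> fixed_pts act m (carrier D)" and y: "y \<in> fixed_pts act m (carrier D)"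
   have xc: "x \<in> carrier_mat m m" "y \<in> carrier_mat m m" using x y by (auto simp: fixed_pts_def)
   have xA: "rf x \<in> AD" "rf y \<in> AD" using AD_fixed xc x y by auto
   show "x \<otimes>\<^bsub>ring_mat TYPE('e) m ()\<^esub> y \<in> fixed_pts act m (carrier D)"
    using AD_fixed[of "x * y"] xc AD_mult[OF xA] by (simp add: ring_mat_simps rf_mult[OF xc])
   show "x \<oplus>\<^bsub>ring_mat TYPE('e) m ()\<^esub> y \<in> fixed_pts act m (carrier D)"
    using AD_fixed[of "x + y"] xc AD_add[OF xA] by (simp add: ring_mat_simps rf_add[OF xc])
  next
   fix x assume x: "x \<in> fixed_pts act m (carrier D)"
   let ?y = "\<ominus>\<^bsub>ring_mat TYPE('e) m ()\<^esub> x"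
   have xc: "x \<in> carrier_mat m m" using x by (auto simp: fixed_pts_def)
   have yc: "?y \<in> carrier_mat m m" using M.a_inv_closed[of x] xc by (simp add: ring_mat_simps)
   have "x + ?y = 0\<^sub>m m m" using M.r_neg[of x] xc by (simp add: ring_mat_simps)
   hence "rf x + rf ?y = 0" using rf_add[OF xc yc] by (simp add: rf_zero)
   hence "rf ?y = - rf x" by (simp add: eq_neg_iff_add_eq_0 add.commute)
   thus "?y \<in> fixed_pts act m (carrier D)" using AD_fixed[OF yc] AD_fixed[OF xc] x AD_uminus by simp
  qed
 qed
 \<comment> \<open>The functor on the fixed algebra, a ring homomorphism onto the matrices of size
   \<open>n\<close>. Its kernel is the Brauer kernel, so it identifies the Brauer quotient with a
   full matrix algebra.\<close>
 define h where "h x = tm n (Ta id id (rf x))" for x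
 have idFA: "comm_ring_hom (id :: 'e => 'e)" by (rule id_comm_ring_hom)
 have ADG: "AD = GP P m (%g. g) id id" by (auto simp: AP_def GP_def)
 have TaM: "Ta id id A \<in> Mat n n" if "A \<in> AD" for A using F' idFA aut_id that unfolding ADG by blast
 have Taadd: "Ta id id (A + B) = Ta id id A + Ta id id B" if "A \<in> AD" "B \<in> AD" for A B
  using F' idFA aut_id that unfolding ADG by blast
 have Tamult: "Ta id id (A * B) = Ta id id A * Ta id id B" if "A \<in> AD" "B \<in> AD" for A B
 proof -
  have "Ta (id \<circ> id) (id \<circ> id) (A * rmap id B) = Ta id id A * rmap id (Ta id id B)"
   using F' idFA aut_id that unfolding ADG by blast
  thus ?thesis by simp
 qed
 have Taee: "Ta id id (ee m) = ee n" using F' by blast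
 have h_hom: "h \<in> ring_hom ?R ?S"
 proof (rule ring_hom_memI)
  show "h x \<in> carrier ?S" for x by (simp add: h_def ring_mat_simps)
  show "h \<one>\<^bsub>?R\<^esub> = \<one>\<^bsub>?S\<^esub>" by (simp add: h_def R_simps rf_one Taee ring_mat_simps tm_ee)
  fix x y assume xy: "x \<in> carrier ?R" "y \<in> carrier ?R"
  note c = Rc(1)[OF xy(1)] Rc(1)[OF xy(2)] and A = Rc(2)[OF xy(1)] Rc(2)[OF xy(2)]
  have "tm n (Ta id id (rf x) * Ta id id (rf y)) = h x * h y"
   unfolding h_def by (rule tm_mult[OF TaM[OF A(1)] TaM[OF A(2)]])
  thus "h (x \<otimes>\<^bsub>?R\<^esub> y) = h x \<otimes>\<^bsub>?S\<^esub> h y" by (simp add: R_simps ring_mat_simps h_def rf_mult[OF c] Tamult[OF A])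
  have "tm n (Ta id id (rf x) + Ta id id (rf y)) = h x + h y"
   unfolding h_def by (rule tm_add[OF TaM[OF A(1)] TaM[OF A(2)]])
  thus "h (x \<oplus>\<^bsub>?R\<^esub> y) = h x \<oplus>\<^bsub>?S\<^esub> h y" by (simp add: R_simps ring_mat_simps h_def rf_add[OF c] Taadd[OF A])
 qed
 interpret h: ring_hom_ring ?R ?S h by (rule ring_hom_ringI2[OF ringR ring_mat h_hom])
 have ker: "brauer_kernel D act m = a_kernel ?R ?S h"
 proof -
  have h0: "h x = 0\<^sub>m n n \<longleftrightarrow> Ta id id (rf x) = 0" if "x \<in> carrier ?R" for x
   using rf_tm[OF TaM[OF Rc(2)[OF that]]] tm_rf[OF zero_carrier_mat, of n] rf_zero[of n] unfolding h_def by metis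
  have K: "x \<in> brauer_kernel D act m \<longleftrightarrow> x \<in> carrier ?R & Ta id id (rf x) = 0" for x
  proof -
   have "x \<in> brauer_kernel D act m \<longleftrightarrow> x \<in> carrier_mat m m & rf x \<in> AD & (\<forall>a\<in>XD. cf a (rf x) = 0)"
    by (simp only: brauer_kernel_BK BK_iff)
   also have "... \<longleftrightarrow> x \<in> carrier_mat m m & rf x \<in> AD & Ta id id (rf x) = 0" using F' by blast
   finally show ?thesis using Rc RI by blast
  qed
  show ?thesis
  proof (rule Set.set_eqI)
   fix x
   have "x \<in> a_kernel ?R ?S h \<longleftrightarrow> x \<in> carrier ?R & h x = 0\<^sub>m n n" unfolding a_kernel_def' by (simp add: ring_mat_simps)
   thus "x \<in> brauer_kernel D act m \<longleftrightarrow> x \<in> a_kernel ?R ?S h" using K h0 by blast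
  qed
 qed
 have h_surj: "h ` carrier ?R = carrier ?S"
 proof
  show "carrier ?S \<subseteq> h ` carrier ?R"
  proof
   fix y assume "y \<in> carrier ?S"
   hence y: "y \<in> carrier_mat n n" by (simp add: ring_mat_simps)
   obtain c where c: "c \<in> AD" "Ta id id c = rf y" using F' rf_Mat[OF y] by blast
   have cM: "c \<in> Mat m m" using c by (simp add: AP_def)
   have "h (tm m c) = y" using rf_tm[OF cM] c(2) tm_rf[OF y] by (simp add: h_def)
   moreover have "tm m c \<in> carrier ?R" using RI[OF tm_carrier] rf_tm[OF cM] c(1) by simp
   ultimately show "y \<in> h ` carrier ?R" by blast
  qed
 qed (use h.hom_closed in auto)
 let ?tt = "%Y. the_elem (h ` Y)"
 have tt: "?tt \<in> ring_iso ?B ?S"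
  unfolding brauer_quotient_def ker by (rule h.FactRing_iso_set[OF h_surj])
 have bij: "bij_betw ?tt (carrier ?B) (carrier_mat n n)" using tt by (auto simp: ring_iso_def ring_mat_simps)
 have ringB: "ring ?B" unfolding brauer_quotient_def ker by (rule ideal.quotient_is_ring[OF h.kernel_is_ideal])
 have "bij_betw rf (carrier_mat n n) (Mat n n :: 'e rfm set)"
  by (rule bij_betw_byWitness[of _ "tm n"]) (auto simp: tm_rf rf_tm rf_Mat)
 hence "card (carrier ?B) = card (UNIV :: 'e set) ^ (n * n)"
  using bij_betw_same_card[OF bij] card_Mat[of n n] by (simp add: bij_betw_same_card)
 \<comment> \<open>The statement fixes \<open>l\<close> through the cardinality of the Brauer
   quotient; comparing exponents gives \<open>n = l\<close>.\<close>
 hence "card (UNIV :: 'e set) ^ (n * n) = card (UNIV :: 'e set) ^ (l ^ 2)" using assms(11) by simp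
 moreover have "card (UNIV :: 'e set) > 1"
 proof -
  have "card {0, 1 :: 'e} \<le> card (UNIV :: 'e set)" by (rule card_mono) auto
  thus ?thesis by simp
 qed
 ultimately have "n * n = l ^ 2" by (simp only: power_inject_exp)
 hence nl: "n = l" by (simp add: power2_eq_square) (metis mult_cancel_left mult_le_mono nat_le_linear le_antisym mult_le_cancel1 nat_mult_le_cancel_disj)
 define tt' where "tt' = inv_into (carrier ?B) ?tt"
 have tt': "tt' \<in> ring_iso ?S ?B" unfolding tt'_def by (rule ring_iso_set_sym[OF ringB tt])
 have tt'h: "tt' (h c) = brD D act m c" if "c \<in> carrier ?R" for c
 proof -
  have "brD D act m c \<in> carrier ?B"
   using that by (auto simp: brD_def brauer_quotient_def FactRing_def A_RCOSETS_def RCOSETS_def a_r_coset_def)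
  moreover have "?tt (brD D act m c) = h c" unfolding brD_def ker by (rule h.the_elem_simp[OF that])
  ultimately show ?thesis unfolding tt'_def using bij_betw_inv_into_left[OF bij, of "brD D act m c"] by simp
 qed
 have tt'hom: "tt' \<in> ring_hom ?S ?B" and tt'bij: "bij_betw tt' (carrier ?S) (carrier ?B)" using tt' by (auto simp: ring_iso_def)
 \<comment> \<open>The given embedding of the Brauer quotient, moved to matrices of size
   \<open>n\<close>, so that \<open>emb\<close> applies to it.\<close>
 define ch where "ch = \<iota>' \<circ> tt'"
 have ch: "ch \<in> ring_hom (ring_mat TYPE('e) n ()) (ring_mat TYPE('f) (n * s) ())"
  unfolding ch_def using ring_hom_trans[OF tt'hom assms(14)] nl by simp
 have chinj: "inj_on ch (carrier_mat n n)"
  unfolding ch_def using tt'bij assms(15) by (intro comp_inj_on) (auto simp: bij_betw_def ring_mat_simps)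
 define io1 where "io1 A = rf (\<iota> (tm m A))" for A
 define io2 where "io2 A = rf (ch (tm n A))" for A
 have e1: "emb p s m io1" unfolding io1_def by (rule emb_of_ring_hom[OF assms(1) pE assms(6,7,12,13)])
 have e2: "emb p s n io2" unfolding io2_def by (rule emb_of_ring_hom[OF assms(1) pE assms(6,7) ch chinj])
 interpret N: nrm P p m L "%g. g" bx b ka cf s n io1 io2 Ta
  by (intro nrm.intro nrm_axioms.intro dr.drep_axioms e1 e2 F) (use finD in \<open>auto simp: inj_on_def\<close>)
 let ?G = "units_of (ring_mat TYPE('f) (m * s) ())" and ?H = "\<iota> ` \<rho> ` carrier D"
 interpret K: ring "ring_mat TYPE('f) (m * s) ()" by (rule ring_mat)
 interpret G: group ?G by (rule K.units_group)
 have ioc: "\<iota> x \<in> carrier_mat (m * s) (m * s)" if "x \<in> carrier_mat m m" for x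
  using ring_hom_closed[OF assms(12), of x] that by (simp add: ring_mat_simps)
 have iorf: "io1 (rf x) = rf (\<iota> x)" if "x \<in> carrier_mat m m" for x by (simp add: io1_def tm_rf[OF that])
 have G_units: "x \<in> carrier ?G \<longleftrightarrow> x \<in> carrier_mat (m * s) (m * s) & (\<exists>y\<in>carrier_mat (m * s) (m * s). y * x = 1\<^sub>m (m * s) & x * y = 1\<^sub>m (m * s))" for x
  by (simp add: units_of_def Units_def ring_mat_simps)
 have HG: "?H \<subseteq> carrier ?G"
 proof
  fix x assume "x \<in> ?H"
  then obtain d where d: "d \<in> carrier D" "x = \<iota> (\<rho> d)" by blast
  have mul: "\<iota> (a * b) = \<iota> a * \<iota> b" if "a \<in> carrier_mat m m" "b \<in> carrier_mat m m" for a b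
   using ring_hom_mult[OF assms(12), of a b] that by (simp add: ring_mat_simps)
  have one: "\<iota> (1\<^sub>m m) = 1\<^sub>m (m * s)" using ring_hom_one[OF assms(12)] by (simp add: ring_mat_simps)
  have "\<rho> (inv\<^bsub>D\<^esub> d) * \<rho> d = 1\<^sub>m m" "\<rho> d * \<rho> (inv\<^bsub>D\<^esub> d) = 1\<^sub>m m"
   using d rh_mult[of "inv\<^bsub>D\<^esub> d" d] rh_mult[of d "inv\<^bsub>D\<^esub> d"] rh_one by auto
  hence "\<iota> (\<rho> (inv\<^bsub>D\<^esub> d)) * \<iota> (\<rho> d) = 1\<^sub>m (m * s)" "\<iota> (\<rho> d) * \<iota> (\<rho> (inv\<^bsub>D\<^esub> d)) = 1\<^sub>m (m * s)"
   using mul[OF rh_carrier rh_carrier] d one by (metis inv_closed)+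
  thus "x \<in> carrier ?G" unfolding G_units using ioc[OF rh_carrier] d by blast
 qed
 let ?k = "m * s"
 have norm_NN: "rf ga \<in> N.NN" "ga \<in> carrier_mat ?k ?k" if "ga \<in> normalizer ?G ?H" for ga
 proof -
  have gaG: "ga \<in> carrier ?G" and stab: "ga <#\<^bsub>?G\<^esub> ?H #>\<^bsub>?G\<^esub> inv\<^bsub>?G\<^esub> ga = ?H"
   using that HG by (auto simp: normalizer_def stabilizer_def)
  obtain ga' where ga': "ga' \<in> carrier_mat ?k ?k" "ga' * ga = 1\<^sub>m ?k" "ga * ga' = 1\<^sub>m ?k" and gac: "ga \<in> carrier_mat ?k ?k"
   using gaG unfolding G_units by blast
  show "ga \<in> carrier_mat ?k ?k" by (fact gac)
  \<comment> \<open>Preserving the set \<open>?H\<close> under conjugation, rewritten without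
    inverses, is the condition in \<open>N.NN\<close>.\<close>
  have "\<exists>g'\<in>carrier P. rf ga * io1 g = io1 g' * rf ga" if g: "g \<in> carrier P" for g
  proof -
   obtain d where d: "d \<in> carrier D" "g = R d" using g by auto
   have x: "\<iota> (\<rho> d) \<in> carrier ?G" using HG d(1) by blast
   have "ga \<otimes>\<^bsub>?G\<^esub> \<iota> (\<rho> d) \<otimes>\<^bsub>?G\<^esub> inv\<^bsub>?G\<^esub> ga \<in> ga <#\<^bsub>?G\<^esub> ?H #>\<^bsub>?G\<^esub> inv\<^bsub>?G\<^esub> ga"
    using d(1) by (auto simp: l_coset_def r_coset_def)
   then obtain e where e: "e \<in> carrier D" "ga \<otimes>\<^bsub>?G\<^esub> \<iota> (\<rho> d) \<otimes>\<^bsub>?G\<^esub> inv\<^bsub>?G\<^esub> ga = \<iota> (\<rho> e)" unfolding stab by blast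
   have "ga \<otimes>\<^bsub>?G\<^esub> \<iota> (\<rho> d) \<otimes>\<^bsub>?G\<^esub> inv\<^bsub>?G\<^esub> ga \<otimes>\<^bsub>?G\<^esub> ga = ga \<otimes>\<^bsub>?G\<^esub> \<iota> (\<rho> d)"
    using gaG x by (simp add: G.m_assoc)
   hence "\<iota> (\<rho> e) * ga = ga * \<iota> (\<rho> d)" using e(2) by (simp add: units_of_def ring_mat_simps)
   hence "rf (\<iota> (\<rho> e) * ga) = rf (ga * \<iota> (\<rho> d))" by simp
   hence "io1 (R e) * rf ga = rf ga * io1 (R d)"
    unfolding R_def iorf[OF rh_carrier[OF d(1)]] iorf[OF rh_carrier[OF e(1)]]
     rf_mult[OF ioc[OF rh_carrier[OF e(1)]] gac] rf_mult[OF gac ioc[OF rh_carrier[OF d(1)]]] .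
   thus ?thesis using e(1) d(2) by (intro bexI[of _ "R e"]) auto
  qed
  moreover have "rf ga * rf ga' = ee ?k" "rf ga' * rf ga = ee ?k"
   using rf_mult[OF gac ga'(1)] rf_mult[OF ga'(1) gac] ga' by (simp_all add: rf_one)
  ultimately show "rf ga \<in> N.NN" unfolding N.NN_def using rf_Mat[OF gac] rf_Mat[OF ga'(1)] by blast
 qed
 define ph where "ph ga = tm (n * s) (N.Ph (rf ga))" for ga
 have PhM: "N.Ph ga \<in> Mat (n * s) (n * s)" if "ga \<in> N.NN" for ga using N.Ph[OF that] by (simp add: N.E2.rep_def)
 have "ph \<in> hom (?G\<lparr>carrier := normalizer ?G ?H\<rparr>) (units_of (ring_mat TYPE('f) (l * s) ()))"
 proof (rule homI)
  fix ga assume "ga \<in> carrier (?G\<lparr>carrier := normalizer ?G ?H\<rparr>)"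
  hence "ga \<in> normalizer ?G ?H" by simp
  note ga = norm_NN[OF this]
  obtain de where de: "de \<in> Mat ?k ?k" "rf ga * de = ee ?k" "de * rf ga = ee ?k" using ga(1) by (auto simp: N.NN_def)
  have deN: "de \<in> N.NN" by (rule N.NN_inverse[OF ga(1) de])
  have e: "N.Ph (rf ga) * N.Ph de = ee (n * s)" "N.Ph de * N.Ph (rf ga) = ee (n * s)"
   using N.Ph_mult[OF ga(1) deN] N.Ph_mult[OF deN ga(1)] de N.Ph_ee by auto
  have "ph ga * tm (n * s) (N.Ph de) = 1\<^sub>m (n * s)"
   unfolding ph_def tm_mult[OF PhM[OF ga(1)] PhM[OF deN], symmetric] e(1) by (rule tm_ee)
  moreover have "tm (n * s) (N.Ph de) * ph ga = 1\<^sub>m (n * s)"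
   unfolding ph_def tm_mult[OF PhM[OF deN] PhM[OF ga(1)], symmetric] e(2) by (rule tm_ee)
  ultimately show "ph ga \<in> carrier (units_of (ring_mat TYPE('f) (l * s) ()))"
   unfolding units_of_def Units_def nl[symmetric] by (auto simp: ring_mat_simps ph_def)
 next
  fix ga de assume "ga \<in> carrier (?G\<lparr>carrier := normalizer ?G ?H\<rparr>)" "de \<in> carrier (?G\<lparr>carrier := normalizer ?G ?H\<rparr>)"
  hence "ga \<in> normalizer ?G ?H" "de \<in> normalizer ?G ?H" by auto
  note ga = norm_NN[OF this(1)] and de = norm_NN[OF this(2)]
  have "ph (ga * de) = ph ga * ph de"
   unfolding ph_def rf_mult[OF ga(2) de(2)] N.Ph_mult[OF ga(1) de(1)] by (rule tm_mult[OF PhM[OF ga(1)] PhM[OF de(1)]])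
  thus "ph (ga \<otimes>\<^bsub>?G\<lparr>carrier := normalizer ?G ?H\<rparr>\<^esub> de) = ph ga \<otimes>\<^bsub>units_of (ring_mat TYPE('f) (l * s) ())\<^esub> ph de"
   by (simp add: units_of_def ring_mat_simps)
 qed
 moreover have "ph (\<iota> c) = \<iota>' (brD D act m c)" if cU: "c \<in> Units ?R" for c
 proof -
  obtain c' where c: "c \<in> carrier ?R" "c' \<in> carrier ?R" "c' * c = 1\<^sub>m m" "c * c' = 1\<^sub>m m"
   using cU unfolding Units_def R_simps by blast
  note cc = Rc(1)[OF c(1)] Rc(1)[OF c(2)]
  have inv: "rf c * rf c' = ee m" "rf c' * rf c = ee m"
   using rf_mult[OF cc] rf_mult[OF cc(2) cc(1)] c by (simp_all add: rf_one)
  have "N.Ph (rf (\<iota> c)) = io2 (Ta id id (rf c))"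
   using N.Ph_io[OF Rc(2)[OF c(1)] rf_Mat[OF cc(2)] inv] iorf[OF cc(1)] by simp
  also have "... = rf (ch (h c))" by (simp add: io2_def h_def)
  finally have "ph (\<iota> c) = tm (n * s) (rf (ch (h c)))" by (simp add: ph_def)
  also have "... = ch (h c)"
   using ring_hom_closed[OF ch, of "h c"] by (intro tm_rf) (simp add: ring_mat_simps h_def)
  finally show ?thesis using tt'h[OF c(1)] by (simp add: ch_def)
 qed
 ultimately show ?thesis by blast
qed

end
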